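(* Let $T\subset S^3_{\mathrm{eq}}$ be an ideal CCT of width $k\ge 3$. Then there exists an ideal $(k+1)$-CCT $T'$ in $S^3_{\mathrm{eq}}$ extending $T$.
   Context: Spheres are unit spheres; $S^4\subset\mathbb{R}^5$ and $S^3_{\mathrm{eq}}=\{x\in S^4:x_5=0\}$. Polytopal complexes are finite collections of spherical polytopes closed under faces with pairwise intersections common faces; a cube is a polytope combinatorially equivalent to some $[0,1]^j$. CCTs: Let $\mathfrak{C}$ be the unit cube tiling of $\mathbb{R}^3$ with vertex set $\mathbb{Z}^3$ and $\mathfrak{C}[k]$ its subcomplex induced by vertices $v$ with $0\le v_1+v_2+v_3\le k$; let $\Lambda$ be the lattice generated by $(3,-3,0)$ and $(-2,-2,4)$ and $\mathfrak{T}[k]=\mathfrak{C}[k]/\Lambda$. A $k$-CCT is a geometric cubical complex $T$ with a combinatorial isomorphism $\varphi_T:\mathfrak{T}[k]\to T$; layer $\ell$ is the image of the vertex classes with coordinate sum $\ell$; $R(T,I)$ is the subcomplex induced by layers in $I$. A CCT $T'$ of width $\ell>k$ extends the $k$-CCT $T$ if $R(T',\{0,\dots,k\})=T$. Symmetry: $r_{1,2}$ rotates the $(x_1,x_2)$-plane of $\mathbb{R}^5$ by $\pi/2$ (fixing other coordinates), $r_{3,4}$ rotates the $(x_3,x_4)$-plane by $\pi/3$, $s$ is $x_4\mapsto -x_4$. $T$ is symmetric if $s$, $r_{3,4}^2$, $r_{3,4}r_{1,2}$ map $T$ to itself and correspond via $\varphi_T$ respectively to the automorphisms of $\mathfrak{T}[k]$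 induced by swapping the first two coordinates, translation by $(-1,1,0)$, and translation by $(0,-1,1)$. $\mathcal{C}_\lambda=\{x\in S^3_{\mathrm{eq}}: x_1^2+x_2^2=1-\lambda/2,\ x_3^2+x_4^2=\lambda/2\}$; $\pi_1(y)=\frac{(y_1,y_2,0,0,0)}{\sqrt2\|(y_1,y_2)\|}+\frac{(0,0,y_3,y_4,0)}{\sqrt2\|(y_3,y_4)\|}$ on $S^3_{\mathrm{eq}}\setminus(\mathcal{C}_0\cup\mathcal{C}_2)$; $\pi_0(y)=\frac{(y_1,y_2,0,0,0)}{\|(y_1,y_2)\|}$ on $S^3_{\mathrm{eq}}\setminus\mathcal{C}_2$. A symmetric 2-CCT is transversal if $\pi_1$ is defined and injective on it; a symmetric $k$-CCT is transversal if $R(T,\{i-1,i,i+1\})$ is transversal for all $1\le i\le k-1$. Slope of a transversal symmetric 2-CCT: for a layer-2 vertex $s$, $t=r_{3,4}^2s$, $u$ the middle vertex of the unique length-2 edge path from $s$ to $t$, $m$ the midpoint of $[s,t]$, $\alpha(T)$ is the angle at $m$ between the segments $[m,\pi_0(m)]$ and $[m,u]$. A transversal symmetric $k$-CCT $T$ ($k\ge 2$) is ideal if $\alpha(R(T,\{k-2,k-1,k\}))>\pi/2$ and the closure of the component of $S^3_{\mathrm{eq}}\setminus T$ containing $\mathcal{C}_0$ meets layer $k$.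
   Formalization: In the definition of symmetric, r_{3,4}^2 is matched with translation by (1,-1,0) instead of (-1,1,0); with the printed sign no symmetric CCT exists, since (r_{3,4}r_{1,2})^4 = r_{3,4}^4 while 4(0,-1,1) ≡ (-1,1,0) mod Λ. *)

theory Defs
  imports "HOL-Analysis.Analysis"
begin

section \<open>Spherical polytopes and polytopal complexes\<close>

definition sph_hull :: "(real^5) set \<Rightarrow> (real^5) set" where
  "sph_hull V = convex_cone hull V \<inter> sphere 0 1"

definition sph_polytope :: "(real^5) set \<Rightarrow> bool" where
  "sph_polytope P \<longleftrightarrow>
     (\<exists>V a. finite V \<and> V \<subseteq> sphere 0 1 \<and> (\<forall>v\<in>V. 0 < a \<bullet> v) \<and> P = sph_hull V)"

text \<open>As for \<^const>\<open>face_of\<close>, the empty set and \<open>P\<close> itself count as faces of \<open>P\<close>;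
  accordingly all complexes below contain the empty face.\<close>

definition sph_face_of :: "(real^5) set \<Rightarrow> (real^5) set \<Rightarrow> bool" (infixr "sph'_face'_of" 50) where
  "F sph_face_of P \<longleftrightarrow> (\<exists>a. (\<forall>x\<in>P. 0 \<le> a \<bullet> x) \<and> F = {x \<in> P. a \<bullet> x = 0})"

definition polytopal_complex :: "(real^5) set set \<Rightarrow> bool" where
  "polytopal_complex T \<longleftrightarrow>
     finite T \<and> (\<forall>P\<in>T. sph_polytope P) \<and>
     (\<forall>P\<in>T. \<forall>F. F sph_face_of P \<longrightarrow> F \<in> T) \<and>
     (\<forall>P\<in>T. \<forall>Q\<in>T. (P \<inter> Q) sph_face_of P \<and> (P \<inter> Q) sph_face_of Q)"

text \<open>The model \<open>[0,1]\<^sup>j\<close> is placed in the coordinate subspace of a \<open>j\<close>-element set \<open>J\<close> of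
  coordinates of \<open>\<real>\<^sup>5\<close>. This loses nothing, as polytopes in \<open>S\<^sup>4\<close> have dimension at most 4.\<close>

definition model_cube :: "5 set \<Rightarrow> (real^5) set" where
  "model_cube J = cbox 0 (\<chi> i. if i \<in> J then 1 else 0)"

definition sph_cube :: "(real^5) set \<Rightarrow> bool" where
  "sph_cube P \<longleftrightarrow> sph_polytope P \<and>
     (\<exists>J h. bij_betw h {F. F face_of model_cube J} {F. F sph_face_of P} \<and>
        (\<forall>F G. F face_of model_cube J \<and> G face_of model_cube J \<longrightarrow> (h F \<subseteq> h G \<longleftrightarrow> F \<subseteq> G)))"

definition cubical_complex :: "(real^5) set set \<Rightarrow> bool" where
  "cubical_complex T \<longleftrightarrow> polytopal_complex T \<and> (\<forall>P\<in>T. P \<noteq> {} \<longrightarrow> sph_cube P)"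

definition induced_subcomplex :: "(real^5) set set \<Rightarrow> (real^5) set \<Rightarrow> (real^5) set set" where
  "induced_subcomplex T W = {P \<in> T. \<forall>x. {x} sph_face_of P \<longrightarrow> x \<in> W}"

definition adjacent :: "(real^5) set set \<Rightarrow> real^5 \<Rightarrow> real^5 \<Rightarrow> bool" where
  "adjacent T x y \<longleftrightarrow> x \<noteq> y \<and> {x} \<in> T \<and> {y} \<in> T \<and> sph_hull {x, y} \<in> T"

section \<open>The cube tiling and its quotients\<close>

definition int_points :: "(real^3) set" where
  "int_points = {v. \<forall>i. v $ i \<in> \<int>}"

definition coord_sum :: "real^3 \<Rightarrow> real" where
  "coord_sum v = v $ 1 + v $ 2 + v $ 3"

definition cube_tiling :: "(real^3) set set" where
  "cube_tiling =
     insert {} {cbox v (v + (\<chi> i. if i \<in> I then 1 else 0)) | v I. v \<in> int_points}"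

definition cube_strip :: "nat \<Rightarrow> (real^3) set set" where
  "cube_strip k =
     {F \<in> cube_tiling. \<forall>v. {v} face_of F \<longrightarrow> 0 \<le> coord_sum v \<and> coord_sum v \<le> real k}"

definition Lam :: "(real^3) set" where
  "Lam = {of_int a *\<^sub>R vector [3, -3, 0] + of_int b *\<^sub>R vector [-2, -2, 4] | a b. True}"

definition orbit :: "(real^3) set \<Rightarrow> (real^3) set set" where
  "orbit F = (\<lambda>l. (+) l ` F) ` Lam"

definition torus_complex :: "nat \<Rightarrow> (real^3) set set set" where
  "torus_complex k = orbit ` cube_strip k"

definition orbit_le :: "(real^3) set set \<Rightarrow> (real^3) set set \<Rightarrow> bool" where
  "orbit_le C D \<longleftrightarrow> (\<exists>F\<in>C. \<exists>G\<in>D. F \<subseteq> G)"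

definition induced :: "(real^3 \<Rightarrow> real^3) \<Rightarrow> (real^3) set set \<Rightarrow> (real^3) set set" where
  "induced f C = (\<lambda>F. f ` F) ` C"

section \<open>Cross-bedding cubical tori (CCTs)\<close>

type_synonym labelling = "(real^3) set set \<Rightarrow> (real^5) set"

definition is_cct :: "nat \<Rightarrow> (real^5) set set \<Rightarrow> labelling \<Rightarrow> bool" where
  "is_cct k T \<phi> \<longleftrightarrow> cubical_complex T \<and> bij_betw \<phi> (torus_complex k) T \<and>
     (\<forall>C\<in>torus_complex k. \<forall>D\<in>torus_complex k. \<phi> C \<subseteq> \<phi> D \<longleftrightarrow> orbit_le C D)"

definition layer :: "labelling \<Rightarrow> nat \<Rightarrow> (real^5) set" where
  "layer \<phi> l = (\<Union>v\<in>{v \<in> int_points. coord_sum v = real l}. \<phi> (orbit {v}))"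

definition restr :: "(real^5) set set \<Rightarrow> labelling \<Rightarrow> nat set \<Rightarrow> (real^5) set set" where
  "restr T \<phi> I = induced_subcomplex T (\<Union>l\<in>I. layer \<phi> l)"

text \<open>\<open>restr T \<phi> {j..j+m}\<close> is regarded as an \<open>m\<close>-CCT by moving its lowest layer \<open>j\<close> to layer 0.
  The translation vector is invariant under the swap of the first two coordinates, so that symmetry
  is inherited.\<close>

definition shift_lab :: "nat \<Rightarrow> labelling \<Rightarrow> labelling" where
  "shift_lab j \<phi> = (\<lambda>C. \<phi> (induced ((+) (vector [0, 0, real j])) C))"

definition extends :: "nat \<Rightarrow> (real^5) set set \<Rightarrow> labelling \<Rightarrow> nat \<Rightarrow> (real^5) set set \<Rightarrow> bool" where
  "extends l T' \<phi>' k T \<longleftrightarrow> k < l \<and> restr T' \<phi>' {0..k} = T"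

section \<open>Symmetry\<close>

definition rot :: "5 \<Rightarrow> 5 \<Rightarrow> real \<Rightarrow> real^5 \<Rightarrow> real^5" where
  "rot i j \<theta> x = (\<chi> m. if m = i then cos \<theta> * x $ i - sin \<theta> * x $ j
                     else if m = j then sin \<theta> * x $ i + cos \<theta> * x $ j
                     else x $ m)"

definition r12 :: "real^5 \<Rightarrow> real^5" where "r12 = rot 1 2 (pi / 2)"
definition r34 :: "real^5 \<Rightarrow> real^5" where "r34 = rot 3 4 (pi / 3)"
definition refl4 :: "real^5 \<Rightarrow> real^5" where "refl4 x = (\<chi> m. if m = 4 then - x $ m else x $ m)"

definition swap12 :: "real^3 \<Rightarrow> real^3" where "swap12 v = vector [v $ 2, v $ 1, v $ 3]"

definition corresponds ::
  "nat \<Rightarrow> (real^5) set set \<Rightarrow> labelling \<Rightarrow> (real^5 \<Rightarrow> real^5) \<Rightarrow> (real^3 \<Rightarrow> real^3) \<Rightarrow> bool" where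
  "corresponds k T \<phi> g f \<longleftrightarrow>
     (\<lambda>P. g ` P) ` T = T \<and> (\<forall>C\<in>torus_complex k. g ` \<phi> C = \<phi> (induced f C))"

text \<open>The sign of \<open>(1,-1,0)\<close> is forced by the two other conditions: conjugating \<open>r34 \<circ> r12\<close> by
  \<open>refl4\<close> gives \<open>r34\<inverse> \<circ> r12\<close>, which thus corresponds to translation by \<open>(-1,0,1)\<close>, so \<open>r34\<^sup>2\<close>
  corresponds to translation by \<open>(0,-1,1) - (-1,0,1) = (1,-1,0)\<close>. With \<open>(-1,1,0)\<close> instead,
  no CCT would be symmetric; see lemma \<open>opposite_sign_inconsistent\<close> below.\<close>

definition symmetric_cct :: "nat \<Rightarrow> (real^5) set set \<Rightarrow> labelling \<Rightarrow> bool" where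
  "symmetric_cct k T \<phi> \<longleftrightarrow> is_cct k T \<phi> \<and>
     corresponds k T \<phi> refl4 swap12 \<and>
     corresponds k T \<phi> (r34 \<circ> r34) ((+) (vector [1, -1, 0])) \<and>
     corresponds k T \<phi> (r34 \<circ> r12) ((+) (vector [0, -1, 1]))"

lemma opposite_sign_inconsistent:
  assumes cct: "is_cct k T \<phi>"
    and a: "corresponds k T \<phi> (r34 \<circ> r34) ((+) (vector [-1, 1, 0]))"
    and b: "corresponds k T \<phi> (r34 \<circ> r12) ((+) (vector [0, -1, 1]))"
  shows False
proof -
  let ?C = "\<lambda>v. orbit {v}"
  have ind: "induced ((+) w) (?C v) = ?C (w + v)" for v w
    by (auto simp: induced_def orbit_def image_image add_ac)
  have tile: "{v} \<in> cube_tiling" if "v \<in> int_points" for v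
  proof -
    have "cbox v (v + (\<chi> i. if i \<in> {} then 1 else 0)) = {v}"
      by (simp flip: zero_vec_def)
    with that show ?thesis unfolding cube_tiling_def by blast
  qed
  have mem: "?C v \<in> torus_complex k" if "v \<in> int_points" "coord_sum v = 0" for v
    unfolding torus_complex_def cube_strip_def using that tile
    by (auto intro!: imageI simp: face_of_singleton)
  have ip: "vector [of_int p, of_int q, of_int r] \<in> int_points" for p q r
    by (auto simp: int_points_def forall_3)
  define v where "v = (\<lambda>n::nat. vector [0, - real n, real n] :: real^3)"
  have vi: "v n \<in> int_points" and vs: "coord_sum (v n) = 0" for n
    using ip[of 0 "- int n" "int n"] by (auto simp: v_def coord_sum_def)
  have step: "(r34 \<circ> r12) ` \<phi> (?C (v n)) = \<phi> (?C (v (Suc n)))" for n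
  proof -
    have "vector [0, -1, 1] + v n = v (Suc n)"
      by (simp add: v_def vec_eq_iff forall_3)
    then show ?thesis
      using b mem[OF vi vs] by (simp add: corresponds_def ind)
  qed
  let ?g = "r34 \<circ> r12"
  have four: "?g ` ?g ` ?g ` ?g ` \<phi> (?C (v 0)) = \<phi> (?C (v 4))"
    by (simp only: step) (simp add: eval_nat_numeral)
  have s60: "sin (pi / 3) * sin (pi / 3) = (3 / 4 :: real)"
    by (simp add: sin_60)
  have c34: "?g (?g (?g (?g x))) = r34 (r34 (r34 (r34 x)))" for x
  proof -
    have comm: "r12 (r34 y) = r34 (r12 y)" for y
      by (simp add: vec_eq_iff r12_def r34_def rot_def)
    have "r12 (r12 (r12 (r12 y))) = y" for y
      by (simp add: vec_eq_iff r12_def rot_def)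
    then show ?thesis by (simp add: comm)
  qed
  have orb_eq: "?C x = ?C y" if "x - y \<in> Lam" for x y
  proof -
    have add: "p + q \<in> Lam" and neg: "- p \<in> Lam" if pq: "p \<in> Lam" "q \<in> Lam" for p q
    proof -
      obtain a b c d where p: "p = of_int a *\<^sub>R vector [3, -3, 0] + of_int b *\<^sub>R vector [-2, -2, 4]"
        and q: "q = of_int c *\<^sub>R vector [3, -3, 0] + of_int d *\<^sub>R vector [-2, -2, 4]"
        using pq unfolding Lam_def by blast
      have "p + q = of_int (a + c) *\<^sub>R vector [3, -3, 0] + of_int (b + d) *\<^sub>R vector [-2, -2, 4]"
        by (simp add: p q algebra_simps)
      then show "p + q \<in> Lam" unfolding Lam_def by blast
      have "- p = of_int (- a) *\<^sub>R vector [3, -3, 0] + of_int (- b) *\<^sub>R vector [-2, -2, 4]"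
        by (simp add: p)
      then show "- p \<in> Lam" unfolding Lam_def by blast
    qed
    have "?C p \<subseteq> ?C q" if "p - q \<in> Lam" for p q
    proof
      fix S assume "S \<in> ?C p"
      then obtain l where l: "l \<in> Lam" "S = {l + p}" by (auto simp: orbit_def)
      have "S = {(l + (p - q)) + q}" using l by simp
      moreover have "l + (p - q) \<in> Lam" using add l that by blast
      ultimately show "S \<in> ?C q"
        unfolding orbit_def by (intro image_eqI[where x = "l + (p - q)"]) simp_all
    qed
    from this[OF that] this[of y x] neg[OF that that] show ?thesis by auto
  qed
  define w :: "real^3" where "w = vector [-1, 1, 0]"
  have w: "w \<in> int_points" "coord_sum w = 0"
    using ip[of "-1" 1 0] by (auto simp: w_def coord_sum_def)
  have "v 4 - w = of_int 1 *\<^sub>R vector [3, -3, 0] + of_int 1 *\<^sub>R vector [-2, -2, 4]"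
    by (simp add: v_def w_def vec_eq_iff forall_3)
  then have "v 4 - w \<in> Lam" unfolding Lam_def by blast
  then have v4: "?C (v 4) = ?C w" by (rule orb_eq)
  have two: "r34 ` r34 ` \<phi> (?C (v 0)) = \<phi> (?C w)"
  proof -
    have "vector [-1, 1, 0] + v 0 = w" by (simp add: v_def w_def vec_eq_iff forall_3)
    then show ?thesis
      using a mem[OF vi vs, of 0] by (simp add: corresponds_def ind image_comp)
  qed
  have inj: "inj r34"
  proof (rule inj_on_inverseI)
    fix x :: "real^5"
    show "rot 3 4 (- pi / 3) (r34 x) = x"
      by (simp add: vec_eq_iff r34_def rot_def algebra_simps cos_60 s60)
  qed
  have "r34 ` r34 ` r34 ` r34 ` \<phi> (?C (v 0)) = r34 ` r34 ` \<phi> (?C (v 0))"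
  proof -
    have "r34 ` r34 ` r34 ` r34 ` X = ?g ` ?g ` ?g ` ?g ` X" for X
      unfolding image_image c34 ..
    from this[of "\<phi> (?C (v 0))"] show ?thesis using four two v4 by metis
  qed
  then have "\<phi> (?C w) = \<phi> (?C (v 0))"
    using two by (metis inj inj_image_eq_iff)
  moreover have "inj_on \<phi> (torus_complex k)"
    using cct by (auto simp: is_cct_def bij_betw_def)
  ultimately have "?C w = ?C (v 0)"
    using mem w vi vs by (meson inj_onD)
  moreover have "(0::real^3) \<in> Lam"
    unfolding Lam_def by (auto intro!: exI[of _ 0])
  ultimately have "{0 + w} \<in> ?C (v 0)"
    unfolding orbit_def by blast
  then obtain c d where
    "w = of_int c *\<^sub>R vector [3, -3, 0] + of_int d *\<^sub>R vector [-2, -2, 4] + v 0"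
    by (auto simp: orbit_def Lam_def)
  then have "4 * real_of_int d = 0" "3 * real_of_int c - 2 * real_of_int d = - 1"
    by (auto simp: v_def w_def vec_eq_iff forall_3)
  then have "3 * c = - 1" by linarith
  then show False by presburger
qed

section \<open>Transversal and ideal CCTs\<close>

definition S3eq :: "(real^5) set" where
  "S3eq = {x \<in> sphere 0 1. x $ 5 = 0}"

definition Clif :: "real \<Rightarrow> (real^5) set" where
  "Clif l = {x \<in> S3eq. (x $ 1)\<^sup>2 + (x $ 2)\<^sup>2 = 1 - l / 2 \<and> (x $ 3)\<^sup>2 + (x $ 4)\<^sup>2 = l / 2}"

definition part12 :: "real^5 \<Rightarrow> real^5" where
  "part12 y = (\<chi> i. if i = 1 \<or> i = 2 then y $ i else 0)"

definition part34 :: "real^5 \<Rightarrow> real^5" where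
  "part34 y = (\<chi> i. if i = 3 \<or> i = 4 then y $ i else 0)"

definition proj1 :: "real^5 \<Rightarrow> real^5" where
  "proj1 y = part12 y /\<^sub>R (sqrt 2 * norm (part12 y)) + part34 y /\<^sub>R (sqrt 2 * norm (part34 y))"

definition proj0 :: "real^5 \<Rightarrow> real^5" where
  "proj0 y = part12 y /\<^sub>R norm (part12 y)"

definition transversal2 :: "(real^5) set set \<Rightarrow> labelling \<Rightarrow> bool" where
  "transversal2 T \<phi> \<longleftrightarrow> symmetric_cct 2 T \<phi> \<and>
     \<Union>T \<subseteq> S3eq - (Clif 0 \<union> Clif 2) \<and> inj_on proj1 (\<Union>T)"

definition transversal :: "nat \<Rightarrow> (real^5) set set \<Rightarrow> labelling \<Rightarrow> bool" where
  "transversal k T \<phi> \<longleftrightarrow> symmetric_cct k T \<phi> \<and>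
     (\<forall>i. 1 \<le> i \<and> i + 1 \<le> k \<longrightarrow>
        transversal2 (restr T \<phi> {i - 1, i, i + 1}) (shift_lab (i - 1) \<phi>))"

text \<open>Angle at \<open>m\<close> between the great-circle segments \<open>[m,a]\<close> and \<open>[m,b]\<close> of the unit sphere:
  the angle between the tangential components of \<open>a\<close> and \<open>b\<close> at \<open>m\<close>.\<close>

definition tangent_at :: "real^5 \<Rightarrow> real^5 \<Rightarrow> real^5" where
  "tangent_at m a = a - (a \<bullet> m) *\<^sub>R m"

definition sph_angle :: "real^5 \<Rightarrow> real^5 \<Rightarrow> real^5 \<Rightarrow> real" where
  "sph_angle m a b =
     arccos ((tangent_at m a \<bullet> tangent_at m b) / (norm (tangent_at m a) * norm (tangent_at m b)))"

definition slope_at :: "(real^5) set set \<Rightarrow> real^5 \<Rightarrow> real" where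
  "slope_at T s =
     (let t = (r34 \<circ> r34) s;
          u = (THE u. adjacent T s u \<and> adjacent T u t);
          m = (s + t) /\<^sub>R norm (s + t)
      in sph_angle m (proj0 m) u)"

text \<open>The choice of the layer-2 vertex is immaterial: the symmetries act transitively on each layer
  and preserve \<^const>\<open>slope_at\<close>.\<close>

definition slope :: "(real^5) set set \<Rightarrow> labelling \<Rightarrow> real" where
  "slope T \<phi> = slope_at T (SOME s. s \<in> layer \<phi> 2)"

definition ideal_cct :: "nat \<Rightarrow> (real^5) set set \<Rightarrow> labelling \<Rightarrow> bool" where
  "ideal_cct k T \<phi> \<longleftrightarrow> 2 \<le> k \<and> transversal k T \<phi> \<and>
     pi / 2 < slope (restr T \<phi> {k - 2, k - 1, k}) (shift_lab (k - 2) \<phi>) \<and>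
     (\<exists>K \<in> components (S3eq - \<Union>T). Clif 0 \<subseteq> K \<and> closure K \<inter> layer \<phi> k \<noteq> {})"

end

theory Submission
  imports Defs
begin

text \<open>By symmetry a transversal CCT is determined by one vertex per layer. In complex coordinates
  \<open>(z, u)\<close> of \<open>\<real>\<^sup>4\<close>, scaled so that the vertices have \<open>u\<close> a sixth root of unity, the vertex in
  layer \<open>n\<close> is \<open>z = i^v\<^sub>3 \<eta>\<^sub>n\<close>, and planarity of the two kinds of squares forces
  \<open>\<eta>\<^sub>n = w\<^sub>n + i w\<^sub>n\<^sub>+\<^sub>1\<close> (in a suitable frame) for a real sequence with
  \<open>w\<^sub>n\<^sub>+\<^sub>2 = 2 w\<^sub>n\<^sub>+\<^sub>1 + b (2 w\<^sub>n\<^sub>+\<^sub>1 - w\<^sub>n)\<close>, \<open>b > 0\<close>. Transversality gives \<open>w\<^sub>n > 0\<close> for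
  \<open>n \<ge> 1\<close> and \<open>w\<^sub>n w\<^sub>n\<^sub>+\<^sub>2 < w\<^sub>n\<^sub>+\<^sub>1\<^sup>2\<close>.

  If \<open>w\<^sub>0 < 2 w\<^sub>1\<close>, the sequence grows, \<open>b\<close> does not depend on \<open>n\<close>, and continuing the recurrence
  for ever gives convex cubes that fit together to an ideal CCT of every width; the first new layer
  is the extension. If \<open>w\<^sub>0 \<ge> 2 w\<^sub>1\<close>, the sequence shrinks, so layer \<open>k \<ge> 3\<close> lies on the far side of
  the torus formed by layers 0 to 2. This torus is a radial graph, hence it separates layer \<open>k\<close> from
  the component of \<open>\<C>\<^sub>0\<close>, and the CCT is not ideal.\<close>

section \<open>Finitely generated cones\<close>

lemma convex_cone_hull_sum:
  assumes "\<And>i. i \<in> A \<Longrightarrow> 0 \<le> c i" "\<And>i. i \<in> A \<Longrightarrow> p i \<in> convex_cone hull S"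
  shows "(\<Sum>i\<in>A. c i *\<^sub>R p i) \<in> convex_cone hull S"
  using assms
  by (induction A rule: infinite_finite_induct)
    (auto simp: convex_cone_hull_contains_0 intro!: convex_cone_hull_add convex_cone_hull_mul)

lemma convex_cone_hull_image_finite:
  assumes "finite A"
  shows "convex_cone hull (p ` A) = {(\<Sum>i\<in>A. c i *\<^sub>R p i) | c. \<forall>i\<in>A. 0 \<le> c i}"
proof
  define C where "C = {(\<Sum>i\<in>A. c i *\<^sub>R p i) | c. \<forall>i\<in>A. 0 \<le> c i}"
  have mem: "(\<Sum>i\<in>A. c i *\<^sub>R p i) \<in> C" if "\<And>i. i \<in> A \<Longrightarrow> 0 \<le> c i" for c
    using that unfolding C_def by blast
  have "convex_cone C"
    unfolding convex_cone_iff
  proof (intro conjI ballI allI impI)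
    show "0 \<in> C"
      using mem[of "\<lambda>_. 0"] by simp
    fix x y assume "x \<in> C" "y \<in> C"
    then obtain c d where "x = (\<Sum>i\<in>A. c i *\<^sub>R p i)" "y = (\<Sum>i\<in>A. d i *\<^sub>R p i)"
      "\<forall>i\<in>A. 0 \<le> c i" "\<forall>i\<in>A. 0 \<le> d i"
      unfolding C_def by blast
    then show "x + y \<in> C"
      using mem[of "\<lambda>i. c i + d i"] by (simp add: sum.distrib scaleR_add_left)
  next
    fix x and r :: real assume "x \<in> C" "0 \<le> r"
    moreover from this obtain c where "x = (\<Sum>i\<in>A. c i *\<^sub>R p i)" "\<forall>i\<in>A. 0 \<le> c i"
      unfolding C_def by blast
    ultimately show "r *\<^sub>R x \<in> C"
      using mem[of "\<lambda>i. r * c i"] by (simp add: scaleR_sum_right)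
  qed
  moreover have "p i \<in> C" if "i \<in> A" for i
    using mem[of "\<lambda>j. if j = i then 1 else 0"] that assms
    by (simp add: if_distrib[of "\<lambda>c. c *\<^sub>R _"] cong: if_cong)
  ultimately show "convex_cone hull (p ` A) \<subseteq> {(\<Sum>i\<in>A. c i *\<^sub>R p i) | c. \<forall>i\<in>A. 0 \<le> c i}"
    unfolding C_def[symmetric]
    by (intro hull_minimal) auto
  show "{(\<Sum>i\<in>A. c i *\<^sub>R p i) | c. \<forall>i\<in>A. 0 \<le> c i} \<subseteq> convex_cone hull (p ` A)"
    by (clarify, rule convex_cone_hull_sum) (auto intro: hull_inc)
qed

lemma convex_cone_hull_imageE:
  assumes "x \<in> convex_cone hull (p ` A)" "finite A"
  obtains c where "x = (\<Sum>i\<in>A. c i *\<^sub>R p i)" "\<forall>i\<in>A. 0 \<le> c i"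
  using assms(1) that unfolding convex_cone_hull_image_finite[OF assms(2)] by blast

lemma convex_cone_hull_face:
  fixes a :: "'a::real_inner"
  assumes "\<And>y. y \<in> S \<Longrightarrow> 0 \<le> a \<bullet> y" "x \<in> convex_cone hull S"
  shows "0 \<le> a \<bullet> x" "a \<bullet> x = 0 \<Longrightarrow> x \<in> convex_cone hull {y \<in> S. a \<bullet> y = 0}"
proof -
  let ?C = "{x. 0 \<le> a \<bullet> x \<and> (a \<bullet> x = 0 \<longrightarrow> x \<in> convex_cone hull {y \<in> S. a \<bullet> y = 0})}"
  have "convex_cone ?C"
    by (rule convex_cone_iff[THEN iffD2])
      (auto simp: inner_add_right add_nonneg_eq_0_iff convex_cone_hull_contains_0
        intro: convex_cone_hull_add convex_cone_hull_mul)
  then have "convex_cone hull S \<subseteq> ?C"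
    using assms(1) by (intro hull_minimal) (auto intro: hull_inc)
  with assms(2) show "0 \<le> a \<bullet> x" "a \<bullet> x = 0 \<Longrightarrow> x \<in> convex_cone hull {y \<in> S. a \<bullet> y = 0}"
    by auto
qed

lemma convex_cone_hull_rescale:
  assumes "\<And>i. i \<in> A \<Longrightarrow> 0 < c i"
  shows "convex_cone hull ((\<lambda>i. c i *\<^sub>R p i) ` A) = convex_cone hull (p ` A)"
proof (intro subset_antisym hull_minimal convex_cone_convex_cone_hull image_subsetI)
  fix i assume i: "i \<in> A"
  then show "c i *\<^sub>R p i \<in> convex_cone hull (p ` A)"
    using assms by (intro convex_cone_hull_mul hull_inc) (auto simp: less_imp_le)
  have "inverse (c i) *\<^sub>R (c i *\<^sub>R p i) \<in> convex_cone hull ((\<lambda>i. c i *\<^sub>R p i) ` A)"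
    using i assms by (intro convex_cone_hull_mul hull_inc) (auto simp: less_imp_le)
  then show "p i \<in> convex_cone hull ((\<lambda>i. c i *\<^sub>R p i) ` A)"
    using assms[OF i] by simp
qed

lemma convex_cone_separation:
  fixes v :: "'a::euclidean_space"
  assumes "convex_cone C" "closed C" "v \<notin> C"
  obtains b where "b \<bullet> v < 0" "\<And>x. x \<in> C \<Longrightarrow> 0 \<le> b \<bullet> x"
proof -
  obtain b c where bc: "b \<bullet> v < c" "\<forall>x\<in>C. c < b \<bullet> x"
    using separating_hyperplane_closed_point assms convex_cone_def by metis
  then have c: "c < 0"
    using convex_cone_contains_0[OF assms(1)] by force
  have "0 \<le> b \<bullet> x" if "x \<in> C" for x
  proof (rule ccontr)
    assume neg: "\<not> 0 \<le> b \<bullet> x"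
    then have "(c / (b \<bullet> x)) *\<^sub>R x \<in> C"
      using that c assms(1) by (simp add: convex_cone_iff divide_nonpos_neg)
    then show False
      using bc(2) neg by force
  qed
  then show ?thesis
    using that[of b] bc(1) c by (meson less_trans)
qed


section \<open>Open cones\<close>

definition open_cone :: "('i \<Rightarrow> 'a::real_vector) \<Rightarrow> 'i set \<Rightarrow> 'a set" where
  "open_cone p A = {(\<Sum>i\<in>A. c i *\<^sub>R p i) | c. \<forall>i\<in>A. 0 < c i}"

lemma open_cone_subset: "open_cone p A \<subseteq> convex_cone hull (p ` A)"
  unfolding open_cone_def by (clarify, rule convex_cone_hull_sum) (auto intro: hull_inc less_imp_le)

lemma sum_mem_open_cone: "(\<Sum>i\<in>A. p i) \<in> open_cone p A"
  by (auto simp: open_cone_def intro!: exI[of _ "\<lambda>_. 1"])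

lemma open_cone_scale:
  assumes "x \<in> open_cone p A" "0 < r"
  shows "r *\<^sub>R x \<in> open_cone p A"
proof -
  obtain c where "x = (\<Sum>i\<in>A. c i *\<^sub>R p i)" "\<forall>i\<in>A. 0 < c i"
    using assms(1) by (auto simp: open_cone_def)
  with assms(2) show ?thesis
    by (auto simp: open_cone_def scaleR_sum_right intro!: exI[of _ "\<lambda>i. r * c i"])
qed

lemma open_cone_image:
  assumes "inj_on f A"
  shows "open_cone p (f ` A) \<subseteq> open_cone (p \<circ> f) A"
proof
  fix x assume "x \<in> open_cone p (f ` A)"
  then obtain c where "x = (\<Sum>i\<in>f ` A. c i *\<^sub>R p i)" "\<forall>i\<in>f ` A. 0 < c i"
    by (auto simp: open_cone_def)
  then show "x \<in> open_cone (p \<circ> f) A"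
    using assms by (auto simp: open_cone_def sum.reindex intro!: exI[of _ "\<lambda>i. c (f i)"])
qed

lemma inner_open_cone_zero_iff:
  fixes a :: "'a::real_inner"
  assumes "x \<in> open_cone p A" "finite A" "\<And>i. i \<in> A \<Longrightarrow> 0 \<le> a \<bullet> p i"
  shows "a \<bullet> x = 0 \<longleftrightarrow> (\<forall>i\<in>A. a \<bullet> p i = 0)"
proof -
  obtain c where c: "x = (\<Sum>i\<in>A. c i *\<^sub>R p i)" "\<forall>i\<in>A. 0 < c i"
    using assms(1) by (auto simp: open_cone_def)
  then have "a \<bullet> x = 0 \<longleftrightarrow> (\<forall>i\<in>A. c i * (a \<bullet> p i) = 0)"
    using assms(2,3) by (simp add: inner_sum_right sum_nonneg_eq_0_iff less_imp_le)
  then show ?thesis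
    using c(2) by (metis less_irrefl mult_eq_0_iff)
qed

definition cone_weights :: "('i \<Rightarrow> 'a::real_vector) \<Rightarrow> 'i set \<Rightarrow> 'a \<Rightarrow> ('i \<Rightarrow> real) set" where
  "cone_weights p A x = {c. (\<forall>i. 0 \<le> c i) \<and> (\<Sum>i\<in>A. c i *\<^sub>R p i) = x}"

lemma cone_weights_midpoint:
  assumes "c \<in> cone_weights p A x" "d \<in> cone_weights p A x"
  shows "(\<lambda>i. (c i + d i) / 2) \<in> cone_weights p A x"
proof -
  have "(\<Sum>i\<in>A. ((c i + d i) / 2) *\<^sub>R p i) = (1/2) *\<^sub>R ((\<Sum>i\<in>A. c i *\<^sub>R p i) + (\<Sum>i\<in>A. d i *\<^sub>R p i))"
    by (simp add: scaleR_sum_right sum.distrib[symmetric] scaleR_add_left[symmetric] add_divide_distrib)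
  then show ?thesis
    using assms by (simp add: cone_weights_def scaleR_half_double)
qed

lemma cone_weights_exchange:
  assumes d: "d \<in> cone_weights p A x" "0 < d i" "0 < d i'"
    and A: "{i, i', j, j'} \<subseteq> A" "distinct [i, i', j, j']" "finite A"
    and pos: "0 < \<alpha>" "0 < \<beta>" "0 < \<gamma>" "0 < \<delta>"
    and relation: "\<alpha> *\<^sub>R p i + \<beta> *\<^sub>R p i' = \<gamma> *\<^sub>R p j + \<delta> *\<^sub>R p j'"
  shows "\<exists>c\<in>cone_weights p A x. 0 < c j \<and> 0 < c j'"
proof -
  define t where "t = min (d i / \<alpha>) (d i' / \<beta>)"
  have t: "0 < t" "t * \<alpha> \<le> d i" "t * \<beta> \<le> d i'"
    using d pos by (auto simp: t_def min_def field_simps)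
  define h where "h n = (if n = i then - (t * \<alpha>) else 0) + (if n = i' then - (t * \<beta>) else 0)
    + (if n = j then t * \<gamma> else 0) + (if n = j' then t * \<delta> else 0)" for n
  have "(\<Sum>n\<in>A. h n *\<^sub>R p n) = t *\<^sub>R (\<gamma> *\<^sub>R p j + \<delta> *\<^sub>R p j') - t *\<^sub>R (\<alpha> *\<^sub>R p i + \<beta> *\<^sub>R p i')"
    using A by (simp add: h_def scaleR_add_left sum.distrib if_distrib[of "\<lambda>c. c *\<^sub>R _"]
        scaleR_add_right cong: if_cong)
  then have "(\<Sum>n\<in>A. (d n + h n) *\<^sub>R p n) = x"
    using d(1) by (simp add: cone_weights_def relation scaleR_add_left sum.distrib)
  moreover have nonneg: "0 \<le> d n" for n
    using d(1) by (simp add: cone_weights_def)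
  moreover have "0 \<le> d n + h n" for n
  proof (cases "n = i \<or> n = i'")
    case True
    then show ?thesis using t(2,3) A(2) by (auto simp: h_def)
  next
    case False
    then show ?thesis using nonneg[of n] t(1) pos(3,4) by (simp add: h_def)
  qed
  ultimately have "(\<lambda>n. d n + h n) \<in> cone_weights p A x"
    by (simp add: cone_weights_def)
  moreover have "0 < d j + h j" "0 < d j' + h j'"
    using A(2) t(1) pos nonneg by (auto simp: h_def intro!: add_nonneg_pos)
  ultimately show ?thesis
    by (intro bexI[of _ "\<lambda>n. d n + h n"] conjI)
qed

lemma cone_weights_common_support:
  assumes "finite B" "\<And>i. i \<in> B \<Longrightarrow> \<exists>c\<in>cone_weights p A x. 0 < c i" "cone_weights p A x \<noteq> {}"
  shows "\<exists>c\<in>cone_weights p A x. \<forall>i\<in>B. 0 < c i"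
  using assms
proof (induction B rule: finite_induct)
  case (insert i B)
  obtain c where c: "c \<in> cone_weights p A x" "\<forall>j\<in>B. 0 < c j"
    using insert by blast
  obtain d where d: "d \<in> cone_weights p A x" "0 < d i"
    using insert.prems(1) by blast
  have "0 \<le> c j" "0 \<le> d j" for j
    using c(1) d(1) by (auto simp: cone_weights_def)
  then have "\<forall>j\<in>insert i B. 0 < (c j + d j) / 2"
    using c(2) d(2) by (auto intro: add_pos_nonneg add_nonneg_pos)
  with cone_weights_midpoint[OF c(1) d(1)] show ?case
    by (intro bexI[of _ "\<lambda>j. (c j + d j) / 2"])
qed blast

lemma mem_open_cone_support:
  assumes "finite A" "x \<in> convex_cone hull (p ` A)"
  shows "x \<in> open_cone p {i \<in> A. \<exists>c\<in>cone_weights p A x. 0 < c i}" (is "x \<in> open_cone p ?B")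
proof -
  obtain c\<^sub>0 where c\<^sub>0: "x = (\<Sum>i\<in>A. c\<^sub>0 i *\<^sub>R p i)" "\<forall>i\<in>A. 0 \<le> c\<^sub>0 i"
    using convex_cone_hull_imageE[OF assms(2,1)] .
  then have "(\<lambda>i. if i \<in> A then c\<^sub>0 i else 0) \<in> cone_weights p A x"
    by (auto simp: cone_weights_def intro!: sum.cong)
  then obtain c where c: "c \<in> cone_weights p A x" "\<forall>i\<in>?B. 0 < c i"
    using cone_weights_common_support[of ?B p A x] assms(1) by fastforce
  have "c i = 0" if "i \<in> A - ?B" for i
    using that c(1) by (auto simp: cone_weights_def less_le)
  then have "(\<Sum>i\<in>A. c i *\<^sub>R p i) = (\<Sum>i\<in>?B. c i *\<^sub>R p i)"
    using assms(1) by (intro sum.mono_neutral_right) auto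
  then have "x = (\<Sum>i\<in>?B. c i *\<^sub>R p i)"
    using c(1) by (simp add: cone_weights_def)
  then show ?thesis
    using c(2) by (auto simp: open_cone_def)
qed


section \<open>Spherical polytopes\<close>

lemma sph_hull_empty [simp]: "sph_hull {} = {}"
  by (auto simp: sph_hull_def)

lemma sph_hull_mono: "X \<subseteq> Y \<Longrightarrow> sph_hull X \<subseteq> sph_hull Y"
  unfolding sph_hull_def using hull_mono[of X Y convex_cone] by blast

lemma sph_hull_rescale:
  "(\<And>i. i \<in> A \<Longrightarrow> 0 < c i) \<Longrightarrow> sph_hull ((\<lambda>i. c i *\<^sub>R p i) ` A) = sph_hull (p ` A)"
  by (simp add: sph_hull_def convex_cone_hull_rescale)

lemma sph_hull_normalised:
  assumes "\<And>i. i \<in> A \<Longrightarrow> p i \<noteq> 0"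
  shows "sph_hull ((\<lambda>i. p i /\<^sub>R norm (p i)) ` A) = sph_hull (p ` A)"
  using assms by (intro sph_hull_rescale) simp

lemma normalised_mem_sph_hull_iff:
  assumes "x \<noteq> 0"
  shows "x /\<^sub>R norm x \<in> sph_hull S \<longleftrightarrow> x \<in> convex_cone hull S"
proof
  assume "x /\<^sub>R norm x \<in> sph_hull S"
  moreover have "norm x *\<^sub>R (x /\<^sub>R norm x) = x"
    using assms by simp
  ultimately show "x \<in> convex_cone hull S"
    using convex_cone_hull_mul[of "x /\<^sub>R norm x" S "norm x"] unfolding sph_hull_def by (metis IntE norm_ge_zero)
qed (use assms in \<open>simp add: sph_hull_def convex_cone_hull_mul\<close>)

lemma sph_hull_singleton:
  assumes "p \<noteq> 0"
  shows "sph_hull {p} = {p /\<^sub>R norm p}"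
proof -
  have "x = p /\<^sub>R norm p" if x: "x \<in> sph_hull {p}" for x
  proof -
    obtain c where c: "x = c *\<^sub>R p" "0 \<le> c"
      using convex_cone_hull_imageE[of x id "{p}"] x by (auto simp: sph_hull_def)
    then have "c * norm p = 1"
      using x by (simp add: sph_hull_def)
    then show ?thesis
      using assms c(1) by (simp add: inverse_unique mult.commute)
  qed
  moreover have "p /\<^sub>R norm p \<in> sph_hull {p}"
    using assms by (simp add: normalised_mem_sph_hull_iff hull_inc)
  ultimately show ?thesis
    by blast
qed

lemma sph_hull_isometry:
  assumes "linear g" "\<And>x. norm (g x) = norm x"
  shows "g ` sph_hull X = sph_hull (g ` X)"
  unfolding sph_hull_def convex_cone_hull_linear_image[OF assms(1)] using assms(2) by auto

lemma sph_hull_face: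
  assumes "\<And>y. y \<in> S \<Longrightarrow> 0 \<le> a \<bullet> y"
  shows "{x \<in> sph_hull S. a \<bullet> x = 0} = sph_hull {y \<in> S. a \<bullet> y = 0}"
proof -
  have "a \<bullet> x = 0" if "x \<in> convex_cone hull {y \<in> S. a \<bullet> y = 0}" for x
    using convex_cone_hull_face(1)[OF _ that, of a] convex_cone_hull_face(1)[OF _ that, of "- a"] by force
  moreover have "convex_cone hull {y \<in> S. a \<bullet> y = 0} \<subseteq> convex_cone hull S"
    by (rule hull_mono) auto
  ultimately show ?thesis
    using convex_cone_hull_face(2)[OF assms] by (auto simp: sph_hull_def)
qed

lemma sph_face_of_sph_hull_iff:
  assumes "0 \<notin> S"
  shows "F sph_face_of sph_hull S \<longleftrightarrow>
    (\<exists>a. (\<forall>y\<in>S. 0 \<le> a \<bullet> y) \<and> F = sph_hull {y \<in> S. a \<bullet> y = 0})"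
proof -
  have "(\<forall>x\<in>sph_hull S. 0 \<le> a \<bullet> x) \<longleftrightarrow> (\<forall>y\<in>S. 0 \<le> a \<bullet> y)" for a
  proof
    assume nonneg: "\<forall>x\<in>sph_hull S. 0 \<le> a \<bullet> x"
    show "\<forall>y\<in>S. 0 \<le> a \<bullet> y"
    proof
      fix y assume y: "y \<in> S"
      then have "y \<noteq> 0" using assms by auto
      then have "0 \<le> a \<bullet> (y /\<^sub>R norm y)"
        using nonneg y by (intro bspec[OF nonneg]) (simp add: normalised_mem_sph_hull_iff hull_inc)
      then show "0 \<le> a \<bullet> y"
        using \<open>y \<noteq> 0\<close> by (simp add: zero_le_mult_iff)
    qed
  qed (auto simp: sph_hull_def intro: convex_cone_hull_face(1))
  then show ?thesis
    unfolding sph_face_of_def using sph_hull_face by (metis (no_types, lifting))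
qed

lemma sph_face_of_sph_hull_vertex:
  assumes "{x} sph_face_of sph_hull S" "S \<subseteq> sphere 0 1"
  shows "x \<in> S"
proof -
  have "0 \<notin> S"
    using assms(2) by auto
  then obtain a where a: "{x} = sph_hull {y \<in> S. a \<bullet> y = 0}"
    using assms(1) sph_face_of_sph_hull_iff by blast
  then have "{y \<in> S. a \<bullet> y = 0} \<noteq> {}"
    by (metis insert_not_empty sph_hull_empty)
  then obtain y where y: "y \<in> S" "a \<bullet> y = 0"
    by blast
  then have "y \<in> {x}"
    unfolding a sph_hull_def using assms(2) by (auto intro: hull_inc)
  then show ?thesis
    using y(1) by simp
qed

lemma sph_polytope_sph_hull:
  assumes "finite S" "\<And>y. y \<in> S \<Longrightarrow> 0 < a \<bullet> y"
  shows "sph_polytope (sph_hull S)"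
proof -
  let ?n = "\<lambda>y. y /\<^sub>R norm y"
  have nonzero: "y \<noteq> 0" if "y \<in> S" for y
    using assms(2)[OF that] by auto
  then have "sph_hull (?n ` S) = sph_hull S"
    using sph_hull_normalised[of S "\<lambda>y. y"] by simp
  moreover have "?n ` S \<subseteq> sphere 0 1" "\<forall>v\<in>?n ` S. 0 < a \<bullet> v"
    using nonzero assms(2) by (auto simp: zero_less_mult_iff)
  ultimately show ?thesis
    unfolding sph_polytope_def using assms(1)
    by (intro exI[of _ "?n ` S"] exI[of _ a]) auto
qed

lemma sph_polytope_pointed:
  assumes "sph_polytope P"
  obtains a where "\<And>x. x \<in> P \<Longrightarrow> 0 < a \<bullet> x"
proof -
  obtain V a where V: "\<forall>v\<in>V. 0 < a \<bullet> v" "P = sph_hull V"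
    using assms unfolding sph_polytope_def by blast
  then have nonneg: "\<And>v. v \<in> V \<Longrightarrow> 0 \<le> a \<bullet> v"
    by (simp add: less_imp_le)
  have "{v \<in> V. a \<bullet> v = 0} = {}"
    using V(1) by force
  then have "{x \<in> P. a \<bullet> x = 0} = {}"
    using sph_hull_face[of V a, OF nonneg] V(2) by (simp only: sph_hull_empty)
  moreover have "0 \<le> a \<bullet> x" if "x \<in> P" for x
    using that V(2) convex_cone_hull_face(1)[of V a x, OF nonneg] by (simp add: sph_hull_def)
  ultimately show ?thesis
    using that[of a] by (force simp: less_le)
qed

lemma compact_sph_polytope:
  assumes "sph_polytope P"
  shows "compact P"
proof -
  obtain V where V: "finite V" "P = sph_hull V"
    using assms unfolding sph_polytope_def by blast
  then show ?thesis
    unfolding sph_hull_def by (metis closed_Int_compact closed_convex_cone_hull compact_sphere)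
qed

lemma sph_face_of_exposed_vertex:
  assumes V: "finite V" "\<And>u. u \<in> V \<Longrightarrow> 0 < a \<bullet> u"
    and v: "v \<in> V" "v \<notin> convex_cone hull (V - {v})" "norm v = 1"
  shows "{v} sph_face_of sph_hull V"
proof -
  have "closed (convex_cone hull (V - {v}))"
    using V(1) by (intro closed_convex_cone_hull) auto
  then obtain b where b: "b \<bullet> v < 0" "\<And>x. x \<in> convex_cone hull (V - {v}) \<Longrightarrow> 0 \<le> b \<bullet> x"
    using convex_cone_separation[OF convex_cone_convex_cone_hull _ v(2)] by blast
  define d where "d = b - ((b \<bullet> v) / (a \<bullet> v)) *\<^sub>R a"
  have d: "d \<bullet> v = 0"
    using V(2)[OF v(1)] by (simp add: d_def inner_diff_left)
  have "0 < d \<bullet> u" if u: "u \<in> V" "u \<noteq> v" for u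
  proof -
    have "(b \<bullet> v) / (a \<bullet> v) * (a \<bullet> u) < 0"
      using b(1) V(2) v(1) u(1) by (simp add: divide_neg_pos mult_neg_pos)
    moreover have "0 \<le> b \<bullet> u"
      using u by (intro b(2) hull_inc) simp
    ultimately show ?thesis
      by (simp add: d_def inner_diff_left)
  qed
  then have "\<forall>u\<in>V. 0 \<le> d \<bullet> u \<and> (d \<bullet> u = 0 \<longleftrightarrow> u = v)"
    using d by (metis less_irrefl less_imp_le order_refl)
  then have "{u \<in> V. d \<bullet> u = 0} = {v}" "\<forall>u\<in>V. 0 \<le> d \<bullet> u"
    using v(1) by blast+
  moreover have "sph_hull {v} = {v}"
    using v(3) sph_hull_singleton[of v] by force
  moreover have "0 \<notin> V"
    using V(2)[of 0] by auto
  ultimately show ?thesis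
    by (subst sph_face_of_sph_hull_iff) (simp, intro exI[of _ d], simp only: simp_thms)
qed

lemma sph_polytope_vertices:
  assumes "sph_polytope P"
  shows "P = sph_hull {x. {x} sph_face_of P}"
proof
  obtain V a where V: "finite V" "V \<subseteq> sphere 0 1" "\<forall>v\<in>V. 0 < a \<bullet> v" "P = sph_hull V"
    using assms unfolding sph_polytope_def by blast
  define \<U> where "\<U> = {U. U \<subseteq> V \<and> sph_hull U = P}"
  have "finite \<U>" "V \<in> \<U>"
    unfolding \<U>_def using V by (auto intro: finite_subset[of _ "Pow V"])
  then obtain U where U: "U \<in> \<U>" "\<And>W. W \<in> \<U> \<Longrightarrow> W \<subseteq> U \<Longrightarrow> W = U"
    using finite_has_minimal2[of \<U> V] by metis
  then have UV: "finite U" "U \<subseteq> V" "sph_hull U = P"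
    using V(1) finite_subset by (auto simp: \<U>_def)
  have "{v} sph_face_of P" if v: "v \<in> U" for v
  proof -
    have "v \<notin> convex_cone hull (U - {v})"
    proof
      assume "v \<in> convex_cone hull (U - {v})"
      then have "convex_cone hull (U - {v}) = convex_cone hull U"
        using hull_redundant[of v convex_cone "U - {v}"] v by (simp add: insert_absorb)
      then have "U - {v} \<in> \<U>"
        using UV by (auto simp: \<U>_def sph_hull_def)
      then show False
        using U(2)[of "U - {v}"] v by blast
    qed
    moreover have "0 < a \<bullet> u" if "u \<in> U" for u
      using that UV(2) V(3) by blast
    moreover have "norm v = 1"
      using v UV(2) V(2) by auto
    ultimately show ?thesis
      using sph_face_of_exposed_vertex[OF UV(1) _ v] UV(3) by metis
  qed
  then show "P \<subseteq> sph_hull {x. {x} sph_face_of P}"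
    unfolding UV(3)[symmetric] using UV(3) by (intro sph_hull_mono) auto
  have "{x. {x} sph_face_of P} \<subseteq> convex_cone hull V"
    using V(4) by (auto simp: sph_face_of_def sph_hull_def)
  then have "convex_cone hull {x. {x} sph_face_of P} \<subseteq> convex_cone hull V"
    by (intro hull_minimal convex_cone_convex_cone_hull)
  then show "sph_hull {x. {x} sph_face_of P} \<subseteq> P"
    unfolding V(4) sph_hull_def by blast
qed

section \<open>Combinatorial cubes\<close>

definition subcubes :: "'a set \<Rightarrow> 'a set set set" where
  "subcubes I = insert {} {{A..B} | A B. A \<subseteq> B \<and> B \<subseteq> I}"

lemma subcubesE:
  assumes "W \<in> subcubes I"
  obtains "W = {}" | A B where "A \<subseteq> B" "B \<subseteq> I" "W = {A..B}"
  using assms unfolding subcubes_def by blast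

lemma empty_mem_subcubes: "{} \<in> subcubes I"
  by (simp add: subcubes_def)

lemma interval_mem_subcubes: "A \<subseteq> B \<Longrightarrow> B \<subseteq> I \<Longrightarrow> {A..B} \<in> subcubes I"
  unfolding subcubes_def by blast

lemma subcubes_Pow: "W \<in> subcubes I \<Longrightarrow> W \<subseteq> Pow I"
  by (erule subcubesE) (auto simp: subset_eq)

lemma subcubes_of_convex:
  fixes W :: "'a::finite set set"
  assumes "W \<subseteq> Pow I"
    and "\<And>S S' S''. S \<in> W \<Longrightarrow> S' \<in> W \<Longrightarrow> S \<inter> S' \<subseteq> S'' \<Longrightarrow> S'' \<subseteq> S \<union> S' \<Longrightarrow> S'' \<in> W"
  shows "W \<in> subcubes I"
proof (cases "W = {}")
  case False
  have i: "Inf W \<in> W"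
    using assms(2)[OF _ _ order_refl] by (intro finite_Inf_in False) auto
  have s: "Sup W \<in> W"
    using assms(2)[OF _ _ _ order_refl] by (intro finite_Sup_in False) auto
  have "S \<in> W" if "Inf W \<subseteq> S" "S \<subseteq> Sup W" for S
    by (rule assms(2)[OF i s]) (use that in blast)+
  then have "W = {Inf W..Sup W}"
    unfolding atLeastAtMost_def by blast
  moreover have "Inf W \<subseteq> Sup W" "Sup W \<subseteq> I"
    using i s assms(1) by (blast, blast)
  ultimately show ?thesis
    using interval_mem_subcubes by metis
qed (simp add: empty_mem_subcubes)

text \<open>Pairs of diagonals \<open>{S, S'}\<close> and \<open>{T, T'}\<close> of the six squares and of two of the diagonal
  rectangles of the 3-cube. In the realisations below the diagonals of these quadrilaterals cross,
  and this alone determines the face lattice.\<close>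

definition cube_diagonals :: "(3 set \<times> 3 set \<times> 3 set \<times> 3 set) set" where
  "cube_diagonals = {({}, {1,2}, {1}, {2}), ({3}, {1,2,3}, {1,3}, {2,3}),
            ({}, {1,3}, {1}, {3}), ({}, {2,3}, {2}, {3}),
            ({1}, {1,2,3}, {1,2}, {1,3}), ({2}, {1,2,3}, {1,2}, {2,3}),
            ({}, {1,2,3}, {3}, {1,2}), ({1}, {2,3}, {2}, {1,3})}"

definition diagonal_closed :: "3 set set \<Rightarrow> bool" where
  "diagonal_closed W \<longleftrightarrow> (\<forall>(S, S', T, T')\<in>cube_diagonals. S \<in> W \<and> S' \<in> W \<longleftrightarrow> T \<in> W \<and> T' \<in> W)"

lemma cube_diagonals_Un: "(S, S', T, T') \<in> cube_diagonals \<Longrightarrow> S \<union> S' = T \<union> T'"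
  unfolding cube_diagonals_def by (elim insertE) auto

lemma cube_diagonals_distinct: "(S, S', T, T') \<in> cube_diagonals \<Longrightarrow> distinct [S, S', T, T']"
proof -
  define g :: "3 set \<Rightarrow> bool \<times> bool \<times> bool" where "g S = (1 \<in> S, 2 \<in> S, 3 \<in> S)" for S
  assume "(S, S', T, T') \<in> cube_diagonals"
  then have "distinct (map g [S, S', T, T'])"
    unfolding cube_diagonals_def by (elim insertE emptyE) (simp_all add: g_def)
  then show ?thesis
    unfolding distinct_map by (rule conjunct1)
qed

lemma bool_cube_convex:
  fixes f :: "bool \<Rightarrow> bool \<Rightarrow> bool \<Rightarrow> bool"
  assumes r: "(f False False False \<and> f True True False) = (f True False False \<and> f False True False)"
      "(f False False True \<and> f True True True) = (f True False True \<and> f False True True)"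
      "(f False False False \<and> f True False True) = (f True False False \<and> f False False True)"
      "(f False False False \<and> f False True True) = (f False True False \<and> f False False True)"
      "(f True False False \<and> f True True True) = (f True True False \<and> f True False True)"
      "(f False True False \<and> f True True True) = (f True True False \<and> f False True True)"
      "(f False False False \<and> f True True True) = (f False False True \<and> f True True False)"
      "(f True False False \<and> f False True True) = (f False True False \<and> f True False True)"
    and h: "f x y z" "f x' y' z'" "x = x' \<Longrightarrow> x'' = x" "y = y' \<Longrightarrow> y'' = y" "z = z' \<Longrightarrow> z'' = z"
  shows "f x'' y'' z''"
  using h
  apply (cases x; cases x'; cases y; cases y'; cases z; cases z')
  apply (simp_all only: simp_thms)
  using r apply -
  by (cases x''; cases y''; cases z''; (simp only: simp_thms)?; argo)+

lemma diagonal_closed_convex: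
  assumes "diagonal_closed W" "S \<in> W" "S' \<in> W" "S \<inter> S' \<subseteq> S''" "S'' \<subseteq> S \<union> S'"
  shows "S'' \<in> W"
proof -
  define m :: "bool \<Rightarrow> bool \<Rightarrow> bool \<Rightarrow> 3 set" where
    "m x y z = (if x then insert 1 else id) ((if y then insert 2 else id) (if z then {3} else {}))" for x y z
  have m: "m (1 \<in> T) (2 \<in> T) (3 \<in> T) = T" for T
    by (simp add: m_def set_eq_iff forall_3)
  have "m (1 \<in> S'') (2 \<in> S'') (3 \<in> S'') \<in> W"
  proof (rule bool_cube_convex[where f = "\<lambda>x y z. m x y z \<in> W"])
    show "m (1 \<in> S) (2 \<in> S) (3 \<in> S) \<in> W" "m (1 \<in> S') (2 \<in> S') (3 \<in> S') \<in> W"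
      using assms(2,3) by (simp_all only: m)
  next
    show "(1 \<in> S) = (1 \<in> S') \<Longrightarrow> (1 \<in> S'') = (1 \<in> S)"
      "(2 \<in> S) = (2 \<in> S') \<Longrightarrow> (2 \<in> S'') = (2 \<in> S)"
      "(3 \<in> S) = (3 \<in> S') \<Longrightarrow> (3 \<in> S'') = (3 \<in> S)"
      using assms(4,5) by blast+
  qed (use assms(1) in \<open>simp_all add: diagonal_closed_def cube_diagonals_def m_def\<close>)
  then show ?thesis by (simp only: m)
qed

lemma diagonal_closed_subcubes:
  assumes "diagonal_closed W" "W \<subseteq> Pow I"
  shows "W \<in> subcubes I"
  using assms diagonal_closed_convex by (intro subcubes_of_convex) blast+

definition diagonals_cross :: "'a::real_vector \<Rightarrow> 'a \<Rightarrow> 'a \<Rightarrow> 'a \<Rightarrow> bool" where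
  "diagonals_cross p p' q q' \<longleftrightarrow> (\<exists>\<alpha> \<beta> \<gamma> \<delta>. 0 < \<alpha> \<and> 0 < \<beta> \<and> 0 < \<gamma> \<and> 0 < \<delta> \<and>
     \<alpha> *\<^sub>R p + \<beta> *\<^sub>R p' = \<gamma> *\<^sub>R q + \<delta> *\<^sub>R q')"

lemma diagonals_crossI:
  assumes "\<alpha> *\<^sub>R p + \<beta> *\<^sub>R p' = \<gamma> *\<^sub>R q + \<delta> *\<^sub>R q'" "0 < \<alpha>" "0 < \<beta>" "0 < \<gamma>" "0 < \<delta>"
  shows "diagonals_cross p p' q q'"
  using assms unfolding diagonals_cross_def by blast

lemma diagonals_crossE:
  assumes "diagonals_cross p p' q q'"
  obtains \<alpha> \<beta> \<gamma> \<delta> where "0 < \<alpha>" "0 < \<beta>" "0 < \<gamma>" "0 < \<delta>" "\<alpha> *\<^sub>R p + \<beta> *\<^sub>R p' = \<gamma> *\<^sub>R q + \<delta> *\<^sub>R q'"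
  using assms unfolding diagonals_cross_def by blast

lemma diagonals_cross_linear_image:
  assumes "diagonals_cross p p' q q'" "linear f"
  shows "diagonals_cross (f p) (f p') (f q) (f q')"
  using assms(1)
proof (rule diagonals_crossE)
  fix \<alpha> \<beta> \<gamma> \<delta> :: real
  assume pos: "0 < \<alpha>" "0 < \<beta>" "0 < \<gamma>" "0 < \<delta>"
    and "\<alpha> *\<^sub>R p + \<beta> *\<^sub>R p' = \<gamma> *\<^sub>R q + \<delta> *\<^sub>R q'"
  then have "f (\<alpha> *\<^sub>R p + \<beta> *\<^sub>R p') = f (\<gamma> *\<^sub>R q + \<delta> *\<^sub>R q')"
    by simp
  then show ?thesis
    using pos assms(2)
    by (intro diagonals_crossI[where \<alpha> = \<alpha> and \<beta> = \<beta> and \<gamma> = \<gamma> and \<delta> = \<delta>])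
      (simp_all add: linear_add linear_scale)
qed

definition cube_config :: "(3 set \<Rightarrow> real^5) \<Rightarrow> bool" where
  "cube_config p \<longleftrightarrow> (\<exists>a. \<forall>S. 0 < a \<bullet> p S) \<and>
     (\<forall>i. \<exists>a. \<forall>S. 0 \<le> a \<bullet> p S \<and> (a \<bullet> p S = 0 \<longleftrightarrow> i \<notin> S)) \<and>
     (\<forall>i. \<exists>a. \<forall>S. 0 \<le> a \<bullet> p S \<and> (a \<bullet> p S = 0 \<longleftrightarrow> i \<in> S)) \<and>
     (\<forall>(S, S', T, T')\<in>cube_diagonals. diagonals_cross (p S) (p S') (p T) (p T'))"

lemma cube_config_nonzero: "cube_config p \<Longrightarrow> p S \<noteq> 0"
  unfolding cube_config_def by (metis inner_zero_right less_irrefl)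

lemma cube_config_pointed: "cube_config p \<Longrightarrow> \<exists>a. \<forall>S. 0 < a \<bullet> p S"
  and cube_config_lower_facets: "cube_config p \<Longrightarrow> \<forall>i. \<exists>a. \<forall>S. 0 \<le> a \<bullet> p S \<and> (a \<bullet> p S = 0 \<longleftrightarrow> i \<notin> S)"
  and cube_config_upper_facets: "cube_config p \<Longrightarrow> \<forall>i. \<exists>a. \<forall>S. 0 \<le> a \<bullet> p S \<and> (a \<bullet> p S = 0 \<longleftrightarrow> i \<in> S)"
  unfolding cube_config_def by (elim conjE, assumption)+

lemma cube_config_diagonals_cross:
  "cube_config p \<Longrightarrow> (S, S', T, T') \<in> cube_diagonals \<Longrightarrow> diagonals_cross (p S) (p S') (p T) (p T')"
  unfolding cube_config_def by blast

lemma cube_config_exposed_interval: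
  assumes "cube_config p"
  obtains a where "\<And>S. 0 \<le> a \<bullet> p S" "\<And>S. a \<bullet> p S = 0 \<longleftrightarrow> S \<in> {A..B}"
proof -
  obtain f where f: "\<And>i S. 0 \<le> f i \<bullet> p S" "\<And>i S. f i \<bullet> p S = 0 \<longleftrightarrow> i \<notin> S"
    using choice[OF cube_config_lower_facets[OF assms]] by blast
  obtain g where g: "\<And>i S. 0 \<le> g i \<bullet> p S" "\<And>i S. g i \<bullet> p S = 0 \<longleftrightarrow> i \<in> S"
    using choice[OF cube_config_upper_facets[OF assms]] by blast
  let ?a = "(\<Sum>i\<in>A. g i) + (\<Sum>i\<in>-B. f i)"
  have expand: "?a \<bullet> p S = (\<Sum>i\<in>A. g i \<bullet> p S) + (\<Sum>i\<in>-B. f i \<bullet> p S)" for S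
    by (simp add: inner_add_left inner_sum_left)
  have nonneg: "0 \<le> (\<Sum>i\<in>A. g i \<bullet> p S)" "0 \<le> (\<Sum>i\<in>-B. f i \<bullet> p S)" for S
    using f g by (auto intro: sum_nonneg)
  have "?a \<bullet> p S = 0 \<longleftrightarrow> (\<forall>i\<in>A. g i \<bullet> p S = 0) \<and> (\<forall>i\<in>-B. f i \<bullet> p S = 0)" for S
    unfolding expand add_nonneg_eq_0_iff[OF nonneg] using f(1) g(1) by (simp add: sum_nonneg_eq_0_iff)
  then have "?a \<bullet> p S = 0 \<longleftrightarrow> S \<in> {A..B}" for S
    using f g by auto
  then show ?thesis
    using nonneg expand that[of ?a] by simp
qed

lemma cube_config_exposed_subcube:
  assumes "cube_config p" "W \<in> subcubes I"
  obtains a where "\<And>S. 0 \<le> a \<bullet> p S" "\<And>S. a \<bullet> p S = 0 \<longleftrightarrow> S \<in> W"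
  using assms(2)
proof (cases rule: subcubesE)
  case 1
  then show ?thesis
    using cube_config_pointed[OF assms(1)] that by (metis empty_iff less_imp_le less_irrefl)
next
  case (2 A B)
  then show ?thesis
    using cube_config_exposed_interval[OF assms(1)] that by metis
qed

lemma cube_config_face_diagonal_closed:
  assumes "cube_config p" "\<And>S. S \<in> Pow I \<Longrightarrow> 0 \<le> a \<bullet> p S"
  shows "diagonal_closed {S \<in> Pow I. a \<bullet> p S = 0}"
  unfolding diagonal_closed_def
proof clarify
  fix S S' T T' assume diagonals: "(S, S', T, T') \<in> cube_diagonals"
  obtain \<alpha> \<beta> \<gamma> \<delta> where pos: "0 < \<alpha>" "0 < \<beta>" "0 < \<gamma>" "0 < \<delta>"
    and relation: "\<alpha> *\<^sub>R p S + \<beta> *\<^sub>R p S' = \<gamma> *\<^sub>R p T + \<delta> *\<^sub>R p T'"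
    using diagonals_crossE[OF cube_config_diagonals_cross[OF assms(1) diagonals]] .
  have "\<alpha> * (a \<bullet> p S) + \<beta> * (a \<bullet> p S') = \<gamma> * (a \<bullet> p T) + \<delta> * (a \<bullet> p T')"
    using arg_cong[OF relation, of "(\<bullet>) a"] by (simp add: inner_add_right)
  moreover have "u * x + v * y = 0 \<longleftrightarrow> x = 0 \<and> y = 0"
    if "0 < u" "0 < v" "0 \<le> x" "0 \<le> y" for u v x y :: real
    using that by (subst add_nonneg_eq_0_iff) auto
  moreover have "0 \<le> a \<bullet> p S" "0 \<le> a \<bullet> p S'" "0 \<le> a \<bullet> p T" "0 \<le> a \<bullet> p T'" if "S \<union> S' \<subseteq> I"
    using assms(2) that cube_diagonals_Un[OF diagonals] by auto
  ultimately have "a \<bullet> p S = 0 \<and> a \<bullet> p S' = 0 \<longleftrightarrow> a \<bullet> p T = 0 \<and> a \<bullet> p T' = 0" if "S \<union> S' \<subseteq> I"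
    using pos that by metis
  then show "S \<in> {S \<in> Pow I. a \<bullet> p S = 0} \<and> S' \<in> {S \<in> Pow I. a \<bullet> p S = 0} \<longleftrightarrow>
      T \<in> {S \<in> Pow I. a \<bullet> p S = 0} \<and> T' \<in> {S \<in> Pow I. a \<bullet> p S = 0}"
    using cube_diagonals_Un[OF diagonals] by auto
qed

lemma cube_config_faces:
  assumes "cube_config p"
  shows "F sph_face_of sph_hull (p ` Pow I) \<longleftrightarrow> (\<exists>W\<in>subcubes I. F = sph_hull (p ` W))"
proof -
  have image: "{y \<in> p ` Pow I. a \<bullet> y = 0} = p ` {S \<in> Pow I. a \<bullet> p S = 0}" for a
    by blast
  have "0 \<notin> p ` Pow I"
    using cube_config_nonzero[OF assms] by force
  then have face: "F sph_face_of sph_hull (p ` Pow I) \<longleftrightarrow>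
      (\<exists>a. (\<forall>S\<in>Pow I. 0 \<le> a \<bullet> p S) \<and> F = sph_hull (p ` {S \<in> Pow I. a \<bullet> p S = 0}))"
    unfolding sph_face_of_sph_hull_iff[OF \<open>0 \<notin> p ` Pow I\<close>] image by simp
  show ?thesis
  proof
    assume "F sph_face_of sph_hull (p ` Pow I)"
    then obtain a where a: "\<forall>S\<in>Pow I. 0 \<le> a \<bullet> p S"
      and F: "F = sph_hull (p ` {S \<in> Pow I. a \<bullet> p S = 0})"
      unfolding face by blast
    have "{S \<in> Pow I. a \<bullet> p S = 0} \<in> subcubes I"
      using a by (intro diagonal_closed_subcubes cube_config_face_diagonal_closed assms) auto
    then show "\<exists>W\<in>subcubes I. F = sph_hull (p ` W)"
      using F by blast
  next
    assume "\<exists>W\<in>subcubes I. F = sph_hull (p ` W)"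
    then obtain W where W: "W \<in> subcubes I" "F = sph_hull (p ` W)" by blast
    obtain a where a: "\<And>S. 0 \<le> a \<bullet> p S" "\<And>S. a \<bullet> p S = 0 \<longleftrightarrow> S \<in> W"
      using cube_config_exposed_subcube[OF assms W(1)] by blast
    have "W = {S \<in> Pow I. a \<bullet> p S = 0}"
      using a(2) subcubes_Pow[OF W(1)] by auto
    then show "F sph_face_of sph_hull (p ` Pow I)"
      unfolding face using a(1) W(2) by (intro exI[of _ a]) simp
  qed
qed

lemma cube_config_corner_mem:
  assumes "cube_config p" "W \<in> subcubes I" "p S \<in> convex_cone hull (p ` W)"
  shows "S \<in> W"
proof -
  obtain a where a: "\<And>S. 0 \<le> a \<bullet> p S" "\<And>S. a \<bullet> p S = 0 \<longleftrightarrow> S \<in> W"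
    using cube_config_exposed_subcube[OF assms(1,2)] by blast
  have "a \<bullet> p T = 0" if "T \<in> W" for T
    using a(2) that by blast
  then have "0 \<le> - a \<bullet> p S"
    by (intro convex_cone_hull_face(1)[OF _ assms(3)]) auto
  then show ?thesis
    using a(1)[of S] a(2)[of S] by simp
qed

lemma cube_config_hull_subset_iff:
  assumes "cube_config p" "W \<in> subcubes I" "W' \<in> subcubes I"
  shows "sph_hull (p ` W) \<subseteq> sph_hull (p ` W') \<longleftrightarrow> W \<subseteq> W'"
proof
  assume subset: "sph_hull (p ` W) \<subseteq> sph_hull (p ` W')"
  show "W \<subseteq> W'"
  proof
    fix S assume "S \<in> W"
    then have "p S /\<^sub>R norm (p S) \<in> sph_hull (p ` W')"
      using subset normalised_mem_sph_hull_iff[OF cube_config_nonzero[OF assms(1)], of S "p ` W"]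
      by (auto intro: hull_inc)
    then show "S \<in> W'"
      using normalised_mem_sph_hull_iff cube_config_nonzero[OF assms(1)] cube_config_corner_mem[OF assms(1,3)]
      by blast
  qed
qed (intro sph_hull_mono image_mono)

lemma cube_config_polytope: "cube_config p \<Longrightarrow> sph_polytope (sph_hull (p ` W))"
  using cube_config_pointed[of p] sph_polytope_sph_hull[of "p ` W"] by auto

lemma cube_config_open_cone:
  assumes "cube_config p" "x \<in> convex_cone hull (p ` Pow I)" "x \<noteq> 0"
  obtains A B where "A \<subseteq> B" "B \<subseteq> I" "x \<in> open_cone p {A..B}"
proof -
  define X where "X = {S \<in> Pow I. \<exists>c\<in>cone_weights p (Pow I) x. 0 < c S}"
  have X: "x \<in> open_cone p X"
    unfolding X_def using mem_open_cone_support[of "Pow I" x p] assms(2) by simp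
  have common: "\<exists>d\<in>cone_weights p (Pow I) x. 0 < d S \<and> 0 < d S'" if "S \<in> X" "S' \<in> X" for S S'
    using cone_weights_common_support[of "{S, S'}" p "Pow I" x] that by (auto simp: X_def)
  have exchange: "T \<in> X \<and> T' \<in> X"
    if X: "S \<in> X \<and> S' \<in> X" and T: "distinct [S, S', T, T']" "S \<union> S' = T \<union> T'"
      and relation: "0 < \<alpha>" "0 < \<beta>" "0 < \<gamma>" "0 < \<delta>" "\<alpha> *\<^sub>R p S + \<beta> *\<^sub>R p S' = \<gamma> *\<^sub>R p T + \<delta> *\<^sub>R p T'"
    for S S' T T' \<alpha> \<beta> \<gamma> \<delta>
  proof -
    obtain d where d: "d \<in> cone_weights p (Pow I) x" "0 < d S" "0 < d S'"
      using common X by blast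
    have sub: "{S, S', T, T'} \<subseteq> Pow I"
      using X T(2) by (auto simp: X_def)
    show ?thesis
      using cone_weights_exchange[OF d sub T(1) finite relation] sub by (auto simp: X_def)
  qed
  have "diagonal_closed X"
    unfolding diagonal_closed_def
  proof clarify
    fix S S' T T' assume diagonals: "(S, S', T, T') \<in> cube_diagonals"
    obtain \<alpha> \<beta> \<gamma> \<delta> where relation: "0 < \<alpha>" "0 < \<beta>" "0 < \<gamma>" "0 < \<delta>"
      "\<alpha> *\<^sub>R p S + \<beta> *\<^sub>R p S' = \<gamma> *\<^sub>R p T + \<delta> *\<^sub>R p T'"
      using diagonals_crossE[OF cube_config_diagonals_cross[OF assms(1) diagonals]] .
    note S = cube_diagonals_distinct[OF diagonals] cube_diagonals_Un[OF diagonals]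
    have T: "distinct [T, T', S, S']" "T \<union> T' = S \<union> S'"
      using S by auto
    show "S \<in> X \<and> S' \<in> X \<longleftrightarrow> T \<in> X \<and> T' \<in> X"
      using exchange[OF _ S relation] exchange[OF _ T relation(3,4,1,2) relation(5)[symmetric]] by blast
  qed
  then have "X \<in> subcubes I"
    by (intro diagonal_closed_subcubes) (auto simp: X_def)
  moreover have "X \<noteq> {}"
    using X assms(3) by (auto simp: open_cone_def)
  ultimately show ?thesis
    using X that by (metis subcubesE)
qed

lemma cube_config_largest_common_subcube:
  assumes p: "cube_config p" and C: "convex_cone C"
    and common: "\<And>x. x \<in> convex_cone hull (p ` Pow I) \<Longrightarrow> x \<in> C \<Longrightarrow> x \<noteq> 0 \<Longrightarrow>
      \<exists>W\<in>subcubes I. p ` W \<subseteq> C \<and> x \<in> open_cone p W"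
  obtains W where "W \<in> subcubes I" "p ` W \<subseteq> C"
    "\<And>V. V \<in> subcubes I \<Longrightarrow> p ` V \<subseteq> C \<Longrightarrow> V \<subseteq> W"
proof -
  define U where "U = \<Union>{V \<in> subcubes I. p ` V \<subseteq> C}"
  define x where "x = (\<Sum>S\<in>U. p S)"
  have U: "U \<subseteq> Pow I" "p ` U \<subseteq> C"
    using subcubes_Pow by (fastforce simp: U_def)+
  show ?thesis
  proof (cases "U = {}")
    case True
    then show ?thesis
      using that[of "{}"] empty_mem_subcubes unfolding U_def by blast
  next
    case False
    obtain b where "\<forall>S. 0 < b \<bullet> p S"
      using cube_config_pointed[OF p] by blast
    then have "0 < b \<bullet> x"
      unfolding x_def inner_sum_right using False by (intro sum_pos) auto
    then have "x \<noteq> 0" by auto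
    have mem: "x \<in> open_cone p U"
      unfolding x_def by (rule sum_mem_open_cone)
    have "x \<in> convex_cone hull (p ` U)"
      using mem open_cone_subset by blast
    moreover have "convex_cone hull (p ` U) \<subseteq> convex_cone hull (p ` Pow I)" "convex_cone hull (p ` U) \<subseteq> C"
      using U C by (intro hull_mono image_mono hull_minimal; simp)+
    ultimately obtain W where W: "W \<in> subcubes I" "p ` W \<subseteq> C" "x \<in> open_cone p W"
      using common[of x] \<open>x \<noteq> 0\<close> by blast
    obtain a where a: "\<And>S. 0 \<le> a \<bullet> p S" "\<And>S. a \<bullet> p S = 0 \<longleftrightarrow> S \<in> W"
      using cube_config_exposed_subcube[OF p W(1)] by blast
    have "a \<bullet> x = 0"
      using inner_open_cone_zero_iff[OF W(3), of a] a by auto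
    then have "U \<subseteq> W"
      using inner_open_cone_zero_iff[OF mem, of a] a by auto
    then show ?thesis
      using that[OF W(1,2)] unfolding U_def by blast
  qed
qed

lemma cube_config_inter_face:
  assumes p: "cube_config p" and q: "cube_config q"
    and open_cones: "\<And>A B A' B' x. A \<subseteq> B \<Longrightarrow> B \<subseteq> I \<Longrightarrow> A' \<subseteq> B' \<Longrightarrow> B' \<subseteq> J \<Longrightarrow>
      x \<in> open_cone p {A..B} \<Longrightarrow> x \<in> open_cone q {A'..B'} \<Longrightarrow> p ` {A..B} = q ` {A'..B'}"
  shows "(sph_hull (p ` Pow I) \<inter> sph_hull (q ` Pow J)) sph_face_of sph_hull (p ` Pow I)"
proof -
  let ?P = "convex_cone hull (p ` Pow I)" and ?Q = "convex_cone hull (q ` Pow J)"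
  have common: "\<exists>W\<in>subcubes I. p ` W \<subseteq> ?Q \<and> x \<in> open_cone p W" if x: "x \<in> ?P" "x \<in> ?Q" "x \<noteq> 0" for x
  proof -
    obtain A B where AB: "A \<subseteq> B" "B \<subseteq> I" "x \<in> open_cone p {A..B}"
      using cube_config_open_cone[OF p x(1,3)] .
    obtain A' B' where AB': "A' \<subseteq> B'" "B' \<subseteq> J" "x \<in> open_cone q {A'..B'}"
      using cube_config_open_cone[OF q x(2,3)] .
    have "p ` {A..B} = q ` {A'..B'}"
      using open_cones AB AB' by blast
    moreover have "q ` {A'..B'} \<subseteq> ?Q"
      using AB'(2) by (auto intro!: hull_inc)
    ultimately show ?thesis
      using AB by (intro bexI[of _ "{A..B}"] interval_mem_subcubes) auto
  qed
  obtain W where W: "W \<in> subcubes I" "p ` W \<subseteq> ?Q"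
    and largest: "\<And>V. V \<in> subcubes I \<Longrightarrow> p ` V \<subseteq> ?Q \<Longrightarrow> V \<subseteq> W"
    using cube_config_largest_common_subcube[OF p convex_cone_convex_cone_hull common] by blast
  have "x \<in> convex_cone hull (p ` W)" if x: "x \<in> ?P" "x \<in> ?Q" "x \<noteq> 0" for x
  proof -
    obtain V where "V \<in> subcubes I" "p ` V \<subseteq> ?Q" "x \<in> open_cone p V"
      using common[OF x] by blast
    then show ?thesis
      using largest[of V] open_cone_subset[of p V] hull_mono[of "p ` V" "p ` W" convex_cone] by blast
  qed
  moreover have "convex_cone hull (p ` W) \<subseteq> ?P"
    using subcubes_Pow[OF W(1)] by (intro hull_mono image_mono)
  moreover have "convex_cone hull (p ` W) \<subseteq> ?Q"
    using W(2) by (intro hull_minimal convex_cone_convex_cone_hull)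
  ultimately have "sph_hull (p ` Pow I) \<inter> sph_hull (q ` Pow J) = sph_hull (p ` W)"
    by (auto simp: sph_hull_def) (metis norm_zero zero_neq_one)
  then show ?thesis
    using cube_config_faces[OF p] W(1) by metis
qed

section \<open>Boxes\<close>

definition ind_vec :: "'n set \<Rightarrow> real^'n" where
  "ind_vec S = (\<chi> i. if i \<in> S then 1 else 0)"

lemma ind_vec_nth [simp]: "ind_vec S $ i = (if i \<in> S then 1 else 0)"
  by (simp add: ind_vec_def)

lemma ind_vec_eq_iff: "ind_vec S = ind_vec T \<longleftrightarrow> S = T"
  by (auto simp: vec_eq_iff split: if_splits)

lemma ind_vec_empty [simp]: "ind_vec {} = 0"
  by (simp add: vec_eq_iff)

lemma ind_vec_Un: "A \<inter> S = {} \<Longrightarrow> ind_vec (A \<union> S) = ind_vec A + ind_vec S"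
  by (auto simp: vec_eq_iff)

lemma mem_unit_box_iff:
  "x \<in> cbox v (v + ind_vec I) \<longleftrightarrow> (\<forall>i. v $ i \<le> x $ i \<and> x $ i \<le> v $ i + ind_vec I $ i)"
  by (simp add: mem_box_cart)

lemma unit_box_face:
  fixes v :: "real^'n"
  shows "{x \<in> cbox v (v + ind_vec I). (\<forall>i\<in>A. x $ i = v $ i + 1) \<and> (\<forall>i\<in>I - B. x $ i = v $ i)}
    face_of cbox v (v + ind_vec I)"
proof -
  let ?C = "cbox v (v + ind_vec I)"
  have facet: "{x \<in> ?C. a \<bullet> x = c} face_of ?C" if "\<And>x. x \<in> ?C \<Longrightarrow> a \<bullet> x \<le> c" for a c
    using face_of_Int_supporting_hyperplane_le[OF convex_box(1) that] by (simp add: Int_def)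
  have bounds: "v $ i \<le> x $ i" "x $ i \<le> v $ i + 1" if "x \<in> ?C" for x i
    using mem_unit_box_iff[THEN iffD1, OF that, rule_format, of i] by (auto split: if_splits)
  have upper: "{x \<in> ?C. x $ i = v $ i + 1} face_of ?C" for i
    using facet[of "axis i 1" "v $ i + 1"] bounds(2) by (simp add: inner_axis')
  have lower: "{x \<in> ?C. x $ i = v $ i} face_of ?C" for i
    using facet[of "- axis i 1" "- v $ i"] bounds(1) by (simp add: inner_axis')
  have "\<Inter>(insert ?C ((\<lambda>i. {x \<in> ?C. x $ i = v $ i + 1}) ` A \<union>
      (\<lambda>i. {x \<in> ?C. x $ i = v $ i}) ` (I - B))) face_of ?C"
    (is "?faces face_of _")
    using upper lower by (intro face_of_Inter) (auto simp: face_of_refl)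
  also have "?faces = {x \<in> ?C. (\<forall>i\<in>A. x $ i = v $ i + 1) \<and> (\<forall>i\<in>I - B. x $ i = v $ i)}"
    by blast
  finally show ?thesis .
qed

lemma extreme_point_of_cbox_cart:
  fixes a b :: "real^'n"
  assumes "x extreme_point_of cbox a b"
  shows "x $ i = a $ i \<or> x $ i = b $ i"
proof (rule ccontr)
  assume interior: "\<not> (x $ i = a $ i \<or> x $ i = b $ i)"
  have x: "x \<in> cbox a b"
    using assms by (simp add: extreme_point_of_def)
  define d where "d = min (x $ i - a $ i) (b $ i - x $ i)"
  have "a $ i \<le> x $ i" "x $ i \<le> b $ i"
    using x by (auto simp: mem_box_cart)
  then have d: "0 < d" "a $ i \<le> x $ i - d" "x $ i + d \<le> b $ i"
    using interior by (auto simp: d_def)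
  have "x + axis i d \<noteq> x - axis i d"
    using d(1) by (auto simp: vec_eq_iff axis_def intro!: exI[of _ i])
  moreover have "x = (1 - 1/2) *\<^sub>R (x + axis i d) + (1/2) *\<^sub>R (x - axis i d)"
    by (simp add: vec_eq_iff axis_def field_simps)
  ultimately have "x \<in> open_segment (x + axis i d) (x - axis i d)"
    unfolding in_segment by (intro conjI exI[of _ "1/2"]) auto
  moreover have "x + axis i d \<in> cbox a b" "x - axis i d \<in> cbox a b"
    using x d by (auto simp: mem_box_cart axis_def)
  ultimately show False
    using assms by (auto simp: extreme_point_of_def)
qed

lemma unit_box_vertex_iff: "{x} face_of cbox v (v + ind_vec I) \<longleftrightarrow> (\<exists>S\<subseteq>I. x = v + ind_vec S)"
proof
  assume "{x} face_of cbox v (v + ind_vec I)"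
  then have extreme: "x extreme_point_of cbox v (v + ind_vec I)"
    by (simp add: face_of_singleton)
  then have ends: "x \<in> cbox v (v + ind_vec I)" "\<And>i. x $ i = v $ i \<or> x $ i = (v + ind_vec I) $ i"
    using extreme_point_of_cbox_cart by (simp add: extreme_point_of_def, blast)
  have "x $ i = v $ i + ind_vec {i. x $ i \<noteq> v $ i} $ i" for i
    using ends(2)[of i] by (auto split: if_splits)
  then have "x = v + ind_vec {i. x $ i \<noteq> v $ i}"
    by (simp add: vec_eq_iff)
  moreover have "i \<in> I" if "x $ i \<noteq> v $ i" for i
    using ends(2)[of i] that by (auto split: if_splits)
  ultimately show "\<exists>S\<subseteq>I. x = v + ind_vec S"
    by (intro exI[of _ "{i. x $ i \<noteq> v $ i}"]) auto
next
  assume "\<exists>S\<subseteq>I. x = v + ind_vec S"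
  then obtain S where S: "S \<subseteq> I" "x = v + ind_vec S" by blast
  have "{y \<in> cbox v (v + ind_vec I). (\<forall>i\<in>S. y $ i = v $ i + 1) \<and> (\<forall>i\<in>I - S. y $ i = v $ i)} = {x}"
  proof (intro set_eqI iffI)
    fix y assume y: "y \<in> {y \<in> cbox v (v + ind_vec I). (\<forall>i\<in>S. y $ i = v $ i + 1) \<and> (\<forall>i\<in>I - S. y $ i = v $ i)}"
    then have "y $ i = v $ i" if "i \<notin> I" for i
      using that by (force simp: mem_unit_box_iff intro: antisym)
    with y have "y $ i = x $ i" for i
      by (cases "i \<in> S"; cases "i \<in> I") (auto simp: S(2))
    then show "y \<in> {x}"
      by (simp add: vec_eq_iff)
  qed (use S in \<open>auto simp: mem_unit_box_iff\<close>)
  then show "{x} face_of cbox v (v + ind_vec I)"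
    using unit_box_face[of v I S S] S(1) by simp
qed

lemma model_cube_eq: "model_cube J = cbox 0 (0 + ind_vec J)"
  by (simp add: model_cube_def ind_vec_def)

lemma model_cube_hull: "model_cube J = convex hull (ind_vec ` Pow J)"
proof -
  have "{x. x extreme_point_of model_cube J} = ind_vec ` Pow J"
    using unit_box_vertex_iff[of _ 0 J] by (auto simp: model_cube_eq face_of_singleton)
  then show ?thesis
    using Krein_Milman_Minkowski[of "model_cube J"] by (simp add: model_cube_eq)
qed


section \<open>The face lattice of the model cube\<close>

definition face_corners :: "5 set \<Rightarrow> (real^5) set \<Rightarrow> 5 set set" where
  "face_corners J F = {S. S \<subseteq> J \<and> ind_vec S \<in> F}"

lemma face_eq_hull_corners:
  assumes "F face_of model_cube J"
  shows "F = convex hull (ind_vec ` face_corners J F)"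
proof
  have "compact (ind_vec ` Pow J)"
    by (intro finite_imp_compact finite_imageI) simp
  then obtain S' where S': "S' \<subseteq> ind_vec ` Pow J" "F = convex hull S'"
    using face_of_convex_hull_subset assms unfolding model_cube_hull by blast
  have "S' \<subseteq> F" unfolding S'(2) by (rule hull_subset)
  then have "S' \<subseteq> ind_vec ` face_corners J F"
    using S'(1) unfolding face_corners_def by blast
  then show "F \<subseteq> convex hull (ind_vec ` face_corners J F)"
    using S'(2) hull_mono by blast
  have "convex F" using assms by (rule face_of_imp_convex)
  then show "convex hull (ind_vec ` face_corners J F) \<subseteq> F"
    by (intro hull_minimal) (auto simp: face_corners_def)
qed

lemma face_corners_subset_iff:
  assumes "F face_of model_cube J" "G face_of model_cube J"
  shows "face_corners J F \<subseteq> face_corners J G \<longleftrightarrow> F \<subseteq> G"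
proof
  assume "face_corners J F \<subseteq> face_corners J G"
  then have "convex hull (ind_vec ` face_corners J F) \<subseteq> convex hull (ind_vec ` face_corners J G)"
    by (intro hull_mono image_mono)
  then show "F \<subseteq> G"
    using assms[THEN face_eq_hull_corners] by simp
qed (auto simp: face_corners_def)

lemma face_corners_subcube:
  assumes "F face_of model_cube J"
  shows "face_corners J F \<in> subcubes J"
proof (rule subcubes_of_convex)
  fix S S' S''
  assume S: "S \<in> face_corners J F" and S': "S' \<in> face_corners J F"
    and between: "S \<inter> S' \<subseteq> S''" "S'' \<subseteq> S \<union> S'"
  define T where "T = (S \<union> S') - (S'' - S \<inter> S')"
  have sub: "S'' \<subseteq> J" "T \<subseteq> J"
    using S S' between(2) by (auto simp: T_def face_corners_def)
  have mem: "ind_vec R \<in> model_cube J" if "R \<subseteq> J" for R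
    using that by (auto simp: model_cube_eq mem_box_cart)
  have parallelogram: "ind_vec S + ind_vec S' = ind_vec S'' + ind_vec T"
    using between by (auto simp: vec_eq_iff T_def)
  have "(1/2) *\<^sub>R ind_vec S + (1/2) *\<^sub>R ind_vec S' \<in> F"
    using S S' face_of_imp_convex[OF assms] by (intro convexD) (auto simp: face_corners_def)
  then have centre: "(1/2) *\<^sub>R ind_vec S'' + (1/2) *\<^sub>R ind_vec T \<in> F"
    using arg_cong[OF parallelogram, of "scaleR (1/2)"] by (simp add: scaleR_add_right)
  have "ind_vec S'' \<in> F"
  proof (cases "S'' = T")
    case True
    have "(1/2) *\<^sub>R ind_vec T + (1/2) *\<^sub>R ind_vec T = ind_vec T" by (simp add: vec_eq_iff)
    then show ?thesis
      using centre True by simp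
  next
    case False
    then have "(1/2) *\<^sub>R ind_vec S'' + (1/2) *\<^sub>R ind_vec T \<in> open_segment (ind_vec S'') (ind_vec T)"
      unfolding in_segment ind_vec_eq_iff by (auto intro!: exI[of _ "1/2"])
    then show ?thesis
      using assms centre mem sub unfolding face_of_def by blast
  qed
  then show "S'' \<in> face_corners J F"
    using sub by (simp add: face_corners_def)
qed (auto simp: face_corners_def)

lemma bij_betw_face_corners: "bij_betw (face_corners J) {F. F face_of model_cube J} (subcubes J)"
  unfolding bij_betw_def
proof
  show "inj_on (face_corners J) {F. F face_of model_cube J}"
  proof (rule inj_onI)
    fix F G assume "F \<in> {F. F face_of model_cube J}" "G \<in> {F. F face_of model_cube J}"
      "face_corners J F = face_corners J G"
    then show "F = G"
      using face_corners_subset_iff[of F J G] face_corners_subset_iff[of G J F] by auto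
  qed
  show "face_corners J ` {F. F face_of model_cube J} = subcubes J"
  proof
    show "subcubes J \<subseteq> face_corners J ` {F. F face_of model_cube J}"
    proof
      fix W assume "W \<in> subcubes J"
      then show "W \<in> face_corners J ` {F. F face_of model_cube J}"
      proof (cases rule: subcubesE)
        case 1
        then show ?thesis
          by (intro image_eqI[of _ _ "{}"]) (auto simp: face_corners_def empty_face_of)
      next
        case (2 A B)
        let ?F = "{x \<in> model_cube J. (\<forall>i\<in>A. x $ i = 0 $ i + 1) \<and> (\<forall>i\<in>J - B. x $ i = 0 $ i)}"
        have "?F face_of model_cube J"
          unfolding model_cube_eq by (rule unit_box_face)
        moreover have "face_corners J ?F = W"
        proof -
          have "S \<in> face_corners J ?F \<longleftrightarrow> S \<subseteq> J \<and> A \<subseteq> S \<and> (\<forall>i\<in>J - B. i \<notin> S)" for S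
            by (auto simp: face_corners_def model_cube_eq mem_box_cart split: if_splits)
          then show ?thesis
            unfolding 2(3) using 2(1,2) by (intro set_eqI) (simp, blast)
        qed
        ultimately show ?thesis by blast
      qed
    qed
  qed (use face_corners_subcube in blast)
qed

lemma vimage_image_subcube:
  assumes "inj f" "W \<in> subcubes (f ` I)"
  shows "(`) f -` W \<in> subcubes I"
  using assms(2)
proof (cases rule: subcubesE)
  case 1
  then show ?thesis by (simp add: empty_mem_subcubes)
next
  case (2 A B)
  then obtain A\<^sub>0 B\<^sub>0 where "A = f ` A\<^sub>0" "B = f ` B\<^sub>0" "A\<^sub>0 \<subseteq> B\<^sub>0" "B\<^sub>0 \<subseteq> I"
    by (metis subset_image_iff)
  moreover from this have "(`) f -` W = {A\<^sub>0..B\<^sub>0}"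
    using 2(3) assms(1) by (auto simp: inj_image_subset_iff)
  ultimately show ?thesis
    by (simp add: interval_mem_subcubes)
qed

lemma image_image_subcube:
  assumes "inj f" "W \<in> subcubes I"
  shows "(`) f ` W \<in> subcubes (f ` I)"
  using assms(2)
proof (cases rule: subcubesE)
  case 1
  then show ?thesis by (simp add: empty_mem_subcubes)
next
  case (2 A B)
  have "S \<in> (`) f ` {A..B}" if "S \<in> {f ` A..f ` B}" for S
  proof -
    obtain S\<^sub>0 where "S\<^sub>0 \<subseteq> B" "S = f ` S\<^sub>0"
      using \<open>S \<in> {f ` A..f ` B}\<close> by (auto simp: subset_image_iff)
    with that show ?thesis
      using assms(1) by (auto simp: inj_image_subset_iff)
  qed
  moreover have "f ` S \<in> {f ` A..f ` B}" if "S \<in> {A..B}" for S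
    using that by (simp add: image_mono)
  ultimately have "(`) f ` W = {f ` A..f ` B}"
    unfolding 2(3) by blast
  then show ?thesis
    using 2(1,2) by (simp add: image_mono interval_mem_subcubes)
qed

lemma bij_betw_vimage_image_subcubes:
  assumes "inj f"
  shows "bij_betw (vimage ((`) f)) (subcubes (f ` I)) (subcubes I)"
proof (rule bij_betwI[where g = "image ((`) f)"])
  show "(`) f ` ((`) f -` W) = W" if "W \<in> subcubes (f ` I)" for W
  proof -
    have "W \<subseteq> range ((`) f)"
      using subcubes_Pow[OF that] by (metis Pow_iff rangeI subsetD subsetI subset_imageE)
    then show ?thesis
      by (simp add: image_vimage_eq inf_absorb1)
  qed
  show "(`) f -` ((`) f ` W) = W" for W
    using assms by (auto simp: inj_image_eq_iff)
qed (use vimage_image_subcube[OF assms] image_image_subcube[OF assms] in blast)+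

lemma cube_config_bij_betw_subcubes:
  assumes "cube_config p"
  shows "bij_betw (\<lambda>W. sph_hull (p ` W)) (subcubes I) {F. F sph_face_of sph_hull (p ` Pow I)}"
proof -
  have "inj_on (\<lambda>W. sph_hull (p ` W)) (subcubes I)"
    using cube_config_hull_subset_iff[OF assms] by (intro inj_onI) (metis order_antisym order_refl)
  then show ?thesis
    unfolding bij_betw_def cube_config_faces[OF assms] by auto
qed

lemma cube_config_sph_cube:
  assumes p: "cube_config p"
  shows "sph_cube (sph_hull (p ` Pow I))"
proof -
  define f :: "3 \<Rightarrow> 5" where "f i = (if i = 1 then 1 else if i = 2 then 2 else 3)" for i
  have f: "inj f"
    unfolding inj_def forall_3 by (simp add: f_def)
  let ?J = "f ` I" and ?corners = "\<lambda>F. (`) f -` face_corners (f ` I) F"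
  have corners: "?corners F \<in> subcubes I" if "F face_of model_cube ?J" for F
    using vimage_image_subcube[OF f face_corners_subcube[OF that]] .
  have "?corners F \<subseteq> ?corners G \<longleftrightarrow> F \<subseteq> G" if "F face_of model_cube ?J" "G face_of model_cube ?J" for F G
  proof -
    have "face_corners ?J F = (`) f ` ?corners F" for F
      by (auto simp: face_corners_def subset_image_iff)
    then have "?corners F \<subseteq> ?corners G \<longleftrightarrow> face_corners ?J F \<subseteq> face_corners ?J G"
      by (metis image_mono vimage_mono)
    then show ?thesis
      using face_corners_subset_iff[OF that] by simp
  qed
  then have "sph_hull (p ` ?corners F) \<subseteq> sph_hull (p ` ?corners G) \<longleftrightarrow> F \<subseteq> G"
    if "F face_of model_cube ?J" "G face_of model_cube ?J" for F G
    using cube_config_hull_subset_iff[OF p corners[OF that(1)] corners[OF that(2)]] that by simp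
  moreover have "bij_betw (\<lambda>F. sph_hull (p ` ?corners F)) {F. F face_of model_cube ?J}
      {F. F sph_face_of sph_hull (p ` Pow I)}"
    using bij_betw_trans[OF bij_betw_trans[OF bij_betw_face_corners bij_betw_vimage_image_subcubes[OF f]]
        cube_config_bij_betw_subcubes[OF p], of I]
    by (simp add: comp_def)
  ultimately show ?thesis
    unfolding sph_cube_def using cube_config_polytope[OF p] by blast
qed

section \<open>Cells of the cube tiling modulo the lattice\<close>

definition cell :: "real^3 \<Rightarrow> 3 set \<Rightarrow> (real^3) set" where
  "cell v I = cbox v (v + ind_vec I)"

lemma cube_tiling_eq: "cube_tiling = insert {} {cell v I | v I. v \<in> int_points}"
  by (simp add: cube_tiling_def cell_def ind_vec_def)

lemma cell_vertex_iff: "{x} face_of cell v I \<longleftrightarrow> (\<exists>S\<subseteq>I. x = v + ind_vec S)"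
  unfolding cell_def by (rule unit_box_vertex_iff)

lemma cell_empty [simp]: "cell v {} = {v}"
  by (simp add: cell_def)

lemma coord_sum_add [simp]: "coord_sum (v + w) = coord_sum v + coord_sum w"
  by (simp add: coord_sum_def)

lemma coord_sum_ind_vec [simp]: "coord_sum (ind_vec S) = real (card S)"
proof -
  have "card S = (\<Sum>i\<in>UNIV. if i \<in> S then 1 else 0)"
    by (simp add: sum.If_cases)
  then show ?thesis
    by (simp add: coord_sum_def sum_3)
qed

lemma int_points_add: "v \<in> int_points \<Longrightarrow> w \<in> int_points \<Longrightarrow> v + w \<in> int_points"
  by (simp add: int_points_def)

lemma int_points_uminus: "v \<in> int_points \<Longrightarrow> - v \<in> int_points"
  by (simp add: int_points_def)

lemma int_points_ind_vec: "ind_vec S \<in> int_points"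
  by (simp add: int_points_def)

lemma int_pointsE:
  assumes "v \<in> int_points"
  obtains i\<^sub>1 i\<^sub>2 i\<^sub>3 :: int where "v $ 1 = i\<^sub>1" "v $ 2 = i\<^sub>2" "v $ 3 = i\<^sub>3"
proof -
  have "v $ 1 \<in> \<int>" "v $ 2 \<in> \<int>" "v $ 3 \<in> \<int>"
    using assms by (simp_all add: int_points_def)
  then show ?thesis using that by (metis Ints_cases)
qed

lemma cell_in_strip_iff:
  assumes "v \<in> int_points"
  shows "cell v I \<in> cube_strip k \<longleftrightarrow> 0 \<le> coord_sum v \<and> coord_sum v + card I \<le> k"
proof -
  have "cell v I \<in> cube_tiling"
    using assms by (auto simp: cube_tiling_eq)
  moreover have "(\<forall>x. (\<exists>S\<subseteq>I. x = v + ind_vec S) \<longrightarrow> 0 \<le> coord_sum x \<and> coord_sum x \<le> k) \<longleftrightarrow>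
     0 \<le> coord_sum v \<and> coord_sum v + card I \<le> k" (is "?L \<longleftrightarrow> ?R")
  proof
    assume ?L
    from this[rule_format, of "v + ind_vec {}"] this[rule_format, of "v + ind_vec I"] show ?R
      by force
  next
    assume R: ?R
    have "card S \<le> card I" if "S \<subseteq> I" for S
      using that by (simp add: card_mono)
    then have "real (card S) \<le> card I" if "S \<subseteq> I" for S
      using that by simp
    then have "coord_sum v + real (card S) \<le> k" if "S \<subseteq> I" for S
      using R that by (meson add_left_mono order_trans)
    then show ?L using R by auto
  qed
  ultimately show ?thesis
    by (simp add: cube_strip_def cell_vertex_iff)
qed

lemma cube_strip_eq:
  "cube_strip k = insert {} {cell v I | v I. v \<in> int_points \<and> 0 \<le> coord_sum v \<and> coord_sum v + card I \<le> k}"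
proof -
  have "{} \<in> cube_strip k"
    by (auto simp: cube_strip_def cube_tiling_def face_of_singleton extreme_point_of_def)
  moreover have "F \<in> cube_tiling" if "F \<in> cube_strip k" for F
    using that by (simp add: cube_strip_def)
  ultimately show ?thesis
    using cell_in_strip_iff[of _ _ k] unfolding cube_tiling_eq by blast
qed

lemma int_points_coord_sum_nat:
  assumes "v \<in> int_points" "0 \<le> coord_sum v"
  shows "coord_sum v = real (nat \<lfloor>coord_sum v\<rfloor>)"
proof -
  have "coord_sum v \<in> \<int>"
    using assms(1) by (simp add: coord_sum_def int_points_def)
  then show ?thesis
    using assms(2) by (auto elim!: Ints_cases)
qed

lemma cell_subset_iff:
  assumes "v \<in> int_points" "u \<in> int_points"
  shows "cell v I \<subseteq> cell u J \<longleftrightarrow> (\<exists>A. v = u + ind_vec A \<and> A \<inter> I = {} \<and> A \<union> I \<subseteq> J)"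
proof -
  have "cell v I \<subseteq> cell u J \<longleftrightarrow> (\<forall>i. u $ i \<le> v $ i \<and> v $ i + ind_vec I $ i \<le> u $ i + ind_vec J $ i)"
    unfolding cell_def subset_interval_cart(1) by simp
  also have "\<dots> \<longleftrightarrow> (\<exists>A. v = u + ind_vec A \<and> A \<inter> I = {} \<and> A \<union> I \<subseteq> J)"
  proof
    assume bounds: "\<forall>i. u $ i \<le> v $ i \<and> v $ i + ind_vec I $ i \<le> u $ i + ind_vec J $ i"
    define A where "A = {i. v $ i \<noteq> u $ i}"
    have A: "v $ i = u $ i + 1" if "i \<in> A" for i
    proof -
      have "v $ i - u $ i \<in> \<int>" using assms by (simp add: int_points_def)
      then obtain n where n: "v $ i - u $ i = of_int n" by (auto elim: Ints_cases)
      have "0 \<le> ind_vec I $ i" "ind_vec J $ i \<le> 1" by simp_all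
      then have "0 < real_of_int n" "real_of_int n \<le> 1"
        using bounds[rule_format, of i] n that by (auto simp: A_def)
      then have "n = 1" by linarith
      then show ?thesis using n by simp
    qed
    have "v = u + ind_vec A"
      using A by (auto simp: vec_eq_iff A_def)
    moreover have "i \<notin> I" if "i \<in> A" for i
      using bounds[rule_format, of i] A[OF that] by (auto split: if_splits)
    moreover have "i \<in> J" if "i \<in> A \<union> I" for i
      using bounds[rule_format, of i] A[of i] that by (auto split: if_splits)
    ultimately show "\<exists>A. v = u + ind_vec A \<and> A \<inter> I = {} \<and> A \<union> I \<subseteq> J" by blast
  qed auto
  finally show ?thesis .
qed

lemma cell_eq_iff:
  assumes "v \<in> int_points" "u \<in> int_points"
  shows "cell v I = cell u J \<longleftrightarrow> v = u \<and> I = J"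
proof
  assume "cell v I = cell u J"
  then obtain A B where A: "v = u + ind_vec A" "A \<inter> I = {}" "A \<union> I \<subseteq> J"
    and B: "u = v + ind_vec B" "B \<inter> J = {}" "B \<union> J \<subseteq> I"
    using cell_subset_iff[OF assms] cell_subset_iff[OF assms(2,1)] by (metis subset_refl)
  then have "A = {}" by blast
  then show "v = u \<and> I = J" using A B by auto
qed simp

lemma cell_nonempty: "v \<in> cell v I"
  by (simp add: cell_def mem_box_cart)

lemma Lam_int_points: "l \<in> Lam \<Longrightarrow> l \<in> int_points"
  by (auto simp: Lam_def int_points_def forall_3)

lemma Lam_iff:
  "l \<in> Lam \<longleftrightarrow> (\<exists>a b. l $ 1 = 3 * of_int a - 2 * of_int b \<and>
    l $ 2 = - 3 * of_int a - 2 * of_int b \<and> l $ 3 = 4 * of_int b)"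
  by (simp add: Lam_def vec_eq_iff forall_3 algebra_simps)

lemma LamE:
  assumes "l \<in> Lam"
  obtains a b :: int where "l $ 1 = 3 * of_int a - 2 * of_int b"
      "l $ 2 = - 3 * of_int a - 2 * of_int b" "l $ 3 = 4 * of_int b"
  using assms unfolding Lam_iff by blast

lemma Lam_zero: "0 \<in> Lam"
  unfolding Lam_iff by (intro exI[of _ 0]) simp

lemma Lam_add:
  assumes "p \<in> Lam" "q \<in> Lam"
  shows "p + q \<in> Lam"
proof -
  obtain a b c d :: int where "p $ 1 = 3 * of_int a - 2 * of_int b"
      "p $ 2 = - 3 * of_int a - 2 * of_int b" "p $ 3 = 4 * of_int b"
    "q $ 1 = 3 * of_int c - 2 * of_int d" "q $ 2 = - 3 * of_int c - 2 * of_int d" "q $ 3 = 4 * of_int d"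
    using assms by (metis LamE)
  then show ?thesis
    unfolding Lam_iff by (intro exI[of _ "a + c"] exI[of _ "b + d"]) simp
qed

lemma Lam_uminus:
  assumes "p \<in> Lam"
  shows "- p \<in> Lam"
proof -
  obtain a b :: int where "p $ 1 = 3 * of_int a - 2 * of_int b"
      "p $ 2 = - 3 * of_int a - 2 * of_int b" "p $ 3 = 4 * of_int b"
    using assms by (rule LamE)
  then show ?thesis
    unfolding Lam_iff by (intro exI[of _ "- a"] exI[of _ "- b"]) simp
qed

lemma diff_mem_LamI:
  assumes "u $ 3 - v $ 3 = 4 * of_int b" "(u $ 1 - u $ 2) - (v $ 1 - v $ 2) = 6 * of_int a"
    and "coord_sum u = coord_sum v"
  shows "u - v \<in> Lam"
  unfolding Lam_iff using assms by (intro exI[of _ a] exI[of _ b]) (auto simp: coord_sum_def)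

lemma coord_sum_Lam: "l \<in> Lam \<Longrightarrow> coord_sum l = 0"
  by (auto simp: Lam_iff coord_sum_def)

lemma ind_vec_diff_Lam_eq:
  fixes S S' :: "3 set"
  assumes "ind_vec S - ind_vec S' \<in> Lam"
  shows "S = S'"
proof -
  let ?d = "ind_vec S - ind_vec S' :: real^3"
  obtain a b :: int where ab: "?d $ 1 = 3 * of_int a - 2 * of_int b"
      "?d $ 2 = - 3 * of_int a - 2 * of_int b" "?d $ 3 = 4 * of_int b"
    using assms by (rule LamE)
  have bound: "\<bar>?d $ i\<bar> \<le> 1" for i by simp
  have "\<bar>4 * real_of_int b\<bar> \<le> 1" using bound[of 3] unfolding ab .
  then have b: "b = 0" by linarith
  have "\<bar>3 * real_of_int a\<bar> \<le> 1" using bound[of 1] unfolding ab b by simp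
  then have a: "a = 0" by linarith
  have "?d = 0"
    unfolding vec_eq_iff forall_3 ab a b by simp
  then show ?thesis by (simp add: ind_vec_eq_iff)
qed

lemma translate_cell: "(+) l ` cell v I = cell (l + v) I"
proof -
  have "(+) l ` cbox v (v + ind_vec I) = cbox (l + v) (l + (v + ind_vec I))"
    by (rule cbox_translation[symmetric])
  then show ?thesis by (simp add: cell_def add.assoc)
qed

lemma orbit_cell: "orbit (cell v I) = {cell (l + v) I | l. l \<in> Lam}"
  by (auto simp: orbit_def translate_cell)

lemma orbit_empty: "orbit {} = {{}}"
  using Lam_zero by (auto simp: orbit_def)

lemma orbit_translate: "l \<in> Lam \<Longrightarrow> orbit (cell (l + v) I) = orbit (cell v I)"
proof -
  assume l: "l \<in> Lam"
  have "\<exists>l''. l' + (l + v) = l'' + v \<and> l'' \<in> Lam" if "l' \<in> Lam" for l'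
    using Lam_add[OF that l] by (intro exI[of _ "l' + l"]) (simp add: add.assoc)
  moreover have "\<exists>l''. l' + v = l'' + (l + v) \<and> l'' \<in> Lam" if "l' \<in> Lam" for l'
    using Lam_add[OF that Lam_uminus[OF l]] by (intro exI[of _ "l' - l"]) simp
  ultimately show ?thesis
    unfolding orbit_cell by (auto, metis+)
qed

lemma orbit_cell_eq_iff:
  assumes "v \<in> int_points" "u \<in> int_points"
  shows "orbit (cell v I) = orbit (cell u J) \<longleftrightarrow> I = J \<and> (\<exists>l\<in>Lam. v = l + u)"
proof
  assume "orbit (cell v I) = orbit (cell u J)"
  moreover have "cell v I \<in> orbit (cell v I)"
    using Lam_zero unfolding orbit_cell by force
  ultimately obtain l where "l \<in> Lam" "cell v I = cell (l + u) J"
    by (auto simp: orbit_cell)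
  then show "I = J \<and> (\<exists>l\<in>Lam. v = l + u)"
    using cell_eq_iff[OF assms(1), of "l + u" I J] assms(2) Lam_int_points int_points_add by blast
qed (auto simp: orbit_translate)

lemma orbit_le_cell_iff:
  assumes "v \<in> int_points" "u \<in> int_points"
  shows "orbit_le (orbit (cell v I)) (orbit (cell u J)) \<longleftrightarrow>
    (\<exists>l\<in>Lam. \<exists>A. v = l + u + ind_vec A \<and> A \<inter> I = {} \<and> A \<union> I \<subseteq> J)"
proof
  assume "orbit_le (orbit (cell v I)) (orbit (cell u J))"
  then obtain l m where lm: "l \<in> Lam" "m \<in> Lam" "cell (l + v) I \<subseteq> cell (m + u) J"
    by (auto simp: orbit_le_def orbit_cell)
  then obtain A where A: "l + v = m + u + ind_vec A" "A \<inter> I = {}" "A \<union> I \<subseteq> J"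
    using cell_subset_iff[of "l + v" "m + u" I J] assms Lam_int_points int_points_add by blast
  have "v = (m - l) + u + ind_vec A"
    using A(1) by (simp add: algebra_simps)
  moreover have "m - l \<in> Lam"
    using Lam_add[OF lm(2) Lam_uminus[OF lm(1)]] by simp
  ultimately show "\<exists>l\<in>Lam. \<exists>A. v = l + u + ind_vec A \<and> A \<inter> I = {} \<and> A \<union> I \<subseteq> J"
    using A by blast
next
  assume "\<exists>l\<in>Lam. \<exists>A. v = l + u + ind_vec A \<and> A \<inter> I = {} \<and> A \<union> I \<subseteq> J"
  then obtain l A where A: "l \<in> Lam" "v = l + u + ind_vec A" "A \<inter> I = {}" "A \<union> I \<subseteq> J" by blast
  then have "cell v I \<subseteq> cell (l + u) J"
    using cell_subset_iff[of v "l + u" I J] assms Lam_int_points int_points_add by blast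
  moreover have "cell v I \<in> orbit (cell v I)"
    using Lam_zero unfolding orbit_cell by force
  moreover have "cell (l + u) J \<in> orbit (cell u J)"
    using A(1) by (auto simp: orbit_cell)
  ultimately show "orbit_le (orbit (cell v I)) (orbit (cell u J))"
    unfolding orbit_le_def by blast
qed

definition strip_cell :: "nat \<Rightarrow> real^3 \<Rightarrow> 3 set \<Rightarrow> bool" where
  "strip_cell k v I \<longleftrightarrow> v \<in> int_points \<and> 0 \<le> coord_sum v \<and> coord_sum v + card I \<le> k"

lemma torus_complex_eq:
  "torus_complex k = insert (orbit {}) {orbit (cell v I) | v I. strip_cell k v I}"
  unfolding torus_complex_def cube_strip_eq strip_cell_def by blast

lemma torus_complexE:
  assumes "C \<in> torus_complex k"
  obtains "C = orbit {}" | v I where "strip_cell k v I" "C = orbit (cell v I)"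
  using assms unfolding torus_complex_eq by blast

lemma torus_complexI: "strip_cell k v I \<Longrightarrow> orbit (cell v I) \<in> torus_complex k"
  unfolding torus_complex_eq by blast

lemma orbit_empty_in: "orbit {} \<in> torus_complex k"
  unfolding torus_complex_eq by blast

lemma orbit_le_empty: "orbit_le (orbit {}) (orbit F)"
  using Lam_zero by (auto simp: orbit_le_def orbit_def)

lemma not_orbit_le_empty: "\<not> orbit_le (orbit (cell v I)) (orbit {})"
  using cell_nonempty by (force simp: orbit_le_def orbit_empty orbit_cell)

lemma orbit_cell_ne_empty: "orbit (cell v I) \<noteq> orbit {}"
  using not_orbit_le_empty orbit_le_empty by metis

lemma induced_translate: "induced ((+) t) (orbit F) = orbit ((+) t ` F)"
  unfolding induced_def orbit_def image_image by (simp add: add.left_commute)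

lemma induced_translate_cell: "induced ((+) t) (orbit (cell v I)) = orbit (cell (t + v) I)"
  by (simp add: induced_translate translate_cell)

lemma strip_cell_int_points: "strip_cell k v I \<Longrightarrow> v \<in> int_points"
  by (simp add: strip_cell_def)

lemma strip_cell_levelE:
  assumes "strip_cell k v I"
  obtains n where "coord_sum v = real n" "n + card I \<le> k"
proof -
  have "coord_sum v = real (nat \<lfloor>coord_sum v\<rfloor>)"
    using assms by (intro int_points_coord_sum_nat) (simp_all add: strip_cell_def)
  moreover from this have "nat \<lfloor>coord_sum v\<rfloor> + card I \<le> k"
    using assms by (simp add: strip_cell_def)
  ultimately show ?thesis
    using that by blast
qed

lemma strip_cell_face:
  assumes "strip_cell k v I" "A \<subseteq> B" "B \<subseteq> I"
  shows "strip_cell k (v + ind_vec A) (B - A)"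
proof -
  have "card A + card (B - A) = card B" "card B \<le> card I"
    using assms by (auto simp: card_Diff_subset card_mono)
  then have "real (card A) + real (card (B - A)) \<le> card I"
    by linarith
  then show ?thesis
    using assms(1) by (auto simp: strip_cell_def int_points_add int_points_ind_vec)
qed

lemma strip_cell_corner: "strip_cell k v I \<Longrightarrow> S \<subseteq> I \<Longrightarrow> strip_cell k (v + ind_vec S) {}"
  using strip_cell_face[of k v I S S] by simp

lemma strip_cell_translate:
  assumes "t \<in> int_points" "coord_sum t = 0"
  shows "strip_cell k (t + v) I \<longleftrightarrow> strip_cell k v I"
proof -
  have "t + v \<in> int_points \<longleftrightarrow> v \<in> int_points"
    using assms(1) int_points_add[of t v] int_points_add[of "t + v" "- t"] int_points_uminus by auto
  then show ?thesis using assms(2) by (simp add: strip_cell_def)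
qed

abbreviation axis_pt :: "nat \<Rightarrow> real^3" where
  "axis_pt l \<equiv> vector [0, 0, real l]"

lemma int_points_axis_pt: "axis_pt l \<in> int_points"
  by (simp add: int_points_def forall_3)

lemma coord_sum_axis_pt: "coord_sum (axis_pt l) = real l"
  by (simp add: coord_sum_def)

lemma strip_cell_axis_pt: "l + card I \<le> k \<Longrightarrow> strip_cell k (axis_pt l) I"
  by (simp add: strip_cell_def coord_sum_axis_pt int_points_axis_pt)

lemma orbit_le_antisym:
  assumes C: "C \<in> torus_complex k" and D: "D \<in> torus_complex k" and le: "orbit_le C D" "orbit_le D C"
  shows "C = D"
  using C
proof (cases rule: torus_complexE)
  case 1
  then show ?thesis using torus_complexE[OF D] le(2) not_orbit_le_empty by metis
next
  case (2 v I)
  with D le(1) obtain u J where u: "strip_cell k u J" "D = orbit (cell u J)"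
    using torus_complexE[OF D] not_orbit_le_empty by metis
  have int: "v \<in> int_points" "u \<in> int_points"
    using 2(1) u(1) strip_cell_int_points by blast+
  obtain l A where A: "l \<in> Lam" "v = l + u + ind_vec A" "A \<inter> I = {}" "A \<union> I \<subseteq> J"
    using le(1) orbit_le_cell_iff[OF int] unfolding 2(2) u(2) by blast
  moreover have "J \<subseteq> I"
    using le(2) orbit_le_cell_iff[OF int(2,1)] unfolding 2(2) u(2) by blast
  ultimately have "I = J" "A = {}" by blast+
  then show ?thesis
    using orbit_cell_eq_iff[OF int, of I J] A(1,2) unfolding 2(2) u(2) by auto
qed

section \<open>Coordinates\<close>

lemma exhaust_5: "x = 1 \<or> x = 2 \<or> x = 3 \<or> x = 4 \<or> x = 5" for x :: 5
proof (induct x)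
  case (of_int z)
  then have "z = 0 \<or> z = 1 \<or> z = 2 \<or> z = 3 \<or> z = 4" by fastforce
  then show ?case by auto
qed

lemma forall_5: "(\<forall>i::5. P i) \<longleftrightarrow> P 1 \<and> P 2 \<and> P 3 \<and> P 4 \<and> P 5"
  by (metis exhaust_5)

lemma UNIV_5: "UNIV = {1, 2, 3, 4, 5::5}"
  using exhaust_5 by auto

lemma sum_5: "sum f (UNIV :: 5 set) = f 1 + f 2 + f 3 + f 4 + f 5"
  unfolding UNIV_5 by (simp add: ac_simps)

lemma set3_cases:
  "S = {} \<or> S = {1} \<or> S = {2} \<or> S = {3} \<or> S = {1,2} \<or> S = {1,3} \<or> S = {2,3} \<or> S = {1,2,3}" for S :: "3 set"
proof -
  define m :: "bool \<Rightarrow> bool \<Rightarrow> bool \<Rightarrow> 3 set" where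
    "m x y z = (if x then insert 1 else id) ((if y then insert 2 else id) (if z then {3} else {}))" for x y z
  have "m (1 \<in> S) (2 \<in> S) (3 \<in> S) = S"
    by (simp add: m_def set_eq_iff forall_3)
  moreover have "m x y z \<in> {{}, {1}, {2}, {3}, {1,2}, {1,3}, {2,3}, {1,2,3}}" for x y z
    by (cases x; cases y; cases z) (simp_all add: m_def)
  ultimately have "S \<in> {{}, {1}, {2}, {3}, {1,2}, {1,3}, {2,3}, {1,2,3}}"
    by metis
  then show ?thesis by (simp only: insert_iff empty_iff simp_thms)
qed

definition emb :: "complex \<Rightarrow> real \<Rightarrow> complex \<Rightarrow> complex \<Rightarrow> real^5" where
  "emb e s z w = (\<chi> i. if i = 1 then Re (e * z) else if i = 2 then Im (e * z)
     else if i = 3 then s * Re w else if i = 4 then s * Im w else 0)"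

lemma emb_nth [simp]:
  "emb e s z w $ 1 = Re (e * z)" "emb e s z w $ 2 = Im (e * z)"
  "emb e s z w $ 3 = s * Re w" "emb e s z w $ 4 = s * Im w" "emb e s z w $ 5 = 0"
  by (simp_all add: emb_def)

lemma emb_add: "emb e s z w + emb e s z' w' = emb e s (z + z') (w + w')"
  by (simp add: vec_eq_iff forall_5 algebra_simps)

lemma emb_scale: "c *\<^sub>R emb e s z w = emb e s (c *\<^sub>R z) (c *\<^sub>R w)"
  by (simp add: vec_eq_iff forall_5 algebra_simps)

lemma emb_zero: "emb e s 0 0 = 0"
  by (simp add: vec_eq_iff forall_5)

lemma emb_sum: "(\<Sum>i\<in>A. c i *\<^sub>R emb e s (z i) (w i)) = emb e s (\<Sum>i\<in>A. c i *\<^sub>R z i) (\<Sum>i\<in>A. c i *\<^sub>R w i)"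
  by (induction A rule: infinite_finite_induct) (simp_all add: emb_zero emb_scale emb_add)

lemma emb_rotate: "emb e s (c * z) u = emb (e * c) s z u"
  by (simp add: vec_eq_iff forall_5 algebra_simps)

locale frame =
  fixes e :: complex and s :: real
  assumes norm_e: "norm e = 1" and s_square: "s * s = 1"
begin

lemma inner_e: "(e * z) \<bullet> (e * z') = z \<bullet> z'"
proof -
  have "Re e * Re e + Im e * Im e = 1"
    using norm_e by (simp add: cmod_def power2_eq_square)
  moreover have "(e * z) \<bullet> (e * z') = (Re e * Re e + Im e * Im e) * (z \<bullet> z')"
    by (simp add: inner_complex_def algebra_simps)
  ultimately show ?thesis by simp
qed

lemma emb_inner: "emb e s z w \<bullet> emb e s z' w' = z \<bullet> z' + w \<bullet> w'"
proof -
  have "emb e s z w \<bullet> emb e s z' w' = (e * z) \<bullet> (e * z') + (s * s) * (w \<bullet> w')"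
    by (simp add: inner_vec_def sum_5 inner_complex_def algebra_simps)
  then show ?thesis by (simp add: inner_e s_square)
qed

lemma emb_norm: "norm (emb e s z w) = sqrt ((norm z)\<^sup>2 + (norm w)\<^sup>2)"
  by (simp add: norm_eq_sqrt_inner[of "emb e s z w"] emb_inner power2_norm_eq_inner)

lemma emb_eq_iff: "emb e s z w = emb e s z' w' \<longleftrightarrow> z = z' \<and> w = w'"
proof
  assume "emb e s z w = emb e s z' w'"
  then have "emb e s (z - z') (w - w') = 0"
    using emb_add[of e s "z - z'" "w - w'" z' w'] by simp
  then have "(norm (z - z'))\<^sup>2 + (norm (w - w'))\<^sup>2 = 0"
    using emb_norm[of "z - z'" "w - w'"] by (metis norm_zero real_sqrt_eq_zero_cancel_iff)
  then show "z = z' \<and> w = w'"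
    by (simp add: add_nonneg_eq_0_iff)
qed simp

lemma emb_eq_0_iff: "emb e s z w = 0 \<longleftrightarrow> z = 0 \<and> w = 0"
  using emb_eq_iff[of z w 0 0] by (simp add: emb_zero)

end

lemma emb_surj:
  assumes "frame e s" "x $ 5 = 0"
  obtains z w where "x = emb e s z w"
proof -
  interpret frame e s by fact
  have nonzero: "e \<noteq> 0" using norm_e by auto
  have "emb e s (Complex (x $ 1) (x $ 2) / e) (Complex (s * x $ 3) (s * x $ 4)) = x"
    using assms(2) nonzero s_square by (simp add: vec_eq_iff forall_5 mult.assoc[symmetric])
  then show ?thesis using that by metis
qed

section \<open>Sixth roots of unity and quarter turns\<close>

definition omega :: complex where "omega = cis (pi / 3)"

lemma omega_Complex: "omega = Complex (1/2) (sqrt 3 / 2)"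
  by (simp add: omega_def complex_eq_iff cos_60 sin_60)

lemma cnj_omega: "cnj omega = 1 - omega"
  by (simp add: omega_Complex complex_eq_iff)

lemma omega_square: "omega * omega = omega - 1"
  by (simp add: omega_Complex complex_eq_iff)

lemma omega_cube: "omega * (omega * omega) = -1"
  unfolding omega_square by (simp add: algebra_simps omega_square)

text \<open>For \<open>a, c \<ge> 0\<close> these points fill the sector between the rays through 1 and \<open>\<omega>\<close>.\<close>

definition sector_pt :: "real \<Rightarrow> real \<Rightarrow> complex" where
  "sector_pt a c = of_real a + of_real c * omega"

lemma sector_pt_sel: "Re (sector_pt a c) = a + c / 2" "Im (sector_pt a c) = c * sqrt 3 / 2"
  by (simp_all add: sector_pt_def omega_Complex)

lemma sector_pt_eq_iff: "sector_pt a c = sector_pt a' c' \<longleftrightarrow> a = a' \<and> c = c'"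
  by (auto simp: complex_eq_iff sector_pt_sel)

lemma sector_pt_scaleR: "r *\<^sub>R sector_pt a c = sector_pt (r * a) (r * c)"
  by (simp add: complex_eq_iff sector_pt_sel algebra_simps)

lemma sector_pt_nonzero:
  assumes "0 \<le> a" "0 \<le> c" "0 < a + c"
  shows "sector_pt a c \<noteq> 0"
proof
  assume "sector_pt a c = 0"
  then have "a + c / 2 = 0" using sector_pt_sel(1)[of a c] by simp
  then show False using assms by simp
qed

lemma omega_sector_pt: "omega * sector_pt a c = sector_pt (- c) (a + c)"
proof -
  have "omega * sector_pt a c = of_real a * omega + of_real c * (omega * omega)"
    by (simp add: sector_pt_def algebra_simps)
  then show ?thesis
    by (simp add: omega_square sector_pt_def algebra_simps)
qed

lemma omega_cnj_sector_pt: "omega * cnj (sector_pt c a) = sector_pt a c"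
proof -
  have "cnj (sector_pt c a) = sector_pt (c + a) (- a)"
    by (simp add: sector_pt_def cnj_omega algebra_simps)
  then show ?thesis
    by (simp add: omega_sector_pt)
qed

lemma omega_power_sector_pt_unique:
  assumes "sector_pt x y = omega ^ n * sector_pt x' y'" "n < 6"
    and "0 < x" "0 \<le> y" "0 < x'" "0 \<le> y'"
  shows "n = 0 \<and> x = x' \<and> y = y'"
proof -
  consider "n = 0" | "n = 1" | "n = 2" | "n = 3" | "n = 4" | "n = 5"
    using assms(2) by linarith
  then show ?thesis
    using assms by cases (auto simp: eval_nat_numeral mult.assoc omega_sector_pt sector_pt_eq_iff)
qed

lemma sector_exists:
  assumes "u \<noteq> 0"
  obtains n a c where "0 \<le> a" "0 \<le> c" "0 < a + c" "u = omega ^ n * sector_pt a c"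
proof -
  define n where "n = nat \<lfloor>Arg2pi u / (pi / 3)\<rfloor>"
  define \<theta> where "\<theta> = Arg2pi u - real n * (pi / 3)"
  have "0 \<le> Arg2pi u / (pi / 3)" using Arg2pi_ge_0 by simp
  then have "real n \<le> Arg2pi u / (pi / 3)" "Arg2pi u / (pi / 3) < real n + 1"
    unfolding n_def by linarith+
  then have \<theta>: "0 \<le> \<theta>" "\<theta> \<le> pi / 3" by (simp_all add: \<theta>_def field_simps)
  define r where "r = norm u * 2 / sqrt 3"
  have r: "0 < r" using assms by (simp add: r_def)
  define a c where "a = r * sin (pi / 3 - \<theta>)" and "c = r * sin \<theta>"
  have ac: "0 \<le> a" "0 \<le> c" using r \<theta> by (auto simp: a_def c_def intro!: mult_nonneg_nonneg sin_ge_zero)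
  have "u = of_real (norm u) * cis (real n * (pi / 3) + \<theta>)"
    using Arg2pi_eq[of u] by (simp add: \<theta>_def cis_conv_exp mult.commute)
  also have "\<dots> = omega ^ n * (of_real (norm u) * cis \<theta>)"
    by (simp add: omega_def Complex.DeMoivre cis_mult[symmetric])
  also have "of_real (norm u) * cis \<theta> = sector_pt a c"
  proof (rule complex_eqI)
    have "a + c / 2 = r * (sqrt 3 / 2 * cos \<theta>)"
      by (simp add: a_def c_def sin_diff sin_60 cos_60 algebra_simps)
    then show "Re (of_real (norm u) * cis \<theta>) = Re (sector_pt a c)"
      by (simp add: sector_pt_sel r_def)
  qed (simp add: sector_pt_sel c_def r_def)
  finally have u: "u = omega ^ n * sector_pt a c" .
  have "a \<noteq> 0 \<or> c \<noteq> 0" using u assms by (auto simp: sector_pt_def)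
  then show ?thesis using that[OF ac _ u] ac by linarith
qed

lemma cis_int_mod:
  fixes d :: int
  assumes "0 < k"
  shows "cis (2 * pi / real k * of_int d) = cis (2 * pi / real k) ^ nat (d mod int k)"
proof -
  have "real_of_int d = real k * of_int (d div int k) + real (nat (d mod int k))"
  proof -
    have "real (nat (d mod int k)) = real_of_int (d mod int k)" using assms by simp
    then show ?thesis
      by (metis mult_div_mod_eq of_int_add of_int_mult of_int_of_nat_eq)
  qed
  then have "cis (2 * pi / real k * of_int d) =
      cis (2 * pi * of_int (d div int k) + real (nat (d mod int k)) * (2 * pi / real k))"
    using assms by (simp add: field_simps del: of_nat_nat)
  also have "\<dots> = cis (2 * pi * of_int (d div int k)) * cis (2 * pi / real k) ^ nat (d mod int k)"
    by (subst Complex.DeMoivre, subst cis_mult, rule refl)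
  also have "cis (2 * pi * of_int (d div int k)) = 1"
    by (rule complex_eqI) (simp_all only: cis.sel cos_int_2pin sin_int_2pin one_complex.sel)
  finally show ?thesis by (simp only: mult_1_left)
qed

lemma cis_pi3_int: "cis (pi / 3 * of_int d) = omega ^ nat (d mod 6)"
  using cis_int_mod[of 6 d] by (simp add: omega_def)

lemma cis_pi2_int: "cis (pi / 2 * of_int d) = \<i> ^ nat (d mod 4)"
  using cis_int_mod[of 4 d] by simp

lemma cis_mult_eq_iff: "cis a * z = cis b * z' \<longleftrightarrow> z = cis (b - a) * z'"
proof -
  have "cis a * cis (b - a) = cis b"
    by (simp add: cis_mult)
  then have "cis b * z' = cis a * (cis (b - a) * z')"
    by (metis mult.assoc)
  then show ?thesis
    by (metis cis_neq_zero mult_left_cancel)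
qed

lemma sector_unique:
  fixes i j :: int
  assumes "cis (pi / 3 * of_int i) * sector_pt x y = cis (pi / 3 * of_int j) * sector_pt x' y'"
    and "0 < x" "0 \<le> y" "0 < x'" "0 \<le> y'"
  shows "6 dvd (j - i) \<and> x = x' \<and> y = y'"
proof -
  have "sector_pt x y = cis (pi / 3 * of_int (j - i)) * sector_pt x' y'"
    using assms(1) unfolding cis_mult_eq_iff right_diff_distrib[symmetric] of_int_diff[symmetric] .
  then have "nat ((j - i) mod 6) = 0 \<and> x = x' \<and> y = y'"
    unfolding cis_pi3_int using assms(2-5)
    by (intro omega_power_sector_pt_unique) (simp_all add: nat_less_iff)
  moreover have "0 \<le> (j - i) mod 6" by simp
  ultimately show ?thesis
    by (simp add: dvd_eq_mod_eq_0)
qed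

lemma quarter_turn_cases:
  fixes i j :: int
  assumes "cis (pi / 2 * of_int i) * z = cis (pi / 2 * of_int j) * z'"
  obtains "4 dvd (j - i)" "z = z'" | "odd (j - i)" "z = \<i> * z'" | "even (j - i)" "z = - z'"
    | "odd (j - i)" "z' = \<i> * z"
proof -
  have "z = cis (pi / 2 * of_int (j - i)) * z'"
    using assms unfolding cis_mult_eq_iff right_diff_distrib[symmetric] of_int_diff[symmetric] .
  then have z: "z = \<i> ^ nat ((j - i) mod 4) * z'"
    unfolding cis_pi2_int .
  have "0 \<le> (j - i) mod 4" "(j - i) mod 4 < 4" by simp_all
  then consider "(j - i) mod 4 = 0" | "(j - i) mod 4 = 1" | "(j - i) mod 4 = 2" | "(j - i) mod 4 = 3"
    by linarith
  then show ?thesis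
  proof cases
    case 1
    then show ?thesis using that(1) z by (simp add: dvd_eq_mod_eq_0)
  next
    case 2
    then have "odd (j - i)" by presburger
    then show ?thesis using that(2) z 2 by simp
  next
    case 3
    then have "even (j - i)" by presburger
    then show ?thesis using that(3) z 3 by (simp add: power2_eq_square)
  next
    case 4
    then have "odd (j - i)" by presburger
    moreover have "z' = \<i> * z"
      using z 4 by (simp add: power3_eq_cube)
    ultimately show ?thesis using that(4) by blast
  qed
qed


section \<open>The model points\<close>

abbreviation z_phase :: "real^3 \<Rightarrow> complex" where
  "z_phase v \<equiv> cis (pi / 2 * v $ 3)"

abbreviation u_phase :: "real^3 \<Rightarrow> complex" where
  "u_phase v \<equiv> cis (pi / 3 * (v $ 1 - v $ 2))"

definition model_pt :: "complex \<Rightarrow> real \<Rightarrow> (nat \<Rightarrow> complex) \<Rightarrow> real^3 \<Rightarrow> real^5" where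
  "model_pt e s h v = emb e s (z_phase v * h (nat \<lfloor>coord_sum v\<rfloor>)) (u_phase v)"

lemma model_pt_Lam:
  assumes "l \<in> Lam"
  shows "model_pt e s h (l + v) = model_pt e s h v"
proof -
  obtain a b :: int where ab: "l $ 1 = 3 * of_int a - 2 * of_int b" "l $ 2 = - 3 * of_int a - 2 * of_int b"
    "l $ 3 = 4 * of_int b"
    using assms by (rule LamE)
  have "cis (pi / 2 * (l + v) $ 3) = z_phase v * cis (2 * pi * b)"
    by (simp add: ab cis_mult algebra_simps)
  moreover have "cis (pi / 3 * ((l + v) $ 1 - (l + v) $ 2)) = u_phase v * cis (2 * pi * a)"
    by (simp add: ab cis_mult algebra_simps)
  moreover have "cis (2 * pi * of_int n) = 1" for n
    by (rule complex_eqI) (simp_all only: cis.sel cos_int_2pin sin_int_2pin one_complex.sel)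
  ultimately show ?thesis
    using coord_sum_Lam[OF assms] by (simp add: model_pt_def)
qed

definition corner_z :: "(nat \<Rightarrow> complex) \<Rightarrow> nat \<Rightarrow> 3 set \<Rightarrow> complex" where
  "corner_z h n S = (if 3 \<in> S then \<i> else 1) * h (n + card S)"

definition corner_u :: "3 set \<Rightarrow> complex" where
  "corner_u S = cis (pi / 3 * ((if 1 \<in> S then 1 else 0) - (if 2 \<in> S then 1 else 0)))"

lemma model_pt_corner:
  assumes "coord_sum v = real n"
  shows "model_pt e s h (v + ind_vec S) = emb e s (z_phase v * corner_z h n S) (u_phase v * corner_u S)"
proof -
  have "nat \<lfloor>coord_sum (v + ind_vec S)\<rfloor> = n + card S"
    using assms by (simp flip: of_nat_add)
  moreover have "cis (pi / 2 * (v + ind_vec S) $ 3) = z_phase v * (if 3 \<in> S then \<i> else 1)"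
    by (simp add: distrib_left cis_mult[symmetric])
  moreover have "cis (pi / 3 * ((v + ind_vec S) $ 1 - (v + ind_vec S) $ 2)) = u_phase v * corner_u S"
    by (simp add: corner_u_def cis_mult algebra_simps)
  ultimately show ?thesis
    by (simp add: model_pt_def corner_z_def mult.assoc)
qed

lemma sum_model_pt_corner:
  assumes "coord_sum v = real n"
  shows "(\<Sum>S\<in>A. c S *\<^sub>R model_pt e s h (v + ind_vec S)) =
    emb e s (z_phase v * (\<Sum>S\<in>A. c S *\<^sub>R corner_z h n S)) (u_phase v * (\<Sum>S\<in>A. c S *\<^sub>R corner_u S))"
  by (simp add: model_pt_corner[OF assms] emb_sum sum_distrib_left)

lemma frame_cis: "frame (cis t) 1"
  by (simp add: frame_def)

lemma cis_inner: "(cis t * z) \<bullet> (cis t * z') = z \<bullet> z'"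
  using frame.inner_e[OF frame_cis] .

lemma (in frame) inner_model_pt:
  assumes "coord_sum v = real n"
  shows "emb e s (z_phase v * z) (u_phase v * w) \<bullet> model_pt e s h (v + ind_vec S)
    = z \<bullet> corner_z h n S + w \<bullet> corner_u S"
  unfolding model_pt_corner[OF assms] emb_inner cis_inner ..

lemma corner_u_simps:
  "corner_u {} = 1" "corner_u {3} = 1" "corner_u {1,2} = 1" "corner_u {1,2,3} = 1"
  "corner_u {1} = Complex (1/2) (sqrt 3 / 2)" "corner_u {1,3} = Complex (1/2) (sqrt 3 / 2)"
  "corner_u {2} = Complex (1/2) (- sqrt 3 / 2)" "corner_u {2,3} = Complex (1/2) (- sqrt 3 / 2)"
  by (simp_all add: corner_u_def complex_eq_iff cos_60 sin_60)

lemma corner_z_simps: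
  "corner_z h n {} = h n" "corner_z h n {3} = \<i> * h (n + 1)"
      "corner_z h n {1,2} = h (n + 2)" "corner_z h n {1,2,3} = \<i> * h (n + 3)"
  "corner_z h n {1} = h (n + 1)" "corner_z h n {1,3} = \<i> * h (n + 2)"
  "corner_z h n {2} = h (n + 1)" "corner_z h n {2,3} = \<i> * h (n + 2)"
  by (simp_all add: corner_z_def numeral_3_eq_3)

lemma corner_u_omega: "corner_u S = (if (1 \<in> S) = (2 \<in> S) then 1 else if 1 \<in> S then omega else cnj omega)"
  using set3_cases[of S] by (elim disjE) (simp_all add: corner_u_simps omega_Complex complex_eq_iff)

section \<open>Growing solutions of the recurrence\<close>

definition eta :: "(nat \<Rightarrow> real) \<Rightarrow> nat \<Rightarrow> complex" where
  "eta w n = Complex (w n) (w (n + 1))"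

lemma eta_sel [simp]: "Re (eta w n) = w n" "Im (eta w n) = w (n + 1)"
  by (simp_all add: eta_def)

locale growing_seq =
  fixes w :: "nat \<Rightarrow> real" and b :: real
  assumes recurrence: "w (n + 2) = 2 * w (n + 1) + b * (2 * w (n + 1) - w n)"
    and b_pos: "0 < b" and w_1_pos: "0 < w 1" and w_0_less: "w 0 < 2 * w 1"
    and sum_0_2_pos: "0 < w 0 + w 2" and det_0_pos: "w 0 * w 2 < w 1 * w 1"
begin

lemma w_Suc_Suc: "w (Suc (Suc n)) = 2 * w (Suc n) + b * (2 * w (Suc n) - w n)"
  using recurrence[of n] by (simp add: numeral_2_eq_2)

lemma w_pos_and_less_double: "0 < w (n + 1) \<and> w n < 2 * w (n + 1)"
proof (induction n)
  case 0
  then show ?case using w_1_pos w_0_less by simp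
next
  case (Suc n)
  then have "0 < b * (2 * w (n + 1) - w n)" using b_pos by simp
  then have "2 * w (n + 1) < w (n + 2)" using recurrence[of n] by simp
  then show ?case using Suc by (simp add: numeral_2_eq_2)
qed

lemma w_pos: "0 < n \<Longrightarrow> 0 < w n"
  using w_pos_and_less_double[of "n - 1"] by simp

lemma w_less_double_Suc: "w n < 2 * w (n + 1)"
  using w_pos_and_less_double by blast

lemma w_double_less: "2 * w (n + 1) < w (n + 2)"
  using recurrence[of n] mult_pos_pos[OF b_pos, of "2 * w (n + 1) - w n"] w_less_double_Suc[of n] by simp

lemma w_less_add_2: "w n < w (n + 2)"
  using w_double_less[of n] w_less_double_Suc[of n] by simp

lemma w_sum_pos: "0 < w n + w (n + 2)"
proof (cases n)
  case 0
  then show ?thesis using sum_0_2_pos by (simp add: numeral_2_eq_2)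
next
  case (Suc m)
  then show ?thesis using w_pos[of n] w_pos[of "n + 2"] by simp
qed

lemma w_mono:
  assumes "0 < n" "n \<le> m"
  shows "w n \<le> w m"
  using assms(2,1)
proof (induction m rule: dec_induct)
  case (step m)
  then have "0 < m" by simp
  then have "w m \<le> w (Suc m)"
    using w_double_less[of "m - 1"] w_pos[of m] by (simp add: numeral_2_eq_2)
  then show ?case using step by simp
qed simp

lemma w_det_less: "w n * w (n + 2) < w (n + 1) * w (n + 1)"
proof (induction n)
  case 0
  then show ?case using det_0_pos by (simp add: numeral_2_eq_2)
next
  case (Suc n)
  have "w (n + 2) * w (n + 2) - w (n + 1) * w (n + 3) = b * (w (n + 1) * w (n + 1) - w n * w (n + 2))"
    by (simp add: eval_nat_numeral w_Suc_Suc algebra_simps)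
  moreover have "0 < b * (w (n + 1) * w (n + 1) - w n * w (n + 2))"
    using Suc b_pos by simp
  ultimately show ?case by (simp add: eval_nat_numeral)
qed

lemma growing_seq_shift: "growing_seq (\<lambda>n. w (n + j)) b"
proof
  show "w (n + 2 + j) = 2 * w (n + 1 + j) + b * (2 * w (n + 1 + j) - w (n + j))" for n
    using recurrence[of "n + j"] by (simp add: ac_simps)
qed (use b_pos w_pos_and_less_double[of j] w_sum_pos[of j] w_det_less[of j] in \<open>simp_all add: add.commute\<close>)

abbreviation \<eta> :: "nat \<Rightarrow> complex" where "\<eta> \<equiv> eta w"

abbreviation excess :: "nat \<Rightarrow> real" where "excess n \<equiv> 2 * w (n + 1) - w n"

lemma excess_pos: "0 < excess n"
  using w_less_double_Suc by simp

end


section \<open>Facets of the model cubes\<close>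

context growing_seq
begin

text \<open>The facet of the cube with base layer \<open>n\<close> on which coordinate \<open>i\<close> is 1 (if \<open>t\<close>) or 0
  has normal vector \<open>(facet_z n i t, facet_u n i t)\<close>.\<close>

definition facet_z :: "nat \<Rightarrow> 3 \<Rightarrow> bool \<Rightarrow> complex" where
  "facet_z n i t = (if i = 3 then (if t then Complex (excess (n + 1)) (excess (n + 2)) else
      Complex (- excess (n + 1)) (excess n))
     else Complex 0 (if t then -1 else 1))"

definition facet_u :: "nat \<Rightarrow> 3 \<Rightarrow> bool \<Rightarrow> complex" where
  "facet_u n i t =
    (if i = 3 then (if t then Complex (excess (n + 1) * w (n + 2) - excess (n + 2) * w (n + 1)) 0
        else Complex (excess (n + 1) * w n - excess n * w (n + 1)) 0)
     else (if t then Complex (w (n + 3)) ((2 * w (n + 2) - w (n + 3)) / sqrt 3 * (if i = 1 then 1 else -1))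
        else Complex (- w (n + 1)) ((w (n + 1) - 2 * w (n + 2)) / sqrt 3 * (if i = 2 then 1 else -1))))"

definition facet_value :: "nat \<Rightarrow> 3 \<Rightarrow> bool \<Rightarrow> complex \<Rightarrow> complex \<Rightarrow> real" where
  "facet_value n i t z u = facet_z n i t \<bullet> z + facet_u n i t \<bullet> u"

lemma facet_value_corner_3:
  "facet_value n 3 False (corner_z \<eta> n S) (corner_u S) =
    (if 3 \<in> S then excess (n + 1) * (w (n + card S - 1) + w (n + card S + 1)) else 0)"
  "facet_value n 3 True (corner_z \<eta> n S) (corner_u S) =
    (if 3 \<in> S then 0 else excess (n + 1) * (w (n + card S) + w (n + card S + 2)))"
  using set3_cases[of S]
  by (elim disjE; simp add: facet_value_def facet_z_def facet_u_def corner_z_simps corner_u_simps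
      inner_complex_def eval_nat_numeral w_Suc_Suc algebra_simps add_divide_distrib)+

lemma sqrt3_cancel: "x / sqrt 3 * (sqrt 3 / 2) = x / 2" "x * sqrt 3 / (sqrt 3 * 2) = x / 2"
    "sqrt 3 * x / (sqrt 3 * 2) = x / 2"
  by simp_all

lemma facet_value_corner_12:
  "facet_value n 1 False (corner_z \<eta> n S) (corner_u S) =
    (if 1 \<in> S then (if 2 \<in> S then w (n + 3) - w (n + 1) else excess (n + 1)) else 0)"
  "facet_value n 2 False (corner_z \<eta> n S) (corner_u S) =
    (if 2 \<in> S then (if 1 \<in> S then w (n + 3) - w (n + 1) else excess (n + 1)) else 0)"
  "facet_value n 1 True (corner_z \<eta> n S) (corner_u S) =
    (if 1 \<in> S then 0 else (if 2 \<in> S then w (n + 3) - 2 * w (n + 2) else w (n + 3) - w (n + 1)))"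
  "facet_value n 2 True (corner_z \<eta> n S) (corner_u S) =
    (if 2 \<in> S then 0 else (if 1 \<in> S then w (n + 3) - 2 * w (n + 2) else w (n + 3) - w (n + 1)))"
  using set3_cases[of S]
  by (elim disjE; simp add: facet_value_def facet_z_def facet_u_def corner_z_simps corner_u_simps
      inner_complex_def eval_nat_numeral sqrt3_cancel field_simps)+

lemma facet_value_corner_sign:
  "0 \<le> facet_value n i t (corner_z \<eta> n S) (corner_u S)"
  "facet_value n i t (corner_z \<eta> n S) (corner_u S) = 0 \<longleftrightarrow> (i \<in> S) = t"
proof -
  let ?f = "facet_value n i t (corner_z \<eta> n S) (corner_u S)"
  have pos: "0 < excess (n + 1)" "0 < w (n + 3) - w (n + 1)" "0 < w (n + 3) - 2 * w (n + 2)"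
    using excess_pos[of "n + 1"] w_less_add_2[of "n + 1"] w_double_less[of "n + 1"]
      by (simp_all add: eval_nat_numeral)
  have "0 \<le> ?f \<and> (?f = 0 \<longleftrightarrow> (i \<in> S) = t)"
  proof -
    consider "i = 1" | "i = 2" | "i = 3" using exhaust_3[of i] by blast
    then show ?thesis
    proof cases
      case 1
      then show ?thesis
        using pos facet_value_corner_12(1,3)[of n S] by (cases t) auto
    next
      case 2
      then show ?thesis
        using pos facet_value_corner_12(2,4)[of n S] by (cases t) auto
    next
      case 3
      have "0 < w (n + card S - 1) + w (n + card S + 1)" if "3 \<in> S"
      proof -
        have "0 < card S" using that by (auto simp: card_gt_0_iff)
        then show ?thesis using w_sum_pos[of "n + card S - 1"] by (cases "card S") simp_all
      qed
      then have "0 < excess (n + 1) * (w (n + card S - 1) + w (n + card S + 1))" if "3 \<in> S"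
        using that pos(1) by (intro mult_pos_pos) auto
      moreover have "0 < excess (n + 1) * (w (n + card S) + w (n + card S + 2))"
        using pos(1) w_sum_pos[of "n + card S"] by (intro mult_pos_pos)
      ultimately show ?thesis
        unfolding 3 using facet_value_corner_3[of n S]
        by (cases t; cases "3 \<in> S") (simp_all only: if_True if_False; force)+
    qed
  qed
  then show "0 \<le> ?f" "?f = 0 \<longleftrightarrow> (i \<in> S) = t"
    by blast+
qed

lemma corner_diagonals_cross:
  assumes "(S, S', T, T') \<in> cube_diagonals"
  shows "diagonals_cross (corner_z \<eta> n S, corner_u S) (corner_z \<eta> n S', corner_u S')
    (corner_z \<eta> n T, corner_u T) (corner_z \<eta> n T', corner_u T')"
proof -
  define c where "c S = (corner_z \<eta> n S, corner_u S)" for S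
  define A B C where "A = w n + w (n + 2)" and "B = w (n + 1) + w (n + 3)" and "C = w (n + 2) + w (n + 4)"
  have pos: "0 < A" "0 < B" "0 < C"
    unfolding A_def B_def C_def
    using w_sum_pos[of n] w_sum_pos[of "n + 1"] w_sum_pos[of "n + 2"] by (simp_all add: eval_nat_numeral)
  note simps = c_def corner_z_simps corner_u_simps complex_eq_iff eval_nat_numeral
  have "diagonals_cross (c {}) (c {1,2}) (c {1}) (c {2})"
      "diagonals_cross (c {3}) (c {1,2,3}) (c {1,3}) (c {2,3})"
    by (rule diagonals_crossI[where \<alpha> = b and \<beta> = 1 and \<gamma> = "1 + b" and \<delta> = "1 + b"];
        use b_pos in \<open>simp add: simps w_Suc_Suc algebra_simps\<close>)+
  moreover have "diagonals_cross (c {}) (c {1,3}) (c {1}) (c {3})"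
      "diagonals_cross (c {}) (c {2,3}) (c {2}) (c {3})"
    by (rule diagonals_crossI[where \<alpha> = B and \<beta> = A and \<gamma> = A and \<delta> = B];
        use pos in \<open>simp add: simps A_def B_def; algebra?\<close>)+
  moreover have "diagonals_cross (c {1}) (c {1,2,3}) (c {1,2}) (c {1,3})"
      "diagonals_cross (c {2}) (c {1,2,3}) (c {1,2}) (c {2,3})"
    by (rule diagonals_crossI[where \<alpha> = C and \<beta> = B and \<gamma> = B and \<delta> = C];
        use pos in \<open>simp add: simps B_def C_def; algebra?\<close>)+
  moreover have "diagonals_cross (c {}) (c {1,2,3}) (c {3}) (c {1,2})"
    by (rule diagonals_crossI[where \<alpha> = C and \<beta> = A and \<gamma> = C and \<delta> = A];
        use pos in \<open>simp add: simps A_def C_def; algebra?\<close>)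
  moreover have "diagonals_cross (c {1}) (c {2,3}) (c {2}) (c {1,3})"
    by (rule diagonals_crossI[where \<alpha> = 1 and \<beta> = 1 and \<gamma> = 1 and \<delta> = 1]) (simp_all add: simps)
  ultimately show ?thesis
    using assms unfolding cube_diagonals_def c_def by auto
qed

end

locale growing = frame + growing_seq
begin

lemma growing_shift: "growing (cis t * e) s (\<lambda>n. w (n + j)) b"
proof -
  have "frame (cis t * e) s"
    using norm_e s_square by (simp add: frame_def norm_mult)
  then show ?thesis
    unfolding growing_def using growing_seq_shift by blast
qed

abbreviation corner :: "real^3 \<Rightarrow> 3 set \<Rightarrow> real^5" where
  "corner v \<equiv> \<lambda>S. model_pt e s \<eta> (v + ind_vec S)"

lemma inner_facet_normal:
  assumes "coord_sum v = real n"
  shows "emb e s (z_phase v * facet_z n i t) (u_phase v * facet_u n i t) \<bullet> corner v S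
    = facet_value n i t (corner_z \<eta> n S) (corner_u S)"
  unfolding inner_model_pt[OF assms] facet_value_def ..

lemma Re_corner_u: "1/2 \<le> Re (corner_u S)"
  using set3_cases[of S] by (elim disjE) (simp_all add: corner_u_simps)

lemma model_cube_config:
  assumes "v \<in> int_points" "0 \<le> coord_sum v"
  shows "cube_config (corner v)"
proof -
  obtain n where n: "coord_sum v = real n"
    using int_points_coord_sum_nat[OF assms] by blast
  let ?E = "\<lambda>(z, u). emb e s (z_phase v * z) (u_phase v * u)"
  have "linear ?E"
    by (rule linearI) (auto simp: emb_add emb_scale distrib_left)
  have "0 < ?E (0, 1) \<bullet> corner v S" for S
    using inner_model_pt[OF n, of 0 1 \<eta> S] Re_corner_u[of S] by (simp add: inner_complex_def)
  moreover have facet: "0 \<le> ?E (facet_z n i t, facet_u n i t) \<bullet> corner v S \<and>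
      (?E (facet_z n i t, facet_u n i t) \<bullet> corner v S = 0 \<longleftrightarrow> (i \<in> S) = t)" for i t S
    unfolding split inner_facet_normal[OF n] using facet_value_corner_sign by blast
  have "\<exists>a. \<forall>S. 0 \<le> a \<bullet> corner v S \<and> (a \<bullet> corner v S = 0 \<longleftrightarrow> i \<notin> S)"
    "\<exists>a. \<forall>S. 0 \<le> a \<bullet> corner v S \<and> (a \<bullet> corner v S = 0 \<longleftrightarrow> i \<in> S)" for i
    by (rule exI[of _ "?E (facet_z n i False, facet_u n i False)"], use facet[of i False] in simp)
      (rule exI[of _ "?E (facet_z n i True, facet_u n i True)"], use facet[of i True] in simp)
  moreover have "diagonals_cross (corner v S) (corner v S') (corner v T) (corner v T')"
    if "(S, S', T, T') \<in> cube_diagonals" for S S' T T'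
    using diagonals_cross_linear_image[OF corner_diagonals_cross[OF that, of n] \<open>linear ?E\<close>]
    by (simp add: model_pt_corner[OF n])
  ultimately show ?thesis
    unfolding cube_config_def by blast
qed

end


section \<open>Sections of the model cubes\<close>

context growing_seq
begin

definition slab_bottom :: "nat \<Rightarrow> real \<Rightarrow> real \<Rightarrow> real" where
  "slab_bottom n a c = w (n + 1) * a + w (n + 2) * c"

definition slab_top :: "nat \<Rightarrow> real \<Rightarrow> real \<Rightarrow> real" where
  "slab_top n a c = w (n + 3) * a + w (n + 2) * c"

definition slab_right :: "nat \<Rightarrow> real \<Rightarrow> real \<Rightarrow> complex \<Rightarrow> real" where
  "slab_right n a c z = excess n * (Im z - w (n + 1) * (a + c / 2)) -
      excess (n + 1) * (Re z - w n * (a + c / 2))"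

definition slab_left :: "nat \<Rightarrow> real \<Rightarrow> real \<Rightarrow> complex \<Rightarrow> real" where
  "slab_left n a c z = excess (n + 1) * (Re z + w (n + 2) * (a + c / 2)) +
      excess (n + 2) * (Im z - w (n + 1) * (a + c / 2))"

text \<open>The section of a cube with base layer \<open>n\<close> by the half-plane \<open>u \<in> \<real>\<^sub>\<ge>\<^sub>0 (a + c \<omega>)\<close> is a
  trapezoid bounded by the lines \<open>Im z = slab_bottom\<close>, \<open>Im z = slab_top\<close>, \<open>slab_right = 0\<close> and \<open>slab_left = 0\<close>.\<close>

definition slab :: "nat \<Rightarrow> real \<Rightarrow> real \<Rightarrow> complex \<Rightarrow> bool" where
  "slab n a c z \<longleftrightarrow> slab_bottom n a c \<le> Im z \<and> Im z < slab_top n a c \<and>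
      0 \<le> slab_right n a c z \<and> 0 < slab_left n a c z"

definition swap_unless :: "bool \<Rightarrow> real \<Rightarrow> real \<Rightarrow> real" where
  "swap_unless t x y = (if t then x else y)"

lemma slab_top_le_bottom:
  assumes "0 \<le> x" "0 \<le> y" "n < m" "t = t' \<longleftrightarrow> even (m - n)"
  shows "slab_top n (swap_unless t x y) (swap_unless t y x) \<le>
      slab_bottom m (swap_unless t' x y) (swap_unless t' y x)"
proof -
  have mono: "w (n + 2) \<le> w (m + 1)" "w (n + 3) \<le> w (m + 2)"
    using assms(3) by (auto intro!: w_mono)
  show ?thesis
  proof (cases "t = t'")
    case True
    then have "n + 2 \<le> m" using assms(3,4) by (cases "m = n + 1") auto
    then have "w (n + 3) \<le> w (m + 1)" "w (n + 2) \<le> w (m + 2)"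
      by (auto intro!: w_mono)
    then show ?thesis
      using assms(1,2) True by (auto simp: swap_unless_def slab_top_def slab_bottom_def
          intro!: add_mono mult_right_mono)
  next
    case False
    then have "swap_unless t' x y = swap_unless t y x" "swap_unless t' y x = swap_unless t x y"
      by (auto simp: swap_unless_def)
    moreover have "0 \<le> swap_unless t x y" "0 \<le> swap_unless t y x"
      using assms by (auto simp: swap_unless_def)
    moreover from this have "w (n + 3) * swap_unless t x y \<le> w (m + 2) * swap_unless t x y"
        "w (n + 2) * swap_unless t y x \<le> w (m + 1) * swap_unless t y x"
      using mono by (auto intro: mult_right_mono)
    ultimately show ?thesis
      unfolding slab_top_def slab_bottom_def by simp
  qed
qed

lemma slab_left_corner:
  "slab_left n a c z = excess (n + 1) * (Re z + slab_top (n + 1) a c) +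
      excess (n + 2) * (Im z - slab_top n a c)"
  by (simp add: slab_left_def slab_top_def eval_nat_numeral w_Suc_Suc algebra_simps add_divide_distrib)

lemma slab_right_corner:
  "slab_right n a c z = excess n * (Im z - slab_top n a c) -
      excess (n + 1) * (Re z - (w (n + 2) * a + w (n + 1) * c))"
  by (simp add: slab_right_def slab_top_def eval_nat_numeral w_Suc_Suc algebra_simps add_divide_distrib)

lemma slab_right_Suc: "slab_right (n + 1) a c z = - slab_left n a c (\<i> * z)"
  by (simp add: slab_right_def slab_left_def eval_nat_numeral algebra_simps)

lemma slab_Im_pos: "slab n a c z \<Longrightarrow> 0 \<le> a \<Longrightarrow> 0 \<le> c \<Longrightarrow> 0 < a + c \<Longrightarrow> 0 < Im z"
proof -
  assume "slab n a c z" "0 \<le> a" "0 \<le> c" "0 < a + c"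
  moreover have "0 < w (n + 1)" "0 < w (n + 2)" by (auto intro: w_pos)
  ultimately have "0 < slab_bottom n a c"
    unfolding slab_bottom_def by (cases "a = 0") (auto intro: add_pos_nonneg add_nonneg_pos)
  then show ?thesis using \<open>slab n a c z\<close> by (simp add: slab_def)
qed

lemma slab_level_unique:
  assumes "0 \<le> x" "0 \<le> y"
    and "slab n (swap_unless t x y) (swap_unless t y x) z" "slab m (swap_unless t' x y) (swap_unless t' y x) z"
    and "t = t' \<longleftrightarrow> even (n + m)"
  shows "n = m"
proof (rule ccontr)
  assume "n \<noteq> m"
  then consider "n < m" | "m < n" by linarith
  then show False
  proof cases
    case 1
    then have "t = t' \<longleftrightarrow> even (m - n)" using assms(5) by (auto simp: even_diff_nat)
    from slab_top_le_bottom[OF assms(1,2) 1 this] show False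
      using assms(3,4) by (simp add: slab_def)
  next
    case 2
    then have "t' = t \<longleftrightarrow> even (n - m)" using assms(5) by (auto simp add: even_diff_nat)
    from slab_top_le_bottom[OF assms(1,2) 2 this] show False
      using assms(3,4) by (simp add: slab_def)
  qed
qed

lemma swap_unless_nonneg: "0 \<le> x \<Longrightarrow> 0 \<le> y \<Longrightarrow> 0 \<le> swap_unless t x y"
  by (simp add: swap_unless_def)

lemma slab_corner_le_bottom:
  assumes "0 \<le> x" "0 \<le> y" "m \<le> n" "t = t' \<longleftrightarrow> odd (n + m)"
  shows "w (m + 2) * swap_unless t' x y + w (m + 1) * swap_unless t' y x
    \<le> slab_bottom n (swap_unless t x y) (swap_unless t y x)"
proof -
  let ?a = "swap_unless t x y" and ?c = "swap_unless t y x"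
  have nonneg: "0 \<le> ?a" "0 \<le> ?c"
    using assms(1,2) by (simp_all add: swap_unless_nonneg)
  show ?thesis
  proof (cases "t = t'")
    case True
    then have "m < n" using assms(3,4) by (cases "m = n") auto
    then have "w (m + 2) \<le> w (n + 1)" "w (m + 1) \<le> w (n + 2)"
      by (auto intro!: w_mono)
    then show ?thesis
      unfolding slab_bottom_def using nonneg True by (auto intro!: add_mono mult_right_mono)
  next
    case False
    then have "swap_unless t' x y = ?c" "swap_unless t' y x = ?a" by (auto simp: swap_unless_def)
    moreover have "w (m + 2) \<le> w (n + 2)" "w (m + 1) \<le> w (n + 1)"
      using assms(3) by (auto intro!: w_mono)
    then have "w (m + 2) * ?c \<le> w (n + 2) * ?c" "w (m + 1) * ?a \<le> w (n + 1) * ?a"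
      using nonneg by (auto intro!: mult_right_mono)
    ultimately show ?thesis
      by (simp add: slab_bottom_def)
  qed
qed

lemma slab_left_nonpos:
  assumes "Re z \<le> - slab_top (n + 1) a c" "Im z \<le> slab_top n a c"
  shows "slab_left n a c z \<le> 0"
proof -
  have "excess (n + 1) * (Re z + slab_top (n + 1) a c) \<le> 0"
    using assms(1) excess_pos[of "n + 1"] by (intro mult_nonneg_nonpos) auto
  moreover have "excess (n + 2) * (Im z - slab_top n a c) \<le> 0"
    using assms(2) excess_pos[of "n + 2"] by (intro mult_nonneg_nonpos) auto
  ultimately show ?thesis
    unfolding slab_left_corner by linarith
qed

lemma slab_right_neg:
  assumes "w (n + 2) * a + w (n + 1) * c \<le> Re z" "Im z < slab_top n a c"
  shows "slab_right n a c z < 0"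
proof -
  have "0 \<le> excess (n + 1) * (Re z - (w (n + 2) * a + w (n + 1) * c))"
    using assms(1) excess_pos[of "n + 1"] by (intro mult_nonneg_nonneg) auto
  moreover have "excess n * (Im z - slab_top n a c) < 0"
    using assms(2) excess_pos[of n] by (intro mult_pos_neg) auto
  ultimately show ?thesis
    unfolding slab_right_corner by linarith
qed

lemma slab_quarter_turn:
  assumes xy: "0 \<le> x" "0 \<le> y"
    and turned: "slab n (swap_unless t x y) (swap_unless t y x) (\<i> * z)"
    and slab: "slab m (swap_unless t' x y) (swap_unless t' y x) z"
    and parity: "t = t' \<longleftrightarrow> odd (n + m)"
  shows False
proof -
  let ?a = "swap_unless t x y" and ?c = "swap_unless t y x"
  let ?a' = "swap_unless t' x y" and ?c' = "swap_unless t' y x"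
  consider "m = n + 1" | "n + 1 < m" | "m \<le> n" by linarith
  then show False
  proof cases
    case 1
    then have "t = t'" using parity by simp
    then show False
      using turned slab slab_right_Suc[of n ?a ?c z] 1 by (simp add: slab_def)
  next
    case 2
    have "t = t' \<longleftrightarrow> even (m - (n + 1))"
      using parity 2 by (auto simp: even_diff_nat)
    from slab_top_le_bottom[OF xy 2 this] have "slab_top (n + 1) ?a ?c \<le> Im z"
      using slab by (simp add: slab_def)
    then have "slab_left n ?a ?c (\<i> * z) \<le> 0"
      using turned by (intro slab_left_nonpos) (auto simp: slab_def)
    then show False using turned by (simp add: slab_def)
  next
    case 3
    have "w (m + 2) * ?a' + w (m + 1) * ?c' \<le> slab_bottom n ?a ?c"
      using slab_corner_le_bottom[OF xy 3 parity] .
    also have "\<dots> \<le> Re z"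
      using turned by (simp add: slab_def)
    finally have "slab_right m ?a' ?c' z < 0"
      using slab by (intro slab_right_neg) (simp_all add: slab_def)
    then show False using slab by (simp add: slab_def)
  qed
qed

end

section \<open>Open cells are disjoint\<close>

lemma sum_if_pos:
  fixes c :: "'i \<Rightarrow> real"
  assumes "finite A" "\<forall>i\<in>A. 0 < c i"
  shows "0 \<le> (\<Sum>i\<in>A. if P i then c i else 0)" "0 < (\<Sum>i\<in>A. if P i then c i else 0) \<longleftrightarrow> (\<exists>i\<in>A. P i)"
proof -
  have nonneg: "0 \<le> (if P i then c i else 0)" if "i \<in> A" for i
    using assms(2) that by (simp add: less_imp_le)
  then show "0 \<le> (\<Sum>i\<in>A. if P i then c i else 0)"
    by (rule sum_nonneg)
  have "(\<Sum>i\<in>A. if P i then c i else 0) = 0 \<longleftrightarrow> (\<forall>i\<in>A. \<not> P i)"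
    using sum_nonneg_eq_0_iff[OF assms(1) nonneg] assms(2) by force
  with \<open>0 \<le> _\<close> show "0 < (\<Sum>i\<in>A. if P i then c i else 0) \<longleftrightarrow> (\<exists>i\<in>A. P i)"
    by (simp add: less_le)
qed

lemma corner_u_combination:
  fixes I :: "3 set"
  assumes "\<forall>S\<in>Pow I. 0 < c S"
  obtains C\<^sub>0 C\<^sub>1 C\<^sub>2 :: real where
    "(\<Sum>S\<in>Pow I. c S *\<^sub>R corner_u S) = of_real C\<^sub>0 + of_real C\<^sub>1 * omega + of_real C\<^sub>2 * cnj omega"
    "0 < C\<^sub>0" "0 \<le> C\<^sub>1" "0 < C\<^sub>1 \<longleftrightarrow> 1 \<in> I" "0 \<le> C\<^sub>2" "0 < C\<^sub>2 \<longleftrightarrow> 2 \<in> I"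
proof
  let ?C = "\<lambda>P. \<Sum>S\<in>Pow I. if P S then c S else 0"
  show "(\<Sum>S\<in>Pow I. c S *\<^sub>R corner_u S) = of_real (?C (\<lambda>S. (1 \<in> S) = (2 \<in> S)))
      + of_real (?C (\<lambda>S. 1 \<in> S \<and> 2 \<notin> S)) * omega + of_real (?C (\<lambda>S. 2 \<in> S \<and> 1 \<notin> S)) * cnj omega"
    unfolding of_real_sum sum_distrib_right sum.distrib[symmetric]
    by (intro sum.cong refl) (auto simp: corner_u_omega scaleR_conv_of_real)
  have "{} \<in> Pow I" "1 \<in> I \<Longrightarrow> {1} \<in> Pow I" "2 \<in> I \<Longrightarrow> {2} \<in> Pow I"
    by simp_all
  then have ex: "(\<exists>S\<in>Pow I. (1 \<in> S) = (2 \<in> S)) \<longleftrightarrow> True" "(\<exists>S\<in>Pow I. 1 \<in> S \<and> 2 \<notin> S) \<longleftrightarrow> 1 \<in> I"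
    "(\<exists>S\<in>Pow I. 2 \<in> S \<and> 1 \<notin> S) \<longleftrightarrow> 2 \<in> I"
    by (fastforce simp del: Pow_iff dest: subsetD[OF PowD])+
  note pos = sum_if_pos[OF finite assms]
  show "0 < ?C (\<lambda>S. (1 \<in> S) = (2 \<in> S))" "0 \<le> ?C (\<lambda>S. 1 \<in> S \<and> 2 \<notin> S)"
    "0 < ?C (\<lambda>S. 1 \<in> S \<and> 2 \<notin> S) \<longleftrightarrow> 1 \<in> I" "0 \<le> ?C (\<lambda>S. 2 \<in> S \<and> 1 \<notin> S)"
    "0 < ?C (\<lambda>S. 2 \<in> S \<and> 1 \<notin> S) \<longleftrightarrow> 2 \<in> I"
    by (simp_all only: pos ex)
qed

context growing_seq
begin

lemma facet_value_sector:
  "facet_value n 2 False z (sector_pt a c) = Im z - slab_bottom n a c"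
  "facet_value n 1 True z (sector_pt a c) = slab_top n a c - Im z"
  "facet_value n 3 False z (sector_pt a c) = slab_right n a c z"
  "facet_value n 3 True z (sector_pt a c) = slab_left n a c z"
  by (simp_all add: facet_value_def facet_z_def facet_u_def inner_complex_def sector_pt_sel
      slab_bottom_def slab_top_def slab_right_def slab_left_def field_simps)

lemma facet_value_cnj_sector:
  "facet_value n 1 False z (cnj (sector_pt a c)) = Im z - slab_bottom n a c"
  "facet_value n 2 True z (cnj (sector_pt a c)) = slab_top n a c - Im z"
  "facet_value n 3 False z (cnj (sector_pt a c)) = slab_right n a c z"
  "facet_value n 3 True z (cnj (sector_pt a c)) = slab_left n a c z"
  by (simp_all add: facet_value_def facet_z_def facet_u_def inner_complex_def sector_pt_sel
      slab_bottom_def slab_top_def slab_right_def slab_left_def field_simps)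

text \<open>The section of the open cell \<open>I\<close> of a cube with base layer \<open>n\<close> by the half-plane \<open>u \<in> \<real>\<^sub>\<ge>\<^sub>0 (p + q \<omega>)\<close>
  (if \<open>t\<close>, when \<open>u\<close> lies above the real axis) or by \<open>u \<in> \<real>\<^sub>\<ge>\<^sub>0 (q + p \<omega>\<inverse>)\<close> (otherwise).\<close>

definition cell_section :: "nat \<Rightarrow> 3 set \<Rightarrow> bool \<Rightarrow> real \<Rightarrow> real \<Rightarrow> complex \<Rightarrow> bool" where
  "cell_section n I t p q z \<longleftrightarrow> 0 < p \<and> 0 \<le> q \<and> (t \<or> 0 < q) \<and>
     slab n (swap_unless t p q) (swap_unless t q p) z \<and>
     (3 \<in> I \<longleftrightarrow> slab_right n (swap_unless t p q) (swap_unless t q p) z \<noteq> 0) \<and>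
     (t \<longrightarrow> (2 \<in> I \<longleftrightarrow> slab_bottom n p q < Im z) \<and> (1 \<in> I \<longleftrightarrow> 0 < q \<or> 2 \<in> I)) \<and>
     (\<not> t \<longrightarrow> 2 \<in> I \<and> (1 \<in> I \<longleftrightarrow> slab_bottom n q p < Im z))"

lemma cell_sectionD:
  assumes "cell_section n I t p q z"
  shows "0 < p" "0 \<le> q" "slab n (swap_unless t p q) (swap_unless t q p) z"
    "3 \<in> I \<longleftrightarrow> slab_right n (swap_unless t p q) (swap_unless t q p) z \<noteq> 0"
    "t \<Longrightarrow> 2 \<in> I \<longleftrightarrow> slab_bottom n p q < Im z" "t \<Longrightarrow> 1 \<in> I \<longleftrightarrow> 0 < q \<or> 2 \<in> I"
    "\<not> t \<Longrightarrow> 2 \<in> I" "\<not> t \<Longrightarrow> 1 \<in> I \<longleftrightarrow> slab_bottom n q p < Im z"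
  using assms by (simp_all add: cell_section_def)

lemma facet_value_open_cell:
  assumes "(z, u) \<in> open_cone (\<lambda>S. (corner_z \<eta> n S, corner_u S)) (Pow I)"
  shows "0 \<le> facet_value n i False z u" "facet_value n i False z u = 0 \<longleftrightarrow> i \<notin> I" "0 < facet_value n i True z u"
proof -
  let ?p = "\<lambda>S. (corner_z \<eta> n S, corner_u S)" and ?a = "\<lambda>t. (facet_z n i t, facet_u n i t)"
  have inner: "?a t \<bullet> (z, u) = facet_value n i t z u" for t z u
    by (simp add: facet_value_def)
  have corner: "0 \<le> ?a t \<bullet> ?p S" "?a t \<bullet> ?p S = 0 \<longleftrightarrow> (i \<in> S) = t" for t S
    unfolding inner by (rule facet_value_corner_sign)+
  have nonneg: "0 \<le> facet_value n i t z u" for t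
  proof -
    have "0 \<le> ?a t \<bullet> (z, u)"
    proof (rule convex_cone_hull_face(1))
      show "(z, u) \<in> convex_cone hull (?p ` Pow I)"
        using assms open_cone_subset by blast
      show "0 \<le> ?a t \<bullet> y" if "y \<in> ?p ` Pow I" for y
        using that corner(1) by blast
    qed
    then show ?thesis
      unfolding inner .
  qed
  have zero: "facet_value n i t z u = 0 \<longleftrightarrow> (\<forall>S\<in>Pow I. (i \<in> S) = t)" for t
    using inner_open_cone_zero_iff[OF assms finite corner(1), of t] unfolding inner facet_value_corner_sign(2) .
  show "0 \<le> facet_value n i False z u" "facet_value n i False z u = 0 \<longleftrightarrow> i \<notin> I"
    using nonneg zero by auto
  show "0 < facet_value n i True z u"
    using nonneg[of True] zero[of True] by (auto simp: less_le)
qed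

lemma open_corner_cone_section:
  assumes "(z, u) \<in> open_cone (\<lambda>S. (corner_z \<eta> n S, corner_u S)) (Pow I)"
  obtains p q t where "u = (if t then sector_pt p q else cnj (sector_pt q p))" "cell_section n I t p q z"
proof -
  note facets = facet_value_open_cell[OF assms]
  obtain c where "(z, u) = (\<Sum>S\<in>Pow I. c S *\<^sub>R (corner_z \<eta> n S, corner_u S))" and c: "\<forall>S\<in>Pow I. 0 < c S"
    using assms by (auto simp: open_cone_def)
  then have u: "u = (\<Sum>S\<in>Pow I. c S *\<^sub>R corner_u S)"
    by (simp add: scaleR_Pair sum_prod)
  obtain C\<^sub>0 C\<^sub>1 C\<^sub>2 :: real where C: "u = of_real C\<^sub>0 + of_real C\<^sub>1 * omega + of_real C\<^sub>2 * cnj omega"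
    "0 < C\<^sub>0" "0 \<le> C\<^sub>1" "0 < C\<^sub>1 \<longleftrightarrow> 1 \<in> I" "0 \<le> C\<^sub>2" "0 < C\<^sub>2 \<longleftrightarrow> 2 \<in> I"
    unfolding u by (rule corner_u_combination[OF c])
  show ?thesis
  proof (cases "C\<^sub>2 \<le> C\<^sub>1")
    case True
    have upper: "u = sector_pt (C\<^sub>0 + C\<^sub>2) (C\<^sub>1 - C\<^sub>2)"
      unfolding C(1) cnj_omega sector_pt_def by (simp add: algebra_simps)
    have "0 < C\<^sub>1 - C\<^sub>2 \<or> 2 \<in> I \<longleftrightarrow> 1 \<in> I"
      using C True by linarith
    then have "cell_section n I True (C\<^sub>0 + C\<^sub>2) (C\<^sub>1 - C\<^sub>2) z"
      using C True facets(1)[of 2] facets(2)[of 2] facets(3)[of 1] facets(1)[of 3]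
          facets(2)[of 3] facets(3)[of 3]
      unfolding upper facet_value_sector by (auto simp: cell_section_def swap_unless_def slab_def)
    then show ?thesis
      using that[of True] upper by simp
  next
    case False
    have lower: "u = cnj (sector_pt (C\<^sub>0 + C\<^sub>1) (C\<^sub>2 - C\<^sub>1))"
      unfolding C(1) cnj_omega sector_pt_def by (simp add: cnj_omega algebra_simps)
    have "2 \<in> I"
      using C False by linarith
    then have "cell_section n I False (C\<^sub>2 - C\<^sub>1) (C\<^sub>0 + C\<^sub>1) z"
      using C False facets(1)[of 1] facets(2)[of 1] facets(3)[of 2]
          facets(1)[of 3] facets(2)[of 3] facets(3)[of 3]
      unfolding lower facet_value_cnj_sector by (auto simp: cell_section_def swap_unless_def slab_def)
    then show ?thesis
      using that[of False] lower by simp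
  qed
qed

lemma cell_section_cell_unique:
  assumes "cell_section n I t p q z" "cell_section n I' t p q z"
  shows "I = I'"
proof -
  have "1 \<in> I \<longleftrightarrow> 1 \<in> I'" "2 \<in> I \<longleftrightarrow> 2 \<in> I'" "3 \<in> I \<longleftrightarrow> 3 \<in> I'"
    using cell_sectionD(4-8)[OF assms(1)] cell_sectionD(4-8)[OF assms(2)] by (cases t; simp)+
  then show ?thesis
    by (simp add: set_eq_iff forall_3)
qed

lemma cell_section_unique:
  fixes i j :: int
  assumes sections: "cell_section n I t p q z" "cell_section n' I' t' p q z'"
    and phase: "cis (pi / 2 * of_int i) * z = cis (pi / 2 * of_int j) * z'"
    and parity: "t = t' \<longleftrightarrow> even (int n + int n' + (j - i))"
  shows "4 dvd (j - i) \<and> n = n' \<and> t = t' \<and> I = I'"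
proof -
  note D = cell_sectionD[OF sections(1)] and D' = cell_sectionD[OF sections(2)]
  have pq: "0 \<le> p" "0 \<le> q"
    using D(1,2) by simp_all
  from phase show ?thesis
  proof (cases rule: quarter_turn_cases)
    case 1
    then have "even (j - i)"
      using dvd_trans[of 2 4 "j - i"] by simp
    then have "t = t' \<longleftrightarrow> even (n + n')"
      using parity by simp
    moreover from this have "n = n'"
      using slab_level_unique[OF pq D(3)] D'(3) 1(2) by blast
    ultimately have eq: "n = n'" "t = t'" "z = z'"
      using 1(2) by auto
    then have "I = I'"
      using cell_section_cell_unique sections by blast
    then show ?thesis
      using 1(1) eq by blast
  next
    case 2
    then have "t = t' \<longleftrightarrow> odd (n + n')"
      using parity by simp
    then show ?thesis
      using slab_quarter_turn[OF pq _ D'(3)] D(3) 2(2) by blast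
  next
    case 3
    have "0 < Im z" "0 < Im z'"
      using slab_Im_pos[OF D(3)] slab_Im_pos[OF D'(3)] D(1,2) by (auto simp: swap_unless_def)
    then show ?thesis
      using 3(2) by simp
  next
    case 4
    then have "t' = t \<longleftrightarrow> odd (n' + n)"
      using parity by auto
    then show ?thesis
      using slab_quarter_turn[OF pq _ D(3)] D'(3) 4(2) by blast
  qed
qed

end

context growing
begin

lemma open_cell_section:
  assumes v: "v \<in> int_points" "coord_sum v = real n" and x: "x \<in> open_cone (corner v) (Pow I)"
  obtains z p q t and k m :: int where
    "x = emb e s (cis (pi / 2 * of_int k) * z) (cis (pi / 3 * of_int m) * sector_pt p q)"
    "v $ 3 = k" "v $ 1 - v $ 2 = of_int m + (if t then 0 else 1)" "t \<longleftrightarrow> even (int n - k - m)"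
    "cell_section n I t p q z"
proof -
  obtain c where c: "x = (\<Sum>S\<in>Pow I. c S *\<^sub>R corner v S)" "\<forall>S\<in>Pow I. 0 < c S"
    using x by (auto simp: open_cone_def)
  define z u where "z = (\<Sum>S\<in>Pow I. c S *\<^sub>R corner_z \<eta> n S)" and "u = (\<Sum>S\<in>Pow I. c S *\<^sub>R corner_u S)"
  have "(z, u) = (\<Sum>S\<in>Pow I. c S *\<^sub>R (corner_z \<eta> n S, corner_u S))"
    by (simp add: z_def u_def scaleR_Pair sum_prod)
  then have "(z, u) \<in> open_cone (\<lambda>S. (corner_z \<eta> n S, corner_u S)) (Pow I)"
    using c(2) unfolding open_cone_def by blast
  then obtain p q t where u: "u = (if t then sector_pt p q else cnj (sector_pt q p))"
    and "cell_section n I t p q z"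
    by (rule open_corner_cone_section)
  obtain i\<^sub>1 i\<^sub>2 i\<^sub>3 :: int where i: "v $ 1 = i\<^sub>1" "v $ 2 = i\<^sub>2" "v $ 3 = i\<^sub>3"
    using int_pointsE[OF v(1)] .
  define m where "m = i\<^sub>1 - i\<^sub>2 - (if t then 0 else 1)"
  have "u_phase v * u = cis (pi / 3 * of_int m) * sector_pt p q"
  proof (cases t)
    case False
    have "pi / 3 * (v $ 1 - v $ 2) = pi / 3 * of_int m + pi / 3"
      using False by (simp add: m_def i field_simps)
    then have "u_phase v * u = cis (pi / 3 * of_int m) * (omega * u)"
      by (simp only: cis_mult[symmetric] omega_def mult.assoc)
    then show ?thesis
      using False by (simp add: u omega_cnj_sector_pt)
  qed (simp add: u m_def i)
  then have "x = emb e s (cis (pi / 2 * of_int i\<^sub>3) * z) (cis (pi / 3 * of_int m) * sector_pt p q)"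
    unfolding c(1) sum_model_pt_corner[OF v(2)] z_def[symmetric] u_def[symmetric] i(3) by simp
  moreover have "int n = i\<^sub>1 + i\<^sub>2 + i\<^sub>3"
    using v(2) i by (simp add: coord_sum_def)
  then have "t \<longleftrightarrow> even (int n - i\<^sub>3 - m)"
    by (auto simp: m_def)
  moreover have "v $ 1 - v $ 2 = of_int m + (if t then 0 else 1)"
    by (simp add: i m_def)
  ultimately show ?thesis
    using that i(3) \<open>cell_section n I t p q z\<close> by blast
qed

lemma open_cell_unique:
  assumes v: "v \<in> int_points" "coord_sum v = real n" and v': "v' \<in> int_points" "coord_sum v' = real n'"
    and x: "x \<in> open_cone (corner v) (Pow I)" "x \<in> open_cone (corner v') (Pow I')"
  shows "I = I' \<and> (\<exists>l\<in>Lam. v' = l + v)"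
proof -
  obtain z p q t and k m :: int where L:
      "x = emb e s (cis (pi / 2 * of_int k) * z) (cis (pi / 3 * of_int m) * sector_pt p q)"
    "v $ 3 = k" "v $ 1 - v $ 2 = of_int m + (if t then 0 else 1)"
        "t \<longleftrightarrow> even (int n - k - m)" "cell_section n I t p q z"
    by (rule open_cell_section[OF v x(1)])
  obtain z' p' q' t' and k' m' :: int where L':
      "x = emb e s (cis (pi / 2 * of_int k') * z') (cis (pi / 3 * of_int m') * sector_pt p' q')"
    "v' $ 3 = k'" "v' $ 1 - v' $ 2 = of_int m' + (if t' then 0 else 1)" "t' \<longleftrightarrow> even (int n' - k' - m')"
    "cell_section n' I' t' p' q' z'"
    by (rule open_cell_section[OF v' x(2)])
  have phases: "cis (pi / 2 * of_int k) * z = cis (pi / 2 * of_int k') * z'"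
    "cis (pi / 3 * of_int m) * sector_pt p q = cis (pi / 3 * of_int m') * sector_pt p' q'"
    using L(1) L'(1) emb_eq_iff by blast+
  have sector: "6 dvd (m' - m)" "p = p'" "q = q'"
    using sector_unique[OF phases(2)] cell_sectionD(1,2)[OF L(5)] cell_sectionD(1,2)[OF L'(5)] by auto
  have "even (m' - m)"
    using dvd_trans[of 2 6 "m' - m"] sector(1) by simp
  then have "t = t' \<longleftrightarrow> even (int n + int n' + (k' - k))"
    unfolding L(4) L'(4) by auto
  then have same: "4 dvd (k' - k)" "n = n'" "t = t'" "I = I'"
    using cell_section_unique[OF L(5) _ phases(1)] L'(5) sector by blast+
  obtain b a where "k' - k = 4 * b" "m' - m = 6 * a"
    using same(1) sector(1) by (auto elim!: dvdE)
  then have "v' $ 3 - v $ 3 = 4 * of_int b" "(v' $ 1 - v' $ 2) - (v $ 1 - v $ 2) = 6 * of_int a"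
    unfolding L(2,3) L'(2,3) same(3) by linarith+
  then have "v' - v \<in> Lam"
    using diff_mem_LamI v(2) v'(2) same(2) by metis
  then show ?thesis
    using same(4) by (intro conjI bexI[of _ "v' - v"]) auto
qed

end

section \<open>The model complex\<close>

definition model_lab :: "complex \<Rightarrow> real \<Rightarrow> (nat \<Rightarrow> complex) \<Rightarrow> labelling" where
  "model_lab e s h C = sph_hull (model_pt e s h ` {v. \<exists>F\<in>C. {v} face_of F})"

lemma model_lab_cell: "model_lab e s h (orbit (cell v I)) =
    sph_hull ((\<lambda>S. model_pt e s h (v + ind_vec S)) ` Pow I)"
proof -
  let ?V = "{u. \<exists>F\<in>orbit (cell v I). {u} face_of F}"
  have V: "u \<in> ?V \<longleftrightarrow> (\<exists>l\<in>Lam. \<exists>S\<subseteq>I. u = l + (v + ind_vec S))" for u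
    unfolding orbit_cell mem_Collect_eq add.assoc[symmetric] using cell_vertex_iff by blast
  have "model_pt e s h ` ?V = (\<lambda>S. model_pt e s h (v + ind_vec S)) ` Pow I"
  proof (intro equalityI image_subsetI)
    show "model_pt e s h u \<in> (\<lambda>S. model_pt e s h (v + ind_vec S)) ` Pow I" if "u \<in> ?V" for u
      using that model_pt_Lam unfolding V by auto
    show "model_pt e s h (v + ind_vec S) \<in> model_pt e s h ` ?V" if "S \<in> Pow I" for S
    proof (rule imageI)
      have "v + ind_vec S = 0 + (v + ind_vec S)"
        by simp
      then show "v + ind_vec S \<in> ?V"
        using that Lam_zero unfolding V by blast
    qed
  qed
  then show ?thesis
    unfolding model_lab_def by simp
qed

lemma model_lab_empty [simp]: "model_lab e s h (orbit {}) = {}"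
  by (auto simp: model_lab_def orbit_empty face_of_singleton extreme_point_of_def)

lemma set_interval_eq_image_Un: "A \<subseteq> B \<Longrightarrow> {A..B} = (\<union>) A ` Pow (B - A)"
proof (intro equalityI subsetI)
  fix S assume "S \<in> {A..B}"
  then have "S = A \<union> (S - A)" "S - A \<in> Pow (B - A)" by auto
  then show "S \<in> (\<union>) A ` Pow (B - A)" by blast
qed auto

lemma add_ind_vec_Un: "S \<in> Pow (B - A) \<Longrightarrow> v + ind_vec (A \<union> S) = v + ind_vec A + ind_vec S"
  by (subst ind_vec_Un) (auto simp: add.assoc)

lemma corner_image_interval:
  assumes "A \<subseteq> B"
  shows "(\<lambda>S. q (v + ind_vec S)) ` {A..B} = (\<lambda>S. q (v + ind_vec A + ind_vec S)) ` Pow (B - A)"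
  unfolding set_interval_eq_image_Un[OF assms] image_image by (intro image_cong) (simp_all only: add_ind_vec_Un)

lemma open_cone_interval:
  assumes "A \<subseteq> B"
  shows "open_cone (\<lambda>S. q (v + ind_vec S)) {A..B} \<subseteq> open_cone (\<lambda>S. q (v + ind_vec A + ind_vec S)) (Pow (B - A))"
proof -
  have "open_cone (\<lambda>S. q (v + ind_vec S)) ((\<union>) A ` Pow (B - A)) \<subseteq>
      open_cone (\<lambda>S. q (v + ind_vec (A \<union> S))) (Pow (B - A))"
    using open_cone_image[of "(\<union>) A" "Pow (B - A)" "\<lambda>S. q (v + ind_vec S)"] by (auto simp: inj_on_def o_def)
  also have "\<dots> = open_cone (\<lambda>S. q (v + ind_vec A + ind_vec S)) (Pow (B - A))"
    unfolding open_cone_def by (simp only: add_ind_vec_Un cong: sum.cong)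
  finally show ?thesis
    unfolding set_interval_eq_image_Un[OF assms] .
qed

lemma model_pt_mem_grid:
  assumes "v \<in> int_points" "coord_sum v \<le> real k"
  shows "model_pt e s h v \<in> (\<lambda>(a, c, n). emb e s (\<i> ^ a * h n) (omega ^ c)) ` ({..<4} \<times> {..<6} \<times> {..k})"
proof -
  obtain i\<^sub>1 i\<^sub>2 i\<^sub>3 :: int where i: "v $ 1 = i\<^sub>1" "v $ 2 = i\<^sub>2" "v $ 3 = i\<^sub>3"
    using int_pointsE[OF assms(1)] .
  have "model_pt e s h v = emb e s (\<i> ^ nat (i\<^sub>3 mod 4) * h (nat \<lfloor>coord_sum v\<rfloor>))
      (omega ^ nat ((i\<^sub>1 - i\<^sub>2) mod 6))"
    unfolding model_pt_def i of_int_diff[symmetric] cis_pi2_int cis_pi3_int ..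
  moreover have "nat (i\<^sub>3 mod 4) < 4" "nat ((i\<^sub>1 - i\<^sub>2) mod 6) < 6"
    by (simp_all add: nat_less_iff)
  moreover have "nat \<lfloor>coord_sum v\<rfloor> \<le> k"
    using assms(2) by linarith
  ultimately show ?thesis
    by (intro image_eqI[where x = "(nat (i\<^sub>3 mod 4), nat ((i\<^sub>1 - i\<^sub>2) mod 6), nat \<lfloor>coord_sum v\<rfloor>)"]) auto
qed

context growing
begin

definition model :: "nat \<Rightarrow> (real^5) set set" where
  "model k = model_lab e s \<eta> ` torus_complex k"

lemma strip_cell_cube_config: "strip_cell k v I \<Longrightarrow> cube_config (corner v)"
  by (simp add: strip_cell_def model_cube_config)

lemma modelE:
  assumes "P \<in> model k"
  obtains "P = {}" | v I where "strip_cell k v I" "P = sph_hull (corner v ` Pow I)"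
  using assms unfolding model_def torus_complex_eq by (auto simp: model_lab_cell)

lemma model_cell: "strip_cell k v I \<Longrightarrow> sph_hull (corner v ` Pow I) \<in> model k"
  unfolding model_def using torus_complexI model_lab_cell by (metis imageI)

lemma model_empty: "{} \<in> model k"
  unfolding model_def using orbit_empty_in model_lab_empty by (metis imageI)

lemma open_interval_cone_unique:
  assumes cells: "strip_cell k v I" "strip_cell k' u J"
    and intervals: "A \<subseteq> B" "B \<subseteq> I" "A' \<subseteq> B'" "B' \<subseteq> J"
    and x: "x \<in> open_cone (corner v) {A..B}" "x \<in> open_cone (corner u) {A'..B'}"
  shows "B - A = B' - A' \<and> (\<exists>l\<in>Lam. u + ind_vec A' = l + (v + ind_vec A))"
proof -
  have face: "strip_cell k (v + ind_vec A) (B - A)" "strip_cell k' (u + ind_vec A') (B' - A')"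
    using cells intervals by (auto intro: strip_cell_face)
  obtain n n' where level: "coord_sum (v + ind_vec A) = real n" "coord_sum (u + ind_vec A') = real n'"
    using strip_cell_levelE[OF face(1)] strip_cell_levelE[OF face(2)] by metis
  show ?thesis
    using open_cell_unique[OF strip_cell_int_points[OF face(1)] level(1)
        strip_cell_int_points[OF face(2)] level(2)]
      open_cone_interval[OF intervals(1)] open_cone_interval[OF intervals(3)] x by blast
qed

lemma finite_model: "finite (model k)"
proof (rule finite_subset)
  let ?Q = "(\<lambda>(a, c, n). emb e s (\<i> ^ a * \<eta> n) (omega ^ c)) ` ({..<4} \<times> {..<6} \<times> {..k})"
  show "model k \<subseteq> insert {} (sph_hull ` Pow ?Q)"
  proof
    fix P assume "P \<in> model k"
    then show "P \<in> insert {} (sph_hull ` Pow ?Q)"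
    proof (cases rule: modelE)
      case (2 v I)
      have "corner v S \<in> ?Q" if "S \<in> Pow I" for S
        using strip_cell_corner[OF 2(1), of S] that by (intro model_pt_mem_grid) (auto simp: strip_cell_def)
      then have "corner v ` Pow I \<in> Pow ?Q"
        by blast
      then show ?thesis
        using 2(2) by blast
    qed simp
  qed
qed simp

lemma model_inter:
  assumes "P \<in> model k" "Q \<in> model k"
  shows "(P \<inter> Q) sph_face_of P"
  using assms(1)
proof (cases rule: modelE)
  case 1
  then show ?thesis by (auto simp: sph_face_of_def)
next
  case (2 v I)
  note v = 2 strip_cell_cube_config[OF 2(1)]
  show ?thesis
    using assms(2)
  proof (cases rule: modelE)
    case 1
    then show ?thesis
      unfolding 1 v(2) Int_empty_right cube_config_faces[OF v(3)]
      by (intro bexI[of _ "{}"]) (auto simp: empty_mem_subcubes)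
  next
    case (2 u J)
    show ?thesis
      unfolding 2(2) v(2)
    proof (rule cube_config_inter_face[OF v(3) strip_cell_cube_config[OF 2(1)]])
      fix A B A' B' x
      assume AB: "A \<subseteq> B" "B \<subseteq> I" "A' \<subseteq> B'" "B' \<subseteq> J"
        and x: "x \<in> open_cone (corner v) {A..B}" "x \<in> open_cone (corner u) {A'..B'}"
      obtain l where l: "B - A = B' - A'" "l \<in> Lam" "u + ind_vec A' = l + (v + ind_vec A)"
        using open_interval_cone_unique[OF v(1) 2(1) AB x] by blast
      show "corner v ` {A..B} = corner u ` {A'..B'}"
        unfolding corner_image_interval[OF AB(1)] corner_image_interval[OF AB(3)] l(1,3)
        using model_pt_Lam[OF l(2), of e s \<eta>] by (simp add: add.assoc)
    qed
  qed
qed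

lemma model_face:
  assumes "P \<in> model k" "F sph_face_of P"
  shows "F \<in> model k"
  using assms(1)
proof (cases rule: modelE)
  case 1
  then show ?thesis using assms(2) by (auto simp: sph_face_of_def model_empty)
next
  case (2 v I)
  then obtain W where W: "W \<in> subcubes I" "F = sph_hull (corner v ` W)"
    using assms(2) cube_config_faces[OF strip_cell_cube_config[OF 2(1)]] by blast
  from W(1) show ?thesis
  proof (cases rule: subcubesE)
    case 1
    then show ?thesis using W(2) model_empty by simp
  next
    case AB: (2 A B)
    show ?thesis
      unfolding W(2) AB(3) corner_image_interval[OF AB(1)]
      by (rule model_cell[OF strip_cell_face[OF 2(1) AB(1,2)]])
  qed
qed

lemma model_sph_polytope:
  assumes "P \<in> model k"
  shows "sph_polytope P"
  using assms
proof (cases rule: modelE)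
  case 1
  then show ?thesis using sph_polytope_sph_hull[of "{}"] by simp
next
  case (2 v I)
  then show ?thesis using cube_config_polytope strip_cell_cube_config by blast
qed

lemma model_polytopal: "polytopal_complex (model k)"
  unfolding polytopal_complex_def
proof (intro conjI ballI allI impI)
  show "(P \<inter> Q) sph_face_of Q" if "P \<in> model k" "Q \<in> model k" for P Q
    using model_inter[OF that(2,1)] by (simp add: Int_commute)
qed (use finite_model model_sph_polytope model_face model_inter in blast)+

lemma model_cubical: "cubical_complex (model k)"
  unfolding cubical_complex_def
proof (intro conjI ballI impI model_polytopal)
  fix P assume "P \<in> model k" "P \<noteq> {}"
  then show "sph_cube P"
    by (cases rule: modelE) (auto intro: cube_config_sph_cube strip_cell_cube_config)
qed

lemma corner_sum_ne_zero:
  assumes "strip_cell k v I"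
  shows "(\<Sum>S\<in>Pow I. corner v S) \<noteq> 0"
proof -
  obtain a where "\<forall>S. 0 < a \<bullet> corner v S"
    using cube_config_pointed[OF strip_cell_cube_config[OF assms]] by blast
  then have "0 < a \<bullet> (\<Sum>S\<in>Pow I. corner v S)"
    unfolding inner_sum_right by (intro sum_pos) auto
  then show ?thesis
    by auto
qed

text \<open>The barycentre of the smaller cell lies in exactly one open face of the larger one.\<close>

lemma orbit_le_if_model_lab_subset:
  assumes v: "strip_cell k v I" and u: "strip_cell k' u J"
    and subset: "model_lab e s \<eta> (orbit (cell v I)) \<subseteq> model_lab e s \<eta> (orbit (cell u J))"
  shows "orbit_le (orbit (cell v I)) (orbit (cell u J))"
proof -
  define x where "x = (\<Sum>S\<in>Pow I. corner v S)"
  have x: "x \<in> open_cone (corner v) (Pow I)" "x \<noteq> 0"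
    using sum_mem_open_cone corner_sum_ne_zero[OF v] unfolding x_def by blast+
  then have "x \<in> convex_cone hull (corner u ` Pow J)"
    using subset open_cone_subset normalised_mem_sph_hull_iff[OF x(2)] unfolding model_lab_cell by blast
  then obtain A B where AB: "A \<subseteq> B" "B \<subseteq> J" "x \<in> open_cone (corner u) {A..B}"
    using cube_config_open_cone[OF strip_cell_cube_config[OF u] _ x(2)] by blast
  have "x \<in> open_cone (corner v) {{}..I}"
    using x(1) by (simp add: atLeastAtMost_def atLeast_def atMost_def Pow_def)
  then obtain l where l: "I = B - A" "l \<in> Lam" "u + ind_vec A = l + v"
    using open_interval_cone_unique[OF v u _ _ AB(1,2) _ AB(3), of "{}" I] by auto
  have "v = - l + u + ind_vec A"
    using l(3) by (simp add: algebra_simps)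
  moreover have "A \<inter> I = {}" "A \<union> I \<subseteq> J"
    using l(1) AB by auto
  ultimately show ?thesis
    using orbit_le_cell_iff[OF strip_cell_int_points[OF v] strip_cell_int_points[OF u]]
        Lam_uminus[OF l(2)] by blast
qed

lemma model_lab_subset_if_orbit_le:
  assumes v: "strip_cell k v I" and u: "strip_cell k' u J"
    and le: "orbit_le (orbit (cell v I)) (orbit (cell u J))"
  shows "model_lab e s \<eta> (orbit (cell v I)) \<subseteq> model_lab e s \<eta> (orbit (cell u J))"
proof -
  obtain l A where A: "l \<in> Lam" "v = l + u + ind_vec A" "A \<inter> I = {}" "A \<union> I \<subseteq> J"
    using le orbit_le_cell_iff[OF strip_cell_int_points[OF v] strip_cell_int_points[OF u]] by blast
  have "corner v S = corner u (A \<union> S)" if "S \<subseteq> I" for S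
  proof -
    have "v + ind_vec S = l + (u + ind_vec (A \<union> S))"
      using A(2,3) that by (subst ind_vec_Un) (auto simp: add.assoc)
    then show ?thesis using model_pt_Lam[OF A(1)] by simp
  qed
  moreover have "A \<union> S \<in> Pow J" if "S \<subseteq> I" for S
    using A(4) that by blast
  ultimately have "corner v ` Pow I \<subseteq> corner u ` Pow J"
    by blast
  then show ?thesis
    unfolding model_lab_cell by (rule sph_hull_mono)
qed

lemma model_lab_cell_nonempty:
  assumes "strip_cell k v I"
  shows "model_lab e s \<eta> (orbit (cell v I)) \<noteq> {}"
  using sum_mem_open_cone open_cone_subset normalised_mem_sph_hull_iff[OF corner_sum_ne_zero[OF assms]]
  unfolding model_lab_cell by blast

lemma model_lab_subset_iff:
  assumes C: "C \<in> torus_complex k" and D: "D \<in> torus_complex k"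
  shows "model_lab e s \<eta> C \<subseteq> model_lab e s \<eta> D \<longleftrightarrow> orbit_le C D"
  using C
proof (cases rule: torus_complexE)
  case 1
  moreover have "\<exists>F. D = orbit F"
    using D by (auto simp: torus_complex_def)
  ultimately show ?thesis using orbit_le_empty by auto
next
  case v: (2 v I)
  from D show ?thesis
  proof (cases rule: torus_complexE)
    case 1
    then show ?thesis using v model_lab_cell_nonempty not_orbit_le_empty by auto
  next
    case (2 u J)
    then show ?thesis using v orbit_le_if_model_lab_subset model_lab_subset_if_orbit_le by blast
  qed
qed

lemma model_is_cct: "is_cct k (model k) (model_lab e s \<eta>)"
proof -
  have "inj_on (model_lab e s \<eta>) (torus_complex k)"
  proof (rule inj_onI)
    fix C D assume C: "C \<in> torus_complex k" and D: "D \<in> torus_complex k"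
      and "model_lab e s \<eta> C = model_lab e s \<eta> D"
    then show "C = D"
      using model_lab_subset_iff[OF C D] model_lab_subset_iff[OF D C] orbit_le_antisym[OF C D] by simp
  qed
  then have "bij_betw (model_lab e s \<eta>) (torus_complex k) (model k)"
    by (simp add: bij_betw_def model_def)
  then show ?thesis
    unfolding is_cct_def using model_cubical model_lab_subset_iff by blast
qed

end

section \<open>Symmetry of the model\<close>

lemma r12_isometry: "linear r12" "norm (r12 x) = norm x" "r12 (emb e s z u) = emb e s (\<i> * z) u"
proof -
  show "linear r12"
    unfolding linear_iff r12_def rot_def by (simp add: vec_eq_iff)
  have "r12 x \<bullet> r12 x = x \<bullet> x"
    by (simp add: r12_def rot_def inner_vec_def sum_5)
  then show "norm (r12 x) = norm x" by (simp add: norm_eq_sqrt_inner)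
  show "r12 (emb e s z u) = emb e s (\<i> * z) u"
    by (simp add: r12_def rot_def vec_eq_iff forall_5 algebra_simps)
qed

lemma r34_isometry: "linear r34" "norm (r34 x) = norm x" "r34 (emb e s z u) = emb e s z (omega * u)"
proof -
  show "linear r34"
    unfolding linear_iff r34_def rot_def by (simp add: vec_eq_iff algebra_simps)
  have s: "sqrt 3 * sqrt 3 = (3::real)" "sqrt 3 * (sqrt 3 * t) = 3 * t" for t
    by (simp_all add: mult.assoc[symmetric])
  have "r34 x \<bullet> r34 x = x \<bullet> x"
    by (simp add: r34_def rot_def inner_vec_def sum_5 cos_60 sin_60 algebra_simps s)
  then show "norm (r34 x) = norm x" by (simp add: norm_eq_sqrt_inner)
  show "r34 (emb e s z u) = emb e s z (omega * u)"
    by (simp add: r34_def rot_def vec_eq_iff forall_5 omega_Complex cos_60 sin_60 algebra_simps)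
qed

lemma refl4_isometry: "linear refl4" "norm (refl4 x) = norm x" "refl4 (emb e s z u) = emb e s z (cnj u)"
proof -
  show "linear refl4"
    unfolding linear_iff refl4_def by (simp add: vec_eq_iff)
  have "refl4 x \<bullet> refl4 x = x \<bullet> x"
    by (simp add: refl4_def inner_vec_def sum_5)
  then show "norm (refl4 x) = norm x" by (simp add: norm_eq_sqrt_inner)
  show "refl4 (emb e s z u) = emb e s z (cnj u)"
    by (simp add: refl4_def vec_eq_iff forall_5)
qed

lemma r34_r34_isometry: "linear (r34 \<circ> r34)" "norm ((r34 \<circ> r34) x) = norm x"
  by (simp_all add: linear_compose r34_isometry)

lemma r34_r12_isometry: "linear (r34 \<circ> r12)" "norm ((r34 \<circ> r12) x) = norm x"
  by (simp_all add: linear_compose r34_isometry r12_isometry)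

lemma r34_r34_model_pt: "(r34 \<circ> r34) (model_pt e s h v) = model_pt e s h (vector [1, -1, 0] + v)"
proof -
  have "omega * (omega * u_phase v) = cis
      (pi / 3 * ((vector [1, -1, 0] + v) $ 1 - (vector [1, -1, 0] + v) $ 2))"
    unfolding omega_def cis_mult by (rule arg_cong[of _ _ cis]) (simp add: field_simps)
  moreover have "coord_sum (vector [1, -1, 0] + v) = coord_sum v"
    by (simp add: coord_sum_def)
  ultimately show ?thesis
    by (simp add: model_pt_def r34_isometry(3))
qed

lemma r34_r12_model_pt: "(r34 \<circ> r12) (model_pt e s h v) = model_pt e s h (vector [0, -1, 1] + v)"
proof -
  have "omega * u_phase v = cis (pi / 3 * ((vector [0, -1, 1] + v) $ 1 - (vector [0, -1, 1] + v) $ 2))"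
    unfolding omega_def cis_mult by (rule arg_cong[of _ _ cis]) (simp add: field_simps)
  moreover have "\<i> * z_phase v = cis (pi / 2 * (vector [0, -1, 1] + v) $ 3)"
    unfolding cis_pi_half[symmetric] cis_mult by (simp add: algebra_simps)
  moreover have "coord_sum (vector [0, -1, 1] + v) = coord_sum v"
    by (simp add: coord_sum_def)
  ultimately show ?thesis
    by (simp add: model_pt_def r34_isometry(3) r12_isometry(3) mult.assoc[symmetric])
qed

lemma swap12_nth [simp]: "swap12 v $ 1 = v $ 2" "swap12 v $ 2 = v $ 1" "swap12 v $ 3 = v $ 3"
  by (simp_all add: swap12_def)

lemma refl4_model_pt: "refl4 (model_pt e s h v) = model_pt e s h (swap12 v)"
proof -
  have "cnj (u_phase v) = cis (pi / 3 * (swap12 v $ 1 - swap12 v $ 2))"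
    by (simp add: cis_cnj algebra_simps)
  moreover have "coord_sum (swap12 v) = coord_sum v"
    by (simp add: coord_sum_def)
  ultimately show ?thesis
    by (simp add: model_pt_def refl4_isometry(3))
qed

definition swap_index :: "3 \<Rightarrow> 3" where "swap_index i = (if i = 1 then 2 else if i = 2 then 1 else 3)"

lemma swap_index_involution [simp]: "swap_index (swap_index i) = i"
  using exhaust_3[of i] by (auto simp: swap_index_def)

lemma mem_swap_index_image: "1 \<in> swap_index ` S \<longleftrightarrow> 2 \<in> S" "2 \<in> swap_index ` S \<longleftrightarrow> 1 \<in> S"
    "3 \<in> swap_index ` S \<longleftrightarrow> 3 \<in> S"
proof -
  have "i \<in> swap_index ` S \<longleftrightarrow> swap_index i \<in> S" for i
    by (metis image_iff swap_index_involution)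
  then show "1 \<in> swap_index ` S \<longleftrightarrow> 2 \<in> S" "2 \<in> swap_index ` S \<longleftrightarrow> 1 \<in> S" "3 \<in> swap_index ` S \<longleftrightarrow> 3 \<in> S"
    by (simp_all add: swap_index_def)
qed

lemma swap_index_image_image: "swap_index ` swap_index ` S = S"
  by (simp add: set_eq_iff forall_3 mem_swap_index_image)

lemma card_swap_index_image: "card (swap_index ` S) = card S"
proof (rule card_image)
  show "inj_on swap_index S"
    by (rule inj_on_inverseI[of _ swap_index]) simp
qed

lemma linear_swap12: "linear swap12"
  by (rule linearI) (simp_all add: vec_eq_iff forall_3)

lemma swap12_add: "swap12 (u + v) = swap12 u + swap12 v"
  by (rule linear_add[OF linear_swap12])

lemma swap12_ind_vec: "swap12 (ind_vec S) = ind_vec (swap_index ` S)"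
  by (simp add: vec_eq_iff forall_3 mem_swap_index_image)

lemma swap12_swap12 [simp]: "swap12 (swap12 v) = v"
  by (simp add: vec_eq_iff forall_3)

lemma inj_swap12: "inj swap12"
  by (rule inj_on_inverseI[of _ swap12]) simp

lemma swap12_cell: "swap12 ` cell v I = cell (swap12 v) (swap_index ` I)"
proof -
  have "swap12 x \<in> cell v I \<longleftrightarrow> x \<in> cell (swap12 v) (swap_index ` I)" for x
    by (auto simp: cell_def mem_box_cart forall_3 mem_swap_index_image)
  moreover have "x \<in> swap12 ` cell v I \<longleftrightarrow> swap12 x \<in> cell v I" for x
    by (metis image_iff swap12_swap12)
  ultimately show ?thesis by blast
qed

lemma swap12_Lam:
  assumes "l \<in> Lam"
  shows "swap12 l \<in> Lam"
proof -
  obtain a b :: int where "l $ 1 = 3 * of_int a - 2 * of_int b"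
      "l $ 2 = - 3 * of_int a - 2 * of_int b" "l $ 3 = 4 * of_int b"
    using assms by (rule LamE)
  then show ?thesis
    unfolding Lam_iff by (intro exI[of _ "- a"] exI[of _ b]) simp
qed

lemma induced_swap12: "induced swap12 (orbit (cell v I)) = orbit (cell (swap12 v) (swap_index ` I))"
proof -
  have "induced swap12 (orbit (cell v I)) = {cell (swap12 l + swap12 v) (swap_index ` I) | l. l \<in> Lam}"
    unfolding induced_def orbit_cell using swap12_cell swap12_add by (auto simp: image_iff) metis
  also have "\<dots> = {cell (l + swap12 v) (swap_index ` I) | l. l \<in> Lam}"
    using swap12_Lam swap12_swap12 by (metis (no_types, lifting))
  finally show ?thesis by (simp add: orbit_cell)
qed

lemma induced_empty: "induced f (orbit {}) = orbit {}"
  by (simp add: induced_def orbit_empty)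

lemma strip_cell_swap: "strip_cell K (swap12 v) (swap_index ` I) \<longleftrightarrow> strip_cell K v I"
  by (auto simp: strip_cell_def int_points_def forall_3 coord_sum_def card_swap_index_image)

lemma induced_image_torus_complex:
  assumes induced: "\<And>v I. induced f (orbit (cell v I)) = orbit (cell (f v) (p I))"
    and strip: "\<And>v I. strip_cell k (f v) (p I) \<longleftrightarrow> strip_cell k v I"
    and surj: "\<And>v. \<exists>u. f u = v" "\<And>I. \<exists>J. p J = I"
  shows "induced f ` torus_complex k = torus_complex k"
proof (intro equalityI image_subsetI subsetI)
  fix C assume "C \<in> torus_complex k"
  then show "induced f C \<in> torus_complex k"
    by (cases rule: torus_complexE) (simp_all add: induced_empty orbit_empty_in induced torus_complexI strip)
next
  fix C assume "C \<in> torus_complex k"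
  then show "C \<in> induced f ` torus_complex k"
  proof (cases rule: torus_complexE)
    case 1
    then show ?thesis using induced_empty orbit_empty_in by (metis imageI)
  next
    case (2 v I)
    obtain u J where "f u = v" "p J = I"
      using surj by metis
    then show ?thesis
      using 2 induced[of u J] strip[of u J] torus_complexI[of k u J] by (metis imageI)
  qed
qed

lemma torus_translate:
  assumes "t \<in> int_points" "coord_sum t = 0"
  shows "induced ((+) t) ` torus_complex k = torus_complex k"
proof (rule induced_image_torus_complex[where p = "\<lambda>I. I"])
  show "\<exists>u. t + u = v" for v
    by (rule exI[of _ "v - t"]) simp
qed (simp_all add: induced_translate_cell strip_cell_translate[OF assms])

lemma torus_swap: "induced swap12 ` torus_complex k = torus_complex k"
proof (rule induced_image_torus_complex)
  show "\<exists>u. swap12 u = v" "\<exists>J. swap_index ` J = I" for v I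
    by (metis swap12_swap12) (metis swap_index_image_image)
qed (simp_all add: induced_swap12 strip_cell_swap)

lemma model_lab_equivariant:
  assumes g: "linear g" "\<And>x. norm (g x) = norm x" "\<And>v. g (model_pt e s h v) = model_pt e s h (f v)"
    and f: "surj f" "\<And>v F. {f v} face_of f ` F \<longleftrightarrow> {v} face_of F"
  shows "g ` model_lab e s h C = model_lab e s h (induced f C)"
proof -
  have "{v. \<exists>F\<in>induced f C. {v} face_of F} = f ` {v. \<exists>F\<in>C. {v} face_of F}"
  proof (intro set_eqI)
    fix v
    obtain u where "v = f u"
      using f(1) by (rule surjE)
    then show "v \<in> {v. \<exists>F\<in>induced f C. {v} face_of F} \<longleftrightarrow> v \<in> f ` {v. \<exists>F\<in>C. {v} face_of F}"
      unfolding induced_def using f(2) by auto metis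
  qed
  then show ?thesis
    unfolding model_lab_def sph_hull_isometry[OF g(1,2)] by (simp add: image_image g(3))
qed

lemma corresponds_model_lab:
  assumes "induced f ` torus_complex k = torus_complex k"
    and equivariant: "\<And>C. g ` model_lab e s h C = model_lab e s h (induced f C)"
  shows "corresponds k (model_lab e s h ` torus_complex k) (model_lab e s h) g f"
proof -
  have "(\<lambda>P. g ` P) ` model_lab e s h ` torus_complex k = model_lab e s h ` induced f ` torus_complex k"
    by (simp add: image_image equivariant)
  then show ?thesis
    unfolding corresponds_def assms(1) by (simp add: equivariant)
qed

lemma corresponds_translate:
  assumes g: "linear g" "\<And>x. norm (g x) = norm x" "\<And>v. g (model_pt e s h v) = model_pt e s h (t + v)"
    and t: "t \<in> int_points" "coord_sum t = 0"
  shows "corresponds k (model_lab e s h ` torus_complex k) (model_lab e s h) g ((+) t)"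
proof (rule corresponds_model_lab[OF torus_translate[OF t] model_lab_equivariant[OF g]])
  show "{t + v} face_of (+) t ` F \<longleftrightarrow> {v} face_of F" for v F
    using face_of_translation_eq[of t "{v}" F] by simp
qed simp

lemma corresponds_swap: "corresponds k (model_lab e s h ` torus_complex k) (model_lab e s h) refl4 swap12"
proof (rule corresponds_model_lab[OF torus_swap model_lab_equivariant[OF refl4_isometry(1,2) refl4_model_pt]])
  show "surj swap12"
    by (metis surjI swap12_swap12)
  show "{swap12 v} face_of swap12 ` F \<longleftrightarrow> {v} face_of F" for v F
    using face_of_linear_image[OF linear_swap12 inj_swap12, of "{v}" F] by simp
qed

lemma translation_vectors: "vector [1, -1, 0] \<in> int_points" "coord_sum (vector [1, -1, 0]) = 0"
   "vector [0, -1, 1] \<in> int_points" "coord_sum (vector [0, -1, 1]) = 0"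
  by (auto simp: int_points_def forall_3 coord_sum_def)

lemma (in growing) model_symmetric: "symmetric_cct k (model k) (model_lab e s \<eta>)"
  unfolding symmetric_cct_def
proof (intro conjI model_is_cct; unfold model_def)
  show "corresponds k (model_lab e s \<eta> ` torus_complex k) (model_lab e s \<eta>) refl4 swap12"
    by (rule corresponds_swap)
qed (rule corresponds_translate r34_r34_isometry r34_r34_model_pt r34_r12_isometry
    r34_r12_model_pt translation_vectors)+

lemma symmetric_cct_cong:
  assumes symmetric: "symmetric_cct k T \<phi>" and eq: "\<And>C. C \<in> torus_complex k \<Longrightarrow> \<phi>' C = \<phi> C"
  shows "symmetric_cct k T \<phi>'"
proof -
  have corresponds: "corresponds k T \<phi>' g f" if "corresponds k T \<phi> g f"
      "induced f ` torus_complex k = torus_complex k" for g f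
    using that eq unfolding corresponds_def by (metis imageI)
  have "is_cct k T \<phi>'"
    using symmetric eq unfolding symmetric_cct_def is_cct_def by (metis bij_betw_cong)
  moreover have "corresponds k T \<phi> refl4 swap12" "corresponds k T \<phi> (r34 \<circ> r34) ((+) (vector [1, -1, 0]))"
    "corresponds k T \<phi> (r34 \<circ> r12) ((+) (vector [0, -1, 1]))"
    using symmetric unfolding symmetric_cct_def by blast+
  ultimately show ?thesis
    unfolding symmetric_cct_def
    by (intro conjI corresponds torus_swap torus_translate translation_vectors)
qed

section \<open>Restriction to consecutive layers\<close>

lemma not_sph_face_of_empty: "\<not> {x} sph_face_of {}"
  by (auto simp: sph_face_of_def)

lemma strip_cell_shift: "strip_cell (j + m) (axis_pt j + v) I \<and> real j \<le> coord_sum (axis_pt j + v) \<longleftrightarrow>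
    strip_cell m v I"
proof -
  have "axis_pt j + v \<in> int_points \<longleftrightarrow> v \<in> int_points"
    using int_points_add[OF int_points_axis_pt, of v j]
        int_points_add[OF int_points_uminus[OF int_points_axis_pt[of j]], of "axis_pt j + v"]
    by auto
  then show ?thesis
    by (auto simp: strip_cell_def coord_sum_axis_pt)
qed

context growing
begin

definition model_vertex :: "real^3 \<Rightarrow> real^5" where
  "model_vertex v = model_pt e s \<eta> v /\<^sub>R norm (model_pt e s \<eta> v)"

lemma model_pt_nonzero: "v \<in> int_points \<Longrightarrow> 0 \<le> coord_sum v \<Longrightarrow> model_pt e s \<eta> v \<noteq> 0"
  using cube_config_nonzero[OF model_cube_config, of v "{}"] by simp

lemma sph_hull_model_pt: "v \<in> int_points \<Longrightarrow> 0 \<le> coord_sum v \<Longrightarrow> sph_hull {model_pt e s \<eta> v} = {model_vertex v}"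
  unfolding model_vertex_def by (rule sph_hull_singleton[OF model_pt_nonzero])

lemma model_lab_vertex: "v \<in> int_points \<Longrightarrow> 0 \<le> coord_sum v \<Longrightarrow> model_lab e s \<eta> (orbit {v}) = {model_vertex v}"
  using model_lab_cell[of e s \<eta> v "{}"] sph_hull_model_pt by simp

lemma model_vertex_eqD:
  assumes v: "v \<in> int_points" "0 \<le> coord_sum v" and u: "u \<in> int_points" "0 \<le> coord_sum u"
    and eq: "model_vertex v = model_vertex u"
  shows "\<exists>l\<in>Lam. u = l + v"
proof -
  have "model_vertex v \<in> open_cone (corner v) (Pow {})" if "v \<in> int_points" "0 \<le> coord_sum v" for v
  proof -
    have "model_pt e s \<eta> v \<in> open_cone (corner v) (Pow {})"
      using sum_mem_open_cone[of "corner v" "Pow {}"] by simp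
    then show ?thesis
      unfolding model_vertex_def using model_pt_nonzero[OF that] by (intro open_cone_scale) auto
  qed
  then show ?thesis
    using open_cell_unique[OF v(1) int_points_coord_sum_nat[OF v] u(1) int_points_coord_sum_nat[OF u]]
        v u eq by metis
qed

lemma model_vertex_layer_iff:
  assumes "v \<in> int_points" "0 \<le> coord_sum v"
  shows "model_vertex v \<in> layer (model_lab e s \<eta>) l \<longleftrightarrow> coord_sum v = real l"
proof
  assume "model_vertex v \<in> layer (model_lab e s \<eta>) l"
  then obtain u where u: "u \<in> int_points" "coord_sum u = real l" "model_vertex v = model_vertex u"
    using model_lab_vertex by (auto simp: layer_def)
  then show "coord_sum v = real l"
    using model_vertex_eqD[OF assms u(1) _ u(3)] coord_sum_Lam by auto
next
  assume "coord_sum v = real l"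
  then show "model_vertex v \<in> layer (model_lab e s \<eta>) l"
    using assms model_lab_vertex unfolding layer_def by blast
qed

lemma cell_vertex_face:
  assumes "strip_cell k v I"
  shows "{x} sph_face_of sph_hull (corner v ` Pow I) \<longleftrightarrow> (\<exists>S\<subseteq>I. x = model_vertex (v + ind_vec S))"
proof -
  note config = strip_cell_cube_config[OF assms]
  have vertex: "sph_hull (corner v ` {S}) = {model_vertex (v + ind_vec S)}" for S
    using sph_hull_singleton[OF cube_config_nonzero[OF config, of S]] by (simp add: model_vertex_def)
  show ?thesis
  proof
    assume "{x} sph_face_of sph_hull (corner v ` Pow I)"
    then obtain W where W: "W \<in> subcubes I" "{x} = sph_hull (corner v ` W)"
      using cube_config_faces[OF config] by blast
    then obtain S where S: "S \<in> W"
      by fastforce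
    then have "sph_hull (corner v ` {S}) \<subseteq> {x}"
      unfolding W(2) by (intro sph_hull_mono) auto
    then show "\<exists>S\<subseteq>I. x = model_vertex (v + ind_vec S)"
      using S subcubes_Pow[OF W(1)] vertex by blast
  next
    assume "\<exists>S\<subseteq>I. x = model_vertex (v + ind_vec S)"
    then obtain S where S: "S \<subseteq> I" "x = model_vertex (v + ind_vec S)" by blast
    have "{S} \<in> subcubes I"
      using interval_mem_subcubes[OF _ S(1), of S] by simp
    then show "{x} sph_face_of sph_hull (corner v ` Pow I)"
      unfolding cube_config_faces[OF config] S(2) using vertex by blast
  qed
qed

lemma cell_vertices_in_layers_iff:
  assumes "strip_cell k v I"
  shows "(\<forall>x. {x} sph_face_of sph_hull (corner v ` Pow I) \<longrightarrow> x \<in> (\<Union>l\<in>{j..m}. layer (model_lab e s \<eta>) l)) \<longleftrightarrow>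
    strip_cell m v I \<and> real j \<le> coord_sum v" (is "?L \<longleftrightarrow> ?R")
proof -
  have layers: "model_vertex (v + ind_vec S) \<in> (\<Union>l\<in>{j..m}. layer (model_lab e s \<eta>) l) \<longleftrightarrow>
      real j \<le> coord_sum v + card S \<and> coord_sum v + card S \<le> real m" for S
  proof -
    have "v + ind_vec S \<in> int_points" "0 \<le> coord_sum (v + ind_vec S)"
      using assms by (auto simp: strip_cell_def int_points_add int_points_ind_vec)
    moreover obtain n where "coord_sum v = real n"
      using assms by (rule strip_cell_levelE)
    ultimately show ?thesis
      using model_vertex_layer_iff[of "v + ind_vec S"] by (auto simp flip: of_nat_add)
  qed
  show ?thesis
  proof
    assume ?L
    then have "model_vertex (v + ind_vec S) \<in> (\<Union>l\<in>{j..m}. layer (model_lab e s \<eta>) l)" if "S \<subseteq> I" for S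
      using that cell_vertex_face[OF assms] by blast
    from this[of "{}"] this[of I] show ?R
      unfolding layers using assms by (simp add: strip_cell_def)
  next
    assume R: ?R
    have "real j \<le> coord_sum v + card S \<and> coord_sum v + card S \<le> real m" if "S \<subseteq> I" for S
    proof -
      have "card S \<le> card I"
        using that by (simp add: card_mono)
      then show ?thesis
        using R unfolding strip_cell_def by linarith
    qed
    then show ?L
      unfolding cell_vertex_face[OF assms] using layers by blast
  qed
qed

lemma restr_model:
  assumes "m \<le> k"
  shows "restr (model k) (model_lab e s \<eta>) {j..m} =
    insert {} {sph_hull (corner v ` Pow I) | v I. strip_cell m v I \<and> real j \<le> coord_sum v}" (is "?L = ?R")
proof (intro equalityI subsetI)
  fix P assume "P \<in> ?L"
  then have P: "P \<in> model k" "\<forall>x. {x} sph_face_of P \<longrightarrow> x \<in> (\<Union>l\<in>{j..m}. layer (model_lab e s \<eta>) l)"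
    by (auto simp: restr_def induced_subcomplex_def)
  from P(1) show "P \<in> ?R"
  proof (cases rule: modelE)
    case (2 v I)
    then have "strip_cell m v I \<and> real j \<le> coord_sum v"
      using P(2) cell_vertices_in_layers_iff[OF 2(1)] by simp
    then show ?thesis using 2(2) by blast
  qed simp
next
  fix P assume "P \<in> ?R"
  then consider "P = {}" | v I where "strip_cell m v I" "real j \<le> coord_sum v" "P = sph_hull (corner v ` Pow I)"
    by blast
  then show "P \<in> ?L"
  proof cases
    case 1
    then show ?thesis
      using model_empty not_sph_face_of_empty by (simp add: restr_def induced_subcomplex_def)
  next
    case (2 v I)
    then have "strip_cell k v I"
      using assms by (simp add: strip_cell_def)
    then show ?thesis
      using model_cell cell_vertices_in_layers_iff 2 by (simp add: restr_def induced_subcomplex_def)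
  qed
qed

lemma model_pt_shift:
  assumes "0 \<le> coord_sum v"
  shows "model_pt (cis (pi / 2 * real j) * e) s (eta (\<lambda>n. w (n + j))) v = model_pt e s \<eta> (axis_pt j + v)"
proof -
  have "nat \<lfloor>coord_sum (axis_pt j + v)\<rfloor> = nat \<lfloor>coord_sum v\<rfloor> + j"
  proof -
    have "coord_sum (axis_pt j + v) = coord_sum v + of_int (int j)"
      by (simp add: coord_sum_def)
    then show ?thesis using assms by (simp only: floor_add_int[symmetric]) (simp add: nat_add_distrib)
  qed
  moreover have "emb (cis (pi / 2 * real j) * e) s z u = emb e s (cis (pi / 2 * real j) * z) u" for z u
  proof -
    have "cis (pi / 2 * real j) * e * z = e * (cis (pi / 2 * real j) * z)" by (simp only: mult_ac)
    then show ?thesis by (simp only: emb_def)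
  qed
  moreover have "cis (pi / 2 * real j) * z_phase v = cis (pi / 2 * (axis_pt j + v) $ 3)"
    unfolding cis_mult by (simp add: algebra_simps)
  moreover have "eta (\<lambda>n. w (n + j)) n = \<eta> (n + j)" for n
    by (simp add: eta_def)
  ultimately show ?thesis
    by (simp add: model_pt_def mult.assoc[symmetric])
qed

lemma model_lab_shift:
  assumes "C \<in> torus_complex m"
  shows "shift_lab j (model_lab e s \<eta>) C = model_lab (cis (pi / 2 * real j) * e) s (eta (\<lambda>n. w (n + j))) C"
  using assms
proof (cases rule: torus_complexE)
  case 1
  then show ?thesis by (simp add: shift_lab_def induced_empty)
next
  case (2 v I)
  have "model_pt (cis (pi / 2 * real j) * e) s (eta (\<lambda>n. w (n + j))) (v + ind_vec S) =
      model_pt e s \<eta> (axis_pt j + v + ind_vec S)" for S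
    using model_pt_shift[of "v + ind_vec S" j] 2(1) by (simp add: strip_cell_def add.assoc)
  then show ?thesis
    unfolding shift_lab_def 2(2) induced_translate_cell model_lab_cell by simp
qed

lemma restr_shift:
  assumes "j + m \<le> k"
  shows "restr (model k) (model_lab e s \<eta>) {j..j + m} =
    model_lab (cis (pi / 2 * real j) * e) s (eta (\<lambda>n. w (n + j))) ` torus_complex m" (is "_ = ?lab ` _")
proof -
  have shift: "(\<exists>v. Q v) \<longleftrightarrow> (\<exists>v. Q (axis_pt j + v))" for Q :: "real^3 \<Rightarrow> bool"
    by (metis add_minus_cancel)
  have "P \<in> restr (model k) (model_lab e s \<eta>) {j..j + m} \<longleftrightarrow> P \<in> ?lab ` torus_complex m" for P
  proof -
    have "P \<in> restr (model k) (model_lab e s \<eta>) {j..j + m} \<longleftrightarrow>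
        P = {} \<or> (\<exists>v I. P = sph_hull (corner v ` Pow I) \<and> strip_cell (j + m) v I \<and> real j \<le> coord_sum v)"
      unfolding restr_model[OF assms] by blast
    also have "\<dots> \<longleftrightarrow> P = {} \<or> (\<exists>v I. P = sph_hull (corner (axis_pt j + v) ` Pow I) \<and> strip_cell m v I)"
      unfolding shift[of "\<lambda>v. \<exists>I. P = sph_hull (corner v ` Pow I) \<and>
          strip_cell (j + m) v I \<and> real j \<le> coord_sum v"]
        strip_cell_shift ..
    also have "\<dots> \<longleftrightarrow> P = {} \<or> (\<exists>v I. P = ?lab (orbit (cell v I)) \<and> strip_cell m v I)"
      using model_lab_shift[OF torus_complexI] by (metis shift_lab_def induced_translate_cell model_lab_cell)
    also have "\<dots> \<longleftrightarrow> P \<in> ?lab ` torus_complex m"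
      unfolding torus_complex_eq image_insert model_lab_empty by blast
    finally show ?thesis .
  qed
  then show ?thesis
    by blast
qed

end

section \<open>Transversality\<close>

context frame
begin

lemma part12_emb: "part12 (emb e s z u) = emb e s z 0"
  by (simp add: part12_def vec_eq_iff forall_5)

lemma part34_emb: "part34 (emb e s z u) = emb e s 0 u"
  by (simp add: part34_def vec_eq_iff forall_5)

lemma norm_emb_z: "norm (emb e s z 0) = norm z" and norm_emb_u: "norm (emb e s 0 u) = norm u"
  by (simp_all add: emb_norm)

lemma proj1_emb: "proj1 (emb e s z u) = emb e s (z /\<^sub>R (sqrt 2 * norm z)) (u /\<^sub>R (sqrt 2 * norm u))"
  unfolding proj1_def part12_emb part34_emb norm_emb_z norm_emb_u emb_scale emb_add by simp

lemma proj1_eqE: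
  assumes "proj1 (emb e s z u) = proj1 (emb e s z' u')" "z \<noteq> 0" "z' \<noteq> 0" "u \<noteq> 0" "u' \<noteq> 0"
  obtains a b where "0 < a" "0 < b" "z = a *\<^sub>R z'" "u = b *\<^sub>R u'"
proof -
  have "z /\<^sub>R (sqrt 2 * norm z) = z' /\<^sub>R (sqrt 2 * norm z')"
      "u /\<^sub>R (sqrt 2 * norm u) = u' /\<^sub>R (sqrt 2 * norm u')"
    using assms(1) unfolding proj1_emb emb_eq_iff by auto
  moreover have "x = (c / c') *\<^sub>R y" if "x /\<^sub>R c = y /\<^sub>R c'" "c \<noteq> 0" for x y :: complex and c c' :: real
  proof -
    have "x = c *\<^sub>R (x /\<^sub>R c)" using that(2) by simp
    also have "\<dots> = (c / c') *\<^sub>R y" unfolding that(1) by (simp add: divide_inverse)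
    finally show ?thesis .
  qed
  ultimately have "z = ((sqrt 2 * norm z) / (sqrt 2 * norm z')) *\<^sub>R z'"
      "u = ((sqrt 2 * norm u) / (sqrt 2 * norm u')) *\<^sub>R u'"
    using assms(2,4) by (metis mult_eq_0_iff norm_eq_zero real_sqrt_eq_zero_cancel_iff zero_neq_numeral)+
  moreover have "0 < (sqrt 2 * norm z) / (sqrt 2 * norm z')" "0 < (sqrt 2 * norm u) / (sqrt 2 * norm u')"
    using assms(2-5) by simp_all
  ultimately show ?thesis using that by blast
qed

lemma proj1_emb_scale: "0 < a \<Longrightarrow> 0 < b \<Longrightarrow> proj1 (emb e s (a *\<^sub>R z) (b *\<^sub>R u)) = proj1 (emb e s z u)"
  unfolding proj1_emb by (simp add: field_simps)

lemma emb_S3eq_iff: "emb e s z u \<in> S3eq \<longleftrightarrow> (norm z)\<^sup>2 + (norm u)\<^sup>2 = 1"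
  by (simp add: S3eq_def emb_norm)

lemma emb_coords: "(emb e s z u $ 1)\<^sup>2 + (emb e s z u $ 2)\<^sup>2 = (norm z)\<^sup>2"
  "(emb e s z u $ 3)\<^sup>2 + (emb e s z u $ 4)\<^sup>2 = (norm u)\<^sup>2"
proof -
  have "(emb e s z u $ 1)\<^sup>2 + (emb e s z u $ 2)\<^sup>2 = (norm (e * z))\<^sup>2"
    by (simp add: cmod_power2)
  then show "(emb e s z u $ 1)\<^sup>2 + (emb e s z u $ 2)\<^sup>2 = (norm z)\<^sup>2"
    by (simp add: norm_mult norm_e)
  have "(emb e s z u $ 3)\<^sup>2 + (emb e s z u $ 4)\<^sup>2 = (s * s) * (norm u)\<^sup>2"
    by (simp add: cmod_power2 power_mult_distrib power2_eq_square[of s] distrib_left)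
  then show "(emb e s z u $ 3)\<^sup>2 + (emb e s z u $ 4)\<^sup>2 = (norm u)\<^sup>2"
    by (simp add: s_square)
qed

lemma emb_Clif_iff:
  assumes "emb e s z u \<in> S3eq"
  shows "emb e s z u \<in> Clif 0 \<longleftrightarrow> u = 0" "emb e s z u \<in> Clif 2 \<longleftrightarrow> z = 0"
  using assms unfolding Clif_def mem_Collect_eq emb_coords by (auto simp: emb_S3eq_iff)

end

context growing_seq
begin

lemma slab_right_bottom:
  "slab_right n a c z = excess n * (Im z - slab_bottom n a c) -
      excess (n + 1) * (Re z - (w n * a + w (n + 1) * c))"
  by (simp add: slab_right_def slab_bottom_def eval_nat_numeral algebra_simps add_divide_distrib)

lemma slab_left_bottom:
  "slab_left n a c z = excess (n + 1) * (Re z + (w (n + 2) * a + w (n + 3) * c)) +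
      excess (n + 2) * (Im z - slab_bottom n a c)"
  by (simp add: slab_left_def slab_bottom_def eval_nat_numeral algebra_simps add_divide_distrib)

lemma slab_bottom_right_corner:
  assumes "slab_right n a c z = 0" "Im z = slab_bottom n a c"
  shows "Re z = w n * a + w (n + 1) * c"
proof -
  have "excess (n + 1) * (Re z - (w n * a + w (n + 1) * c)) = 0"
    using assms unfolding slab_right_bottom by simp
  then show ?thesis
    using excess_pos[of "n + 1"] by (simp only: mult_eq_0_iff) simp
qed

lemma slab_bottom_pos:
  assumes "0 \<le> a" "0 \<le> c" "0 < a + c"
  shows "0 < slab_bottom n a c"
  unfolding slab_bottom_def using assms w_pos[of "n + 1"] w_pos[of "n + 2"]
  by (cases "a = 0") (auto intro: add_pos_nonneg add_nonneg_pos)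

lemma slab_bottom_le_top:
  assumes "0 \<le> a"
  shows "slab_bottom n a c \<le> slab_top n a c"
  unfolding slab_bottom_def slab_top_def
  using mult_right_mono[OF w_mono[of "n + 1" "n + 3"] assms] by simp

text \<open>A section of the union of the cells between layers 0 and 2 is a polygon, star-shaped about
  the origin; \<open>rim\<close> describes the two of its eight sides that belong to one cube.\<close>

definition rim :: "real \<Rightarrow> real \<Rightarrow> complex \<Rightarrow> bool" where
  "rim a c z \<longleftrightarrow> slab_bottom 0 a c \<le> Im z \<and> Im z \<le> slab_top 0 a c \<and>
      0 \<le> slab_right 0 a c z \<and> 0 < slab_left 0 a c z \<and>
     (Im z = slab_bottom 0 a c \<or> slab_right 0 a c z = 0)"

definition rim_corner :: "real \<Rightarrow> real \<Rightarrow> complex" where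
  "rim_corner a c = Complex (w 2 * a + w 1 * c) (w 3 * a + w 2 * c)"

lemma rim_rim_corner:
  assumes "0 \<le> a" "0 \<le> c" "0 < a + c"
  shows "rim a c (rim_corner a c)"
proof -
  have Im: "Im (rim_corner a c) = slab_top 0 a c"
    by (simp add: rim_corner_def slab_top_def numeral_2_eq_2)
  have "0 < (w 2 + w 2) * a + (w 1 + w 3) * c"
    using assms w_pos[of 1] w_pos[of 2] w_pos[of 3]
      by (cases "a = 0") (auto intro: add_pos_nonneg add_nonneg_pos)
  then have "0 < excess (0 + 1) * (Re (rim_corner a c) + (w (0 + 2) * a + w (0 + 3) * c))"
    using excess_pos[of "0 + 1"] by (intro mult_pos_pos)
        (simp_all add: rim_corner_def numeral_2_eq_2 algebra_simps)
  moreover have "0 \<le> excess (0 + 2) * (slab_top 0 a c - slab_bottom 0 a c)"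
    using excess_pos[of "0 + 2"] slab_bottom_le_top[OF assms(1)] by (intro mult_nonneg_nonneg) auto
  ultimately have "0 < slab_left 0 a c (rim_corner a c)"
    unfolding slab_left_bottom Im by linarith
  moreover have "slab_right 0 a c (rim_corner a c) = 0"
    unfolding slab_right_corner Im by (simp add: rim_corner_def numeral_2_eq_2)
  ultimately show ?thesis
    unfolding rim_def Im using slab_bottom_le_top[OF assms(1)] by simp
qed

lemma cell_section_bottom:
  assumes "cell_section n I t p q z" "1 \<notin> I \<or> 2 \<notin> I"
  shows "Im z = slab_bottom n (swap_unless t p q) (swap_unless t q p)"
  using cell_sectionD(3,5-8)[OF assms(1)] assms(2) by (cases t) (auto simp: slab_def swap_unless_def)

lemma rim_of_top_edge:
  assumes sections: "cell_section 1 I t p q z" and card: "card I \<le> 1"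
  shows "rim (swap_unless t q p) (swap_unless t p q) z"
proof (cases "3 \<in> I")
  case True
  note D = cell_sectionD[OF sections]
  have I: "I = {3}"
    using True card card_le_Suc0_iff_eq[of I] by auto
  have t: t "q = 0"
    using D(2,5-7) I by auto
  then have slab: "slab 1 p 0 z" "Im z = w 2 * p"
    using D(3,5) I by (simp_all add: swap_unless_def slab_def slab_bottom_def not_less eval_nat_numeral)
  then have Im: "Im z = slab_bottom 1 p 0" "Im z = slab_bottom 0 0 p"
    by (simp_all add: slab_bottom_def eval_nat_numeral)
  have "0 \<le> excess 2 * (w 1 * p - Re z)" "0 < excess 2 * (Re z + w 3 * p)"
    using slab(1) unfolding slab_def slab_right_bottom slab_left_bottom Im(1)
    by (simp_all add: eval_nat_numeral algebra_simps)
  then have "0 \<le> w 1 * p - Re z" "0 < Re z + w 3 * p"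
    using excess_pos[of 2] by (simp_all add: zero_le_mult_iff zero_less_mult_iff)
  then have "0 \<le> excess 1 * (w 1 * p - Re z)" "0 < excess 1 * (Re z + w 3 * p)"
    using excess_pos[of 1] by simp_all
  then have "0 \<le> slab_right 0 0 p z" "0 < slab_left 0 0 p z"
    unfolding slab_right_bottom slab_left_bottom Im(2) by (simp_all add: eval_nat_numeral algebra_simps)
  then have "rim 0 p z"
    unfolding rim_def Im(2) using slab_bottom_le_top[of 0 0 p] by simp
  then show ?thesis
    using t by (simp add: swap_unless_def)
next
  case False
  note D = cell_sectionD[OF sections]
  have "1 \<notin> I \<or> 2 \<notin> I"
    using card card_mono[of I "{1, 2}"] by auto
  then have "z = rim_corner (swap_unless t q p) (swap_unless t p q)"
    using slab_bottom_right_corner[of 1 _ _ z] D(4) cell_section_bottom[OF sections] False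
    by (simp add: complex_eq_iff rim_corner_def slab_bottom_def eval_nat_numeral add.commute)
  then show ?thesis
    using rim_rim_corner D(1,2) by (simp add: swap_unless_def)
qed

lemma cell_section_rim:
  assumes sections: "cell_section n I t p q z" and card: "n + card I \<le> 2"
  shows "rim (swap_unless (t \<longleftrightarrow> even n) p q) (swap_unless (t \<longleftrightarrow> even n) q p) z"
proof -
  note D = cell_sectionD[OF sections]
  let ?a = "swap_unless t p q" and ?c = "swap_unless t q p"
  have nonneg: "0 \<le> ?a" "0 \<le> ?c" "0 < ?a + ?c"
    using D(1,2) by (auto simp: swap_unless_def)
  note bottom = cell_section_bottom[OF sections]
  consider "n = 0" | "n = 1" | "n = 2"
    using card by linarith
  then show ?thesis
  proof cases
    case 1
    have "slab_right 0 ?a ?c z = 0 \<or> Im z = slab_bottom 0 ?a ?c"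
    proof (cases "3 \<in> I")
      case True
      then have "1 \<notin> I \<or> 2 \<notin> I"
        using card 1 card_mono[of I "{1, 2, 3}"] by auto
      then show ?thesis using bottom 1 by simp
    qed (use D(4) 1 in simp)
    then have "rim ?a ?c z"
      using D(3) 1 by (auto simp: rim_def slab_def)
    then show ?thesis using 1 by (simp add: swap_unless_def)
  next
    case 2
    then show ?thesis
      using rim_of_top_edge[of I t p q z] sections card by (cases t) (simp_all add: swap_unless_def)
  next
    case 3
    then have "I = {}"
      using card by simp
    then have t: t "q = 0"
      using D(2,5-7) by auto
    then have "z = rim_corner p 0"
      using slab_bottom_right_corner[of n ?a ?c z] D(4) bottom \<open>I = {}\<close> 3
      by (simp add: complex_eq_iff rim_corner_def slab_bottom_def swap_unless_def)
    then show ?thesis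
      using rim_rim_corner[of p 0] D(1) t 3 by (simp add: swap_unless_def)
  qed
qed

lemma rim_corner_cross:
  "excess 1 * ((\<i> * rim_corner a c) \<bullet> z) =
    slab_top 0 a c * slab_right 0 a c z + (w 1 * w 1 - w 0 * w 2) * (2 * a + c) * (slab_top 0 a c - Im z)"
proof -
  have "excess 0 * slab_top 0 a c - excess 1 * (w 2 * a + w 1 * c) = (w 1 * w 1 - w 0 * w 2) * (2 * a + c)"
    by (simp add: slab_top_def eval_nat_numeral w_Suc_Suc algebra_simps)
  moreover have "(\<i> * rim_corner a c) \<bullet> z = (w 2 * a + w 1 * c) * Im z - slab_top 0 a c * Re z"
    by (simp add: rim_corner_def inner_complex_def slab_top_def numeral_2_eq_2 algebra_simps)
  ultimately show ?thesis
    unfolding slab_right_corner by (simp add: eval_nat_numeral) algebra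
qed

lemma rim_corner_inner:
  "excess 1 * (rim_corner c a \<bullet> z) =
    slab_bottom 0 a c * slab_left 0 a c z + (w 2 * w 2 - w 1 * w 3) * (2 * a + c) * (Im z - slab_bottom 0 a c)"
  unfolding slab_left_bottom
  by (simp add: rim_corner_def inner_complex_def slab_bottom_def eval_nat_numeral algebra_simps)

context
  fixes a c :: real and z :: complex
  assumes ac: "0 \<le> a" "0 \<le> c" "0 < a + c" and rim: "rim a c z"
begin

lemma rim_Im_pos: "0 < Im z"
  using slab_bottom_pos[OF ac, of 0] rim by (simp add: rim_def)

lemma rim_corner_cross_nonneg: "0 \<le> (\<i> * rim_corner a c) \<bullet> z"
proof -
  have "0 \<le> (w 1 * w 1 - w 0 * w 2) * (2 * a + c) * (slab_top 0 a c - Im z)"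
    using det_0_pos ac rim by (intro mult_nonneg_nonneg) (auto simp: rim_def)
  moreover have "0 \<le> slab_top 0 a c * slab_right 0 a c z"
    using slab_bottom_pos[OF ac, of 0] slab_bottom_le_top[OF ac(1), of 0 c] rim
      by (intro mult_nonneg_nonneg) (auto simp: rim_def)
  ultimately have "0 \<le> excess 1 * ((\<i> * rim_corner a c) \<bullet> z)"
    unfolding rim_corner_cross by simp
  then show ?thesis
    using excess_pos[of 1] by (simp only: zero_le_mult_iff) linarith
qed

lemma rim_corner_inner_pos: "0 < rim_corner c a \<bullet> z"
proof -
  have "0 \<le> (w 2 * w 2 - w 1 * w 3) * (2 * a + c) * (Im z - slab_bottom 0 a c)"
    using w_det_less[of 1] ac rim by (intro mult_nonneg_nonneg) (auto simp: rim_def eval_nat_numeral)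
  moreover have "0 < slab_bottom 0 a c * slab_left 0 a c z"
    using slab_bottom_pos[OF ac, of 0] rim by (intro mult_pos_pos) (auto simp: rim_def)
  ultimately have "0 < excess 1 * (rim_corner c a \<bullet> z)"
    unfolding rim_corner_inner by simp
  then show ?thesis
    using excess_pos[of 1] by (simp only: zero_less_mult_iff) linarith
qed

lemma rim_not_outside:
  assumes "rim a c (r *\<^sub>R z)"
  shows "r \<le> 1"
proof (rule ccontr)
  assume "\<not> r \<le> 1"
  define f where "f = excess 0 * Im z - excess 1 * Re z"
  define C where "C = (w 1 * w 1 - w 0 * w 2) * (2 * a + c)"
  have right: "slab_right 0 a c z = f - C" "slab_right 0 a c (r *\<^sub>R z) = r * f - C"
    by (simp_all add: slab_right_def f_def C_def eval_nat_numeral algebra_simps)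
  have "0 < C"
    using det_0_pos ac by (simp add: C_def)
  moreover have "C \<le> f"
    using rim right(1) by (simp add: rim_def)
  ultimately have "f < r * f"
    using \<open>\<not> r \<le> 1\<close> by simp
  moreover have "Im z < r * Im z"
    using \<open>\<not> r \<le> 1\<close> rim_Im_pos by simp
  ultimately show False
    using rim assms \<open>C \<le> f\<close> right by (simp add: rim_def)
qed

end

lemma rim_ray_unique:
  assumes ac: "0 \<le> a" "0 \<le> c" "0 < a + c" and rim: "rim a c z" "rim a c (r *\<^sub>R z)"
  shows "r = 1"
proof -
  have "0 < r * Im z"
    using rim_Im_pos[OF ac rim(2)] by simp
  then have "0 < r"
    using rim_Im_pos[OF ac rim(1)] by (simp add: zero_less_mult_iff)
  moreover have "rim a c ((1 / r) *\<^sub>R (r *\<^sub>R z))"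
    using rim(1) \<open>0 < r\<close> by simp
  ultimately show ?thesis
    using rim_not_outside[OF ac rim(1,2)] rim_not_outside[OF ac rim(2), of "1 / r"] by simp
qed

lemma rim_quarter_turn:
  assumes ac: "0 \<le> a" "0 \<le> c" "0 < a + c" and rim: "rim a c z" "rim c a y" and r: "0 < r"
  shows "z \<noteq> \<i> * (r *\<^sub>R y)"
proof
  assume z: "z = \<i> * (r *\<^sub>R y)"
  have "rim_corner c a \<bullet> z = - r * ((\<i> * rim_corner c a) \<bullet> y)"
    unfolding z by (simp add: inner_complex_def algebra_simps)
  moreover have "0 < rim_corner c a \<bullet> z" "0 \<le> (\<i> * rim_corner c a) \<bullet> y"
    using rim_corner_inner_pos[OF ac rim(1)] rim_corner_cross_nonneg[OF ac(2,1) _ rim(2)] ac(3) by simp_all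
  ultimately show False
    using r by (simp add: zero_less_mult_iff mult_less_0_iff)
qed

lemma rim_scale:
  assumes "rim a c z" "0 < r"
  shows "rim (r * a) (r * c) (r *\<^sub>R z)"
proof -
  have "slab_right 0 (r * a) (r * c) (r *\<^sub>R z) = r * slab_right 0 a c z"
      "slab_left 0 (r * a) (r * c) (r *\<^sub>R z) = r * slab_left 0 a c z"
    "slab_bottom 0 (r * a) (r * c) = r * slab_bottom 0 a c" "slab_top 0 (r * a) (r * c) = r * slab_top 0 a c"
    by (simp_all add: slab_right_def slab_left_def slab_bottom_def slab_top_def field_simps)
  then show ?thesis
    using assms by (auto simp: rim_def)
qed

lemma rim_section_unique:
  fixes k k' :: int
  assumes pq: "0 < p" "0 \<le> q" and r: "0 < r"
    and rim: "rim (swap_unless t p q) (swap_unless t q p) z" "rim (swap_unless t' p q) (swap_unless t' q p) y"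
    and phase: "cis (pi / 2 * of_int k) * z = cis (pi / 2 * of_int k') * (r *\<^sub>R y)"
    and parity: "t = t' \<longleftrightarrow> even (k' - k)"
  shows "r = 1"
proof -
  let ?a = "swap_unless t p q" and ?c = "swap_unless t q p"
  have ac: "0 \<le> ?a" "0 \<le> ?c" "0 < ?a + ?c" "0 < ?c + ?a"
    using pq by (auto simp: swap_unless_def)
  have swapped: "swap_unless t' p q = ?c" "swap_unless t' q p = ?a" if "t \<noteq> t'"
    using that by (auto simp: swap_unless_def)
  from phase show ?thesis
  proof (cases rule: quarter_turn_cases)
    case 1
    then have "t = t'"
      using parity dvd_trans[of 2 4 "k' - k"] by simp
    moreover have "y = (1 / r) *\<^sub>R z"
      using 1(2) r by simp
    ultimately have "1 / r = 1"
      using rim_ray_unique[OF ac(1-3) rim(1), of "1 / r"] rim(2) by simp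
    then show ?thesis by simp
  next
    case 2
    then show ?thesis
      using rim_quarter_turn[OF ac(1-3) rim(1) _ r, of y] rim(2) swapped parity by simp
  next
    case 3
    then have "0 < Im z" "0 < Im y" "Im z = - (r * Im y)"
      using rim_Im_pos[OF ac(1-3) rim(1)] rim_Im_pos[OF ac(1-3)] rim(2) parity by auto
    then show ?thesis
      using mult_pos_pos[OF r, of "Im y"] by simp
  next
    case 4
    then have "y = \<i> * ((1 / r) *\<^sub>R z)"
      using r by (simp add: complex_eq_iff field_simps)
    then show ?thesis
      using rim_quarter_turn[OF ac(2,1,4) _ rim(1), of y "1 / r"] rim(2) swapped parity 4 r by simp
  qed
qed

end

context growing
begin

lemma union_model2_rim:
  assumes "x \<in> \<Union>(model 2)"
  obtains z p q and k m :: int where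
    "x = emb e s (cis (pi / 2 * of_int k) * z) (cis (pi / 3 * of_int m) * sector_pt p q)" "0 < p" "0 \<le> q"
    "rim (swap_unless (even (k + m)) p q) (swap_unless (even (k + m)) q p) z" "norm x = 1"
proof -
  obtain P where "P \<in> model 2" "x \<in> P"
    using assms by blast
  then obtain v I where v: "strip_cell 2 v I" and "x \<in> sph_hull (corner v ` Pow I)"
    by (auto elim: modelE)
  then have x: "x \<in> convex_cone hull (corner v ` Pow I)" "norm x = 1"
    by (auto simp: sph_hull_def)
  then have "x \<noteq> 0"
    by auto
  then obtain A B where AB: "A \<subseteq> B" "B \<subseteq> I" "x \<in> open_cone (corner v) {A..B}"
    using cube_config_open_cone[OF strip_cell_cube_config[OF v] x(1)] by blast
  note face = strip_cell_face[OF v AB(1,2)]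
  obtain n where n: "coord_sum (v + ind_vec A) = real n" "n + card (B - A) \<le> 2"
    using face by (rule strip_cell_levelE)
  have "x \<in> open_cone (corner (v + ind_vec A)) (Pow (B - A))"
    using open_cone_interval[OF AB(1)] AB(3) by blast
  then obtain z p q t and k m :: int where section_x:
    "x = emb e s (cis (pi / 2 * of_int k) * z) (cis (pi / 3 * of_int m) * sector_pt p q)"
    "t \<longleftrightarrow> even (int n - k - m)" "cell_section n (B - A) t p q z"
    by (rule open_cell_section[OF strip_cell_int_points[OF face] n(1)])
  have "(t \<longleftrightarrow> even n) \<longleftrightarrow> even (k + m)"
    unfolding section_x(2) by auto
  then show ?thesis
    using that[OF section_x(1) _ _ _ x(2)] cell_sectionD(1,2)[OF section_x(3)]
        cell_section_rim[OF section_x(3) n(2)] by simp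
qed

lemma rim_swap_unless_nonzero: "rim (swap_unless t p q) (swap_unless t q p) z \<Longrightarrow> 0 < p \<Longrightarrow> 0 \<le> q \<Longrightarrow> z \<noteq> 0"
  using rim_Im_pos[of "swap_unless t p q" "swap_unless t q p" z]
    by (auto simp: swap_unless_def split: if_splits)

lemma model2_inj: "inj_on proj1 (\<Union>(model 2))"
proof (rule inj_onI)
  fix x x' assume x: "x \<in> \<Union>(model 2)" and x': "x' \<in> \<Union>(model 2)" and proj: "proj1 x = proj1 x'"
  obtain z p q and k m :: int where L:
    "x = emb e s (cis (pi / 2 * of_int k) * z) (cis (pi / 3 * of_int m) * sector_pt p q)" "0 < p" "0 \<le> q"
    "rim (swap_unless (even (k + m)) p q) (swap_unless (even (k + m)) q p) z" "norm x = 1"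
    by (rule union_model2_rim[OF x])
  obtain z' p' q' and k' m' :: int where L':
    "x' = emb e s (cis (pi / 2 * of_int k') * z') (cis (pi / 3 * of_int m') * sector_pt p' q')"
        "0 < p'" "0 \<le> q'"
    "rim (swap_unless (even (k' + m')) p' q') (swap_unless (even (k' + m')) q' p') z'" "norm x' = 1"
    by (rule union_model2_rim[OF x'])
  have "cis (pi / 2 * of_int k) * z \<noteq> 0" "cis (pi / 2 * of_int k') * z' \<noteq> 0"
    "cis (pi / 3 * of_int m) * sector_pt p q \<noteq> 0" "cis (pi / 3 * of_int m') * sector_pt p' q' \<noteq> 0"
    using rim_swap_unless_nonzero[OF L(4,2,3)] rim_swap_unless_nonzero[OF L'(4,2,3)]
      sector_pt_nonzero[of p q] sector_pt_nonzero[of p' q'] L(2,3) L'(2,3) by auto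
  then obtain r\<^sub>1 r\<^sub>2 where r: "0 < r\<^sub>1" "0 < r\<^sub>2"
    and z: "cis (pi / 2 * of_int k) * z = r\<^sub>1 *\<^sub>R (cis (pi / 2 * of_int k') * z')"
    and u: "cis (pi / 3 * of_int m) * sector_pt p q = r\<^sub>2 *\<^sub>R (cis (pi / 3 * of_int m') * sector_pt p' q')"
    using proj1_eqE[OF proj[unfolded L(1) L'(1)]] by metis
  have "cis (pi / 3 * of_int m) * sector_pt p q = cis (pi / 3 * of_int m') * sector_pt (r\<^sub>2 * p') (r\<^sub>2 * q')"
    unfolding u sector_pt_scaleR[symmetric] by simp
  then have sector: "6 dvd (m' - m)" "p = r\<^sub>2 * p'" "q = r\<^sub>2 * q'"
    using sector_unique[of m p q m' "r\<^sub>2 * p'" "r\<^sub>2 * q'"] L(2,3) L'(2,3) r(2) by auto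
  have rim: "rim (swap_unless (even (k' + m')) p q) (swap_unless (even (k' + m')) q p) (r\<^sub>2 *\<^sub>R z')"
    using rim_scale[OF L'(4) r(2)] unfolding sector(2,3)
      by (cases "even (k' + m')") (simp_all add: swap_unless_def)
  have phase: "cis (pi / 2 * of_int k) * z = cis (pi / 2 * of_int k') * ((r\<^sub>1 / r\<^sub>2) *\<^sub>R (r\<^sub>2 *\<^sub>R z'))"
    unfolding z using r(2) by simp
  have parity: "even (k + m) = even (k' + m') \<longleftrightarrow> even (k' - k)"
    using dvd_trans[of 2 6 "m' - m"] sector(1) by auto
  have "r\<^sub>1 / r\<^sub>2 = 1"
    using rim_section_unique[OF L(2,3) _ L(4) rim phase parity] r by simp
  then have "r\<^sub>1 = r\<^sub>2"
    by simp
  then have "x = r\<^sub>2 *\<^sub>R x'"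
    unfolding L(1) L'(1) emb_scale z u by simp
  then have "r\<^sub>2 = 1"
    using L(5) L'(5) r(2) by simp
  with \<open>x = r\<^sub>2 *\<^sub>R x'\<close> show "x = x'"
    by simp
qed

lemma model2_transversal2: "transversal2 (model 2) (model_lab e s \<eta>)"
  unfolding transversal2_def
proof (intro conjI model_symmetric model2_inj subsetI)
  fix x assume x: "x \<in> \<Union>(model 2)"
  obtain z p q and k m :: int where L:
    "x = emb e s (cis (pi / 2 * of_int k) * z) (cis (pi / 3 * of_int m) * sector_pt p q)" "0 < p" "0 \<le> q"
    "rim (swap_unless (even (k + m)) p q) (swap_unless (even (k + m)) q p) z" "norm x = 1"
    by (rule union_model2_rim[OF x])
  have S: "x \<in> S3eq"
    using L(1,5) by (simp add: S3eq_def)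
  moreover have "x \<notin> Clif 0" "x \<notin> Clif 2"
    using emb_Clif_iff[OF S[unfolded L(1)]] sector_pt_nonzero[of p q]
        rim_swap_unless_nonzero[OF L(4,2,3)] L(2,3)
    unfolding L(1) by auto
  ultimately show "x \<in> S3eq - (Clif 0 \<union> Clif 2)"
    by blast
qed

lemma model_restr_transversal2:
  assumes "j + 2 \<le> k"
  shows "transversal2 (restr (model k) (model_lab e s \<eta>) {j..j + 2}) (shift_lab j (model_lab e s \<eta>))"
proof -
  interpret shifted: growing "cis (pi / 2 * real j) * e" s "\<lambda>n. w (n + j)" b
    by (rule growing_shift)
  have "restr (model k) (model_lab e s \<eta>) {j..j + 2} = shifted.model 2"
    unfolding restr_shift[OF assms] shifted.model_def ..
  then show ?thesis
    using shifted.model2_transversal2 symmetric_cct_cong[OF shifted.model_symmetric,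
        of 2 "shift_lab j (model_lab e s \<eta>)"] model_lab_shift
    unfolding transversal2_def by metis
qed

lemma model_transversal: "transversal k (model k) (model_lab e s \<eta>)"
  unfolding transversal_def
proof (intro conjI model_symmetric allI impI)
  fix i assume i: "1 \<le> i \<and> i + 1 \<le> k"
  then have "{i - 1, i, i + 1} = {i - 1..i - 1 + 2}" by auto
  then show "transversal2 (restr (model k) (model_lab e s \<eta>) {i - 1, i, i + 1})
      (shift_lab (i - 1) (model_lab e s \<eta>))"
    using model_restr_transversal2[of "i - 1" k] i by simp
qed

section \<open>Slope of the model\<close>

lemma model_vertex_Lam: "l \<in> Lam \<Longrightarrow> model_vertex (l + v) = model_vertex v"
  by (simp add: model_vertex_def model_pt_Lam)

lemma inj_on_cell_vertices:
  assumes "strip_cell k v I"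
  shows "inj_on (\<lambda>S. model_vertex (v + ind_vec S)) (Pow I)"
proof (rule inj_onI)
  fix S S' assume eq: "model_vertex (v + ind_vec S) = model_vertex (v + ind_vec S')"
  have "v + ind_vec S \<in> int_points" "0 \<le> coord_sum (v + ind_vec S)" for S
    using assms by (auto simp: strip_cell_def int_points_add int_points_ind_vec)
  then obtain l where "l \<in> Lam" "v + ind_vec S' = l + (v + ind_vec S)"
    using model_vertex_eqD[OF _ _ _ _ eq] by blast
  then have "ind_vec S' - ind_vec S \<in> Lam"
    by (simp add: algebra_simps)
  then show "S = S'"
    using ind_vec_diff_Lam_eq by blast
qed

lemma model_edgeE:
  assumes "adjacent (model k) x y"
  obtains c i where "strip_cell k c {i}" "{x, y} = {model_vertex c, model_vertex (c + ind_vec {i})}"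
proof -
  let ?P = "sph_hull {x, y}"
  have P: "x \<noteq> y" "{x} \<in> model k" "{y} \<in> model k" "?P \<in> model k"
    using assms by (auto simp: adjacent_def)
  have unit: "{x, y} \<subseteq> sphere 0 1"
    using P(2,3) by (auto elim!: modelE simp: sph_hull_def)
  then have mem: "{x, y} \<subseteq> ?P"
    unfolding sph_hull_def by (auto intro: hull_inc)
  then obtain c I where c: "strip_cell k c I" "?P = sph_hull (corner c ` Pow I)"
    using P(4) by (auto elim!: modelE)
  have "z \<in> {x, y} \<longleftrightarrow> {z} sph_face_of ?P" for z
  proof
    assume "z \<in> {x, y}"
    then show "{z} sph_face_of ?P"
      using model_inter[OF P(4,2)] model_inter[OF P(4,3)] mem by (auto simp: Int_absorb1)
  qed (use sph_face_of_sph_hull_vertex unit in blast)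
  then have vertices: "{x, y} = (\<lambda>S. model_vertex (c + ind_vec S)) ` Pow I"
    unfolding c(2) using cell_vertex_face[OF c(1)] by blast
  then have "card {x, y} = 2 ^ card I"
    by (simp only: card_image[OF inj_on_cell_vertices[OF c(1)]]) (simp add: card_Pow)
  then have "card I = 1"
    using P(1) power_inject_exp[of "2::nat" 1 "card I"] by simp
  then obtain i where "I = {i}"
    by (rule card_1_singletonE)
  then show ?thesis
    using that c(1) vertices by (auto simp: Pow_insert insert_commute)
qed

lemma model_edge:
  assumes "strip_cell k c {i}"
  shows "adjacent (model k) (model_vertex c) (model_vertex (c + ind_vec {i}))"
proof -
  have "sph_hull ((\<lambda>S. model_vertex (c + ind_vec S)) ` Pow {i}) = sph_hull (corner c ` Pow {i})"
    unfolding model_vertex_def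
    using cube_config_nonzero[OF strip_cell_cube_config[OF assms]] by (rule sph_hull_normalised)
  then have "sph_hull {model_vertex c, model_vertex (c + ind_vec {i})} \<in> model k"
    using model_cell[OF assms] by (simp add: Pow_insert insert_commute)
  moreover have "{model_vertex (c + ind_vec S)} \<in> model k" if "S \<subseteq> {i}" for S
    using model_cell[OF strip_cell_corner[OF assms that]] sph_hull_model_pt strip_cell_corner[OF assms that]
    by (simp add: strip_cell_def)
  from this[of "{}"] this[of "{i}"] have "{model_vertex c} \<in> model k"
      "{model_vertex (c + ind_vec {i})} \<in> model k"
    by simp_all
  moreover have "model_vertex c \<noteq> model_vertex (c + ind_vec {i})"
    using inj_onD[OF inj_on_cell_vertices[OF assms], of "{}" "{i}"] by auto
  ultimately show ?thesis
    unfolding adjacent_def by blast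
qed

lemma adjacent_commute: "adjacent T x y \<longleftrightarrow> adjacent T y x"
  by (auto simp: adjacent_def insert_commute)

lemma model_top_neighbour:
  assumes v: "v \<in> int_points" "coord_sum v = real k" and adjacent: "adjacent (model k) (model_vertex v) y"
  obtains i where "y = model_vertex (v - ind_vec {i})"
proof -
  obtain c i where c: "strip_cell k c {i}"
      "{model_vertex v, y} = {model_vertex c, model_vertex (c + ind_vec {i})}"
    using adjacent by (rule model_edgeE)
  have lattice: "\<exists>l\<in>Lam. v = l + (c + ind_vec S)"
      if "model_vertex v = model_vertex (c + ind_vec S)" "S \<subseteq> {i}" for S
    using model_vertex_eqD[of "c + ind_vec S" v] strip_cell_corner[OF c(1) that(2)] v that(1)
      by (auto simp: strip_cell_def)
  have "model_vertex v \<noteq> model_vertex c"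
    using lattice[of "{}"] c(1) v(2) coord_sum_Lam by (auto simp: strip_cell_def)
  then have vertices: "model_vertex v = model_vertex (c + ind_vec {i})" "y = model_vertex c"
    using c(2) by (auto simp: doubleton_eq_iff)
  then obtain l where l: "l \<in> Lam" "v = l + (c + ind_vec {i})"
    using lattice[of "{i}"] by blast
  then have "v - ind_vec {i} = l + c"
    by simp
  then show ?thesis
    using that vertices(2) model_vertex_Lam[OF l(1)] by metis
qed

end

lemma normalised_scaleR: "0 < c \<Longrightarrow> (c *\<^sub>R x) /\<^sub>R norm (c *\<^sub>R x) = x /\<^sub>R norm (x :: 'a::real_normed_vector)"
  by (cases "x = 0") (simp_all add: field_simps)

context frame
begin

lemma proj0_emb: "proj0 (emb e s z u) = emb e s (z /\<^sub>R norm z) 0"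
  unfolding proj0_def part12_emb norm_emb_z emb_scale by simp

lemma proj0_emb_scaleR: "0 < c \<Longrightarrow> proj0 (c *\<^sub>R emb e s z u) = proj0 (emb e s z u)"
  unfolding emb_scale proj0_emb by (simp only: normalised_scaleR)

lemma continuous_on_emb: "continuous_on X (\<lambda>(z, u). emb e s z u)"
proof -
  have "emb e s z u = Re z *\<^sub>R emb e s 1 0 + Im z *\<^sub>R emb e s \<i> 0 +
      Re u *\<^sub>R emb e s 0 1 + Im u *\<^sub>R emb e s 0 \<i>" for z u
  proof -
    have "Re x *\<^sub>R 1 + Im x *\<^sub>R \<i> = x" for x by (simp add: complex_eq_iff)
    then show ?thesis unfolding emb_scale emb_add by simp
  qed
  then have "(\<lambda>(z, u). emb e s z u) = (\<lambda>p. Re (fst p) *\<^sub>R emb e s 1 0 + Im (fst p) *\<^sub>R emb e s \<i> 0 +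
      Re (snd p) *\<^sub>R emb e s 0 1 + Im (snd p) *\<^sub>R emb e s 0 \<i>)"
    unfolding case_prod_beta by (intro ext)
  then show ?thesis
    by (simp only:) (intro continuous_intros)
qed

end

lemma tangent_inner:
  assumes "norm m = 1"
  shows "tangent_at m a \<bullet> tangent_at m c = a \<bullet> c - (a \<bullet> m) * (c \<bullet> m)"
proof -
  have "m \<bullet> m = 1" using assms by (simp add: norm_eq_1)
  then show ?thesis
    by (simp add: tangent_at_def inner_diff_left inner_diff_right inner_commute algebra_simps)
qed

lemma sph_angle_obtuse:
  assumes obtuse: "(a \<bullet> c) * (m \<bullet> m) < (a \<bullet> m) * (c \<bullet> m)" and "0 < \<alpha>" "0 < \<gamma>"
  shows "pi / 2 < sph_angle (m /\<^sub>R norm m) (\<alpha> *\<^sub>R a) (\<gamma> *\<^sub>R c)"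
proof -
  let ?x = "tangent_at (m /\<^sub>R norm m) (\<alpha> *\<^sub>R a)" and ?y = "tangent_at (m /\<^sub>R norm m) (\<gamma> *\<^sub>R c)"
  have "m \<noteq> 0"
    using obtuse by auto
  then have m: "0 < norm m" "norm (m /\<^sub>R norm m) = 1"
    by simp_all
  have "?x \<bullet> ?y * (norm m)\<^sup>2 = (\<alpha> * \<gamma>) * ((a \<bullet> c) * (m \<bullet> m) - (a \<bullet> m) * (c \<bullet> m))"
    unfolding tangent_inner[OF m(2)] using m(1)
    by (simp add: power2_norm_eq_inner[symmetric] field_simps power2_eq_square)
  also have "\<dots> < 0"
    using obtuse \<open>0 < \<alpha>\<close> \<open>0 < \<gamma>\<close> by (simp add: mult_pos_neg)
  finally have neg: "?x \<bullet> ?y < 0"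
    by (simp add: mult_less_0_iff)
  then have "?x \<noteq> 0" "?y \<noteq> 0" by auto
  then have pos: "0 < norm ?x * norm ?y" by simp
  have "- (norm ?x * norm ?y) \<le> ?x \<bullet> ?y"
    using Cauchy_Schwarz_ineq2[of ?x ?y] by linarith
  then have "- 1 \<le> (?x \<bullet> ?y) / (norm ?x * norm ?y)"
    using pos by (simp add: field_simps)
  moreover have "(?x \<bullet> ?y) / (norm ?x * norm ?y) < 0"
    using neg pos by (simp add: divide_neg_pos)
  ultimately have "arccos 0 < arccos ((?x \<bullet> ?y) / (norm ?x * norm ?y))"
    by (intro arccos_less_arccos) auto
  then show ?thesis by (simp add: sph_angle_def)
qed

lemma edge_path_direction:
  assumes "vector [1, -1, 0] - ind_vec {j} + ind_vec {i} \<in> Lam"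
  shows "i = 2"
proof -
  let ?l = "vector [1, -1, 0] - ind_vec {j} + ind_vec {i} :: real^3"
  obtain a b :: int where ab: "?l $ 1 = 3 * of_int a - 2 * of_int b"
      "?l $ 2 = - 3 * of_int a - 2 * of_int b" "?l $ 3 = 4 * of_int b"
    using assms by (rule LamE)
  have "\<bar>?l $ 3\<bar> \<le> 1" by simp
  then have b: "b = 0" unfolding ab(3) by linarith
  have "0 \<le> ?l $ 1" "?l $ 1 \<le> 2" by simp_all
  then have "a = 0" unfolding ab(1) b by simp
  then have "?l $ 2 = 0" using ab(2) b by simp
  then show ?thesis by (auto split: if_splits)
qed

context growing
begin

lemma norm_r34_r34_model_pt: "norm (model_pt e s \<eta> (vector [1, -1, 0] + v)) = norm (model_pt e s \<eta> v)"
  unfolding r34_r34_model_pt[symmetric] by (rule r34_r34_isometry(2))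

lemma model_vertex_translate: "(r34 \<circ> r34) (model_vertex v) = model_vertex (vector [1, -1, 0] + v)"
  unfolding model_vertex_def linear_scale[OF r34_r34_isometry(1)] r34_r34_model_pt norm_r34_r34_model_pt ..

lemma top_edge_path_middle:
  assumes v: "v \<in> int_points" "coord_sum v = real (Suc k)"
  shows "(THE u. adjacent (model (Suc k)) (model_vertex v) u \<and>
    adjacent (model (Suc k)) u ((r34 \<circ> r34) (model_vertex v))) = model_vertex (v - ind_vec {2})"
proof (rule the_equality)
  let ?t = "vector [1, -1, 0] + v"
  have t: "?t \<in> int_points" "coord_sum ?t = real (Suc k)"
    using v translation_vectors int_points_add by auto
  have below: "strip_cell (Suc k) (x - ind_vec {i}) {i}" if "x \<in> int_points"
      "coord_sum x = real (Suc k)" for x i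
  proof -
    have "coord_sum x = coord_sum (x - ind_vec {i}) + coord_sum (ind_vec {i})"
      unfolding coord_sum_add[symmetric] by simp
    moreover have "x - ind_vec {i} \<in> int_points"
      using int_points_add[OF that(1) int_points_uminus[OF int_points_ind_vec]] by simp
    ultimately show ?thesis
      using that(2) by (simp add: strip_cell_def)
  qed
  have "?t - ind_vec {1} = v - ind_vec {2}"
    by (simp add: vec_eq_iff forall_3)
  moreover have "adjacent (model (Suc k)) (model_vertex (?t - ind_vec {1})) (model_vertex ?t)"
    using model_edge[OF below[OF t, of 1]] by (simp only: diff_add_cancel)
  ultimately have "adjacent (model (Suc k)) (model_vertex (v - ind_vec {2})) (model_vertex ?t)"
    by (simp only:)
  then show "adjacent (model (Suc k)) (model_vertex v) (model_vertex (v - ind_vec {2})) \<and>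
      adjacent (model (Suc k)) (model_vertex (v - ind_vec {2})) ((r34 \<circ> r34) (model_vertex v))"
    using model_edge[OF below[OF v, of 2]] adjacent_commute
    unfolding model_vertex_translate by simp
  fix u assume u: "adjacent (model (Suc k)) (model_vertex v) u \<and>
      adjacent (model (Suc k)) u ((r34 \<circ> r34) (model_vertex v))"
  then have "adjacent (model (Suc k)) (model_vertex ?t) u"
    unfolding model_vertex_translate using adjacent_commute by blast
  then obtain i j where ij: "u = model_vertex (v - ind_vec {i})" "u = model_vertex (?t - ind_vec {j})"
    using model_top_neighbour[OF v] model_top_neighbour[OF t] u by metis
  then obtain l where "l \<in> Lam" "?t - ind_vec {j} = l + (v - ind_vec {i})"
    using model_vertex_eqD[of "v - ind_vec {i}" "?t - ind_vec {j}"] below[OF v] below[OF t]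
      by (auto simp: strip_cell_def)
  then have "vector [1, -1, 0] - ind_vec {j} + ind_vec {i} \<in> Lam"
    by (simp add: algebra_simps)
  then show "u = model_vertex (v - ind_vec {2})"
    using edge_path_direction ij(1) by simp
qed

lemma eta_inner_less: "\<eta> n \<bullet> \<eta> (n + 1) < 2 * (\<eta> (n + 1) \<bullet> \<eta> (n + 1))"
proof -
  have "w n * w (n + 1) < 2 * w (n + 1) * w (n + 1)" "w (n + 1) * w (n + 2) < 2 * w (n + 2) * w (n + 2)"
    using w_less_double_Suc[of n] w_less_double_Suc[of "n + 1"] w_pos[of "n + 1"] w_pos[of "n + 2"]
    by (intro mult_strict_right_mono; simp)+
  then show ?thesis
    by (simp add: inner_complex_def)
qed

lemma model_pt_top_triangle:
  assumes v: "v \<in> int_points" "coord_sum v = real (Suc k)"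
  defines "c \<equiv> v - ind_vec {2}"
  shows "c \<in> int_points" "coord_sum c = real k"
    "model_pt e s \<eta> c = emb e s (z_phase v * \<eta> k) (u_phase c * 1)"
    "model_pt e s \<eta> v + model_pt e s \<eta> (vector [1, -1, 0] + v) =
        emb e s (z_phase v * (2 * \<eta> (Suc k))) (u_phase c * 1)"
proof -
  let ?t = "vector [1, -1, 0] + v"
  have cv: "c + ind_vec {2} = v" "c + ind_vec {1} = ?t"
    by (simp_all add: c_def vec_eq_iff forall_3)
  show c: "coord_sum c = real k" "c \<in> int_points"
    using v coord_sum_add[of c "ind_vec {2}"] int_points_add[OF v(1) int_points_uminus[OF int_points_ind_vec]]
    unfolding cv by (simp_all add: c_def)
  show "model_pt e s \<eta> c = emb e s (z_phase v * \<eta> k) (u_phase c * 1)"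
    using model_pt_corner[of c k e s \<eta> "{}"] c by (simp add: corner_z_def corner_u_omega c_def)
  have pt_v: "model_pt e s \<eta> v = emb e s (z_phase v * \<eta> (Suc k)) (u_phase c * cnj omega)"
    and pt_t: "model_pt e s \<eta> ?t = emb e s (z_phase v * \<eta> (Suc k)) (u_phase c * omega)"
    using model_pt_corner[of c k e s \<eta> "{2}"] model_pt_corner[of c k e s \<eta> "{1}"] c unfolding cv
    by (simp_all add: corner_z_def corner_u_omega c_def)
  show "model_pt e s \<eta> v + model_pt e s \<eta> ?t = emb e s (z_phase v * (2 * \<eta> (Suc k))) (u_phase c * 1)"
    unfolding pt_v pt_t emb_add distrib_left[symmetric] cnj_omega by simp
qed

lemma model_slope_at:
  assumes v: "v \<in> int_points" "coord_sum v = real (Suc k)"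
  shows "pi / 2 < slope_at (model (Suc k)) (model_vertex v)"
proof -
  define c where "c = v - ind_vec {2}"
  note triangle = model_pt_top_triangle[OF v, folded c_def]
  let ?t = "vector [1, -1, 0] + v"
  define M A where "M = emb e s (z_phase v * (2 * \<eta> (Suc k))) (u_phase c * 1)"
    and "A = emb e s (z_phase v * (2 * \<eta> (Suc k))) (u_phase c * 0)"
  have M: "model_pt e s \<eta> v + model_pt e s \<eta> ?t = M"
    unfolding triangle(4) M_def ..
  have pos: "0 < inverse (norm (model_pt e s \<eta> v))" "0 < inverse (norm (model_pt e s \<eta> c))"
    using model_pt_nonzero[OF v(1)] v(2) model_pt_nonzero[OF triangle(1)] triangle(2) by auto
  have "(model_vertex v + model_vertex ?t) = inverse (norm (model_pt e s \<eta> v)) *\<^sub>R M"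
    unfolding model_vertex_def norm_r34_r34_model_pt scaleR_add_right[symmetric] M ..
  then have midpoint: "(model_vertex v + (r34 \<circ> r34) (model_vertex v)) /\<^sub>R
      norm (model_vertex v + (r34 \<circ> r34) (model_vertex v)) = M /\<^sub>R norm M"
    unfolding model_vertex_translate by (simp only: normalised_scaleR[OF pos(1)])
  have "\<eta> (Suc k) \<noteq> 0"
    using w_pos[of "Suc k"] by (auto simp: complex_eq_iff)
  then have M_pos: "0 < inverse (norm M)" "0 < inverse (norm (2 * \<eta> (Suc k)))"
    by (simp_all add: M_def emb_eq_0_iff)
  have "proj0 (M /\<^sub>R norm M) = proj0 M"
    unfolding M_def by (rule proj0_emb_scaleR[OF M_pos(1)[unfolded M_def]])
  then have proj: "proj0 (M /\<^sub>R norm M) = inverse (norm (2 * \<eta> (Suc k))) *\<^sub>R A"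
    by (simp add: M_def A_def proj0_emb emb_scale norm_mult)
  have "(A \<bullet> model_pt e s \<eta> c) * (M \<bullet> M) < (A \<bullet> M) * (model_pt e s \<eta> c \<bullet> M)"
  proof -
    let ?X = "\<eta> k \<bullet> \<eta> (Suc k)" and ?Y = "\<eta> (Suc k) \<bullet> \<eta> (Suc k)"
    have "A \<bullet> model_pt e s \<eta> c = 2 * ?X" "M \<bullet> M = 4 * ?Y + 1" "A \<bullet> M = 4 * ?Y"
        "model_pt e s \<eta> c \<bullet> M = 2 * ?X + 1"
      unfolding A_def M_def triangle(3) emb_inner cis_inner
      by (simp_all add: inner_complex_def algebra_simps)
    then show ?thesis
      using eta_inner_less[of k] by (simp add: algebra_simps)
  qed
  then show ?thesis
    unfolding slope_at_def Let_def top_edge_path_middle[OF v] midpoint proj c_def[symmetric]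
      model_vertex_def[of c]
    by (rule sph_angle_obtuse[OF _ M_pos(2) pos(2)])
qed

lemma model2_slope: "pi / 2 < slope (model 2) (model_lab e s \<eta>)"
proof -
  have "model_vertex (axis_pt 2) \<in> layer (model_lab e s \<eta>) 2"
    using model_vertex_layer_iff[OF int_points_axis_pt] by (simp add: coord_sum_axis_pt del: of_nat_numeral)
  then have "(SOME x. x \<in> layer (model_lab e s \<eta>) 2) \<in> layer (model_lab e s \<eta>) 2"
    by (rule someI)
  then obtain v where "v \<in> int_points" "coord_sum v = real (Suc 1)"
      "(SOME x. x \<in> layer (model_lab e s \<eta>) 2) = model_vertex v"
    using model_lab_vertex by (auto simp: layer_def)
  then show ?thesis
    unfolding slope_def using model_slope_at[of v 1] by (simp add: numeral_2_eq_2)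
qed

lemma model_slope:
  assumes "2 \<le> k"
  shows "pi / 2 < slope (restr (model k) (model_lab e s \<eta>) {k - 2, k - 1, k})
      (shift_lab (k - 2) (model_lab e s \<eta>))"
proof -
  let ?j = "k - 2"
  interpret shifted: growing "cis (pi / 2 * real ?j) * e" s "\<lambda>n. w (n + ?j)" b
    by (rule growing_shift)
  have "{k - 2, k - 1, k} = {?j..?j + 2}"
    using assms by auto
  then have restr: "restr (model k) (model_lab e s \<eta>) {k - 2, k - 1, k} = shifted.model 2"
    using restr_shift[of ?j 2 k] assms unfolding shifted.model_def by simp
  have "shift_lab ?j (model_lab e s \<eta>) (orbit {v}) =
      model_lab (cis (pi / 2 * real ?j) * e) s shifted.\<eta> (orbit {v})"
    if "v \<in> {v \<in> int_points. coord_sum v = real 2}" for v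
    using that torus_complexI[of 2 v "{}"] by (intro model_lab_shift) (simp add: strip_cell_def)
  then have "layer (shift_lab ?j (model_lab e s \<eta>)) 2 =
      layer (model_lab (cis (pi / 2 * real ?j) * e) s shifted.\<eta>) 2"
    unfolding layer_def by (intro SUP_cong refl)
  then show ?thesis
    using shifted.model2_slope unfolding restr slope_def by simp
qed

end

section \<open>The component of the complement at the core circle\<close>

context frame
begin

definition tube :: "real \<Rightarrow> (real^5) set" where
  "tube r = (\<lambda>(z, u). emb e s z u /\<^sub>R norm (emb e s z u)) ` (sphere 0 1 \<times> ball 0 r)"

lemma continuous_on_normalised_emb: "continuous_on (sphere 0 1 \<times> X)
    (\<lambda>(z, u). emb e s z u /\<^sub>R norm (emb e s z u))"
  unfolding case_prod_beta
  by (intro continuous_intros continuous_on_emb[unfolded case_prod_beta]) (auto simp: emb_eq_0_iff)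

lemma connected_tube: "connected (tube r)"
  unfolding tube_def
  by (intro connected_continuous_image continuous_on_normalised_emb connected_Times connected_sphere) auto

lemma tube_S3eq: "tube r \<subseteq> S3eq"
proof
  fix x assume "x \<in> tube r"
  then obtain z u where x: "x = emb e s z u /\<^sub>R norm (emb e s z u)" and "norm z = 1"
    by (auto simp: tube_def)
  then have "emb e s z u \<noteq> 0"
    by (auto simp: emb_eq_0_iff)
  then show "x \<in> S3eq"
    unfolding x by (simp add: S3eq_def)
qed

lemma Clif_0_subset_tube:
  assumes "0 < r"
  shows "Clif 0 \<subseteq> tube r"
proof
  fix x assume x: "x \<in> Clif 0"
  then have S: "x \<in> S3eq" "x $ 5 = 0" "norm x = 1"
    by (auto simp: Clif_def S3eq_def)
  obtain z u where zu: "x = emb e s z u"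
    using emb_surj[OF frame_axioms S(2)] .
  have "u = 0"
    using emb_Clif_iff(1) x S(1) zu by blast
  moreover from this have "norm z = 1"
    using S(3) unfolding zu by (simp add: norm_emb_z)
  ultimately show "x \<in> tube r"
    using assms S(3) zu unfolding tube_def by (intro image_eqI[where x = "(z, 0)"]) auto
qed

lemma closure_tubeI:
  assumes "0 < r" "norm z = 1" "norm u \<le> r"
  shows "emb e s z u /\<^sub>R norm (emb e s z u) \<in> closure (tube r)"
proof -
  let ?f = "\<lambda>(z, u). emb e s z u /\<^sub>R norm (emb e s z u)"
  have closure: "closure (sphere (0::complex) 1 \<times> ball (0::complex) r) = sphere 0 1 \<times> cball 0 r"
    using assms(1) by (simp add: closure_Times)
  have "?f ` closure (sphere 0 1 \<times> ball 0 r) \<subseteq> closure (tube r)"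
  proof (rule image_closure_subset)
    show "continuous_on (closure (sphere 0 1 \<times> ball 0 r)) ?f"
      unfolding closure by (rule continuous_on_normalised_emb)
  qed (simp_all add: tube_def closure_subset)
  moreover have "(z, u) \<in> sphere 0 1 \<times> cball 0 r"
    using assms by simp
  ultimately have "?f (z, u) \<in> closure (tube r)"
    unfolding closure by blast
  then show ?thesis
    by simp
qed

end

lemma inner_corner_u_top:
  shows "S \<subseteq> I \<Longrightarrow> 1/2 \<le> corner_u I \<bullet> corner_u S" "corner_u I \<bullet> corner_u I = 1"
proof -
  show "1/2 \<le> corner_u I \<bullet> corner_u S" if "S \<subseteq> I"
    using that unfolding corner_u_omega
    by (cases "1 \<in> S"; cases "2 \<in> S"; cases "1 \<in> I"; cases "2 \<in> I")
      (auto simp: inner_complex_def omega_Complex)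
  show "corner_u I \<bullet> corner_u I = 1"
    unfolding corner_u_omega by (auto simp: inner_complex_def omega_Complex)
qed

context growing
begin

lemma norm_eta_double_le:
  assumes "j < k" "3 \<le> k"
  shows "2 * norm (\<eta> j) \<le> norm (\<eta> k)"
proof -
  have "2 * \<bar>w j\<bar> \<le> w k \<and> 2 * \<bar>w (j + 1)\<bar> \<le> w (k + 1)"
  proof (cases j)
    case 0
    have double: "2 * w 2 \<le> w 3" "2 * w 1 \<le> w 2"
      using w_double_less[of 1] w_double_less[of 0] by (simp_all add: eval_nat_numeral)
    moreover have "w 3 \<le> w k" "w 2 \<le> w (k + 1)"
      using assms by (auto intro!: w_mono)
    moreover have "\<bar>w 0\<bar> \<le> w 2"
      using w_0_less sum_0_2_pos double by linarith
    ultimately show ?thesis using 0 w_1_pos by simp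
  next
    case (Suc i)
    then have "2 * w j \<le> w (j + 1)" "2 * w (j + 1) \<le> w (j + 2)"
      using w_double_less[of i] w_double_less[of j] by (simp_all add: eval_nat_numeral)
    moreover have "w (j + 1) \<le> w k" "w (j + 2) \<le> w (k + 1)"
      using assms by (auto intro!: w_mono)
    moreover have "0 < w j" "0 < w (j + 1)"
      using Suc by (auto intro: w_pos)
    ultimately show ?thesis by simp
  qed
  then have "(2 * \<bar>w j\<bar>)\<^sup>2 \<le> (w k)\<^sup>2" "(2 * \<bar>w (j + 1)\<bar>)\<^sup>2 \<le> (w (k + 1))\<^sup>2"
    by (intro power_mono; simp)+
  then have "(2 * norm (\<eta> j))\<^sup>2 \<le> (norm (\<eta> k))\<^sup>2"
    unfolding power_mult_distrib cmod_power2 eta_sel by simp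
  then show ?thesis by (rule power2_le_imp_le) simp
qed

lemma norm_eta_le_inner_corner_u:
  assumes "S \<subseteq> I" "n + card I \<le> k" "3 \<le> k"
  shows "norm (\<eta> (n + card S)) \<le> norm (\<eta> k) * (corner_u I \<bullet> corner_u S)"
proof (cases "S = I")
  case True
  have "norm (\<eta> (n + card I)) \<le> norm (\<eta> k)"
  proof (cases "n + card I = k")
    case False
    then show ?thesis
      using norm_eta_double_le[of "n + card I" k] assms(2,3) norm_ge_zero[of "\<eta> (n + card I)"] by linarith
  qed simp
  then show ?thesis using True inner_corner_u_top(2)[of I] by simp
next
  case False
  then have "card S < card I"
    using assms(1) by (intro psubset_card_mono) auto
  then have "2 * norm (\<eta> (n + card S)) \<le> norm (\<eta> k)"
    using assms(2,3) by (intro norm_eta_double_le) simp_all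
  moreover have "norm (\<eta> k) * (1/2) \<le> norm (\<eta> k) * (corner_u I \<bullet> corner_u S)"
    using inner_corner_u_top(1)[OF assms(1)] by (intro mult_left_mono) auto
  ultimately show ?thesis by simp
qed

lemma norm_le_if_mem_cell_cone:
  assumes v: "strip_cell k v I" and k: "3 \<le> k" and x: "emb e s z u \<in> convex_cone hull (corner v ` Pow I)"
  shows "norm z \<le> norm (\<eta> k) * norm u"
proof -
  obtain n where n: "coord_sum v = real n" "n + card I \<le> k"
    using v by (rule strip_cell_levelE)
  obtain c where c: "emb e s z u = (\<Sum>S\<in>Pow I. c S *\<^sub>R corner v S)" "\<forall>S\<in>Pow I. 0 \<le> c S"
    using convex_cone_hull_imageE[OF x] by auto
  let ?u = "\<Sum>S\<in>Pow I. c S *\<^sub>R corner_u S"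
  have zu: "z = z_phase v * (\<Sum>S\<in>Pow I. c S *\<^sub>R corner_z \<eta> n S)" "u = u_phase v * ?u"
    using c(1) unfolding sum_model_pt_corner[OF n(1)] emb_eq_iff by auto
  have "norm z = norm (\<Sum>S\<in>Pow I. c S *\<^sub>R corner_z \<eta> n S)"
    unfolding zu by (simp add: norm_mult)
  also have "\<dots> \<le> (\<Sum>S\<in>Pow I. c S * norm (\<eta> (n + card S)))"
    by (rule order_trans[OF norm_sum]) (use c(2) in \<open>auto simp: corner_z_def norm_mult intro!: sum_mono\<close>)
  also have "\<dots> \<le> (\<Sum>S\<in>Pow I. c S * (norm (\<eta> k) * (corner_u I \<bullet> corner_u S)))"
    using c(2) n(2) k by (intro sum_mono mult_left_mono norm_eta_le_inner_corner_u) auto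
  also have "\<dots> = norm (\<eta> k) * (corner_u I \<bullet> ?u)"
    by (simp add: inner_sum_right sum_distrib_left algebra_simps)
  also have "\<dots> \<le> norm (\<eta> k) * norm ?u"
  proof (rule mult_left_mono)
    have "norm (corner_u I) = 1"
      using inner_corner_u_top(2)[of I] by (simp add: norm_eq_1)
    then show "corner_u I \<bullet> ?u \<le> norm ?u"
      using norm_cauchy_schwarz[of "corner_u I" ?u] by simp
  qed simp
  also have "norm ?u = norm u"
    unfolding zu by (simp add: norm_mult)
  finally show ?thesis .
qed

lemma tube_disjoint_model:
  assumes k: "3 \<le> k"
  shows "tube (1 / norm (\<eta> k)) \<inter> \<Union>(model k) = {}"
proof (intro Int_emptyI)
  fix x assume "x \<in> tube (1 / norm (\<eta> k))" "x \<in> \<Union>(model k)"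
  then obtain z u v I where zu: "x = emb e s z u /\<^sub>R norm (emb e s z u)" "norm z = 1" "norm u < 1 / norm (\<eta> k)"
    and v: "strip_cell k v I" "x \<in> sph_hull (corner v ` Pow I)"
    by (auto simp: tube_def elim!: modelE)
  have "emb e s z u \<noteq> 0"
    using zu(2) by (auto simp: emb_eq_0_iff)
  then have "emb e s z u \<in> convex_cone hull (corner v ` Pow I)"
    using v(2) normalised_mem_sph_hull_iff unfolding zu(1) by blast
  then have "norm z \<le> norm (\<eta> k) * norm u"
    by (rule norm_le_if_mem_cell_cone[OF v(1) k])
  moreover have "0 < norm (\<eta> k)"
    using zu(3) norm_ge_zero[of u] by (cases "norm (\<eta> k) = 0") auto
  ultimately show False
    using zu(2,3) by (simp add: field_simps)
qed

lemma model_component: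
  assumes k: "3 \<le> k"
  shows "\<exists>Q\<in>components (S3eq - \<Union>(model k)). Clif 0 \<subseteq> Q \<and> closure Q \<inter> layer (model_lab e s \<eta>) k \<noteq> {}"
proof -
  define R where "R = norm (\<eta> k)"
  have R: "0 < R"
    using w_pos[of k] k by (auto simp: R_def complex_eq_iff)
  have "emb e s 1 0 \<in> Clif 0"
    using emb_Clif_iff(1)[of 1 0] by (simp add: emb_S3eq_iff)
  then have "tube (1 / R) \<noteq> {}"
    using Clif_0_subset_tube[of "1 / R"] R by auto
  moreover have "tube (1 / R) \<subseteq> S3eq - \<Union>(model k)"
    using tube_S3eq tube_disjoint_model[OF k] unfolding R_def by blast
  ultimately obtain Q where Q: "Q \<in> components (S3eq - \<Union>(model k))" "tube (1 / R) \<subseteq> Q"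
    using exists_component_superset[OF _ _ connected_tube] by blast
  let ?z = "(z_phase (axis_pt k) * \<eta> k) /\<^sub>R R" and ?u = "complex_of_real (1 / R)"
  have "R *\<^sub>R ?u = 1"
    using R by (simp add: scaleR_conv_of_real)
  then have "model_pt e s \<eta> (axis_pt k) = R *\<^sub>R emb e s ?z ?u"
    unfolding model_pt_def emb_scale using R by (simp add: coord_sum_axis_pt)
  then have "model_vertex (axis_pt k) = emb e s ?z ?u /\<^sub>R norm (emb e s ?z ?u)"
    unfolding model_vertex_def by (simp only: normalised_scaleR[OF R])
  moreover have "norm ?z = 1" "norm ?u \<le> 1 / R"
    using R by (simp_all add: norm_mult R_def[symmetric] norm_divide)
  ultimately have "model_vertex (axis_pt k) \<in> closure (tube (1 / R))"
    using closure_tubeI[of "1 / R" ?z ?u] R by simp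
  then have "model_vertex (axis_pt k) \<in> closure Q"
    using closure_mono[OF Q(2)] by blast
  moreover have "model_vertex (axis_pt k) \<in> layer (model_lab e s \<eta>) k"
    using model_vertex_layer_iff[OF int_points_axis_pt] by (simp add: coord_sum_axis_pt)
  moreover have "Clif 0 \<subseteq> Q"
    using Clif_0_subset_tube[of "1 / R"] R Q(2) by simp
  ultimately show ?thesis
    using Q(1) by blast
qed

lemma model_S3eq: "\<Union>(model k) \<subseteq> S3eq"
proof
  fix x assume "x \<in> \<Union>(model k)"
  then obtain v I where x: "x \<in> convex_cone hull (corner v ` Pow I)" "norm x = 1"
    by (auto elim!: modelE simp: sph_hull_def)
  then obtain c where "x = (\<Sum>S\<in>Pow I. c S *\<^sub>R corner v S)"
    using convex_cone_hull_imageE[OF x(1)] by auto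
  then have "x $ 5 = 0" by (simp add: model_pt_def)
  then show "x \<in> S3eq" using x(2) by (simp add: S3eq_def)
qed

lemma model_ideal:
  assumes "3 \<le> k"
  shows "ideal_cct k (model k) (model_lab e s \<eta>)"
  unfolding ideal_cct_def using model_transversal model_slope[of k] model_component[OF assms] assms by auto

lemma restr_model_Suc: "restr (model (k + 1)) (model_lab e s \<eta>) {0..k} = model k"
proof -
  have "restr (model (k + 1)) (model_lab e s \<eta>) {0..k} =
      insert {} {sph_hull (corner v ` Pow I) | v I. strip_cell k v I \<and> real 0 \<le> coord_sum v}"
    by (rule restr_model) simp
  also have "\<dots> = insert {} {sph_hull (corner v ` Pow I) | v I. strip_cell k v I}"
    by (auto simp: strip_cell_def)
  also have "\<dots> = model k"
  proof (intro equalityI subsetI)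
    fix P assume "P \<in> model k"
    then show "P \<in> insert {} {sph_hull (corner v ` Pow I) | v I. strip_cell k v I}"
      by (rule modelE) blast+
  qed (use model_empty model_cell in blast)
  finally show ?thesis .
qed

end

section \<open>Vertices and cells of a CCT\<close>

lemma empty_sph_face_of:
  assumes "sph_polytope P"
  shows "{} sph_face_of P"
proof -
  obtain a where "\<And>x. x \<in> P \<Longrightarrow> 0 < a \<bullet> x"
    using sph_polytope_pointed[OF assms] by blast
  then have "(\<forall>x\<in>P. 0 \<le> a \<bullet> x) \<and> {} = {x \<in> P. a \<bullet> x = 0}"
    by force
  then show ?thesis
    unfolding sph_face_of_def by blast
qed

lemma norm_sph_polytope: "sph_polytope P \<Longrightarrow> x \<in> P \<Longrightarrow> norm x = 1"
  by (auto simp: sph_polytope_def sph_hull_def)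

lemma ind_vec_eq_if_Lam_translate:
  assumes "l \<in> Lam" "v + ind_vec S = l + v + ind_vec A"
  shows "S = A"
  using assms by (intro ind_vec_diff_Lam_eq) (simp add: algebra_simps)

locale cct =
  fixes k :: nat and T :: "(real^5) set set" and \<phi> :: labelling
  assumes is_cct: "is_cct k T \<phi>"
begin

lemma lab_in: "C \<in> torus_complex k \<Longrightarrow> \<phi> C \<in> T"
  using is_cct by (auto simp: is_cct_def bij_betw_def)

lemma lab_onto: "P \<in> T \<Longrightarrow> \<exists>C\<in>torus_complex k. P = \<phi> C"
  using is_cct by (auto simp: is_cct_def bij_betw_def)

lemma lab_inj: "C \<in> torus_complex k \<Longrightarrow> D \<in> torus_complex k \<Longrightarrow> \<phi> C = \<phi> D \<Longrightarrow> C = D"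
  using is_cct by (auto simp: is_cct_def bij_betw_def inj_on_def)

lemma lab_le: "C \<in> torus_complex k \<Longrightarrow> D \<in> torus_complex k \<Longrightarrow> \<phi> C \<subseteq> \<phi> D \<longleftrightarrow> orbit_le C D"
  using is_cct by (auto simp: is_cct_def)

lemma polytopal: "polytopal_complex T"
  using is_cct by (auto simp: is_cct_def cubical_complex_def)

lemma face_in: "P \<in> T \<Longrightarrow> F sph_face_of P \<Longrightarrow> F \<in> T"
  using polytopal unfolding polytopal_complex_def by blast

lemma polytope: "P \<in> T \<Longrightarrow> sph_polytope P"
  using polytopal unfolding polytopal_complex_def by blast

lemma inter_face: "P \<in> T \<Longrightarrow> Q \<in> T \<Longrightarrow> (P \<inter> Q) sph_face_of Q"
  using polytopal unfolding polytopal_complex_def by blast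

lemma sub_face: "P \<in> T \<Longrightarrow> Q \<in> T \<Longrightarrow> P \<subseteq> Q \<Longrightarrow> P sph_face_of Q"
  using inter_face[of P Q] by (simp add: Int_absorb2)

lemma lab_cell_in: "strip_cell k v I \<Longrightarrow> \<phi> (orbit (cell v I)) \<in> T"
  by (rule lab_in[OF torus_complexI])

lemma lab_empty: "\<phi> (orbit {}) = {}"
proof -
  obtain C where C: "C \<in> torus_complex k" "{} = \<phi> C"
    using face_in[OF lab_in empty_sph_face_of[OF polytope[OF lab_in]]] orbit_empty_in lab_onto by metis
  then have "orbit_le C (orbit {})"
    using lab_le[OF C(1) orbit_empty_in] by blast
  then have "C = orbit {}"
    using C(1) not_orbit_le_empty by (metis torus_complexE)
  then show ?thesis
    using C(2) by simp
qed

lemma cctE: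
  assumes "P \<in> T" "P \<noteq> {}"
  obtains v I where "strip_cell k v I" "P = \<phi> (orbit (cell v I))"
  using lab_onto[OF assms(1)] assms(2) lab_empty by (metis torus_complexE)

lemma lab_cell_nonempty:
  assumes "strip_cell k v I"
  shows "\<phi> (orbit (cell v I)) \<noteq> {}"
  using lab_inj[OF torus_complexI[OF assms] orbit_empty_in] lab_empty orbit_cell_ne_empty by metis

lemma lab_face:
  assumes v: "strip_cell k v I" and AB: "A \<subseteq> B" "B \<subseteq> I"
  shows "\<phi> (orbit (cell (v + ind_vec A) (B - A))) sph_face_of \<phi> (orbit (cell v I))"
proof -
  note face = strip_cell_face[OF v AB]
  have "orbit_le (orbit (cell (v + ind_vec A) (B - A))) (orbit (cell v I))"
    unfolding orbit_le_cell_iff[OF strip_cell_int_points[OF face] strip_cell_int_points[OF v]]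
    using Lam_zero AB by (intro bexI[of _ 0] exI[of _ A]) auto
  then show ?thesis
    using lab_le[OF torus_complexI[OF face] torus_complexI[OF v]]
    by (intro sub_face lab_cell_in face v) simp
qed

lemma lab_faceE:
  assumes v: "strip_cell k v I" and F: "F sph_face_of \<phi> (orbit (cell v I))" "F \<noteq> {}"
  obtains A B where "A \<subseteq> B" "B \<subseteq> I" "F = \<phi> (orbit (cell (v + ind_vec A) (B - A)))"
proof -
  have "F \<in> T" "F \<subseteq> \<phi> (orbit (cell v I))"
    using face_in[OF lab_cell_in[OF v] F(1)] F(1) by (auto simp: sph_face_of_def)
  then obtain u J where u: "strip_cell k u J" "F = \<phi> (orbit (cell u J))"
    using F(2) by (blast elim: cctE)
  then have "orbit_le (orbit (cell u J)) (orbit (cell v I))"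
    using \<open>F \<subseteq> _\<close> lab_le[OF torus_complexI[OF u(1)] torus_complexI[OF v]] by simp
  then obtain l A where A: "l \<in> Lam" "u = l + v + ind_vec A" "A \<inter> J = {}" "A \<union> J \<subseteq> I"
    unfolding orbit_le_cell_iff[OF strip_cell_int_points[OF u(1)] strip_cell_int_points[OF v]] by blast
  have "orbit (cell u J) = orbit (cell (v + ind_vec A) ((A \<union> J) - A))"
    using orbit_translate[OF A(1), of "v + ind_vec A" J] A(2,3)
      by (simp add: add.assoc Un_Diff Diff_triv Int_commute)
  then show ?thesis
    using that[of A "A \<union> J"] A(4) u(2) by simp
qed

lemma lab_vertex_ex:
  assumes v: "strip_cell k v {}"
  shows "\<exists>x. \<phi> (orbit {v}) = {x}"
proof -
  have "{x. {x} sph_face_of \<phi> (orbit (cell v {}))} \<noteq> {}"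
    using sph_polytope_vertices[OF polytope[OF lab_cell_in[OF v]]] lab_cell_nonempty[OF v]
      by (metis sph_hull_empty)
  then obtain x where x: "{x} sph_face_of \<phi> (orbit (cell v {}))"
    by blast
  then show ?thesis
    by (rule lab_faceE[OF v]) auto
qed

definition vertex :: "real^3 \<Rightarrow> real^5" where
  "vertex v = the_elem (\<phi> (orbit {v}))"

lemma lab_vertex:
  assumes "strip_cell k v {}"
  shows "\<phi> (orbit {v}) = {vertex v}"
proof -
  obtain x where "\<phi> (orbit {v}) = {x}"
    using lab_vertex_ex[OF assms] by blast
  then show ?thesis
    by (simp add: vertex_def)
qed

lemma vertex_mem_iff:
  assumes u: "strip_cell k u {}" and v: "strip_cell k v I"
  shows "vertex u \<in> \<phi> (orbit (cell v I)) \<longleftrightarrow> (\<exists>l\<in>Lam. \<exists>A\<subseteq>I. u = l + v + ind_vec A)"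
proof -
  have "vertex u \<in> \<phi> (orbit (cell v I)) \<longleftrightarrow> \<phi> (orbit (cell u {})) \<subseteq> \<phi> (orbit (cell v I))"
    using lab_vertex[OF u] by simp
  also have "\<dots> \<longleftrightarrow> orbit_le (orbit (cell u {})) (orbit (cell v I))"
    by (rule lab_le[OF torus_complexI[OF u] torus_complexI[OF v]])
  also have "\<dots> \<longleftrightarrow> (\<exists>l\<in>Lam. \<exists>A\<subseteq>I. u = l + v + ind_vec A)"
    unfolding orbit_le_cell_iff[OF strip_cell_int_points[OF u] strip_cell_int_points[OF v]] by auto
  finally show ?thesis .
qed

lemma vertex_mem_face_iff:
  assumes v: "strip_cell k v I" and AB: "A \<subseteq> B" "B \<subseteq> I" and S: "S \<subseteq> I"
  shows "vertex (v + ind_vec S) \<in> \<phi> (orbit (cell (v + ind_vec A) (B - A))) \<longleftrightarrow> S \<in> {A..B}"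
  unfolding vertex_mem_iff[OF strip_cell_corner[OF v S] strip_cell_face[OF v AB]]
proof
  assume "\<exists>l\<in>Lam. \<exists>R\<subseteq>B - A. v + ind_vec S = l + (v + ind_vec A) + ind_vec R"
  then obtain l R where R: "l \<in> Lam" "R \<subseteq> B - A" "v + ind_vec S = l + (v + ind_vec A) + ind_vec R"
    by blast
  have "ind_vec (A \<union> R) = ind_vec A + ind_vec R"
    using R(2) by (intro ind_vec_Un) auto
  then have "S = A \<union> R"
    using R(3) by (intro ind_vec_eq_if_Lam_translate[OF R(1)]) (simp add: add.assoc)
  then show "S \<in> {A..B}"
    using R(2) AB(1) by auto
next
  assume "S \<in> {A..B}"
  then have "ind_vec S = ind_vec A + ind_vec (S - A)" "S - A \<subseteq> B - A"
    using ind_vec_Un[of A "S - A"] by (auto simp: Un_absorb1)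
  then show "\<exists>l\<in>Lam. \<exists>R\<subseteq>B - A. v + ind_vec S = l + (v + ind_vec A) + ind_vec R"
    using Lam_zero by (intro bexI[of _ 0] exI[of _ "S - A"]) (auto simp: add.assoc)
qed

lemma vertex_mem_cell: "strip_cell k v I \<Longrightarrow> S \<subseteq> I \<Longrightarrow> vertex (v + ind_vec S) \<in> \<phi> (orbit (cell v I))"
  using vertex_mem_face_iff[of v I "{}" I S] by simp

lemma inj_on_vertices:
  assumes v: "strip_cell k v I"
  shows "inj_on (\<lambda>S. vertex (v + ind_vec S)) (Pow I)"
proof (rule inj_onI)
  fix S S' assume S: "S \<in> Pow I" "S' \<in> Pow I" and eq: "vertex (v + ind_vec S) = vertex (v + ind_vec S')"
  have "vertex (v + ind_vec S') \<in> \<phi> (orbit (cell (v + ind_vec S') (S' - S')))"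
    using vertex_mem_face_iff[OF v order_refl, of S' S'] S(2) by simp
  then show "S = S'"
    using vertex_mem_face_iff[OF v order_refl, of S' S] S unfolding eq[symmetric] by simp
qed

lemma lab_vertices:
  assumes v: "strip_cell k v I"
  shows "{x} sph_face_of \<phi> (orbit (cell v I)) \<longleftrightarrow> (\<exists>S\<subseteq>I. x = vertex (v + ind_vec S))"
proof
  assume "{x} sph_face_of \<phi> (orbit (cell v I))"
  then obtain A B where AB: "A \<subseteq> B" "B \<subseteq> I" "{x} = \<phi> (orbit (cell (v + ind_vec A) (B - A)))"
    by (rule lab_faceE[OF v]) auto
  then have "vertex (v + ind_vec A) \<in> {x}"
    using vertex_mem_face_iff[OF v AB(1,2), of A] by simp
  then show "\<exists>S\<subseteq>I. x = vertex (v + ind_vec S)"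
    using AB(1,2) by auto
next
  assume "\<exists>S\<subseteq>I. x = vertex (v + ind_vec S)"
  then obtain S where S: "S \<subseteq> I" "x = vertex (v + ind_vec S)"
    by blast
  then show "{x} sph_face_of \<phi> (orbit (cell v I))"
    using lab_face[OF v order_refl S(1)] lab_vertex[OF strip_cell_corner[OF v S(1)]] by simp
qed

lemma lab_cell:
  assumes "strip_cell k v I"
  shows "\<phi> (orbit (cell v I)) = sph_hull ((\<lambda>S. vertex (v + ind_vec S)) ` Pow I)"
proof -
  have "{x. {x} sph_face_of \<phi> (orbit (cell v I))} = (\<lambda>S. vertex (v + ind_vec S)) ` Pow I"
    using lab_vertices[OF assms] by auto
  then show ?thesis
    using sph_polytope_vertices[OF polytope[OF lab_cell_in[OF assms]]] by simp
qed

lemma norm_vertex: "strip_cell k v {} \<Longrightarrow> norm (vertex v) = 1"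
  using norm_sph_polytope[OF polytope[OF lab_cell_in]] vertex_mem_cell[of v "{}" "{}"] by simp

lemma cell_pointed:
  assumes "strip_cell k v I"
  obtains a where "\<And>S. S \<subseteq> I \<Longrightarrow> 0 < a \<bullet> vertex (v + ind_vec S)"
  using sph_polytope_pointed[OF polytope[OF lab_cell_in[OF assms]]] vertex_mem_cell[OF assms] by metis

lemma cell_exposed_face:
  assumes v: "strip_cell k v I" and AB: "A \<subseteq> B" "B \<subseteq> I"
  obtains a where "\<And>S. S \<subseteq> I \<Longrightarrow> 0 \<le> a \<bullet> vertex (v + ind_vec S)"
    "\<And>S. S \<subseteq> I \<Longrightarrow> a \<bullet> vertex (v + ind_vec S) = 0 \<longleftrightarrow> S \<in> {A..B}"
proof -
  obtain a where a: "\<forall>x\<in>\<phi> (orbit (cell v I)). 0 \<le> a \<bullet> x"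
    "\<phi> (orbit (cell (v + ind_vec A) (B - A))) = {x \<in> \<phi> (orbit (cell v I)). a \<bullet> x = 0}"
    using lab_face[OF v AB] unfolding sph_face_of_def by blast
  show ?thesis
  proof (rule that)
    fix S assume S: "S \<subseteq> I"
    show "0 \<le> a \<bullet> vertex (v + ind_vec S)" "a \<bullet> vertex (v + ind_vec S) = 0 \<longleftrightarrow> S \<in> {A..B}"
      using a vertex_mem_cell[OF v S] vertex_mem_face_iff[OF v AB S] by auto
  qed
qed

lemma vertex_corresponds:
  assumes "corresponds k T \<phi> g f" "strip_cell k v {}" "strip_cell k (f v) {}"
    and "induced f (orbit (cell v {})) = orbit (cell (f v) {})"
  shows "vertex (f v) = g (vertex v)"
proof -
  have "g ` \<phi> (orbit {v}) = \<phi> (orbit {f v})"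
    using assms torus_complexI[OF assms(2)] by (simp add: corresponds_def)
  then show ?thesis
    using lab_vertex[OF assms(2)] lab_vertex[OF assms(3)] by simp
qed

end

section \<open>Square faces\<close>

lemma functional_on_independent:
  fixes B :: "'a::euclidean_space set" and f :: "'a \<Rightarrow> real"
  assumes "independent B"
  obtains b where "\<And>x. x \<in> B \<Longrightarrow> b \<bullet> x = f x"
proof -
  obtain g where g: "linear g" "\<forall>x\<in>B. g x = f x"
    using linear_independent_extend[OF assms, of f] by blast
  have "adjoint g 1 \<bullet> x = g x" for x
    using adjoint_works[OF g(1), of x 1] by (simp add: inner_commute)
  then show ?thesis using that g(2) by metis
qed

lemma opposite_signs:
  fixes x y f g :: real
  assumes "x * f + y * g = 0" "0 < f" "0 < g" "x \<noteq> 0 \<or> y \<noteq> 0"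
  shows "x * y < 0"
proof -
  have x: "x = - (y * g / f)"
    using assms(1,2) by (simp add: field_simps)
  then have "y \<noteq> 0"
    using assms(4) by auto
  then have "0 < y\<^sup>2 * g / f"
    using assms(2,3) by simp
  then show ?thesis
    unfolding x by (simp add: power2_eq_square field_simps)
qed

context cct
begin

text \<open>Otherwise two opposite corners would span an exposed face of the square.\<close>

lemma square_dependent:
  assumes v: "strip_cell k v {i, j}" and ij: "i \<noteq> j"
  shows "dependent ((\<lambda>S. vertex (v + ind_vec S)) ` Pow {i, j})"
proof (rule ccontr)
  let ?p = "\<lambda>S. vertex (v + ind_vec S)" and ?P = "\<phi> (orbit (cell v {i, j}))"
  assume independent: "independent (?p ` Pow {i, j})"
  obtain b where b: "\<And>x. x \<in> ?p ` Pow {i, j} \<Longrightarrow> b \<bullet> x = (if x \<in> {?p {}, ?p {i, j}} then 0 else 1)"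
    by (rule functional_on_independent[OF independent, of "\<lambda>x. if x \<in> {?p {}, ?p {i, j}} then 0 else 1"]) blast
  have nonneg: "0 \<le> b \<bullet> x" if "x \<in> ?P" for x
  proof (rule convex_cone_hull_face(1))
    show "x \<in> convex_cone hull (?p ` Pow {i, j})"
      using that lab_cell[OF v] by (simp add: sph_hull_def)
  qed (use b in auto)
  let ?F = "{x \<in> ?P. b \<bullet> x = 0}"
  have corner: "?p S \<in> ?F \<longleftrightarrow> S = {} \<or> S = {i, j}" if S: "S \<subseteq> {i, j}" for S
    using b[of "?p S"] inj_on_eq_iff[OF inj_on_vertices[OF v], of S "{}"]
        inj_on_eq_iff[OF inj_on_vertices[OF v], of S "{i, j}"]
      vertex_mem_cell[OF v S] S by auto
  have "?F sph_face_of ?P"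
    unfolding sph_face_of_def using nonneg by blast
  moreover have "?F \<noteq> {}"
    using corner[of "{}"] by blast
  ultimately obtain A B where AB: "A \<subseteq> B" "B \<subseteq> {i, j}" "?F = \<phi> (orbit (cell (v + ind_vec A) (B - A)))"
    by (rule lab_faceE[OF v])
  have "S \<in> {A..B} \<longleftrightarrow> S = {} \<or> S = {i, j}" if "S \<subseteq> {i, j}" for S
    using vertex_mem_face_iff[OF v AB(1,2) that] corner[OF that] unfolding AB(3) by blast
  from this[of "{}"] this[of "{i, j}"] this[of "{i}"] show False
    using ij by auto
qed

lemma face_relation_opposite_signs:
  assumes v: "strip_cell k v I" and relation: "(\<Sum>S\<in>Pow I. c S *\<^sub>R vertex (v + ind_vec S)) = 0"
    and face: "A \<subseteq> B" "B \<subseteq> I" "Pow I - {A..B} = {S, S'}" "S \<noteq> S'"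
    and nonzero: "c S \<noteq> 0 \<or> c S' \<noteq> 0"
  shows "c S * c S' < 0"
proof -
  let ?p = "\<lambda>S. vertex (v + ind_vec S)"
  obtain a where a: "\<And>S. S \<subseteq> I \<Longrightarrow> 0 \<le> a \<bullet> ?p S" "\<And>S. S \<subseteq> I \<Longrightarrow> a \<bullet> ?p S = 0 \<longleftrightarrow> S \<in> {A..B}"
    by (rule cell_exposed_face[OF v face(1,2)]) blast
  have "(\<Sum>S\<in>Pow I. c S * (a \<bullet> ?p S)) = 0"
    using arg_cong[OF relation, of "(\<bullet>) a"] by (simp only: inner_sum_right inner_scaleR_right inner_zero_right)
  moreover have "(\<Sum>S\<in>Pow I. c S * (a \<bullet> ?p S)) = (\<Sum>S\<in>{S, S'}. c S * (a \<bullet> ?p S))"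
    unfolding face(3)[symmetric] using a(2) by (intro sum.mono_neutral_right) auto
  moreover have "S \<in> Pow I - {A..B}" "S' \<in> Pow I - {A..B}"
    unfolding face(3) by simp_all
  then have "0 < a \<bullet> ?p S" "0 < a \<bullet> ?p S'"
    using a[of S] a[of S'] by (simp_all add: less_le)
  ultimately show ?thesis
    using face(4) nonzero by (intro opposite_signs[of _ "a \<bullet> ?p S" _ "a \<bullet> ?p S'"]) simp_all
qed

lemma square_diagonals_cross:
  assumes v: "strip_cell k v {i, j}" and ij: "i \<noteq> j"
  shows "diagonals_cross (vertex (v + ind_vec {})) (vertex (v + ind_vec {i, j}))
      (vertex (v + ind_vec {i})) (vertex (v + ind_vec {j}))"
proof -
  let ?p = "\<lambda>S. vertex (v + ind_vec S)"
  have "finite (?p ` Pow {i, j})"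
    by simp
  then obtain d where "\<exists>x\<in>?p ` Pow {i, j}. d x \<noteq> 0" "(\<Sum>x\<in>?p ` Pow {i, j}. d x *\<^sub>R x) = 0"
    using square_dependent[OF v ij] unfolding dependent_finite[OF \<open>finite _\<close>] by blast
  then obtain c where c: "\<exists>S\<in>Pow {i, j}. c S \<noteq> 0" "(\<Sum>S\<in>Pow {i, j}. c S *\<^sub>R ?p S) = 0"
    using sum.reindex[OF inj_on_vertices[OF v], of "\<lambda>x. d x *\<^sub>R x"] that[of "\<lambda>S. d (?p S)"] by auto
  have "c {j} * c {i, j} < 0" if "c {j} \<noteq> 0 \<or> c {i, j} \<noteq> 0"
    using that ij by (intro face_relation_opposite_signs[OF v c(2), of "{}" "{i}"]) auto
  moreover have "c {i} * c {i, j} < 0" if "c {i} \<noteq> 0 \<or> c {i, j} \<noteq> 0"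
    using that ij by (intro face_relation_opposite_signs[OF v c(2), of "{}" "{j}"]) auto
  moreover have "c {} * c {j} < 0" if "c {} \<noteq> 0 \<or> c {j} \<noteq> 0"
    using that ij by (intro face_relation_opposite_signs[OF v c(2), of "{i}" "{i, j}"]) auto
  moreover have "c {} * c {i} < 0" if "c {} \<noteq> 0 \<or> c {i} \<noteq> 0"
    using that ij by (intro face_relation_opposite_signs[OF v c(2), of "{j}" "{i, j}"]) auto
  moreover have "c {} \<noteq> 0 \<or> c {i} \<noteq> 0 \<or> c {j} \<noteq> 0 \<or> c {i, j} \<noteq> 0"
    using c(1) by (auto simp: Pow_insert)
  ultimately have signs: "0 < c {} * c {}" "c {} * c {i} < 0" "c {} * c {j} < 0" "0 < c {} * c {i, j}"
    by (auto simp: mult_less_0_iff zero_less_mult_iff)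
  have "(c {} *\<^sub>R ?p {} + c {i, j} *\<^sub>R ?p {i, j}) + (c {i} *\<^sub>R ?p {i} + c {j} *\<^sub>R ?p {j}) = 0"
    using c(2) ij by (simp add: Pow_insert insert_commute add_ac)
  then have "c {} *\<^sub>R ?p {} + c {i, j} *\<^sub>R ?p {i, j} = - (c {i} *\<^sub>R ?p {i} + c {j} *\<^sub>R ?p {j})"
    by (rule eq_neg_iff_add_eq_0[THEN iffD2])
  then have "c {} *\<^sub>R (c {} *\<^sub>R ?p {} + c {i, j} *\<^sub>R ?p {i, j}) =
      c {} *\<^sub>R - (c {i} *\<^sub>R ?p {i} + c {j} *\<^sub>R ?p {j})"
    by (rule arg_cong)
  then have "(c {} * c {}) *\<^sub>R ?p {} + (c {} * c {i, j}) *\<^sub>R ?p {i, j} =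
      (- (c {} * c {i})) *\<^sub>R ?p {i} + (- (c {} * c {j})) *\<^sub>R ?p {j}"
    by (simp add: scaleR_add_right scaleR_right_diff_distrib)
  then show ?thesis
    by (rule diagonals_crossI) (use signs in simp_all)
qed

end

section \<open>Transversal CCTs\<close>

locale transversal_cct =
  fixes k :: nat and T :: "(real^5) set set" and \<phi> :: labelling
  assumes transversal_T: "transversal k T \<phi>" and two_le_k: "2 \<le> k" and in_S3eq: "\<Union>T \<subseteq> S3eq"
begin

sublocale cct k T \<phi>
  using transversal_T by unfold_locales (auto simp: transversal_def symmetric_cct_def)

lemma transversal2_restr:
  assumes "j + 2 \<le> k"
  shows "transversal2 (restr T \<phi> {j..j + 2}) (shift_lab j \<phi>)"
proof -
  have "{j, j + 1, j + 1 + 1} = {j..j + 2}"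
    by auto
  then show ?thesis
    using transversal_T[unfolded transversal_def, THEN conjunct2, rule_format, of "j + 1"] assms by simp
qed

lemma cell_in_restr:
  assumes v: "strip_cell k v I" and layers: "real j \<le> coord_sum v" "coord_sum v + card I \<le> real (j + 2)"
  shows "\<phi> (orbit (cell v I)) \<in> restr T \<phi> {j..j + 2}"
proof -
  have "x \<in> (\<Union>l\<in>{j..j + 2}. layer \<phi> l)" if "{x} sph_face_of \<phi> (orbit (cell v I))" for x
  proof -
    obtain S where S: "S \<subseteq> I" "x = vertex (v + ind_vec S)"
      using lab_vertices[OF v] \<open>{x} sph_face_of _\<close> by blast
    note corner = strip_cell_corner[OF v S(1)]
    obtain n where n: "coord_sum (v + ind_vec S) = real n"
      using corner by (rule strip_cell_levelE)
    have "card S \<le> card I"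
      using S(1) by (simp add: card_mono)
    then have "real j \<le> real n" "real n \<le> real (j + 2)"
      using layers n by auto
    then have "n \<in> {j..j + 2}"
      by (simp only: of_nat_le_iff atLeastAtMost_iff)
    moreover have "x \<in> layer \<phi> n"
      using lab_vertex[OF corner] S n strip_cell_int_points[OF corner] unfolding layer_def by blast
    ultimately show ?thesis by blast
  qed
  then show ?thesis
    using lab_cell_in[OF v] by (simp add: restr_def induced_subcomplex_def)
qed

lemma square_avoids_Clif:
  assumes v: "strip_cell k v I" "card I \<le> 2" and x: "x \<in> \<phi> (orbit (cell v I))"
  shows "x \<in> S3eq" "x \<notin> Clif 0" "x \<notin> Clif 2"
proof -
  obtain n where n: "coord_sum v = real n" "n + card I \<le> k"
    using v(1) by (rule strip_cell_levelE)
  define j where "j = min n (k - 2)"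
  have "j + 2 \<le> k" "j \<le> n" "n + card I \<le> j + 2"
    using two_le_k n(2) v(2) by (auto simp: j_def)
  then have "\<phi> (orbit (cell v I)) \<in> restr T \<phi> {j..j + 2}"
    using v(1) n(1) by (intro cell_in_restr) auto
  then have "x \<in> S3eq - (Clif 0 \<union> Clif 2)"
    using transversal2_restr[OF \<open>j + 2 \<le> k\<close>] x unfolding transversal2_def by blast
  then show "x \<in> S3eq" "x \<notin> Clif 0" "x \<notin> Clif 2" by auto
qed

lemma vertex_equivariant:
  assumes "strip_cell k v {}"
  shows "vertex (vector [1, -1, 0] + v) = (r34 \<circ> r34) (vertex v)"
      "vertex (vector [0, -1, 1] + v) = (r34 \<circ> r12) (vertex v)"
    "vertex (swap12 v) = refl4 (vertex v)"
proof -
  have "symmetric_cct k T \<phi>"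
    using transversal_T by (simp add: transversal_def)
  then have corresponds: "corresponds k T \<phi> (r34 \<circ> r34) ((+) (vector [1, -1, 0]))"
    "corresponds k T \<phi> (r34 \<circ> r12) ((+) (vector [0, -1, 1]))" "corresponds k T \<phi> refl4 swap12"
    by (simp_all add: symmetric_cct_def)
  have translate: "strip_cell k (vector [1, -1, 0] + v) {}" "strip_cell k (vector [0, -1, 1] + v) {}"
    using assms strip_cell_translate translation_vectors by blast+
  have swap: "strip_cell k (swap12 v) {}" "induced swap12 (orbit (cell v {})) = orbit (cell (swap12 v) {})"
    using strip_cell_swap[of k v "{}"] assms induced_swap12[of v "{}"] by simp_all
  show "vertex (vector [1, -1, 0] + v) = (r34 \<circ> r34) (vertex v)"
    using corresponds(1) assms translate(1) induced_translate_cell by (rule vertex_corresponds)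
  show "vertex (vector [0, -1, 1] + v) = (r34 \<circ> r12) (vertex v)"
    using corresponds(2) assms translate(2) induced_translate_cell by (rule vertex_corresponds)
  show "vertex (swap12 v) = refl4 (vertex v)"
    using corresponds(3) assms swap by (rule vertex_corresponds)
qed

end

section \<open>Coordinates for a transversal CCT\<close>

lemma axis_pt_step: "axis_pt l + ind_vec {3} = axis_pt (l + 1)"
  by (simp add: vec_eq_iff forall_3)

lemma S3eq_Clif_0I:
  assumes "x \<in> S3eq" "x $ 3 = 0" "x $ 4 = 0"
  shows "x \<in> Clif 0"
proof -
  have "x $ 5 = 0" "norm x = 1" using assms(1) by (auto simp: S3eq_def)
  then have "x \<bullet> x = 1" by (simp add: norm_eq_1)
  then show ?thesis using assms \<open>x $ 5 = 0\<close>
    by (simp add: Clif_def inner_vec_def sum_5 power2_eq_square)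
qed

lemma isometry_inj:
  assumes "linear f" "\<And>x. norm (f x) = norm x" "f x = f y"
  shows "x = y"
proof -
  have "norm (f (x - y)) = 0" using assms(1,3) by (simp add: linear_diff)
  then show ?thesis unfolding assms(2) by simp
qed

lemma int_translates:
  fixes t :: "'a::real_vector"
  assumes "\<And>u. P (t + u) \<longleftrightarrow> P u"
  shows "P (of_int a *\<^sub>R t + u) \<longleftrightarrow> P u"
proof (induction a rule: int_induct[of _ 0])
  case base
  then show ?case by simp
next
  case (step1 i)
  have "of_int (i + 1) *\<^sub>R t + u = t + (of_int i *\<^sub>R t + u)" by (simp add: algebra_simps)
  then show ?case using step1 assms by metis
next
  case (step2 i)
  have "t + (of_int (i - 1) *\<^sub>R t + u) = of_int i *\<^sub>R t + u" by (simp add: algebra_simps)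
  then show ?case using step2 assms by metis
qed

lemma diagonals_cross_emb:
  assumes cross: "diagonals_cross (r *\<^sub>R emb e s z u) (r' *\<^sub>R emb e s z' u')
      (t *\<^sub>R emb e s y x) (t' *\<^sub>R emb e s y' x')"
    and e: "frame e s" and pos: "0 < r" "0 < r'" "0 < t" "0 < t'"
  shows "diagonals_cross (z, u) (z', u') (y, x) (y', x')"
proof -
  interpret frame e s by fact
  obtain \<alpha> \<beta> \<gamma> \<delta> where c: "0 < \<alpha>" "0 < \<beta>" "0 < \<gamma>" "0 < \<delta>"
    "\<alpha> *\<^sub>R r *\<^sub>R emb e s z u + \<beta> *\<^sub>R r' *\<^sub>R emb e s z' u' =
        \<gamma> *\<^sub>R t *\<^sub>R emb e s y x + \<delta> *\<^sub>R t' *\<^sub>R emb e s y' x'"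
    using cross by (rule diagonals_crossE)
  have "(\<alpha> * r) *\<^sub>R (z, u) + (\<beta> * r') *\<^sub>R (z', u') = (\<gamma> * t) *\<^sub>R (y, x) + (\<delta> * t') *\<^sub>R (y', x')"
    using c(5) unfolding scaleR_scaleR emb_scale emb_add emb_eq_iff by simp
  then show ?thesis
    by (rule diagonals_crossI) (use c(1-4) pos in simp_all)
qed

context transversal_cct
begin

lemma vertex_S3eq: "strip_cell k v {} \<Longrightarrow> vertex v \<in> S3eq" "strip_cell k v {} \<Longrightarrow> vertex v \<notin> Clif 0"
  using square_avoids_Clif[of v "{}" "vertex v"] lab_vertex by simp_all

definition axis_vertex :: "nat \<Rightarrow> real^5" where
  "axis_vertex l = vertex (axis_pt l)"

definition axis_radius :: "nat \<Rightarrow> real" where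
  "axis_radius l = \<bar>axis_vertex l $ 3\<bar>"

definition axis_sign :: real where
  "axis_sign = sgn (axis_vertex 0 $ 3)"

definition axis_z :: "nat \<Rightarrow> complex" where
  "axis_z l = cis (- (pi / 2 * l)) * (Complex (axis_vertex l $ 1)
      (axis_vertex l $ 2) / of_real (axis_radius l))"

lemma axis_vertex_nth_4:
  assumes "l \<le> k"
  shows "axis_vertex l $ 4 = 0"
proof -
  have "strip_cell k (axis_pt l) {}"
    using assms by (intro strip_cell_axis_pt) simp
  moreover have "swap12 (axis_pt l) = axis_pt l"
    by (simp add: vec_eq_iff forall_3)
  ultimately have "refl4 (axis_vertex l) = axis_vertex l"
    using vertex_equivariant(3)[of "axis_pt l"] by (simp add: axis_vertex_def)
  then have "refl4 (axis_vertex l) $ 4 = axis_vertex l $ 4"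
    by simp
  then show ?thesis
    by (simp add: refl4_def)
qed

lemma axis_vertex_nth_3_nonzero: "l \<le> k \<Longrightarrow> axis_vertex l $ 3 \<noteq> 0"
  using S3eq_Clif_0I[of "axis_vertex l"] vertex_S3eq[OF strip_cell_axis_pt[of l "{}" k]]
      axis_vertex_nth_4[of l] by (auto simp: axis_vertex_def)

lemma axis_radius_pos: "l \<le> k \<Longrightarrow> 0 < axis_radius l"
  using axis_vertex_nth_3_nonzero by (simp add: axis_radius_def)

text \<open>Otherwise the edge between the two vertices would meet the circle \<^term>\<open>Clif 0\<close>.\<close>

lemma axis_vertex_nth_3_same_sign:
  assumes l: "l + 1 \<le> k"
  shows "sgn (axis_vertex (l + 1) $ 3) = sgn (axis_vertex l $ 3)"
proof (rule ccontr)
  assume opposite: "sgn (axis_vertex (l + 1) $ 3) \<noteq> sgn (axis_vertex l $ 3)"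
  have nth: "axis_vertex l $ 3 \<noteq> 0" "axis_vertex (l + 1) $ 3 \<noteq> 0"
      "axis_vertex l $ 4 = 0" "axis_vertex (l + 1) $ 4 = 0"
    using axis_vertex_nth_3_nonzero axis_vertex_nth_4 l by simp_all
  have radius: "0 < axis_radius l" "0 < axis_radius (l + 1)"
    using axis_radius_pos l by simp_all
  have edge: "strip_cell k (axis_pt l) {3}"
    using l by (intro strip_cell_axis_pt) simp
  let ?p = "\<lambda>S. vertex (axis_pt l + ind_vec S)"
  have p: "?p {} = axis_vertex l" "?p {3} = axis_vertex (l + 1)"
    unfolding axis_pt_step by (simp_all add: axis_vertex_def)
  define y where "y = axis_radius (l + 1) *\<^sub>R axis_vertex l + axis_radius l *\<^sub>R axis_vertex (l + 1)"
  obtain a where a: "\<And>S. S \<subseteq> {3} \<Longrightarrow> 0 < a \<bullet> ?p S"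
    using cell_pointed[OF edge] by blast
  have "0 < a \<bullet> y"
    unfolding y_def inner_add_right inner_scaleR_right p[symmetric]
    using radius a[of "{}"] a[of "{3}"] by (intro add_pos_pos mult_pos_pos) auto
  then have "y \<noteq> 0"
    by auto
  moreover have "?p S \<in> ?p ` Pow {3}" if "S \<subseteq> {3}" for S
    using that by blast
  from this[of "{}"] this[of "{3}"] have "y \<in> convex_cone hull (?p ` Pow {3})"
    unfolding y_def p using radius by (intro convex_cone_hull_add convex_cone_hull_mul hull_inc) auto
  ultimately have mem: "y /\<^sub>R norm y \<in> \<phi> (orbit (cell (axis_pt l) {3}))"
    unfolding lab_cell[OF edge] by (rule normalised_mem_sph_hull_iff[THEN iffD2])
  have "y $ 3 = 0" "y $ 4 = 0"
    unfolding y_def using opposite nth by (auto simp: axis_radius_def sgn_if abs_if split: if_splits)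
  then have "y /\<^sub>R norm y \<in> Clif 0"
    using square_avoids_Clif(1)[OF edge _ mem] by (intro S3eq_Clif_0I) auto
  then show False
    using square_avoids_Clif(2)[OF edge _ mem] by simp
qed

lemma axis_vertex_nth_3:
  assumes "l \<le> k"
  shows "axis_vertex l $ 3 = axis_sign * axis_radius l"
proof -
  have "sgn (axis_vertex l $ 3) = axis_sign"
    using assms by (induction l) (use axis_vertex_nth_3_same_sign in \<open>auto simp: axis_sign_def\<close>)
  then show ?thesis
    unfolding axis_radius_def by (metis mult.commute abs_mult_sgn)
qed

lemma axis_sign_square: "axis_sign * axis_sign = 1"
  using axis_vertex_nth_3_nonzero[of 0] by (simp add: axis_sign_def sgn_if)

lemma frame_axis_sign: "norm c = 1 \<Longrightarrow> frame c axis_sign"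
  using axis_sign_square by (simp add: frame_def)

lemma axis_vertex_model_pt:
  assumes l: "l \<le> k"
  shows "axis_vertex l = axis_radius l *\<^sub>R model_pt 1 axis_sign axis_z (axis_pt l)"
proof -
  have "cis (pi / 2 * l) * axis_z l = Complex (axis_vertex l $ 1) (axis_vertex l $ 2) / of_real (axis_radius l)"
    unfolding axis_z_def mult.assoc[symmetric] cis_mult by simp
  then have "model_pt 1 axis_sign axis_z (axis_pt l) =
      emb 1 axis_sign (Complex (axis_vertex l $ 1) (axis_vertex l $ 2) / of_real (axis_radius l)) 1"
    by (simp add: model_pt_def coord_sum_axis_pt)
  moreover have "axis_vertex l $ 5 = 0"
    using vertex_S3eq(1)[OF strip_cell_axis_pt[of l "{}" k]] l by (simp add: axis_vertex_def S3eq_def)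
  ultimately show ?thesis
    using l axis_vertex_nth_4[OF l] axis_vertex_nth_3[OF l] axis_radius_pos[OF l]
      by (simp add: vec_eq_iff forall_5)
qed

lemma vertex_model_pt_translate:
  assumes t: "t \<in> int_points" "coord_sum t = 0" and f: "linear f" "\<And>x. norm (f x) = norm x"
    and model: "f (model_pt 1 axis_sign axis_z u) = model_pt 1 axis_sign axis_z (t + u)"
    and vertex: "strip_cell k u {} \<Longrightarrow> vertex (t + u) = f (vertex u)"
  shows "strip_cell k (t + u) {} \<and> vertex (t + u) = r *\<^sub>R model_pt 1 axis_sign axis_z (t + u) \<longleftrightarrow>
    strip_cell k u {} \<and> vertex u = r *\<^sub>R model_pt 1 axis_sign axis_z u"
proof -
  have "vertex (t + u) = r *\<^sub>R model_pt 1 axis_sign axis_z (t + u) \<longleftrightarrow>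
      vertex u = r *\<^sub>R model_pt 1 axis_sign axis_z u"
    if "strip_cell k u {}"
    unfolding vertex[OF that] model[symmetric] linear_scale[OF f(1), symmetric] using isometry_inj[OF f]
      by metis
  then show ?thesis
    unfolding strip_cell_translate[OF t] by blast
qed

lemma vertex_model_pt:
  assumes v: "strip_cell k v {}" "coord_sum v = real n"
  shows "vertex v = axis_radius n *\<^sub>R model_pt 1 axis_sign axis_z v"
proof -
  define G where "G u \<longleftrightarrow> strip_cell k u {} \<and> vertex u = axis_radius n *\<^sub>R model_pt 1 axis_sign axis_z u" for u
  have r34_r34: "G (vector [1, -1, 0] + u) \<longleftrightarrow> G u" for u
    unfolding G_def
    by (rule vertex_model_pt_translate translation_vectors r34_r34_isometry
        r34_r34_model_pt vertex_equivariant(1))+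
  have r34_r12: "G (vector [0, -1, 1] + u) \<longleftrightarrow> G u" for u
    unfolding G_def
    by (rule vertex_model_pt_translate translation_vectors r34_r12_isometry
        r34_r12_model_pt vertex_equivariant(2))+
  have n: "n \<le> k"
    using v by (simp add: strip_cell_def)
  obtain i\<^sub>1 i\<^sub>2 i\<^sub>3 :: int where i: "v $ 1 = i\<^sub>1" "v $ 2 = i\<^sub>2" "v $ 3 = i\<^sub>3"
    using int_pointsE[OF strip_cell_int_points[OF v(1)]] .
  have "real_of_int i\<^sub>1 + real_of_int i\<^sub>2 + real_of_int i\<^sub>3 = real n"
    using v(2) i by (simp add: coord_sum_def)
  then have "v = of_int i\<^sub>1 *\<^sub>R vector [1, -1, 0] + (of_int (i\<^sub>3 - int n) *\<^sub>R vector [0, -1, 1] + axis_pt n)"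
    by (simp add: vec_eq_iff forall_3 i)
  moreover have "G (axis_pt n)"
    using strip_cell_axis_pt[of n "{}" k] n axis_vertex_model_pt[OF n] unfolding G_def axis_vertex_def by simp
  ultimately have "G v"
    using int_translates[of G, OF r34_r34] int_translates[of G, OF r34_r12] by metis
  then show ?thesis
    by (simp add: G_def)
qed

lemma vertex_axis_corner:
  assumes "l + card S \<le> k"
  shows "vertex (axis_pt l + ind_vec S) =
      axis_radius (l + card S) *\<^sub>R emb (cis (pi / 2 * l)) axis_sign (corner_z axis_z l S) (corner_u S)"
proof -
  have "strip_cell k (axis_pt l + ind_vec S) {}"
    using strip_cell_corner[OF strip_cell_axis_pt[of l S k], of S] assms by simp
  moreover have "coord_sum (axis_pt l + ind_vec S) = real (l + card S)"
    by (simp add: coord_sum_axis_pt)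
  ultimately have "vertex (axis_pt l + ind_vec S) =
      axis_radius (l + card S) *\<^sub>R model_pt 1 axis_sign axis_z (axis_pt l + ind_vec S)"
    by (rule vertex_model_pt)
  then show ?thesis
    unfolding model_pt_corner[OF coord_sum_axis_pt] by (simp add: emb_rotate)
qed

lemma axis_square_diagonals_cross:
  assumes l: "l + 2 \<le> k" and ij: "i \<noteq> j"
  shows "diagonals_cross (corner_z axis_z l {}, corner_u {}) (corner_z axis_z l {i, j}, corner_u {i, j})
    (corner_z axis_z l {i}, corner_u {i}) (corner_z axis_z l {j}, corner_u {j})"
proof (rule diagonals_cross_emb)
  have "strip_cell k (axis_pt l) {i, j}"
    using l ij by (intro strip_cell_axis_pt) simp
  then show "diagonals_cross (axis_radius l *\<^sub>R emb (cis (pi / 2 * l)) axis_sign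
      (corner_z axis_z l {}) (corner_u {}))
      (axis_radius (l + 2) *\<^sub>R emb (cis (pi / 2 * l)) axis_sign (corner_z axis_z l {i, j}) (corner_u {i, j}))
      (axis_radius (l + 1) *\<^sub>R emb (cis (pi / 2 * l)) axis_sign (corner_z axis_z l {i}) (corner_u {i}))
      (axis_radius (l + 1) *\<^sub>R emb (cis (pi / 2 * l)) axis_sign (corner_z axis_z l {j}) (corner_u {j}))"
    using square_diagonals_cross[of "axis_pt l" i j] ij l vertex_axis_corner[of l "{}"]
        vertex_axis_corner[of l "{i}"]
      vertex_axis_corner[of l "{j}"] vertex_axis_corner[of l "{i, j}"] by simp
qed (use l frame_axis_sign axis_radius_pos in simp_all)

lemma axis_z_recurrence:
  assumes l: "l + 2 \<le> k"
  shows "\<exists>b>0. axis_z (l + 2) = 2 * axis_z (l + 1) + of_real b * (2 * axis_z (l + 1) - axis_z l)"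
proof -
  have "diagonals_cross (corner_z axis_z l {}, corner_u {}) (corner_z axis_z l {1, 2}, corner_u {1, 2})
      (corner_z axis_z l {1}, corner_u {1}) (corner_z axis_z l {2}, corner_u {2})"
    using l by (rule axis_square_diagonals_cross) simp
  then obtain a b c d :: real where pos: "0 < a" "0 < b"
    and z: "a *\<^sub>R axis_z l + b *\<^sub>R axis_z (l + 2) = c *\<^sub>R axis_z (l + 1) + d *\<^sub>R axis_z (l + 1)"
    and u: "a *\<^sub>R 1 + b *\<^sub>R 1 = c *\<^sub>R Complex (1/2) (sqrt 3 / 2) + d *\<^sub>R Complex (1/2) (- sqrt 3 / 2)"
    by (rule diagonals_crossE) (auto simp: corner_z_simps corner_u_simps)
  have "c = d" "c / 2 + d / 2 = a + b"
    using arg_cong[OF u, of Im] arg_cong[OF u, of Re] by simp_all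
  then have "c = a + b" "d = a + b"
    by simp_all
  then have "b *\<^sub>R axis_z (l + 2) = b *\<^sub>R (2 * axis_z (l + 1)) + a *\<^sub>R (2 * axis_z (l + 1) - axis_z l)"
    using z by (simp add: complex_eq_iff algebra_simps)
  also have "\<dots> = b *\<^sub>R (2 * axis_z (l + 1) + of_real (a / b) * (2 * axis_z (l + 1) - axis_z l))"
    using pos by (simp add: complex_eq_iff field_simps)
  finally have "axis_z (l + 2) = 2 * axis_z (l + 1) + of_real (a / b) * (2 * axis_z (l + 1) - axis_z l)"
    using pos by (simp only: scaleR_cancel_left) simp
  then show ?thesis
    using pos by (intro exI[of _ "a / b"]) simp
qed

definition axis_gap :: "nat \<Rightarrow> complex" where
  "axis_gap l = axis_z l - \<i> * axis_z (l + 1)"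

lemma axis_gap_ratio:
  assumes l: "l + 2 \<le> k"
  shows "\<exists>\<rho>>0. axis_gap (l + 1) = of_real \<rho> * axis_gap l"
proof -
  have "diagonals_cross (corner_z axis_z l {}, corner_u {}) (corner_z axis_z l {1, 3}, corner_u {1, 3})
      (corner_z axis_z l {1}, corner_u {1}) (corner_z axis_z l {3}, corner_u {3})"
    using l by (rule axis_square_diagonals_cross) simp
  then obtain a b c d :: real where pos: "0 < a" "0 < b"
    and z: "a *\<^sub>R axis_z l + b *\<^sub>R (\<i> * axis_z (l + 2)) = c *\<^sub>R axis_z (l + 1) + d *\<^sub>R (\<i> * axis_z (l + 1))"
    and u: "a *\<^sub>R 1 + b *\<^sub>R Complex (1/2) (sqrt 3 / 2) = c *\<^sub>R Complex (1/2) (sqrt 3 / 2) + d *\<^sub>R 1"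
    by (rule diagonals_crossE) (auto simp: corner_z_simps corner_u_simps)
  have "b = c" "a + b / 2 = c / 2 + d"
    using arg_cong[OF u, of Im] arg_cong[OF u, of Re] by simp_all
  then have "c = b" "d = a"
    by simp_all
  then have "b *\<^sub>R axis_gap (l + 1) = a *\<^sub>R axis_gap l"
    using z by (simp add: axis_gap_def complex_eq_iff algebra_simps numeral_2_eq_2)
  also have "\<dots> = b *\<^sub>R (of_real (a / b) * axis_gap l)"
    using pos by (simp add: complex_eq_iff)
  finally have "axis_gap (l + 1) = of_real (a / b) * axis_gap l"
    using pos by (simp only: scaleR_cancel_left) simp
  then show ?thesis
    using pos by (intro exI[of _ "a / b"]) simp
qed

lemma axis_gap_0_nonzero: "axis_gap 0 \<noteq> 0"
proof
  assume "axis_gap 0 = 0"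
  then have eq: "\<i> * axis_z 1 = axis_z 0"
    by (simp add: axis_gap_def)
  have edge: "strip_cell k (axis_pt 0) {3}"
    using two_le_k by (intro strip_cell_axis_pt) simp
  define q where "q = emb 1 axis_sign (axis_z 0) 1"
  have p: "vertex (axis_pt 0 + ind_vec {}) = axis_radius 0 *\<^sub>R q"
      "vertex (axis_pt 0 + ind_vec {3}) = axis_radius 1 *\<^sub>R q"
    using vertex_axis_corner[of 0 "{}"] vertex_axis_corner[of 0 "{3}"] two_le_k eq
    unfolding corner_z_simps corner_u_simps by (simp_all add: q_def)
  have "norm (axis_radius 0 *\<^sub>R q) = 1" "norm (axis_radius 1 *\<^sub>R q) = 1"
    using norm_vertex[OF strip_cell_corner[OF edge, of "{}"]]
        norm_vertex[OF strip_cell_corner[OF edge, of "{3}"]]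
    unfolding p by simp_all
  then have "axis_radius 0 * norm q = 1" "axis_radius 1 * norm q = 1"
    using axis_radius_pos[of 0] axis_radius_pos[of 1] two_le_k by simp_all
  then have "axis_radius 0 = axis_radius 1"
    by (metis mult_cancel_right mult_zero_right zero_neq_one)
  then have "vertex (axis_pt 0 + ind_vec {3}) = vertex (axis_pt 0 + ind_vec {})"
    unfolding p by simp
  then show False
    using inj_onD[OF inj_on_vertices[OF edge], of "{3}" "{}"] by simp
qed

definition axis_phase :: complex where
  "axis_phase = sgn (axis_gap 0)"

lemma norm_axis_phase: "norm axis_phase = 1"
  using axis_gap_0_nonzero by (simp add: axis_phase_def norm_sgn)

lemma axis_gap_phase:
  assumes "l + 1 \<le> k"
  shows "\<exists>q>0. axis_gap l / axis_phase = of_real q"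
  using assms
proof (induction l)
  case 0
  have "axis_gap 0 / axis_phase = of_real (norm (axis_gap 0))"
    using axis_gap_0_nonzero by (simp add: axis_phase_def sgn_eq)
  then show ?case
    using axis_gap_0_nonzero by (intro exI[of _ "norm (axis_gap 0)"]) simp
next
  case (Suc l)
  then obtain q where q: "0 < q" "axis_gap l / axis_phase = of_real q"
    by auto
  obtain \<rho> where \<rho>: "0 < \<rho>" "axis_gap (l + 1) = of_real \<rho> * axis_gap l"
    using axis_gap_ratio[of l] Suc.prems by auto
  have "axis_gap (Suc l) / axis_phase = of_real \<rho> * (axis_gap l / axis_phase)"
    using \<rho>(2) by simp
  then have "axis_gap (Suc l) / axis_phase = of_real (\<rho> * q)"
    unfolding q(2) by simp
  then show ?case
    using q(1) \<rho>(1) by (intro exI[of _ "\<rho> * q"]) simp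
qed

text \<open>Dividing out the common phase of the gaps turns the \<open>axis_z l\<close> into consecutive pairs of
  one real sequence.\<close>

definition axis_w :: "nat \<Rightarrow> real" where
  "axis_w l = (if l \<le> k then Re (axis_z l / axis_phase) else Im (axis_z k / axis_phase))"

lemma eta_axis_w:
  assumes "l \<le> k"
  shows "eta axis_w l = axis_z l / axis_phase"
proof -
  have "Im (axis_z l / axis_phase) = axis_w (l + 1)"
  proof (cases "l = k")
    case False
    then obtain q where q: "axis_gap l / axis_phase = of_real q"
      using axis_gap_phase[of l] assms by auto
    have "Im (axis_z l / axis_phase - \<i> * (axis_z (l + 1) / axis_phase)) = Im (axis_gap l / axis_phase)"
      by (simp add: axis_gap_def diff_divide_distrib)
    then have "Im (axis_z l / axis_phase) = Re (axis_z (l + 1) / axis_phase)"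
      unfolding q by (simp del: times_divide_eq_right)
    then show ?thesis
      using False assms by (simp add: axis_w_def)
  qed (simp add: axis_w_def)
  then show ?thesis
    using assms by (simp add: complex_eq_iff axis_w_def)
qed

lemma axis_w_sum_pos:
  assumes "l + 1 \<le> k"
  shows "0 < axis_w l + axis_w (l + 2)"
proof -
  obtain q where q: "0 < q" "axis_gap l / axis_phase = of_real q"
    using axis_gap_phase[OF assms] by blast
  have "axis_gap l / axis_phase = eta axis_w l - \<i> * eta axis_w (l + 1)"
    using assms by (simp add: axis_gap_def eta_axis_w diff_divide_distrib)
  then have "eta axis_w l - \<i> * eta axis_w (l + 1) = of_real q"
    using q(2) by simp
  from arg_cong[OF this, of Re] q(1) show ?thesis
    by simp
qed

lemma axis_w_recurrence:
  assumes l: "l + 2 \<le> k"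
  shows "\<exists>b>0. axis_w (l + 2) = 2 * axis_w (l + 1) + b * (2 * axis_w (l + 1) - axis_w l) \<and>
    axis_w (l + 3) = 2 * axis_w (l + 2) + b * (2 * axis_w (l + 2) - axis_w (l + 1))"
proof -
  obtain b where b: "0 < b" "axis_z (l + 2) = 2 * axis_z (l + 1) + of_real b * (2 * axis_z (l + 1) - axis_z l)"
    using axis_z_recurrence[OF l] by blast
  have "eta axis_w (l + 2) = 2 * eta axis_w (l + 1) + of_real b * (2 * eta axis_w (l + 1) - eta axis_w l)"
    using l b(2) by (simp add: eta_axis_w add_divide_distrib diff_divide_distrib right_diff_distrib)
  from arg_cong[OF this, of Re] arg_cong[OF this, of Im] b(1) show ?thesis
    by (intro exI[of _ b]) (simp add: eval_nat_numeral)
qed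

lemma vertex_axis_w:
  assumes v: "strip_cell k v {}"
  shows "vertex v = axis_radius (nat \<lfloor>coord_sum v\<rfloor>) *\<^sub>R model_pt axis_phase axis_sign (eta axis_w) v"
    "0 < axis_radius (nat \<lfloor>coord_sum v\<rfloor>)"
proof -
  obtain n where n: "coord_sum v = real n" "n + card ({} :: 3 set) \<le> k"
    using v by (rule strip_cell_levelE)
  then have "axis_z n = axis_phase * eta axis_w n"
    using eta_axis_w[of n] norm_axis_phase by auto
  then have "model_pt 1 axis_sign axis_z v = model_pt axis_phase axis_sign (eta axis_w) v"
    using n emb_rotate[of 1 axis_sign axis_phase] by (simp add: model_pt_def mult.left_commute)
  then show "vertex v = axis_radius (nat \<lfloor>coord_sum v\<rfloor>) *\<^sub>R model_pt axis_phase axis_sign (eta axis_w) v"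
    using vertex_model_pt[OF v n(1)] n by simp
  show "0 < axis_radius (nat \<lfloor>coord_sum v\<rfloor>)"
    using axis_radius_pos n by simp
qed

lemma lab_axis_w:
  assumes "C \<in> torus_complex k"
  shows "\<phi> C = model_lab axis_phase axis_sign (eta axis_w) C"
  using assms
proof (cases rule: torus_complexE)
  case 1
  then show ?thesis
    using lab_empty by simp
next
  case (2 v I)
  let ?r = "\<lambda>S. axis_radius (nat \<lfloor>coord_sum (v + ind_vec S)\<rfloor>)"
    and ?p = "\<lambda>S. model_pt axis_phase axis_sign (eta axis_w) (v + ind_vec S)"
  have "(\<lambda>S. vertex (v + ind_vec S)) ` Pow I = (\<lambda>S. ?r S *\<^sub>R ?p S) ` Pow I"
    using vertex_axis_w(1)[OF strip_cell_corner[OF 2(1)]] by (intro image_cong) auto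
  moreover have "sph_hull ((\<lambda>S. ?r S *\<^sub>R ?p S) ` Pow I) = sph_hull (?p ` Pow I)"
    using vertex_axis_w(2)[OF strip_cell_corner[OF 2(1)]] by (intro sph_hull_rescale) auto
  ultimately show ?thesis
    unfolding 2(2) lab_cell[OF 2(1)] model_lab_cell by (simp only:)
qed

end

section \<open>Sign conditions imposed by transversality\<close>

locale coordinate_cct = transversal_cct k T \<phi> + frame e s
  for k T \<phi> and e :: complex and s :: real +
  fixes w :: "nat \<Rightarrow> real"
  assumes lab: "C \<in> torus_complex k \<Longrightarrow> \<phi> C = model_lab e s (eta w) C"
    and sum_pos: "l + 1 \<le> k \<Longrightarrow> 0 < w l + w (l + 2)"
    and recurrence: "l + 2 \<le> k \<Longrightarrow> \<exists>b>0. w (l + 2) = 2 * w (l + 1) + b * (2 * w (l + 1) - w l) \<and>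
       w (l + 3) = 2 * w (l + 2) + b * (2 * w (l + 2) - w (l + 1))"
begin

abbreviation \<eta> :: "nat \<Rightarrow> complex" where "\<eta> \<equiv> eta w"

abbreviation cell_cone :: "real^3 \<Rightarrow> 3 set \<Rightarrow> (real^5) set" where
  "cell_cone v I \<equiv> convex_cone hull ((\<lambda>S. model_pt e s \<eta> (v + ind_vec S)) ` Pow I)"

lemma lab_sph_hull: "strip_cell k v I \<Longrightarrow> \<phi> (orbit (cell v I)) =
    sph_hull ((\<lambda>S. model_pt e s \<eta> (v + ind_vec S)) ` Pow I)"
  using lab[OF torus_complexI] by (simp add: model_lab_cell)

lemma normalised_mem_lab_iff:
  "strip_cell k v I \<Longrightarrow> y \<noteq> 0 \<Longrightarrow> y /\<^sub>R norm y \<in> \<phi> (orbit (cell v I)) \<longleftrightarrow> y \<in> cell_cone v I"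
  unfolding lab_sph_hull by (rule normalised_mem_sph_hull_iff)

lemma cell_cone_z_nonzero:
  assumes v: "strip_cell k v I" "card I \<le> 2" and E: "frame E s"
    and y: "emb E s z u \<in> cell_cone v I" and u: "u \<noteq> 0"
  shows "z \<noteq> 0"
proof
  interpret E: frame E s by fact
  assume z: "z = 0"
  let ?y = "emb E s z u"
  have "?y \<noteq> 0"
    using u by (simp add: E.emb_eq_0_iff)
  then have mem: "?y /\<^sub>R norm ?y \<in> \<phi> (orbit (cell v I))"
    using normalised_mem_lab_iff[OF v(1)] y by blast
  have "?y /\<^sub>R norm ?y = emb E s 0 (u /\<^sub>R norm ?y)"
    using z by (simp add: emb_scale)
  then show False
    using square_avoids_Clif(1,3)[OF v mem] E.emb_Clif_iff(2) by metis
qed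

lemma cell_cone_ray_unique:
  assumes E: "frame E s" and j: "j + 2 \<le> k"
    and v: "strip_cell k v I" "real j \<le> coord_sum v" "coord_sum v + card I \<le> real (j + 2)"
    and v': "strip_cell k v' I'" "real j \<le> coord_sum v'" "coord_sum v' + card I' \<le> real (j + 2)"
    and y: "emb E s z u \<in> cell_cone v I" and y': "emb E s (a *\<^sub>R z) (b *\<^sub>R u) \<in> cell_cone v' I'"
    and ab: "0 < a" "0 < b" and u: "u \<noteq> 0"
  shows "a = b"
proof -
  interpret E: frame E s by fact
  have z: "z \<noteq> 0"
    using v(2,3) by (intro cell_cone_z_nonzero[OF v(1) _ E y u]) simp
  let ?y = "emb E s z u" and ?y' = "emb E s (a *\<^sub>R z) (b *\<^sub>R u)"
  define r r' where "r = inverse (norm ?y)" and "r' = inverse (norm ?y')"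
  have nonzero: "?y \<noteq> 0" "?y' \<noteq> 0"
    using u ab by (simp_all add: E.emb_eq_0_iff)
  then have r: "0 < r" "0 < r'"
    by (simp_all add: r_def r'_def)
  have "r *\<^sub>R ?y \<in> \<Union>(restr T \<phi> {j..j + 2})" "r' *\<^sub>R ?y' \<in> \<Union>(restr T \<phi> {j..j + 2})"
    using normalised_mem_lab_iff[OF v(1) nonzero(1)] cell_in_restr[OF v] y
      normalised_mem_lab_iff[OF v'(1) nonzero(2)] cell_in_restr[OF v'] y' unfolding r_def r'_def by blast+
  moreover have scaled: "r *\<^sub>R ?y = emb E s (r *\<^sub>R z) (r *\<^sub>R u)"
      "r' *\<^sub>R ?y' = emb E s ((r' * a) *\<^sub>R z) ((r' * b) *\<^sub>R u)"
    by (simp_all add: emb_scale)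
  then have "proj1 (r *\<^sub>R ?y) = proj1 (r' *\<^sub>R ?y')"
    using E.proj1_emb_scale r ab by simp
  ultimately have "r *\<^sub>R ?y = r' *\<^sub>R ?y'"
    using transversal2_restr[OF j] unfolding transversal2_def by (meson inj_onD)
  then have "r *\<^sub>R z = (r' * a) *\<^sub>R z" "r *\<^sub>R u = (r' * b) *\<^sub>R u"
    unfolding scaled E.emb_eq_iff by blast+
  then have "r' * a = r' * b"
    using z u by (metis scaleR_cancel_right)
  then show ?thesis
    using r by simp
qed

abbreviation e_turn :: "nat \<Rightarrow> complex" where "e_turn l \<equiv> e * cis (pi / 2 * l)"

lemma frame_e_turn: "frame (e_turn l) s"
  using norm_e s_square by (simp add: frame_def norm_mult)

lemma model_pt_axis: "model_pt e s \<eta> (axis_pt l + ind_vec S) = emb (e_turn l) s (corner_z \<eta> l S) (corner_u S)"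
  unfolding model_pt_corner[OF coord_sum_axis_pt] by (simp add: emb_rotate)

lemma square_mem:
  assumes "0 \<le> c\<^sub>0" "0 \<le> c\<^sub>1" "0 \<le> c\<^sub>2" "0 \<le> c\<^sub>3"
  shows "emb (e_turn l) s
    (c\<^sub>0 *\<^sub>R corner_z \<eta> l {} + c\<^sub>1 *\<^sub>R corner_z \<eta> l {i} +
        c\<^sub>2 *\<^sub>R corner_z \<eta> l {j} + c\<^sub>3 *\<^sub>R corner_z \<eta> l {i, j})
    (c\<^sub>0 *\<^sub>R corner_u {} + c\<^sub>1 *\<^sub>R corner_u {i} + c\<^sub>2 *\<^sub>R corner_u {j} + c\<^sub>3 *\<^sub>R corner_u {i, j})
        \<in> cell_cone (axis_pt l) {i, j}"
proof -
  have "emb (e_turn l) s (corner_z \<eta> l S) (corner_u S) \<in> cell_cone (axis_pt l) {i, j}" if "S \<subseteq> {i, j}" for S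
    unfolding model_pt_axis[symmetric] using that by (intro hull_inc) blast
  then show ?thesis
    unfolding emb_add[symmetric] emb_scale[symmetric]
    using assms by (intro convex_cone_hull_add convex_cone_hull_mul) auto
qed

lemma square_12_mem:
  assumes "0 \<le> a" "0 \<le> c" "0 \<le> c'" "0 \<le> d"
  shows "emb (e_turn l) s (a *\<^sub>R \<eta> l + (c + c') *\<^sub>R \<eta> (l + 1) + d *\<^sub>R \<eta> (l + 2))
    (sector_pt (a + d) c + of_real c' * cnj omega) \<in> cell_cone (axis_pt l) {1, 2}"
  using square_mem[OF assms, of l 1 2]
  by (simp add: corner_z_simps corner_u_omega sector_pt_def scaleR_conv_of_real algebra_simps)

lemma square_13_mem:
  assumes "0 \<le> a" "0 \<le> c" "0 \<le> a'" "0 \<le> c'"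
  shows "emb (e_turn l) s (a *\<^sub>R \<eta> l + c *\<^sub>R \<eta> (l + 1) + \<i> * (a' *\<^sub>R \<eta> (l + 1) + c' *\<^sub>R \<eta> (l + 2)))
    (sector_pt (a + a') (c + c')) \<in> cell_cone (axis_pt l) {1, 3}"
  using square_mem[OF assms, of l 1 3]
  by (simp add: corner_z_simps corner_u_omega sector_pt_def scaleR_conv_of_real algebra_simps)

lemma square_13_section_mem:
  assumes zero: "(1 - t) * w (l + 1) + t * w (l + 2) = 0" and t: "0 \<le> t" "t \<le> 1" and pq: "0 \<le> p" "0 \<le> q"
  shows "emb (e_turn l) s (of_real (p * ((1 - t) * w l + t * w (l + 1)) -
      q * ((1 - t) * w (l + 2) + t * w (l + 3))))
    ((p + q) *\<^sub>R sector_pt (1 - t) t) \<in> cell_cone (axis_pt l) {1, 3}" (is "emb _ _ (of_real ?x) _ \<in> _")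
proof -
  have "(p * (1 - t)) *\<^sub>R \<eta> l + (p * t) *\<^sub>R \<eta> (l + 1) +
      \<i> * ((q * (1 - t)) *\<^sub>R \<eta> (l + 1) + (q * t) *\<^sub>R \<eta> (l + 2)) = of_real ?x"
    (is "?z = _")
  proof (rule complex_eqI)
    have "Im ?z = (p + q) * ((1 - t) * w (l + 1) + t * w (l + 2))"
      by (simp add: algebra_simps)
    then show "Im ?z = Im (of_real ?x)"
      using zero by simp
  qed (simp add: eval_nat_numeral algebra_simps)
  moreover have "sector_pt (p * (1 - t) + q * (1 - t)) (p * t + q * t) = (p + q) *\<^sub>R sector_pt (1 - t) t"
    by (simp add: sector_pt_scaleR algebra_simps)
  ultimately show ?thesis
    using square_13_mem[of "p * (1 - t)" "p * t" "q * (1 - t)" "q * t" l] t pq by simp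
qed

text \<open>At a zero of the interpolation the square on the axes 1 and 3 would meet one ray twice, or the
  circle \<^term>\<open>Clif 2\<close>.\<close>

lemma w_interpolation_nonzero:
  assumes l: "l + 2 \<le> k" and t: "0 \<le> t" "t \<le> 1"
  shows "(1 - t) * w (l + 1) + t * w (l + 2) \<noteq> 0"
proof
  assume zero: "(1 - t) * w (l + 1) + t * w (l + 2) = 0"
  have square: "strip_cell k (axis_pt l) {1, 3}"
    using l by (intro strip_cell_axis_pt) simp
  define X Y U where "X = (1 - t) * w l + t * w (l + 1)" and "Y = (1 - t) * w (l + 2) + t * w (l + 3)"
    and "U = sector_pt (1 - t) t"
  have U: "U \<noteq> 0"
    unfolding U_def using t by (intro sector_pt_nonzero) auto
  have "0 < w l + w (l + 2)" "0 < w (l + 1) + w (l + 3)"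
    using sum_pos[of l] sum_pos[of "l + 1"] l by (simp_all add: eval_nat_numeral)
  then have "0 < (1 - t) * (w l + w (l + 2)) + t * (w (l + 1) + w (l + 3))"
    using t by (cases "t = 0") (auto intro!: add_nonneg_pos)
  then have XY: "0 < X + Y"
    by (simp add: X_def Y_def algebra_simps)
  have mem: "emb (e_turn l) s (of_real (p * X - q * Y)) ((p + q) *\<^sub>R U) \<in> cell_cone (axis_pt l) {1, 3}"
      if "0 \<le> p" "0 \<le> q" for p q
    unfolding X_def Y_def U_def by (rule square_13_section_mem[OF zero t that])
  have nonzero: "p * X - q * Y \<noteq> 0" if "0 \<le> p" "0 \<le> q" "0 < p + q" for p q
    using cell_cone_z_nonzero[OF square _ frame_e_turn mem[OF that(1,2)]] U that(3)
    by (auto simp del: of_real_diff of_real_mult)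
  have "X \<noteq> 0" "Y \<noteq> 0"
    using nonzero[of 1 0] nonzero[of 0 1] by auto
  moreover have "\<not> (0 < X \<and> 0 < Y)"
    using nonzero[of Y X] by (auto simp: mult.commute)
  ultimately have neg: "0 < - Y / X"
    using XY by (auto simp: zero_less_divide_iff divide_less_0_iff)
  have mem_X: "emb (e_turn l) s (of_real X) U \<in> cell_cone (axis_pt l) {1, 3}"
    and mem_Y: "emb (e_turn l) s ((- Y / X) *\<^sub>R of_real X) (1 *\<^sub>R U) \<in> cell_cone (axis_pt l) {1, 3}"
    using mem[of 1 0] mem[of 0 1] \<open>X \<noteq> 0\<close> by (simp_all add: scaleR_conv_of_real)
  have "- Y / X = 1"
    by (rule cell_cone_ray_unique[OF frame_e_turn l square _ _ square _ _ mem_X mem_Y neg _ U])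
        (simp_all add: coord_sum_axis_pt)
  then have "X + Y = 0"
    using \<open>X \<noteq> 0\<close> by (simp add: field_simps)
  then show False
    using XY by simp
qed

lemma w_positive:
  assumes l: "l + 2 \<le> k"
  shows "0 < w (l + 1) \<and> 0 < w (l + 2)"
proof -
  have "0 < w (l + 1) * w (l + 2)"
  proof (rule ccontr)
    assume opposite: "\<not> 0 < w (l + 1) * w (l + 2)"
    have nonzero: "w (l + 1) \<noteq> 0" "w (l + 2) \<noteq> 0"
      using w_interpolation_nonzero[OF l, of 0] w_interpolation_nonzero[OF l, of 1] by simp_all
    define t where "t = w (l + 1) / (w (l + 1) - w (l + 2))"
    have t: "w (l + 1) - w (l + 2) \<noteq> 0" "0 \<le> t" "t \<le> 1"
      using opposite nonzero by (auto simp: t_def divide_simps zero_less_mult_iff)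
    then have "(1 - t) * w (l + 1) + t * w (l + 2) = 0"
      by (simp add: t_def field_simps)
    then show False
      using w_interpolation_nonzero[OF l t(2,3)] by blast
  qed
  then consider "0 < w (l + 1)" "0 < w (l + 2)" | "w (l + 1) < 0" "w (l + 2) < 0"
    by (auto simp: zero_less_mult_iff)
  then show ?thesis
  proof cases
    case 2
    obtain b where b: "0 < b" "w (l + 2) = 2 * w (l + 1) + b * (2 * w (l + 1) - w l)"
      "w (l + 3) = 2 * w (l + 2) + b * (2 * w (l + 2) - w (l + 1))"
      using recurrence[OF l] by blast
    have "0 < w l" "0 < w (l + 3)"
      using sum_pos[of l] sum_pos[of "l + 1"] l 2 by (simp_all add: eval_nat_numeral)
    then have "b * (2 * w (l + 1) - w l) < 0" "0 < b * (2 * w (l + 2) - w (l + 1))"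
      using b 2 by (auto simp: mult_less_0_iff)
    then have "w (l + 2) < 2 * w (l + 1)" "w (l + 1) < 2 * w (l + 2)"
      using b(1,2) by (auto simp: zero_less_mult_iff)
    then show ?thesis using 2 by simp
  qed simp
qed

lemma w_determinant_step:
  assumes "l + 2 \<le> k"
  shows "\<exists>b>0. w (l + 2) * w (l + 2) - w (l + 1) * w (l + 3) = b * (w (l + 1) * w (l + 1) - w l * w (l + 2))"
proof -
  obtain b where b: "0 < b" "w (l + 2) = 2 * w (l + 1) + b * (2 * w (l + 1) - w l)"
    "w (l + 3) = 2 * w (l + 2) + b * (2 * w (l + 2) - w (l + 1))"
    using recurrence[OF assms] by blast
  have "y * y - x * (2 * y + b * (2 * y - x)) = b * (x * x - u * y)"
      if "y = 2 * x + b * (2 * x - u)" for u x y :: real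
    unfolding that by algebra
  from this[OF b(2)] show ?thesis
    using b(1) unfolding b(3) by blast
qed

lemma eta_axis_mem:
  shows "emb (e_turn l) s (\<eta> l) 1 \<in> cell_cone (axis_pt l) {1, 2}"
    "emb (e_turn l) s (2 *\<^sub>R \<eta> (l + 1)) 1 \<in> cell_cone (axis_pt l) {1, 2}"
    "emb (e_turn l) s (\<eta> (l + 2)) 1 \<in> cell_cone (axis_pt l) {1, 2}"
  using square_12_mem[of 1 0 0 0 l] square_12_mem[of 0 1 1 0 l] square_12_mem[of 0 0 0 1 l]
  by (simp_all add: sector_pt_def cnj_omega)

lemma edge_3_mem:
  assumes "0 < w l + w (l + 2)" and z: "Im z = w (l + 1)" "- w (l + 2) \<le> Re z" "Re z \<le> w l"
  shows "emb (e_turn l) s z 1 \<in> cell_cone (axis_pt l) {1, 3}"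
proof -
  define a where "a = (Re z + w (l + 2)) / (w l + w (l + 2))"
  have a: "0 \<le> a" "a \<le> 1" "a * (w l + w (l + 2)) = Re z + w (l + 2)"
    using assms by (simp_all add: a_def)
  have "a *\<^sub>R \<eta> l + \<i> * ((1 - a) *\<^sub>R \<eta> (l + 1)) = z"
  proof (rule complex_eqI)
    have "Re (a *\<^sub>R \<eta> l + \<i> * ((1 - a) *\<^sub>R \<eta> (l + 1))) = a * (w l + w (l + 2)) - w (l + 2)"
      by (simp add: algebra_simps)
    then show "Re (a *\<^sub>R \<eta> l + \<i> * ((1 - a) *\<^sub>R \<eta> (l + 1))) = Re z"
      unfolding a(3) by simp
  qed (simp add: z(1) algebra_simps)
  then show ?thesis
    using square_13_mem[of a 0 "1 - a" 0 l] a by (simp add: sector_pt_def)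
qed

lemma w_determinant_nonzero:
  assumes l: "l + 2 \<le> k" and w: "0 < w l"
  shows "w l * w (l + 2) \<noteq> w (l + 1) * w (l + 1)"
proof
  assume zero: "w l * w (l + 2) = w (l + 1) * w (l + 1)"
  have pos: "0 < w (l + 1)" "0 < w (l + 2)"
    using w_positive[OF l] by auto
  define \<tau> where "\<tau> = w (l + 2) / w l"
  have \<tau>: "0 < \<tau>" "w (l + 2) = \<tau> * w l"
    using pos w by (simp_all add: \<tau>_def)
  have "w (l + 2) * w (l + 2) = w (l + 1) * w (l + 3)"
    using w_determinant_step[OF l] zero by auto
  moreover have "w (l + 2) * w (l + 2) = \<tau> * (w l * w (l + 2))"
    using \<tau>(2) by simp
  ultimately have "w (l + 1) * w (l + 3) = w (l + 1) * (\<tau> * w (l + 1))"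
    unfolding zero by simp
  then have "\<eta> (l + 2) = \<tau> *\<^sub>R \<eta> l"
    using pos \<tau>(2) by (simp add: complex_eq_iff eval_nat_numeral)
  then have mem: "emb (e_turn l) s (\<tau> *\<^sub>R \<eta> l) (1 *\<^sub>R 1) \<in> cell_cone (axis_pt l) {1, 2}"
    using eta_axis_mem(3)[of l] by simp
  have square: "strip_cell k (axis_pt l) {1, 2}"
    using l by (intro strip_cell_axis_pt) simp
  have "\<tau> = 1"
    by (rule cell_cone_ray_unique[OF frame_e_turn l square _ _ square _ _ eta_axis_mem(1) mem \<tau>(1)])
      (simp_all add: coord_sum_axis_pt)
  then have "w (l + 2) = w l" "w (l + 1) = w l"
    using \<tau>(2) zero w pos power2_eq_imp_eq[of "w (l + 1)" "w l"] by (simp_all add: power2_eq_square)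
  moreover obtain b where "0 < b" "w (l + 2) = 2 * w (l + 1) + b * (2 * w (l + 1) - w l)"
    using recurrence[OF l] by blast
  ultimately have "w l + b * w l = 0" "0 < b"
    by (simp_all add: algebra_simps)
  then show False
    using w by (simp add: add_nonneg_eq_0_iff)
qed

text \<open>A larger \<open>w l\<close> would force \<open>w (l + 1) = 2 w (l + 2)\<close>, and a vertex of layer \<open>l + 2\<close> to lie in
  the square on the axes 1 and 3, of which it is no corner.\<close>

lemma eta_not_mem_square_13:
  assumes l: "l + 2 \<le> k"
  shows "emb (e_turn l) s (\<eta> (l + 2)) 1 \<notin> cell_cone (axis_pt l) {1, 3}"
proof
  assume "emb (e_turn l) s (\<eta> (l + 2)) 1 \<in> cell_cone (axis_pt l) {1, 3}"
  have squares: "strip_cell k (axis_pt l) {1, 2}" "strip_cell k (axis_pt l) {1, 3}"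
    using l by (auto intro!: strip_cell_axis_pt)
  have "model_pt e s \<eta> (axis_pt l + ind_vec {1, 2}) \<in> cell_cone (axis_pt l) {1, 3}"
    using \<open>emb (e_turn l) s (\<eta> (l + 2)) 1 \<in> _\<close> unfolding model_pt_axis corner_z_simps corner_u_simps .
  moreover have nonzero: "model_pt e s \<eta> (axis_pt l + ind_vec {1, 2}) \<noteq> 0"
    unfolding model_pt_axis corner_u_simps frame.emb_eq_0_iff[OF frame_e_turn] by simp
  moreover have corner: "strip_cell k (axis_pt l + ind_vec {1, 2}) {}"
    using strip_cell_corner[OF squares(1), of "{1, 2}"] by simp
  then have "{vertex (axis_pt l + ind_vec {1, 2})} = sph_hull {model_pt e s \<eta> (axis_pt l + ind_vec {1, 2})}"
    using lab_vertex lab_sph_hull[OF corner] by simp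
  ultimately have "vertex (axis_pt l + ind_vec {1, 2}) \<in> \<phi> (orbit (cell (axis_pt l) {1, 3}))"
    using normalised_mem_lab_iff[OF squares(2)] sph_hull_singleton[OF nonzero] by simp
  then obtain l' A where A: "l' \<in> Lam" "A \<subseteq> {1, 3}" "axis_pt l + ind_vec {1, 2} = l' + axis_pt l + ind_vec A"
    using vertex_mem_iff[OF corner squares(2)] by blast
  then have "{1, 2} = A"
    by (intro ind_vec_eq_if_Lam_translate[OF A(1,3)])
  then show False
    using A(2) by auto
qed

lemma w_determinant_not_greater:
  assumes l: "l + 2 \<le> k"
  shows "\<not> w (l + 1) * w (l + 1) < w l * w (l + 2)"
proof
  assume greater: "w (l + 1) * w (l + 1) < w l * w (l + 2)"
  have pos: "0 < w (l + 1)" "0 < w (l + 2)"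
    using w_positive[OF l] by auto
  have squares: "strip_cell k (axis_pt l) {1, 2}" "strip_cell k (axis_pt l) {1, 3}"
    using l by (auto intro!: strip_cell_axis_pt)
  have sum: "0 < w l + w (l + 2)"
    using sum_pos l by simp
  define r where "r = w (l + 1) / w (l + 2)"
  have r: "0 < r" "r * w (l + 2) = w (l + 1)"
    using pos by (simp_all add: r_def)
  have less: "r * w (l + 1) < w l"
    using greater pos by (simp add: r_def field_simps)
  have "- w (l + 2) \<le> r * w (l + 1)"
    using mult_pos_pos[OF r(1) pos(1)] pos(2) by linarith
  then have mem: "emb (e_turn l) s (r *\<^sub>R \<eta> (l + 1)) 1 \<in> cell_cone (axis_pt l) {1, 3}"
    using r less pos by (intro edge_3_mem[OF sum]) simp_all
  have mem': "emb (e_turn l) s ((2 / r) *\<^sub>R (r *\<^sub>R \<eta> (l + 1))) (1 *\<^sub>R 1) \<in> cell_cone (axis_pt l) {1, 2}"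
    using eta_axis_mem(2) r by simp
  have "2 / r = 1"
    by (rule cell_cone_ray_unique[OF frame_e_turn l squares(2) _ _ squares(1) _ _ mem mem'])
      (use r in \<open>simp_all add: coord_sum_axis_pt\<close>)
  then have "r = 2"
    using r by (simp add: field_simps)
  then have double: "w (l + 1) = 2 * w (l + 2)"
    using r by simp
  then have "w (l + 3) = w (l + 1)"
    using recurrence[OF l] by auto
  then have "emb (e_turn l) s (\<eta> (l + 2)) 1 \<in> cell_cone (axis_pt l) {1, 3}"
    using less double pos \<open>r = 2\<close> by (intro edge_3_mem[OF sum]) (simp_all add: eval_nat_numeral)
  then show False
    using eta_not_mem_square_13[OF l] by simp
qed

lemma w_determinant_less:
  assumes l: "l + 2 \<le> k"
  shows "w l * w (l + 2) < w (l + 1) * w (l + 1)"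
proof (cases "0 < w l")
  case True
  then show ?thesis
    using w_determinant_nonzero[OF l] w_determinant_not_greater[OF l] by linarith
next
  case False
  then have "w l * w (l + 2) \<le> 0" "0 < w (l + 1) * w (l + 1)"
    using w_positive[OF l] by (simp_all add: mult_nonpos_nonneg)
  then show ?thesis by linarith
qed

end

section \<open>The growing case\<close>

fun solution :: "real \<Rightarrow> real \<Rightarrow> real \<Rightarrow> nat \<Rightarrow> real" where
  "solution b x y 0 = x"
| "solution b x y (Suc 0) = y"
| "solution b x y (Suc (Suc n)) = 2 * solution b x y (Suc n) +
    b * (2 * solution b x y (Suc n) - solution b x y n)"

lemma model_lab_cong:
  assumes C: "C \<in> torus_complex k" and h: "\<And>n. n \<le> k \<Longrightarrow> h n = h' n"
  shows "model_lab e s h C = model_lab e s h' C"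
  using C
proof (cases rule: torus_complexE)
  case (2 v I)
  have "model_pt e s h (v + ind_vec S) = model_pt e s h' (v + ind_vec S)" if S: "S \<subseteq> I" for S
  proof -
    have "coord_sum (v + ind_vec S) \<le> real k"
      using strip_cell_corner[OF 2(1) S] by (simp add: strip_cell_def)
    then have "nat \<lfloor>coord_sum (v + ind_vec S)\<rfloor> \<le> k" by linarith
    then show ?thesis unfolding model_pt_def by (simp only: h)
  qed
  then have "(\<lambda>S. model_pt e s h (v + ind_vec S)) ` Pow I = (\<lambda>S. model_pt e s h' (v + ind_vec S)) ` Pow I"
    by (intro image_cong) auto
  then show ?thesis unfolding 2(2) model_lab_cell by simp
qed simp

context coordinate_cct
begin

lemma T_eq: "T = \<phi> ` torus_complex k"
  using is_cct by (simp add: is_cct_def bij_betw_def)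

lemma w_less_double_Suc:
  assumes "w 0 < 2 * w 1" "l + 1 \<le> k"
  shows "w l < 2 * w (l + 1)"
  using assms(2)
proof (induction l)
  case 0
  then show ?case using assms(1) by simp
next
  case (Suc l)
  then have l: "l + 2 \<le> k" by simp
  obtain b where b: "0 < b" "w (l + 2) = 2 * w (l + 1) + b * (2 * w (l + 1) - w l)"
    using recurrence[OF l] by blast
  have "0 < b * (2 * w (l + 1) - w l)"
    using Suc b(1) by simp
  then show ?case
    using b(2) w_positive[OF l] by simp
qed

lemma recurrence_constant:
  assumes growing: "w 0 < 2 * w 1"
  obtains b where "0 < b" "\<And>l. l + 1 \<le> k \<Longrightarrow> w (l + 2) = 2 * w (l + 1) + b * (2 * w (l + 1) - w l)"
proof -
  obtain b where b: "0 < b" "w (0 + 2) = 2 * w (0 + 1) + b * (2 * w (0 + 1) - w 0)"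
    using recurrence[of 0] two_le_k by auto
  have "w (l + 2) = 2 * w (l + 1) + b * (2 * w (l + 1) - w l)" if "l + 1 \<le> k" for l
    using that
  proof (induction l)
    case 0
    then show ?case using b(2) by simp
  next
    case (Suc l)
    then have l: "l + 2 \<le> k" by simp
    obtain c where c: "w (l + 2) = 2 * w (l + 1) + c * (2 * w (l + 1) - w l)"
      "w (l + 3) = 2 * w (l + 2) + c * (2 * w (l + 2) - w (l + 1))"
      using recurrence[OF l] by blast
    have "2 * w (l + 1) - w l \<noteq> 0"
      using w_less_double_Suc[OF growing, of l] l by simp
    then have "c = b"
      using c(1) Suc by simp
    then show ?case
      using c(2) by (simp add: eval_nat_numeral)
  qed
  then show ?thesis
    using that b(1) by blast
qed

lemma w_solution:
  assumes "\<And>l. l + 1 \<le> k \<Longrightarrow> w (l + 2) = 2 * w (l + 1) + b * (2 * w (l + 1) - w l)" "n \<le> k + 1"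
  shows "solution b (w 0) (w 1) n = w n"
  using assms(2)
proof (induction n rule: less_induct)
  case (less n)
  consider "n = 0" | "n = 1" | l where "n = l + 2"
    by (metis add_2_eq_Suc' not0_implies_Suc One_nat_def)
  then show ?case
  proof cases
    case (3 l)
    then show ?thesis
      using less.IH[of l] less.IH[of "l + 1"] assms(1)[of l] less.prems by simp
  qed simp_all
qed

lemma growing_extension:
  assumes k: "3 \<le> k" and growing: "w 0 < 2 * w 1"
  shows "\<exists>T' \<phi>'. \<Union>T' \<subseteq> S3eq \<and> ideal_cct (k + 1) T' \<phi>' \<and> extends (k + 1) T' \<phi>' k T"
proof -
  obtain b where b: "0 < b" "\<And>l. l + 1 \<le> k \<Longrightarrow> w (l + 2) = 2 * w (l + 1) + b * (2 * w (l + 1) - w l)"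
    by (rule recurrence_constant[OF growing]) blast
  define W where "W = solution b (w 0) (w 1)"
  have W: "W n = w n" if "n \<le> k + 1" for n
    unfolding W_def using w_solution[OF b(2) that] .
  interpret extension: growing e s W b
  proof
    show "W (n + 2) = 2 * W (n + 1) + b * (2 * W (n + 1) - W n)" for n
      by (simp add: W_def)
    show "0 < b"
      by (rule b(1))
    show "0 < W 1" "W 0 < 2 * W 1" "0 < W 0 + W 2" "W 0 * W 2 < W 1 * W 1"
      using W[of 0] W[of 1] W[of 2] k growing w_positive[of 0] sum_pos[of 0] w_determinant_less[of 0]
        by (simp_all add: numeral_2_eq_2)
  qed
  have "model_lab e s (eta w) C = model_lab e s (eta W) C" if "C \<in> torus_complex k" for C
    by (rule model_lab_cong[OF that]) (simp add: eta_def W)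
  then have "T = extension.model k"
    unfolding T_eq extension.model_def using lab by (auto intro!: image_cong)
  then have "extends (k + 1) (extension.model (k + 1)) (model_lab e s (eta W)) k T"
    using extension.restr_model_Suc[of k] by (simp add: extends_def)
  moreover have "ideal_cct (k + 1) (extension.model (k + 1)) (model_lab e s (eta W))"
    using k by (intro extension.model_ideal) simp
  ultimately show ?thesis
    using extension.model_S3eq[of "k + 1"] by blast
qed

end

section \<open>The shrinking case\<close>

definition sup_norm :: "complex \<Rightarrow> real" where
  "sup_norm z = max \<bar>Re z\<bar> \<bar>Im z\<bar>"

lemma sup_norm_scaleR: "0 \<le> c \<Longrightarrow> sup_norm (c *\<^sub>R z) = c * sup_norm z"
  by (simp add: sup_norm_def abs_mult max_mult_distrib_left)

lemma inner_le_sup_norm: "d \<in> {1, \<i>} \<Longrightarrow> d \<bullet> z \<le> sup_norm z"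
  by (auto simp: sup_norm_def inner_complex_def)

lemma sup_norm_quarter_turn: "sup_norm (cis (pi / 2 * of_int d) * z) = sup_norm z"
proof -
  have turn: "sup_norm (\<i> * z) = sup_norm z" for z
    by (simp add: sup_norm_def max.commute)
  have "sup_norm (\<i> ^ n * z) = sup_norm z" for n
    by (induction n) (simp, simp only: power_Suc mult.assoc turn)
  then show ?thesis
    by (simp only: cis_pi2_int)
qed

definition cross :: "complex \<Rightarrow> complex \<Rightarrow> real" where
  "cross x y = Re x * Im y - Im x * Re y"

lemma cross_quarter_turn: "cross (\<i> * x) (\<i> * y) = cross x y"
  by (simp add: cross_def)

lemma wedge_combination:
  assumes pos: "0 < cross x y" and d: "0 \<le> cross x d" "cross y d \<le> 0" "d \<noteq> 0"
  obtains p q where "0 \<le> p" "0 \<le> q" "0 < p + q" "d = p *\<^sub>R x + q *\<^sub>R y"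
proof -
  define p q where "p = - cross y d / cross x y" and "q = cross x d / cross x y"
  have pq: "0 \<le> p" "0 \<le> q"
    using pos d by (simp_all add: p_def q_def divide_nonneg_pos divide_nonpos_pos)
  have "cross x y *\<^sub>R d = (- cross y d) *\<^sub>R x + cross x d *\<^sub>R y"
    by (simp add: complex_eq_iff cross_def algebra_simps)
  also have "\<dots> = cross x y *\<^sub>R (p *\<^sub>R x + q *\<^sub>R y)"
    using pos by (simp add: p_def q_def scaleR_right_diff_distrib)
  finally have combination: "d = p *\<^sub>R x + q *\<^sub>R y"
    using pos by (simp only: scaleR_cancel_left) simp
  then have "p \<noteq> 0 \<or> q \<noteq> 0"
    using d(3) by auto
  then show ?thesis
    using that[OF pq _ combination] pq by linarith
qed

locale shrinking_cct = coordinate_cct +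
  assumes three_le_k: "3 \<le> k" and shrink: "2 * w 1 \<le> w 0"
begin

lemma w_halves:
  assumes "l + 1 \<le> k"
  shows "2 * w (l + 1) \<le> w l"
  using assms
proof (induction l)
  case 0
  then show ?case using shrink by simp
next
  case (Suc l)
  then have l: "l + 2 \<le> k" by simp
  have pos: "0 < w (l + 1)" "0 < w (l + 2)"
    using w_positive[OF l] by auto
  have "2 * w (l + 1) * w (l + 2) \<le> w l * w (l + 2)"
    using Suc pos by (intro mult_right_mono) auto
  then have "w (l + 1) * (2 * w (l + 2)) < w (l + 1) * w (l + 1)"
    using w_determinant_less[OF l] by (simp add: mult_ac)
  then show ?case
    using pos by simp
qed

lemma w_pos:
  assumes "n \<le> k"
  shows "0 < w n"
proof -
  have "0 < w 1"
    using w_positive[of 0] three_le_k by simp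
  consider "n = 0" | "n = 1" | "n = (n - 2) + 2"
    by linarith
  then show ?thesis
  proof cases
    case 3
    then show ?thesis using w_positive[of "n - 2"] assms by simp
  qed (use \<open>0 < w 1\<close> shrink in auto)
qed

lemma w_antimono: "m \<le> n \<Longrightarrow> n \<le> k \<Longrightarrow> w n \<le> w m"
proof (induction n rule: dec_induct)
  case (step n)
  then show ?case using w_halves[of n] w_pos[of "n + 1"] by simp
qed simp

lemma w_dets: "w 0 * w 2 < w 1 * w 1" "w 1 * w 3 < w 2 * w 2"
proof -
  show det: "w 0 * w 2 < w 1 * w 1"
    using w_determinant_less[of 0] three_le_k by (simp add: eval_nat_numeral)
  obtain b where b: "0 < b" "w 2 * w 2 - w 1 * w 3 = b * (w 1 * w 1 - w 0 * w 2)"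
    using w_determinant_step[of 0] three_le_k by (auto simp: eval_nat_numeral)
  have "0 < b * (w 1 * w 1 - w 0 * w 2)"
    using b(1) det by simp
  then show "w 1 * w 3 < w 2 * w 2"
    unfolding b(2)[symmetric] by simp
qed

lemma w_top: "\<bar>w k\<bar> < w 2" "\<bar>w (k + 1)\<bar> < w 2"
proof -
  have pos: "0 < w k" "0 < w (k - 1)"
    using w_pos by simp_all
  have "w (k - 1) \<le> w 2"
    using three_le_k by (intro w_antimono) auto
  moreover have half: "2 * w k \<le> w (k - 1)"
    using w_halves[of "k - 1"] three_le_k by simp
  ultimately show "\<bar>w k\<bar> < w 2"
    using pos by linarith
  have index: "k - 2 + 2 = k" "k - 2 + 1 = k - 1" "k - 2 + 3 = k + 1" "k - 1 + 2 = k + 1"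
    using three_le_k by simp_all
  obtain b where "0 < b" "w k * w k - w (k - 1) * w (k + 1) = b * (w (k - 1) * w (k - 1) - w (k - 2) * w k)"
    using w_determinant_step[of "k - 2"] unfolding index by auto
  moreover have "w (k - 2) * w k < w (k - 1) * w (k - 1)"
    using w_determinant_less[of "k - 2"] unfolding index by simp
  ultimately have "0 < w k * w k - w (k - 1) * w (k + 1)"
    by simp
  moreover have "w k * w k \<le> w (k - 1) * w (k + 1)" if "w k \<le> w (k + 1)"
    using pos half that by (intro mult_mono) auto
  ultimately have "w (k + 1) < w k"
    by fastforce
  moreover have "0 < w (k - 1) + w (k + 1)"
    using sum_pos[of "k - 1"] three_le_k unfolding index by simp
  ultimately show "\<bar>w (k + 1)\<bar> < w 2"
    using \<open>w (k - 1) \<le> w 2\<close> pos half by linarith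
qed

definition inner_cone :: "complex \<Rightarrow> complex \<Rightarrow> bool" where
  "inner_cone z u \<longleftrightarrow> u \<noteq> 0 \<and> (\<exists>v I. strip_cell 2 v I \<and> emb e s z u \<in> cell_cone v I)"

lemma strip_cell_2:
  assumes "strip_cell 2 v I"
  shows "strip_cell k v I" "card I \<le> 2"
  using assms two_le_k by (auto simp: strip_cell_def)

lemma inner_cone_nonzero: "inner_cone z u \<Longrightarrow> z \<noteq> 0 \<and> u \<noteq> 0"
  unfolding inner_cone_def using cell_cone_z_nonzero[OF _ _ frame_axioms] strip_cell_2 by blast

lemma inner_cone_scale:
  assumes "inner_cone z u" "0 < c"
  shows "inner_cone (c *\<^sub>R z) (c *\<^sub>R u)"
proof -
  obtain v I where v: "u \<noteq> 0" "strip_cell 2 v I" "emb e s z u \<in> cell_cone v I"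
    using assms(1) unfolding inner_cone_def by blast
  have "emb e s (c *\<^sub>R z) (c *\<^sub>R u) \<in> cell_cone v I"
    unfolding emb_scale[symmetric] using v(3) assms(2) by (intro convex_cone_hull_mul) auto
  then show ?thesis
    unfolding inner_cone_def using v assms(2) by auto
qed

lemma inner_cone_ray_unique:
  assumes cones: "inner_cone z u" "inner_cone (a *\<^sub>R z) (b *\<^sub>R u)" and ab: "0 < a" "0 < b"
  shows "a = b"
proof -
  obtain v I v' I' where v: "u \<noteq> 0" "strip_cell 2 v I" "emb e s z u \<in> cell_cone v I"
    "strip_cell 2 v' I'" "emb e s (a *\<^sub>R z) (b *\<^sub>R u) \<in> cell_cone v' I'"
    using cones unfolding inner_cone_def by blast
  have "0 + 2 \<le> k" "strip_cell k v I" "strip_cell k v' I'" "real 0 \<le> coord_sum v" "real 0 \<le> coord_sum v'"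
    "coord_sum v + card I \<le> real (0 + 2)" "coord_sum v' + card I' \<le> real (0 + 2)"
    using v(2,4) two_le_k by (auto simp: strip_cell_def)
  then show ?thesis
    using cell_cone_ray_unique[OF frame_axioms _ _ _ _ _ _ _ v(3) v(5) ab v(1)] by blast
qed

lemma inner_cone_equivariant:
  assumes cone: "inner_cone z u" and f: "linear f" "f (emb e s z u) = emb e s z' u'" "u' \<noteq> 0"
    and cells: "\<And>v I. strip_cell 2 v I \<Longrightarrow> strip_cell 2 (g v) (p ` I)"
      "\<And>v S. f (model_pt e s \<eta> (v + ind_vec S)) = model_pt e s \<eta> (g v + ind_vec (p ` S))"
  shows "inner_cone z' u'"
proof -
  obtain v I where v: "strip_cell 2 v I" "emb e s z u \<in> cell_cone v I"
    using cone unfolding inner_cone_def by blast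
  have "emb e s z' u' \<in> f ` cell_cone v I"
    unfolding f(2)[symmetric] using v(2) by (rule imageI)
  also have "\<dots> = convex_cone hull (f ` (\<lambda>S. model_pt e s \<eta> (v + ind_vec S)) ` Pow I)"
    by (rule convex_cone_hull_linear_image[OF f(1), symmetric])
  also have "\<dots> \<subseteq> cell_cone (g v) (p ` I)"
    unfolding image_image cells(2) by (intro hull_mono) blast
  finally show ?thesis
    unfolding inner_cone_def using f(3) cells(1)[OF v(1)] by blast
qed

lemma inner_cone_translate:
  assumes "inner_cone z u" "linear f" "f (emb e s z u) = emb e s z' u'" "u' \<noteq> 0"
    and "\<And>v. f (model_pt e s \<eta> v) = model_pt e s \<eta> (t + v)" "t \<in> int_points" "coord_sum t = 0"
  shows "inner_cone z' u'"
  using assms(1-4)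
proof (rule inner_cone_equivariant[where p = id])
  show "strip_cell 2 (t + v) (id ` I)" if "strip_cell 2 v I" for v I
    using that strip_cell_translate[OF assms(6,7)] by simp
qed (simp add: assms(5) add.assoc)

lemma inner_cone_turn:
  assumes "inner_cone z u"
  shows "inner_cone (\<i> * z) (omega * u)"
proof (rule inner_cone_translate[OF assms r34_r12_isometry(1) _ _ r34_r12_model_pt translation_vectors(3,4)])
  show "(r34 \<circ> r12) (emb e s z u) = emb e s (\<i> * z) (omega * u)"
    by (simp add: r12_isometry r34_isometry)
  show "omega * u \<noteq> 0"
    using inner_cone_nonzero[OF assms] by (simp add: omega_def)
qed

lemma inner_cone_third:
  assumes "inner_cone z u"
  shows "inner_cone z (omega * (omega * u))"
proof (rule inner_cone_translate[OF assms r34_r34_isometry(1) _ _ r34_r34_model_pt translation_vectors(1,2)])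
  show "(r34 \<circ> r34) (emb e s z u) = emb e s z (omega * (omega * u))"
    by (simp add: r34_isometry)
  show "omega * (omega * u) \<noteq> 0"
    using inner_cone_nonzero[OF assms] by (simp add: omega_def)
qed

lemma inner_cone_cnj:
  assumes "inner_cone z u"
  shows "inner_cone z (cnj u)"
  using assms refl4_isometry(1,3)
proof (rule inner_cone_equivariant)
  show "strip_cell 2 (swap12 v) (swap_index ` I)" if "strip_cell 2 v I" for v I
    using that strip_cell_swap by blast
qed (use inner_cone_nonzero[OF assms] in \<open>simp_all add: refl4_model_pt swap12_add swap12_ind_vec\<close>)

lemma inner_cone_uminus:
  assumes "inner_cone z u"
  shows "inner_cone (- z) u"
proof -
  have "inner_cone (\<i> * (\<i> * z)) (omega * (omega * (omega * (omega * (omega * (omega * u))))))"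
    using assms by (intro inner_cone_turn inner_cone_third)
  moreover have "omega * (omega * (omega * (omega * (omega * (omega * u))))) =
      (omega * (omega * omega)) * (omega * (omega * omega)) * u"
    by (simp only: mult.assoc)
  moreover have "\<dots> = u"
    unfolding omega_cube by simp
  moreover have "\<i> * (\<i> * z) = - z"
    by (simp add: mult.assoc[symmetric])
  ultimately show ?thesis
    by simp
qed

lemma corner_z_direction:
  assumes "n + card I \<le> 2"
  obtains d where "d \<in> {1, \<i>}" "\<And>S. S \<in> Pow I \<Longrightarrow> w 2 \<le> d \<bullet> corner_z \<eta> n S"
proof
  have w: "w 2 \<le> w m" if "m \<le> 2" for m
    using that three_le_k by (intro w_antimono) auto
  show "(if 3 \<in> I then \<i> else 1) \<in> {1, \<i>}"
    by simp
  fix S assume S: "S \<in> Pow I"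
  then have "card S \<le> card I"
    by (simp add: card_mono)
  moreover have "card S < card I" if "3 \<in> I" "3 \<notin> S"
    using S that by (intro psubset_card_mono) auto
  ultimately have "w 2 \<le> w (n + card S)" "3 \<in> I \<Longrightarrow> 3 \<notin> S \<Longrightarrow> w 2 \<le> w (n + card S + 1)"
    using assms by (auto intro!: w)
  then show "w 2 \<le> (if 3 \<in> I then \<i> else 1) \<bullet> corner_z \<eta> n S"
    using S by (auto simp: corner_z_def inner_complex_def)
qed

lemma inner_cone_bound:
  assumes "inner_cone z u"
  shows "w 2 * norm u \<le> sup_norm z"
proof -
  obtain v I where v: "strip_cell 2 v I" "emb e s z u \<in> cell_cone v I"
    using assms unfolding inner_cone_def by blast
  obtain n where n: "coord_sum v = real n" "n + card I \<le> 2"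
    using v(1) by (rule strip_cell_levelE)
  obtain i :: int where i: "v $ 3 = i"
    using int_pointsE[OF strip_cell_int_points[OF v(1)]] by metis
  obtain c where c: "emb e s z u = (\<Sum>S\<in>Pow I. c S *\<^sub>R model_pt e s \<eta> (v + ind_vec S))" "\<forall>S\<in>Pow I. 0 \<le> c S"
    using convex_cone_hull_imageE[OF v(2)] by auto
  define Z where "Z = (\<Sum>S\<in>Pow I. c S *\<^sub>R corner_z \<eta> n S)"
  have zu: "z = cis (pi / 2 * of_int i) * Z" "u = u_phase v * (\<Sum>S\<in>Pow I. c S *\<^sub>R corner_u S)"
    using c(1) unfolding sum_model_pt_corner[OF n(1)] emb_eq_iff Z_def i by auto
  have "norm u \<le> (\<Sum>S\<in>Pow I. norm (c S *\<^sub>R corner_u S))"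
    unfolding zu norm_mult norm_cis mult_1 by (rule norm_sum)
  also have "\<dots> = (\<Sum>S\<in>Pow I. c S)"
    using c(2) by (intro sum.cong) (auto simp: norm_mult corner_u_def)
  finally have "w 2 * norm u \<le> w 2 * (\<Sum>S\<in>Pow I. c S)"
    using w_pos[of 2] two_le_k by (intro mult_left_mono) auto
  also obtain d where d: "d \<in> {1, \<i>}" "\<And>S. S \<in> Pow I \<Longrightarrow> w 2 \<le> d \<bullet> corner_z \<eta> n S"
    using corner_z_direction[OF n(2)] by blast
  have "w 2 * (\<Sum>S\<in>Pow I. c S) = (\<Sum>S\<in>Pow I. c S * w 2)"
    by (simp add: sum_distrib_right mult.commute)
  also have "\<dots> \<le> (\<Sum>S\<in>Pow I. c S * (d \<bullet> corner_z \<eta> n S))"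
    using c(2) d(2) by (intro sum_mono mult_left_mono) auto
  also have "\<dots> = d \<bullet> Z"
    by (simp add: Z_def inner_sum_right)
  also have "\<dots> \<le> sup_norm Z"
    by (rule inner_le_sup_norm[OF d(1)])
  also have "\<dots> = sup_norm z"
    unfolding zu sup_norm_quarter_turn ..
  finally show ?thesis .
qed

text \<open>For fixed \<open>u = a + c \<omega>\<close> and with primes exchanging \<open>a\<close> and \<open>c\<close>, the points
  \<open>Q, P, i Q', i P', - Q\<close> (\<open>P\<close> lower, \<open>Q\<close> upper) go half way around the polygon in which \<open>u\<close> meets
  layers 0 to 2; consecutive points lie in a common square.\<close>

definition lower_pt :: "real \<Rightarrow> real \<Rightarrow> complex" where
  "lower_pt a c = a *\<^sub>R \<eta> 0 + c *\<^sub>R \<eta> 1"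

definition upper_pt :: "real \<Rightarrow> real \<Rightarrow> complex" where
  "upper_pt a c = a *\<^sub>R \<eta> 2 + c *\<^sub>R \<eta> 1"

lemma inner_coneI:
  assumes "emb (e_turn 0) s z u \<in> cell_cone (axis_pt 0) I" "card I \<le> 2" "u \<noteq> 0"
  shows "inner_cone z u"
  unfolding inner_cone_def using assms strip_cell_axis_pt[of 0 I 2] by auto

lemma segment_upper_lower:
  assumes ac: "0 \<le> a" "0 \<le> c" "0 < a + c" and pq: "0 \<le> p" "0 \<le> q" "0 < p + q"
  shows "inner_cone (p *\<^sub>R upper_pt a c + q *\<^sub>R lower_pt a c) ((p + q) *\<^sub>R sector_pt a c)"
proof (rule inner_coneI)
  have "(q * a) *\<^sub>R \<eta> 0 + ((p + q) * c + 0) *\<^sub>R \<eta> (0 + 1) + (p * a) *\<^sub>R \<eta> (0 + 2) =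
      p *\<^sub>R upper_pt a c + q *\<^sub>R lower_pt a c"
    by (simp add: lower_pt_def upper_pt_def algebra_simps numeral_2_eq_2)
  moreover have "sector_pt (q * a + p * a) ((p + q) * c) + of_real 0 * cnj omega = (p + q) *\<^sub>R sector_pt a c"
    by (simp add: sector_pt_scaleR algebra_simps)
  ultimately show "emb (e_turn 0) s (p *\<^sub>R upper_pt a c + q *\<^sub>R lower_pt a c)
      ((p + q) *\<^sub>R sector_pt a c) \<in> cell_cone (axis_pt 0) {1, 2}"
    using square_12_mem[of "q * a" "(p + q) * c" 0 "p * a" 0] ac pq
      by (simp only: mult_nonneg_nonneg add_nonneg_nonneg order_refl simp_thms)
qed (use sector_pt_nonzero[OF ac] pq(3) in auto)

lemma segment_lower_upper:
  assumes ac: "0 \<le> a" "0 \<le> c" "0 < a + c" and pq: "0 \<le> p" "0 \<le> q" "0 < p + q"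
  shows "inner_cone (p *\<^sub>R lower_pt a c + q *\<^sub>R (\<i> * upper_pt c a)) ((p + q) *\<^sub>R sector_pt a c)"
proof (rule inner_coneI)
  have "(p * a) *\<^sub>R \<eta> 0 + (p * c) *\<^sub>R \<eta> (0 + 1) + \<i> * ((q * a) *\<^sub>R \<eta> (0 + 1) + (q * c) *\<^sub>R \<eta> (0 + 2)) =
      p *\<^sub>R lower_pt a c + q *\<^sub>R (\<i> * upper_pt c a)"
    by (simp add: lower_pt_def upper_pt_def algebra_simps numeral_2_eq_2)
  moreover have "sector_pt (p * a + q * a) (p * c + q * c) = (p + q) *\<^sub>R sector_pt a c"
    by (simp add: sector_pt_scaleR algebra_simps)
  ultimately show "emb (e_turn 0) s (p *\<^sub>R lower_pt a c + q *\<^sub>R (\<i> * upper_pt c a))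
      ((p + q) *\<^sub>R sector_pt a c) \<in> cell_cone (axis_pt 0) {1, 3}"
    using square_13_mem[of "p * a" "p * c" "q * a" "q * c" 0] ac pq
      by (simp only: mult_nonneg_nonneg add_nonneg_nonneg order_refl simp_thms)
qed (use sector_pt_nonzero[OF ac] pq(3) in auto)

lemma inner_cone_flip:
  assumes "inner_cone z (t *\<^sub>R sector_pt c a)"
  shows "inner_cone (\<i> * z) (t *\<^sub>R sector_pt a c)"
  using inner_cone_turn[OF inner_cone_cnj[OF assms]] by (simp add: omega_cnj_sector_pt)

lemma w_cross_less: "w 3 * w 0 < w 2 * w 1"
proof (cases "0 < w 3")
  case True
  have pos: "0 < w 0" "0 < w 1" "0 < w 2"
    using w_pos three_le_k by simp_all
  have "(w 1 * w 3) * (w 0 * w 2) < (w 2 * w 2) * (w 1 * w 1)"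
    by (rule mult_strict_mono) (use w_dets pos True in simp_all)
  then have "(w 1 * w 2) * (w 3 * w 0) < (w 1 * w 2) * (w 2 * w 1)"
    by (simp add: mult_ac)
  then show ?thesis
    using pos by simp
next
  case False
  then have "w 3 * w 0 \<le> 0"
    using w_pos[of 0] by (simp add: mult_nonpos_nonneg)
  moreover have "0 < w 2 * w 1"
    using w_pos three_le_k by simp
  ultimately show ?thesis by linarith
qed

lemma cross_upper_lower:
  assumes "0 < a" "0 \<le> c"
  shows "0 < cross (upper_pt a c) (lower_pt a c)"
proof -
  have "cross (upper_pt a c) (lower_pt a c) = a * a * (w 2 * w 1 - w 3 * w 0) +
      a * c * (w 2 * w 2 - w 1 * w 3) + a * c * (w 1 * w 1 - w 0 * w 2)"
    by (simp add: cross_def upper_pt_def lower_pt_def eval_nat_numeral algebra_simps)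
  also have "0 < \<dots>"
    using assms w_dets w_cross_less by (intro add_pos_nonneg mult_pos_pos mult_nonneg_nonneg) auto
  finally show ?thesis .
qed

lemma cross_lower_upper:
  assumes "0 \<le> a" "0 \<le> c" "0 < a + c"
  shows "0 < cross (lower_pt a c) (\<i> * upper_pt c a)"
proof -
  have pos: "0 < a * x + c * y" if "0 < x" "0 < y" for x y
    using assms that by (cases "a = 0") (auto intro!: add_pos_nonneg)
  have sums: "0 < w 0 + w 2" "0 < w 1 + w 3"
    using sum_pos[of 0] sum_pos[of 1] three_le_k by (simp_all add: eval_nat_numeral)
  have "cross (lower_pt a c) (\<i> * upper_pt c a) = (a * w 1 + c * w 2) * (a * (w 0 + w 2) + c * (w 1 + w 3))"
    by (simp add: cross_def upper_pt_def lower_pt_def eval_nat_numeral algebra_simps)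
  also have "0 < \<dots>"
    using pos[OF sums] pos[of "w 1" "w 2"] w_pos three_le_k by simp
  finally show ?thesis .
qed

lemma inner_cone_cover_quarter:
  assumes ac: "0 \<le> a" "0 \<le> c" "0 < a + c" and d: "d \<noteq> 0" "0 \<le> cross (upper_pt a c) d"
      "cross (\<i> * upper_pt c a) d \<le> 0"
  shows "\<exists>t>0. inner_cone d (t *\<^sub>R sector_pt a c)"
proof (cases "cross (lower_pt a c) d < 0")
  case True
  then have "0 < a"
    using ac d(2) by (cases "a = 0") (auto simp: lower_pt_def upper_pt_def)
  obtain p q where pq: "0 \<le> p" "0 \<le> q" "0 < p + q" "d = p *\<^sub>R upper_pt a c + q *\<^sub>R lower_pt a c"
    using wedge_combination[OF cross_upper_lower[OF \<open>0 < a\<close> ac(2)] d(2) less_imp_le[OF True] d(1)] .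
  then show ?thesis
    using segment_upper_lower[OF ac pq(1-3)] by blast
next
  case False
  then have "0 \<le> cross (lower_pt a c) d"
    by simp
  then obtain p q where pq: "0 \<le> p" "0 \<le> q" "0 < p + q" "d = p *\<^sub>R lower_pt a c + q *\<^sub>R (\<i> * upper_pt c a)"
    by (rule wedge_combination[OF cross_lower_upper[OF ac] _ d(3,1)])
  then show ?thesis
    using segment_lower_upper[OF ac pq(1-3)] by blast
qed

lemma inner_cone_cover_half:
  assumes ac: "0 \<le> a" "0 \<le> c" "0 < a + c" and d: "d \<noteq> 0" "0 \<le> cross (upper_pt a c) d"
  shows "\<exists>t>0. inner_cone d (t *\<^sub>R sector_pt a c)"
proof (cases "cross (\<i> * upper_pt c a) d \<le> 0")
  case True
  then show ?thesis
    using inner_cone_cover_quarter[OF ac d] by blast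
next
  case False
  define d' where "d' = - (\<i> * d)"
  have d_eq: "d = \<i> * d'"
    by (simp add: d'_def mult.assoc[symmetric])
  have "0 \<le> cross (upper_pt c a) d'"
    using False unfolding d_eq cross_quarter_turn by simp
  moreover have "cross (\<i> * upper_pt a c) d' \<le> 0"
    using d(2) by (simp add: d'_def cross_def)
  ultimately obtain t where "0 < t" "inner_cone d' (t *\<^sub>R sector_pt c a)"
    using inner_cone_cover_quarter[OF ac(2,1), of d'] ac(3) d(1) by (auto simp: d'_def add.commute)
  then show ?thesis
    unfolding d_eq using inner_cone_flip by blast
qed

lemma inner_cone_cover:
  assumes "z \<noteq> 0" "u \<noteq> 0"
  shows "\<exists>t>0. inner_cone z (t *\<^sub>R u)"
proof -
  obtain n a c where ac: "0 \<le> a" "0 \<le> c" "0 < a + c" and u: "u = omega ^ n * sector_pt a c"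
    using sector_exists[OF assms(2)] by metis
  have "\<exists>t>0. inner_cone z (t *\<^sub>R (omega ^ m * sector_pt a c))" if "z \<noteq> 0" for m z
    using that
  proof (induction m arbitrary: z)
    case 0
    show ?case
    proof (cases "0 \<le> cross (upper_pt a c) z")
      case True
      then show ?thesis using inner_cone_cover_half[OF ac 0] by simp
    next
      case False
      then have "0 \<le> cross (upper_pt a c) (- z)" by (simp add: cross_def)
      then obtain t where "0 < t" "inner_cone (- z) (t *\<^sub>R sector_pt a c)"
        using inner_cone_cover_half[OF ac, of "- z"] 0 by auto
      then show ?thesis using inner_cone_uminus[of "- z"] by auto
    qed
  next
    case (Suc m)
    have "- (\<i> * z) \<noteq> 0" using Suc.prems by simp
    from Suc.IH[OF this] obtain t where t: "0 < t" "inner_cone (- (\<i> * z)) (t *\<^sub>R (omega ^ m * sector_pt a c))"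
      by blast
    have "\<i> * (- (\<i> * z)) = z" by (simp add: mult.assoc[symmetric])
    moreover have "omega * (t *\<^sub>R (omega ^ m * sector_pt a c)) = t *\<^sub>R (omega ^ Suc m * sector_pt a c)" by simp
    ultimately show ?case using inner_cone_turn[OF t(2)] t(1) by metis
  qed
  then show ?thesis
    using assms(1) u by simp
qed

definition inner_torus :: "(real^5) set" where
  "inner_torus = \<Union>{\<phi> (orbit (cell v I)) | v I. strip_cell 2 v I}"

lemma inner_torus_iff: "x \<in> inner_torus \<longleftrightarrow> norm x = 1 \<and> (\<exists>z u. x = emb e s z u \<and> inner_cone z u)"
proof
  assume "x \<in> inner_torus"
  then obtain v I where v: "strip_cell 2 v I" "x \<in> \<phi> (orbit (cell v I))"
    by (auto simp: inner_torus_def)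
  note cell = strip_cell_2[OF v(1)]
  have x: "x \<in> S3eq" "x \<notin> Clif 0" "x \<in> cell_cone v I" "norm x = 1"
    using square_avoids_Clif[OF cell v(2)] v(2) unfolding lab_sph_hull[OF cell(1)] sph_hull_def by auto
  obtain z u where zu: "x = emb e s z u"
    using emb_surj[OF frame_axioms, of x] x(1) by (auto simp: S3eq_def)
  have "u \<noteq> 0"
    using emb_Clif_iff(1)[of z u] x(1,2) zu by blast
  then have "inner_cone z u"
    unfolding inner_cone_def using v(1) x(3) zu by blast
  then show "norm x = 1 \<and> (\<exists>z u. x = emb e s z u \<and> inner_cone z u)"
    using x(4) zu by blast
next
  assume "norm x = 1 \<and> (\<exists>z u. x = emb e s z u \<and> inner_cone z u)"
  then obtain v I where v: "norm x = 1" "strip_cell 2 v I" "x \<in> cell_cone v I"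
    unfolding inner_cone_def by blast
  have "x \<in> \<phi> (orbit (cell v I))"
    unfolding lab_sph_hull[OF strip_cell_2(1)[OF v(2)]] sph_hull_def using v by simp
  then show "x \<in> inner_torus"
    unfolding inner_torus_def using v(2) by blast
qed

lemma inner_torus_normalise:
  assumes "inner_cone z u"
  obtains r where "0 < r" "emb e s (r *\<^sub>R z) (r *\<^sub>R u) \<in> inner_torus"
proof
  have nonzero: "emb e s z u \<noteq> 0"
    using inner_cone_nonzero[OF assms] by (simp add: emb_eq_0_iff)
  then show r: "0 < inverse (norm (emb e s z u))"
    by simp
  show "emb e s (inverse (norm (emb e s z u)) *\<^sub>R z) (inverse (norm (emb e s z u)) *\<^sub>R u) \<in> inner_torus"
    unfolding inner_torus_iff
  proof
    show "norm (emb e s (inverse (norm (emb e s z u)) *\<^sub>R z) (inverse (norm (emb e s z u)) *\<^sub>R u)) = 1"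
      unfolding emb_scale[symmetric] using nonzero by simp
  qed (use inner_cone_scale[OF assms r] in blast)
qed

lemma inner_torus_subset: "inner_torus \<subseteq> \<Union>T"
  unfolding inner_torus_def using lab_cell_in strip_cell_2(1) by blast

lemma compact_inner_torus: "compact inner_torus"
  unfolding inner_torus_def
proof (rule compact_Union)
  have subset: "{\<phi> (orbit (cell v I)) | v I. strip_cell 2 v I} \<subseteq> T"
    using lab_cell_in strip_cell_2(1) by blast
  moreover have "finite T"
    using polytopal unfolding polytopal_complex_def by blast
  ultimately show "finite {\<phi> (orbit (cell v I)) | v I. strip_cell 2 v I}"
    by (rule finite_subset)
  show "compact P" if "P \<in> {\<phi> (orbit (cell v I)) | v I. strip_cell 2 v I}" for P
    using that subset compact_sph_polytope polytope by blast
qed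

definition sweep :: "(real^5) \<times> real \<times> real \<Rightarrow> real^5" where
  "sweep = (\<lambda>(x, p, q). (p *\<^sub>R part12 x + q *\<^sub>R part34 x) /\<^sub>R norm (p *\<^sub>R part12 x + q *\<^sub>R part34 x))"

definition swept :: "(real \<times> real) set \<Rightarrow> (real^5) set" where
  "swept A = sweep ` (inner_torus \<times> A)"

lemma parts_emb: "p *\<^sub>R part12 (emb e s z u) + q *\<^sub>R part34 (emb e s z u) = emb e s (p *\<^sub>R z) (q *\<^sub>R u)"
  unfolding part12_emb part34_emb emb_scale emb_add by simp

lemma sweep_emb: "sweep (emb e s z u, p, q) =
    emb e s (p *\<^sub>R z) (q *\<^sub>R u) /\<^sub>R norm (emb e s (p *\<^sub>R z) (q *\<^sub>R u))"
  unfolding sweep_def split parts_emb ..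

lemma closed_swept:
  assumes "compact A" "(0, 0) \<notin> A"
  shows "closed (swept A)"
proof -
  have "linear part12" "linear part34"
    by (rule linearI; simp add: part12_def part34_def vec_eq_iff)+
  then have parts: "continuous_on X (\<lambda>y. part12 (fst y))"
      "continuous_on X (\<lambda>y. part34 (fst y))" for X :: "((real^5) \<times> real \<times> real) set"
    using linear_conv_bounded_linear bounded_linear.continuous_on[OF _
        continuous_on_fst[OF continuous_on_id]] by blast+
  have "p *\<^sub>R part12 x + q *\<^sub>R part34 x \<noteq> 0" if x: "x \<in> inner_torus" and pq: "(p, q) \<in> A" for x p q
  proof -
    obtain z u where zu: "x = emb e s z u" "inner_cone z u"
      using x unfolding inner_torus_iff by blast
    show ?thesis
      unfolding zu(1) parts_emb emb_eq_0_iff using inner_cone_nonzero[OF zu(2)] pq assms(2) by auto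
  qed
  then have "continuous_on (inner_torus \<times> A) sweep"
    unfolding sweep_def case_prod_beta by (intro continuous_intros parts) auto
  then show ?thesis
    unfolding swept_def using assms(1)
      by (intro compact_imp_closed compact_continuous_image compact_Times compact_inner_torus)
qed

lemma mem_sweptI:
  assumes cone: "inner_cone z u" and A: "(p, q) \<in> A" and c: "0 < c" "p *\<^sub>R z = c *\<^sub>R z'" "q *\<^sub>R u = c *\<^sub>R u'"
    and norm: "norm (emb e s z' u') = 1"
  shows "emb e s z' u' \<in> swept A"
proof -
  obtain r where r: "0 < r" "emb e s (r *\<^sub>R z) (r *\<^sub>R u) \<in> inner_torus"
    using cone by (rule inner_torus_normalise)
  have "p *\<^sub>R r *\<^sub>R z = (r * c) *\<^sub>R z'" "q *\<^sub>R r *\<^sub>R u = (r * c) *\<^sub>R u'"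
    using arg_cong[OF c(2), of "scaleR r"] arg_cong[OF c(3), of "scaleR r"] by (simp_all add: mult.commute)
  then have "sweep (emb e s (r *\<^sub>R z) (r *\<^sub>R u), p, q) =
      ((r * c) *\<^sub>R emb e s z' u') /\<^sub>R norm ((r * c) *\<^sub>R emb e s z' u')"
    unfolding sweep_emb emb_scale by (simp only:)
  also have "\<dots> = emb e s z' u'"
    using r(1) c(1) norm by (subst normalised_scaleR) simp_all
  finally show ?thesis
    unfolding swept_def using r(2) A by (metis SigmaI imageI)
qed

lemma sweptE:
  assumes "y \<in> swept A" "(0, 0) \<notin> A"
  obtains z u p q r where "inner_cone z u" "(p, q) \<in> A" "0 < r"
      "y = emb e s (r *\<^sub>R p *\<^sub>R z) (r *\<^sub>R q *\<^sub>R u)" "norm y = 1"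
proof -
  obtain x p q where x: "x \<in> inner_torus" "(p, q) \<in> A" "y = sweep (x, p, q)"
    using assms(1) by (auto simp: swept_def)
  obtain z u where zu: "x = emb e s z u" "inner_cone z u"
    using x(1) unfolding inner_torus_iff by blast
  let ?y = "emb e s (p *\<^sub>R z) (q *\<^sub>R u)"
  have "?y \<noteq> 0"
    using inner_cone_nonzero[OF zu(2)] x(2) assms(2) by (auto simp: emb_eq_0_iff)
  then have "0 < inverse (norm ?y)" "norm (?y /\<^sub>R norm ?y) = 1"
    by simp_all
  moreover have y: "y = ?y /\<^sub>R norm ?y"
    unfolding x(3) zu(1) sweep_emb ..
  ultimately show ?thesis
    using that[OF zu(2) x(2), of "inverse (norm ?y)"] unfolding y emb_scale by blast
qed

text \<open>\<open>outer_region\<close> and \<open>inner_region\<close> are swept by the torus on its way to the circles \<open>u = 0\<close> and \<open>z = 0\<close>.\<close>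

definition outer_region :: "(real^5) set" where
  "outer_region = swept ({1} \<times> {0..1})"

definition inner_region :: "(real^5) set" where
  "inner_region = swept ({0..1} \<times> {1})"

lemma closed_outer_region: "closed outer_region" and closed_inner_region: "closed inner_region"
  unfolding outer_region_def inner_region_def by (intro closed_swept compact_Times; simp)+

lemma S3eq_subset_regions: "S3eq \<subseteq> outer_region \<union> inner_region"
proof
  fix y assume y: "y \<in> S3eq"
  then obtain z u where zu: "y = emb e s z u"
    using emb_surj[OF frame_axioms, of y] by (auto simp: S3eq_def)
  have norm: "norm (emb e s z u) = 1"
    using y zu by (simp add: S3eq_def)
  consider "u = 0" | "z = 0" "u \<noteq> 0" | "z \<noteq> 0" "u \<noteq> 0"
    by blast
  then show "y \<in> outer_region \<union> inner_region"
  proof cases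
    case 1
    then have "z \<noteq> 0"
      using norm by (auto simp: emb_zero)
    then obtain t where "inner_cone z (t *\<^sub>R 1)"
      using inner_cone_cover[of z 1] by auto
    then show ?thesis
      unfolding zu outer_region_def using 1 norm
        by (intro UnI1 mem_sweptI[where p = 1 and q = 0 and c = 1]) auto
  next
    case 2
    obtain t where t: "0 < t" "inner_cone 1 (t *\<^sub>R u)"
      using inner_cone_cover[of 1 u] 2 by auto
    then show ?thesis
      unfolding zu inner_region_def using 2 norm
        by (intro UnI2 mem_sweptI[OF t(2), where p = 0 and q = 1 and c = t]) auto
  next
    case 3
    obtain t where t: "0 < t" "inner_cone z (t *\<^sub>R u)"
      using inner_cone_cover[OF 3] by auto
    show ?thesis
    proof (cases "1 \<le> t")
      case True
      then show ?thesis
        unfolding zu outer_region_def using norm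
          by (intro UnI1 mem_sweptI[OF t(2), where p = 1 and q = "1 / t" and c = 1]) auto
    next
      case False
      then show ?thesis
        unfolding zu inner_region_def using norm t(1)
          by (intro UnI2 mem_sweptI[OF t(2), where p = t and q = 1 and c = t]) auto
    qed
  qed
qed

lemma outer_region_Int_inner_region: "outer_region \<inter> inner_region \<subseteq> inner_torus"
proof
  fix y assume "y \<in> outer_region \<inter> inner_region"
  then have "y \<in> swept ({0..1} \<times> {1})" "y \<in> swept ({1} \<times> {0..1})"
    by (simp_all add: outer_region_def inner_region_def)
  then obtain z u t r z' u' t' r' where cone: "inner_cone z u" "0 \<le> t" "t \<le> 1"
      "0 < r" "y = emb e s (r *\<^sub>R t *\<^sub>R z) (r *\<^sub>R 1 *\<^sub>R u)" "norm y = 1"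
    and cone': "inner_cone z' u'" "0 \<le> t'" "t' \<le> 1" "0 < r'" "y = emb e s (r' *\<^sub>R 1 *\<^sub>R z') (r' *\<^sub>R t' *\<^sub>R u')"
    by (elim sweptE) auto
  have eq: "(r * t) *\<^sub>R z = r' *\<^sub>R z'" "r *\<^sub>R u = (r' * t') *\<^sub>R u'"
    using cone(5) cone'(5) emb_eq_iff by auto
  then have "t \<noteq> 0" "t' \<noteq> 0"
    using cone(4) cone'(4) inner_cone_nonzero[OF cone(1)] inner_cone_nonzero[OF cone'(1)] by auto
  then have t: "0 < t" "0 < t'"
    using cone(2) cone'(2) by simp_all
  have "z' = (r * t / r') *\<^sub>R z"
    using arg_cong[OF eq(1), of "scaleR (inverse r')"] cone'(4) by (simp add: divide_inverse mult_ac)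
  moreover have "u' = (r / (r' * t')) *\<^sub>R u"
    using arg_cong[OF eq(2), of "scaleR (inverse (r' * t'))"] cone'(4) t by (simp add: divide_inverse mult_ac)
  ultimately have "r * t / r' = r / (r' * t')"
    using inner_cone_ray_unique[OF cone(1), of "r * t / r'" "r / (r' * t')"] cone'(1,4) cone(4) t by simp
  then have "t * t' = 1"
    using cone(4) cone'(4) t by (simp add: field_simps)
  moreover have "t * t' \<le> t * 1"
    using t(1) cone'(3) by (intro mult_left_mono) auto
  ultimately have "t = 1"
    using cone(3) by simp
  then show "y \<in> inner_torus"
    unfolding inner_torus_iff using inner_cone_scale[OF cone(1,4)] cone(5,6) by auto
qed

lemma outer_region_bound:
  assumes "emb e s z u \<in> outer_region"
  shows "w 2 * norm u \<le> sup_norm z"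
proof -
  obtain z' u' t r where cone: "inner_cone z' u'" "0 \<le> t" "t \<le> 1" "0 < r"
      "emb e s z u = emb e s (r *\<^sub>R 1 *\<^sub>R z') (r *\<^sub>R t *\<^sub>R u')"
    using assms unfolding outer_region_def by (elim sweptE) auto
  then have zu: "z = r *\<^sub>R z'" "u = (r * t) *\<^sub>R u'"
    using emb_eq_iff by auto
  have "w 2 * norm u = (r * t) * (w 2 * norm u')"
    using cone(2,4) unfolding zu by simp
  also have "\<dots> \<le> (r * 1) * sup_norm z'"
    using cone(2-4) w_pos[of 2] two_le_k inner_cone_bound[OF cone(1)] by (intro mult_mono) auto
  also have "\<dots> = sup_norm z"
    unfolding zu using cone(4) by (simp add: sup_norm_scaleR)
  finally show ?thesis .
qed

lemma outer_region_disjoint_top_layer: "outer_region \<inter> layer \<phi> k = {}"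
proof (intro Int_emptyI)
  fix x assume x: "x \<in> outer_region" "x \<in> layer \<phi> k"
  obtain v where v: "v \<in> int_points" "coord_sum v = real k" "x \<in> \<phi> (orbit {v})"
    using x(2) unfolding layer_def by blast
  have "strip_cell k v {}"
    using v by (simp add: strip_cell_def)
  moreover have pt: "model_pt e s \<eta> v = emb e s (z_phase v * \<eta> k) (u_phase v)"
    using v(2) by (simp add: model_pt_def)
  moreover have nonzero: "model_pt e s \<eta> v \<noteq> 0"
    unfolding pt emb_eq_0_iff by simp
  ultimately have "x = model_pt e s \<eta> v /\<^sub>R norm (model_pt e s \<eta> v)"
    using v(3) lab_sph_hull[of v "{}"] sph_hull_singleton[OF nonzero] by simp
  moreover define r where "r = inverse (norm (model_pt e s \<eta> v))"
  ultimately have "emb e s (r *\<^sub>R (z_phase v * \<eta> k)) (r *\<^sub>R u_phase v) \<in> outer_region"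
    using x(1) unfolding pt emb_scale by simp
  then have "w 2 * norm (r *\<^sub>R u_phase v) \<le> sup_norm (r *\<^sub>R (z_phase v * \<eta> k))"
    by (rule outer_region_bound)
  moreover have r: "0 < r"
    using nonzero by (simp add: r_def)
  moreover obtain i :: int where "v $ 3 = i"
    using int_pointsE[OF v(1)] by metis
  then have "sup_norm (r *\<^sub>R (z_phase v * \<eta> k)) = r * sup_norm (\<eta> k)"
    using r by (simp only: sup_norm_scaleR less_imp_le sup_norm_quarter_turn)
  ultimately have "r * w 2 \<le> r * sup_norm (\<eta> k)"
    by (simp add: mult.commute)
  then show False
    using w_top r by (simp add: sup_norm_def)
qed

lemma shrinking_not_ideal:
  assumes K: "K \<in> components (S3eq - \<Union>T)" "Clif 0 \<subseteq> K"
  shows "closure K \<inter> layer \<phi> k = {}"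
proof -
  have subset: "K \<subseteq> S3eq - \<Union>T" and connected: "connected K"
    using in_components_subset[OF K(1)] in_components_connected[OF K(1)] .
  have cover: "K \<subseteq> outer_region \<union> inner_region"
    using S3eq_subset_regions subset by blast
  have "outer_region \<inter> inner_region \<inter> K = {}"
    using outer_region_Int_inner_region inner_torus_subset subset by blast
  then have "outer_region \<inter> K = {} \<or> inner_region \<inter> K = {}"
    using connected_closedD[OF connected _ cover closed_outer_region closed_inner_region] by blast
  moreover have "emb e s 1 0 \<in> outer_region"
  proof -
    obtain t where cone: "inner_cone 1 (t *\<^sub>R 1)"
      using inner_cone_cover[of 1 1] by auto
    show ?thesis
      unfolding outer_region_def by (rule mem_sweptI[OF cone, where p = 1 and q = 0 and c = 1])
          (simp_all add: norm_emb_z)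
  qed
  moreover have "emb e s 1 0 \<in> K"
    using emb_Clif_iff(1)[of 1 0] K(2) by (auto simp: emb_S3eq_iff)
  ultimately have "K \<subseteq> outer_region"
    using cover by blast
  then have "closure K \<subseteq> outer_region"
    using closed_outer_region by (rule closure_minimal)
  then show ?thesis
    using outer_region_disjoint_top_layer by blast
qed

end

section \<open>Extending ideal CCTs\<close>

theorem theorem4p2:
  fixes k :: nat and T :: "(real^5) set set" and \<phi> :: labelling
  assumes "3 \<le> k" and "\<Union>T \<subseteq> S3eq" and "ideal_cct k T \<phi>"
  shows "\<exists>T' \<phi>'. \<Union>T' \<subseteq> S3eq \<and> ideal_cct (k + 1) T' \<phi>' \<and> extends (k + 1) T' \<phi>' k T"
proof -
  interpret transversal_cct k T \<phi>
    using assms by unfold_locales (auto simp: ideal_cct_def)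
  interpret frame axis_phase axis_sign
    using norm_axis_phase by (rule frame_axis_sign)
  interpret coordinate_cct k T \<phi> axis_phase axis_sign axis_w
    by unfold_locales (fact lab_axis_w axis_w_sum_pos axis_w_recurrence)+
  show ?thesis
  proof (cases "axis_w 0 < 2 * axis_w 1")
    case True
    then show ?thesis
      by (rule growing_extension[OF assms(1)])
  next
    case False
    then interpret shrinking_cct k T \<phi> axis_phase axis_sign axis_w
      using assms(1) by unfold_locales auto
    show ?thesis
      using assms(3) shrinking_not_ideal unfolding ideal_cct_def by blast
  qed
qed

end
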